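(* Let $\phi$ be a Drinfeld $A$-module of rank $r$. The series \[L(\phi^\vee,z_1,\dots,z_n;x,y)=\sum_{d\ge0}x^{-d}\sum_{a\in A_{+,d}}\mu(a)a(z_1)\cdots a(z_n)\langle a\rangle^y,\qquad (x,y)\in\mathbb{S}_\infty,\] can be analytically continued to an entire function on $\mathbb{C}_\infty^n\times\mathbb{S}_\infty$. In particular, $L(\phi^\vee,z_1,\dots,z_n,s):=L(\phi^\vee,z_1,\dots,z_n;\theta^s,-s)=\sum_{a\in A_+}\frac{\mu(a)a(z_1)\cdots a(z_n)}{a^s}$ converges in $\mathbb{T}_n$ for all $s\in\mathbb{Z}$.
   Context: $q=p^l$, $A=\mathbb{F}_q[\theta]$, $A_+$ monic, $A_{+,d}$ monic of degree $d$; $\mathbb{C}_\infty$ the completed algebraic closure of $\mathbb{F}_q((\theta^{-1}))$ with $|\theta|_\infty=q$. Drinfeld $A$-module of rank $r$: $\phi_\theta=\theta+\sum_{i=1}^r\phi_{\theta,i}\tau^i$, $\phi_{\theta,i}\in A$, $\phi_{\theta,r}\neq0$. For irreducible $f\in A_+$ of degree $d$: $r_0$ is the largest $i\ge1$ with $\phi_{\theta,i}\not\equiv0\pmod f$ ($0$ if none); if $r_0\ge1$, $x^{r_0}+\dots+p_0$ is the characteristic polynomial of Frobenius $\tau^d$ on the $h$-adic Tate module ($h\neq f$) of the reduction of $\phi$ mod $f$, $p_0=c(f)^{-1}f$, $c(f)\in\mathbb{F}_q^\times$, $p_{r_0}=1$, $D_f(x)=1+\sum_{i=1}^{r_0}c(f)p_if^{i-1}x^i$;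 $D_f=1$ if $r_0=0$. $\mu:A_+\to A$ multiplicative with $\sum_i\mu(f^i)x^i=D_f(x)^{-1}$. $a(z_k)$: $\theta\mapsto z_k$. $\mathbb{S}_\infty=\mathbb{C}_\infty^\times\times\mathbb{Z}_p$. For $a\in A_+$, $\langle a\rangle=a\theta^{-\deg_\theta a}$ and, for $y\in\mathbb{Z}_p$, $\langle a\rangle^y=\sum_{i\ge0}\binom{y}{i}(\langle a\rangle-1)^i$, where $\binom{y}{i}=\prod_j\binom{\beta_j}{i_j}$ for $y=\sum_j\beta_jp^j$, $i=\sum_j i_jp^j$ the $p$-adic digit expansions. $\mathbb{T}_n$ is the Tate algebra over $\mathbb{C}_\infty$ in $z_1,\dots,z_n$. Entire in Goss's sense: a function $F(x,y)$ on $\mathbb{S}_\infty$ of the form $g_y(1/x)$ where for each $y$, $g_y(u)$ is a power series converging for all $u\in\mathbb{C}_\infty$, is entire if for every bounded $H\subset\mathbb{C}_\infty$ and $\varepsilon>0$ there is $\delta>0$ such that $|y_0-y_1|_p<\delta$ implies $|g_{y_0}(u)-g_{y_1}(u)|_\infty<\varepsilon$ for all $u\in H$; on $\mathbb{C}_\infty^n\times\mathbb{S}_\infty$ the same is required with $g_y$ a power series in $(z_1,\dots,z_n,u)$ everywhere convergent on $\mathbb{C}_\infty^{n+1}$ and $H$ a bounded subset of $\mathbb{C}_\infty^{n+1}$. *)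

theory Defs
  imports
    "HOL-Analysis.Analysis"
    "HOL-Algebra.Algebraic_Closure_Type"
    "HOL-Computational_Algebra.Computational_Algebra"
    "HOL-Library.Poly_Mapping"
    "Jordan_Normal_Form.Char_Poly"
begin

hide_const (open) Polynomials.lead_coeff Polynomials.degree Divisibility.irreducible
  Module.smult UnivPoly.monom UnivPoly.coeff

section \<open>The field \<open>\<complex>\<^sub>\<infinity>\<close>\<close>

text \<open>
  The library constant \<^const>\<open>norm\<close> is reserved for real normed vector spaces, hence the separate
  symbol \<open>vabs\<close> for the absolute value; positivity and definiteness follow from those of \<^const>\<open>dist\<close>.
\<close>

class complete_nonarch_field = field + complete_space +
  fixes vabs :: "'a \<Rightarrow> real"
  assumes dist_vabs: "dist x y = vabs (x - y)"
    and vabs_mult: "vabs (x * y) = vabs x * vabs y"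
    and vabs_add_le_max: "vabs (x + y) \<le> max (vabs x) (vabs y)"

text \<open>
  The finite field is the type \<open>'q\<close>, so \<open>q = CARD('q)\<close>, \<open>p = CHAR('q)\<close> and \<open>A = 'q poly\<close>.
  The local field \<open>K\<^sub>\<infinity> = \<bbbF>\<^sub>q((\<theta>\<^sup>-\<^sup>1))\<close> is \<open>'q fls\<close>, whose indeterminate \<^const>\<open>fls_X\<close> stands for
  \<open>\<theta>\<^sup>-\<^sup>1\<close>; its algebraic closure is \<open>'q fls alg_closure\<close>. A completion of that closure is a
  complete valued field together with a dense embedding \<open>\<iota>\<close> of the closure, the absolute value
  extending the one of \<open>K\<^sub>\<infinity>\<close> with \<open>\<bar>\<theta>\<bar> = q\<close> (the extension to the algebraic closure is unique
  because \<open>K\<^sub>\<infinity>\<close> is complete). This determines \<open>\<complex>\<^sub>\<infinity>\<close> up to isometric isomorphism.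
\<close>

definition is_C_infinity ::
  "('q::finite_field fls alg_closure \<Rightarrow> 'c::complete_nonarch_field) \<Rightarrow> bool" where
  "is_C_infinity \<iota> \<longleftrightarrow>
     \<iota> 1 = 1 \<and> (\<forall>x y. \<iota> (x + y) = \<iota> x + \<iota> y) \<and> (\<forall>x y. \<iota> (x * y) = \<iota> x * \<iota> y) \<and>
     (\<forall>f. f \<noteq> 0 \<longrightarrow> vabs (\<iota> (to_ac f)) = real CARD('q) powi (- fls_subdegree f)) \<and>
     closure (range \<iota>) = UNIV"

definition theta :: "('q::finite_field fls alg_closure \<Rightarrow> 'c::complete_nonarch_field) \<Rightarrow> 'c" where
  "theta \<iota> = \<iota> (to_ac fls_X_inv)"

definition emb_Fq ::
  "('q::finite_field fls alg_closure \<Rightarrow> 'c::complete_nonarch_field) \<Rightarrow> 'q \<Rightarrow> 'c" where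
  "emb_Fq \<iota> c = \<iota> (to_ac (fls_const c))"

definition eval_at ::
  "('q::finite_field fls alg_closure \<Rightarrow> 'c::complete_nonarch_field) \<Rightarrow> 'q poly \<Rightarrow> 'c \<Rightarrow> 'c" where
  "eval_at \<iota> a z = poly (map_poly (emb_Fq \<iota>) a) z"

definition emb_A ::
  "('q::finite_field fls alg_closure \<Rightarrow> 'c::complete_nonarch_field) \<Rightarrow> 'q poly \<Rightarrow> 'c" where
  "emb_A \<iota> a = eval_at \<iota> a (theta \<iota>)"

definition monics :: "nat \<Rightarrow> 'q::field poly set" where
  "monics d = {a. lead_coeff a = 1 \<and> degree a = d}"

definition monic_irreducible :: "'q::field poly \<Rightarrow> bool" where
  "monic_irreducible f \<longleftrightarrow> irreducible f \<and> lead_coeff f = 1"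


section \<open>Adic completions\<close>

text \<open>
  The inverse limit of the rings \<open>R/h\<^sup>n\<close> for \<open>R\<close> the integers or polynomials over a field:
  the \<open>n\<close>-th entry is the representative modulo \<open>h\<^sup>n\<close> picked by \<open>mod\<close>. It yields both \<open>\<int>\<^sub>p\<close>
  and \<open>A\<^sub>h\<close>.
\<close>

definition adic_completion :: "'a::semidom_modulo \<Rightarrow> (nat \<Rightarrow> 'a) set" where
  "adic_completion h = {\<alpha>. \<forall>n. \<alpha> n = \<alpha> (Suc n) mod h ^ n}"

abbreviation padic_ints :: "nat \<Rightarrow> (nat \<Rightarrow> int) set" where
  "padic_ints p \<equiv> adic_completion (int p)"

definition padic_of_int :: "nat \<Rightarrow> int \<Rightarrow> nat \<Rightarrow> int" where
  "padic_of_int p k = (\<lambda>n. k mod int p ^ n)"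

definition padic_digit :: "nat \<Rightarrow> (nat \<Rightarrow> int) \<Rightarrow> nat \<Rightarrow> nat" where
  "padic_digit p y j = nat (y (Suc j) div int p ^ j)"

text \<open>The value of \<open>\<bar>y\<^sub>0 - y\<^sub>1\<bar>\<^sub>p\<close>: the exponent is the largest \<open>n\<close> with \<open>y\<^sub>0 \<equiv> y\<^sub>1\<close> modulo \<open>p\<^sup>n\<close>.\<close>

definition padic_dist :: "nat \<Rightarrow> (nat \<Rightarrow> int) \<Rightarrow> (nat \<Rightarrow> int) \<Rightarrow> real" where
  "padic_dist p y0 y1 =
     (if y0 = y1 then 0 else inverse (real p ^ (LEAST n. y0 (Suc n) \<noteq> y1 (Suc n))))"

text \<open>The product may stop at \<open>j = i\<close>: the digits of \<open>i\<close> beyond vanish as \<open>i < p\<^sup>j\<close> there.\<close>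

definition padic_binomial :: "nat \<Rightarrow> (nat \<Rightarrow> int) \<Rightarrow> nat \<Rightarrow> nat" where
  "padic_binomial p y i = (\<Prod>j\<le>i. padic_digit p y j choose (i div p ^ j mod p))"


section \<open>Drinfeld modules and the Frobenius of their reductions\<close>

text \<open>
  A Drinfeld \<open>A\<close>-module is given by \<open>\<phi>\<^sub>\<theta> = \<Sum>\<^sub>i \<phi>\<^sub>\<theta>\<^sub>,\<^sub>i \<tau>\<^sup>i\<close>. The type \<open>'q poly poly\<close> only serves as the
  container of the coefficients \<open>coeff \<phi> i = \<phi>\<^sub>\<theta>\<^sub>,\<^sub>i\<close>; its (commutative) product is never used.
\<close>

definition drinfeld_module :: "nat \<Rightarrow> 'q::finite_field poly poly \<Rightarrow> bool" where
  "drinfeld_module r \<phi> \<longleftrightarrow> r \<ge> 1 \<and> degree \<phi> = r \<and> coeff \<phi> 0 = [:0, 1:]"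

definition reduced_rank :: "'q::finite_field poly poly \<Rightarrow> 'q poly \<Rightarrow> nat" where
  "reduced_rank \<phi> f = Max (insert 0 {i \<in> {1..degree \<phi>}. \<not> f dvd coeff \<phi> i})"

text \<open>
  A root \<open>t\<close> of \<open>f\<close> in the algebraic closure of \<open>\<bbbF>\<^sub>q\<close> identifies the residue field \<open>A/f\<close> with
  \<open>\<bbbF>\<^sub>q(t)\<close>, the reduction modulo \<open>f\<close> with \<open>a \<mapsto> a(t)\<close>, and \<open>'q alg_closure\<close> with an algebraic
  closure of \<open>A/f\<close>. The roots of \<open>f\<close> are conjugate, so their choice is immaterial.
\<close>

definition residue_root :: "'q::finite_field poly \<Rightarrow> 'q alg_closure" where
  "residue_root f = (SOME t. poly (map_poly to_ac f) t = 0)"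

definition residue :: "'q::finite_field poly \<Rightarrow> 'q poly \<Rightarrow> 'q alg_closure" where
  "residue f a = poly (map_poly to_ac a) (residue_root f)"

text \<open>
  The reduced operators \<open>\<phi>\<^sub>\<theta>\<close> and \<open>\<phi>\<^sub>a = \<Sum>\<^sub>j a\<^sub>j \<phi>\<^sub>\<theta>\<^sup>j\<close>, with \<open>\<tau>\<close> acting as \<open>x \<mapsto> x\<^sup>q\<close> on the algebraic
  closure of the residue field.
\<close>

definition reduced_theta ::
  "'q::finite_field poly poly \<Rightarrow> 'q poly \<Rightarrow> 'q alg_closure \<Rightarrow> 'q alg_closure" where
  "reduced_theta \<phi> f x = (\<Sum>i\<le>degree \<phi>. residue f (coeff \<phi> i) * x ^ (CARD('q) ^ i))"

definition reduced_action ::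
  "'q::finite_field poly poly \<Rightarrow> 'q poly \<Rightarrow> 'q poly \<Rightarrow> 'q alg_closure \<Rightarrow> 'q alg_closure" where
  "reduced_action \<phi> f a x = (\<Sum>j\<le>degree a. to_ac (coeff a j) * (reduced_theta \<phi> f ^^ j) x)"

definition tate_module ::
  "'q::finite_field poly poly \<Rightarrow> 'q poly \<Rightarrow> 'q poly \<Rightarrow> (nat \<Rightarrow> 'q alg_closure) set" where
  "tate_module \<phi> f h =
     {x. \<forall>n. reduced_action \<phi> f (h ^ n) (x n) = 0 \<and> reduced_action \<phi> f h (x (Suc n)) = x n}"

text \<open>
  \<open>\<Sum>\<^sub>i \<alpha>\<^sub>i e\<^sub>i\<close> with \<open>\<alpha>\<^sub>i \<in> A\<^sub>h\<close>: on the \<open>h\<^sup>n\<close>-torsion \<open>\<alpha>\<^sub>i\<close> acts through its representative modulo \<open>h\<^sup>n\<close>.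
\<close>

definition adic_combination ::
  "'q::finite_field poly poly \<Rightarrow> 'q poly \<Rightarrow> nat \<Rightarrow> (nat \<Rightarrow> nat \<Rightarrow> 'q alg_closure) \<Rightarrow>
   (nat \<Rightarrow> nat \<Rightarrow> 'q poly) \<Rightarrow> nat \<Rightarrow> 'q alg_closure" where
  "adic_combination \<phi> f k e \<alpha> = (\<lambda>n. \<Sum>i<k. reduced_action \<phi> f (\<alpha> i n) (e i n))"

definition is_tate_basis ::
  "'q::finite_field poly poly \<Rightarrow> 'q poly \<Rightarrow> 'q poly \<Rightarrow> nat \<Rightarrow> (nat \<Rightarrow> nat \<Rightarrow> 'q alg_closure) \<Rightarrow> bool" where
  "is_tate_basis \<phi> f h k e \<longleftrightarrow>
     (\<forall>i<k. e i \<in> tate_module \<phi> f h) \<and>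
     bij_betw (adic_combination \<phi> f k e) ({..<k} \<rightarrow>\<^sub>E adic_completion h) (tate_module \<phi> f h)"

definition frobenius ::
  "'q::finite_field poly \<Rightarrow> (nat \<Rightarrow> 'q alg_closure) \<Rightarrow> nat \<Rightarrow> 'q alg_closure" where
  "frobenius f x = (\<lambda>n. x n ^ (CARD('q) ^ degree f))"

text \<open>
  \<open>P \<in> A[x]\<close> equals the characteristic polynomial over \<open>A\<^sub>h\<close> of the matrix \<open>M\<close> of \<open>\<tau>\<^sup>d\<close> in some
  basis. Equality in \<open>A\<^sub>h\<close> is checked modulo every \<open>h\<^sup>n\<close>, where \<open>M\<close> is represented by a matrix
  over \<open>A\<close>.
\<close>

definition is_frobenius_charpoly ::
  "'q::finite_field poly poly \<Rightarrow> 'q poly \<Rightarrow> 'q poly \<Rightarrow> 'q poly poly \<Rightarrow> bool" where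
  "is_frobenius_charpoly \<phi> f h P \<longleftrightarrow>
     (let k = reduced_rank \<phi> f in
      \<exists>e M. is_tate_basis \<phi> f h k e \<and>
        (\<forall>i<k. \<forall>j<k. M i j \<in> adic_completion h) \<and>
        (\<forall>j<k. frobenius f (e j) = adic_combination \<phi> f k e (\<lambda>i. M i j)) \<and>
        (\<forall>n m. h ^ n dvd coeff (char_poly (mat k k (\<lambda>(i, j). M i j n))) m - coeff P m))"

definition frobenius_charpoly ::
  "'q::finite_field poly poly \<Rightarrow> 'q poly \<Rightarrow> 'q poly poly" where
  "frobenius_charpoly \<phi> f =
     (THE P. \<forall>h. monic_irreducible h \<and> h \<noteq> f \<longrightarrow> is_frobenius_charpoly \<phi> f h P)"

definition frobenius_const :: "'q::finite_field poly poly \<Rightarrow> 'q poly \<Rightarrow> 'q" where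
  "frobenius_const \<phi> f =
     (THE c. c \<noteq> 0 \<and> coeff (frobenius_charpoly \<phi> f) 0 = smult (inverse c) f)"

definition euler_D :: "'q::finite_field poly poly \<Rightarrow> 'q poly \<Rightarrow> 'q poly poly" where
  "euler_D \<phi> f =
     (if reduced_rank \<phi> f = 0 then 1
      else 1 + (\<Sum>i = 1..reduced_rank \<phi> f.
        monom (smult (frobenius_const \<phi> f) (coeff (frobenius_charpoly \<phi> f) i * f ^ (i - 1))) i))"

text \<open>
  \<open>\<mu>\<close> is multiplicative in the arithmetic sense (on coprime arguments). The identity
  \<open>\<Sum>\<^sub>i \<mu>(f\<^sup>i) x\<^sup>i = D\<^sub>f(x)\<^sup>-\<^sup>1\<close> lives in \<open>A[[x]]\<close>. Only values on monic polynomials matter.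
\<close>

definition is_dual_mu :: "'q::finite_field poly poly \<Rightarrow> ('q poly \<Rightarrow> 'q poly) \<Rightarrow> bool" where
  "is_dual_mu \<phi> \<mu> \<longleftrightarrow>
     \<mu> 1 = 1 \<and>
     (\<forall>a b. lead_coeff a = 1 \<and> lead_coeff b = 1 \<and> coprime a b \<longrightarrow> \<mu> (a * b) = \<mu> a * \<mu> b) \<and>
     (\<forall>f. monic_irreducible f \<longrightarrow> Abs_fps (\<lambda>i. \<mu> (f ^ i)) * fps_of_poly (euler_D \<phi> f) = 1)"


section \<open>Power series, the Tate algebra, and entire functions\<close>

text \<open>
  A power series in variables indexed by \<open>{..<n}\<close> is its family of coefficients, indexed by
  exponent vectors. Points of \<open>\<complex>\<^sub>\<infinity>\<^sup>n\<close> are functions on \<open>nat\<close> of which only the values on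
  \<open>{..<n}\<close> matter.
\<close>

definition in_vars :: "nat \<Rightarrow> ((nat \<Rightarrow>\<^sub>0 nat) \<Rightarrow> 'c::zero) \<Rightarrow> bool" where
  "in_vars n c \<longleftrightarrow> (\<forall>m. c m \<noteq> 0 \<longrightarrow> Poly_Mapping.keys m \<subseteq> {..<n})"

definition ps_term ::
  "((nat \<Rightarrow>\<^sub>0 nat) \<Rightarrow> 'c::complete_nonarch_field) \<Rightarrow> (nat \<Rightarrow> 'c) \<Rightarrow> (nat \<Rightarrow>\<^sub>0 nat) \<Rightarrow> 'c" where
  "ps_term c w m = c m * (\<Prod>k\<in>Poly_Mapping.keys m. w k ^ Poly_Mapping.lookup m k)"

definition ps_eval ::
  "((nat \<Rightarrow>\<^sub>0 nat) \<Rightarrow> 'c::complete_nonarch_field) \<Rightarrow> (nat \<Rightarrow> 'c) \<Rightarrow> 'c" where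
  "ps_eval c w = infsum (ps_term c w) UNIV"

definition everywhere_convergent ::
  "nat \<Rightarrow> ((nat \<Rightarrow>\<^sub>0 nat) \<Rightarrow> 'c::complete_nonarch_field) \<Rightarrow> bool" where
  "everywhere_convergent n c \<longleftrightarrow> in_vars n c \<and> (\<forall>w. ps_term c w summable_on UNIV)"

text \<open>
  Entire functions on \<open>\<complex>\<^sub>\<infinity>\<^sup>n \<times> \<bbbS>\<^sub>\<infinity>\<close>: \<open>F z x y = g\<^sub>y(z, 1/x)\<close>, the variable \<open>u\<close> of \<open>g\<^sub>y\<close> having
  index \<open>n\<close>.
\<close>

definition goss_entire ::
  "nat \<Rightarrow> nat \<Rightarrow> ((nat \<Rightarrow> 'c::complete_nonarch_field) \<Rightarrow> 'c \<Rightarrow> (nat \<Rightarrow> int) \<Rightarrow> 'c) \<Rightarrow> bool" where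
  "goss_entire p n F \<longleftrightarrow>
     (\<exists>g. (\<forall>y\<in>padic_ints p. everywhere_convergent (Suc n) (g y)) \<and>
          (\<forall>z x y. x \<noteq> 0 \<and> y \<in> padic_ints p \<longrightarrow> F z x y = ps_eval (g y) (z(n := inverse x))) \<and>
          (\<forall>H. (\<exists>B. \<forall>w\<in>H. \<forall>k\<le>n. vabs (w k) \<le> B) \<longrightarrow>
             (\<forall>\<epsilon>>0. \<exists>\<delta>>0. \<forall>y0\<in>padic_ints p. \<forall>y1\<in>padic_ints p. padic_dist p y0 y1 < \<delta> \<longrightarrow>
                (\<forall>w\<in>H. vabs (ps_eval (g y0) w - ps_eval (g y1) w) < \<epsilon>))))"

definition tate_algebra :: "nat \<Rightarrow> ((nat \<Rightarrow>\<^sub>0 nat) \<Rightarrow> 'c::complete_nonarch_field) set" where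
  "tate_algebra n = {c. in_vars n c \<and> (\<forall>\<epsilon>>0. finite {m. vabs (c m) \<ge> \<epsilon>})}"

definition gauss_norm :: "((nat \<Rightarrow>\<^sub>0 nat) \<Rightarrow> 'c::complete_nonarch_field) \<Rightarrow> real" where
  "gauss_norm c = (SUP m. vabs (c m))"

definition tate_sums ::
  "nat \<Rightarrow> (nat \<Rightarrow> (nat \<Rightarrow>\<^sub>0 nat) \<Rightarrow> 'c::complete_nonarch_field) \<Rightarrow> ((nat \<Rightarrow>\<^sub>0 nat) \<Rightarrow> 'c) \<Rightarrow> bool" where
  "tate_sums n c G \<longleftrightarrow>
     (\<forall>d. c d \<in> tate_algebra n) \<and> G \<in> tate_algebra n \<and>
     (\<lambda>N. gauss_norm (\<lambda>m. (\<Sum>d<N. c d m) - G m)) \<longlonglongrightarrow> 0"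


section \<open>The \<open>L\<close>-series\<close>

definition one_unit ::
  "('q::finite_field fls alg_closure \<Rightarrow> 'c::complete_nonarch_field) \<Rightarrow> 'q poly \<Rightarrow> 'c" where
  "one_unit \<iota> a = emb_A \<iota> a * inverse (theta \<iota>) ^ degree a"

definition one_unit_power ::
  "('q::finite_field fls alg_closure \<Rightarrow> 'c::complete_nonarch_field) \<Rightarrow> 'q poly \<Rightarrow> (nat \<Rightarrow> int) \<Rightarrow> 'c" where
  "one_unit_power \<iota> a y =
     suminf (\<lambda>i. of_nat (padic_binomial CHAR('q) y i) * (one_unit \<iota> a - 1) ^ i)"

definition L_term ::
  "('q::finite_field fls alg_closure \<Rightarrow> 'c::complete_nonarch_field) \<Rightarrow> ('q poly \<Rightarrow> 'q poly) \<Rightarrow> nat \<Rightarrow>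
   (nat \<Rightarrow> 'c) \<Rightarrow> 'c \<Rightarrow> (nat \<Rightarrow> int) \<Rightarrow> nat \<Rightarrow> 'c" where
  "L_term \<iota> \<mu> n z x y d =
     inverse x ^ d *
     (\<Sum>a\<in>monics d. emb_A \<iota> (\<mu> a) * (\<Prod>k<n. eval_at \<iota> a (z k)) * one_unit_power \<iota> a y)"

text \<open>
  The first conjunct provides a domain of convergence of the series to continue from (\<open>x\<close> large,
  with a bound uniform for \<open>z\<close> in a polydisc); by the second, \<open>F\<close> is the sum wherever the series
  converges.
\<close>

definition continues_L_series ::
  "('q::finite_field fls alg_closure \<Rightarrow> 'c::complete_nonarch_field) \<Rightarrow> ('q poly \<Rightarrow> 'q poly) \<Rightarrow> nat \<Rightarrow>
   ((nat \<Rightarrow> 'c) \<Rightarrow> 'c \<Rightarrow> (nat \<Rightarrow> int) \<Rightarrow> 'c) \<Rightarrow> bool" where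
  "continues_L_series \<iota> \<mu> n F \<longleftrightarrow>
     (\<forall>B. \<exists>R. \<forall>z x y. (\<forall>k<n. vabs (z k) \<le> B) \<and> vabs x > R \<and> x \<noteq> 0 \<and> y \<in> padic_ints CHAR('q)
        \<longrightarrow> summable (L_term \<iota> \<mu> n z x y)) \<and>
     (\<forall>z x y. x \<noteq> 0 \<and> y \<in> padic_ints CHAR('q) \<and> summable (L_term \<iota> \<mu> n z x y)
        \<longrightarrow> F z x y = suminf (L_term \<iota> \<mu> n z x y))"

text \<open>
  \<open>a(z\<^sub>k)\<close> and \<open>\<Sum> \<mu>(a) a(z\<^sub>1) \<dots> a(z\<^sub>n) a\<^sup>-\<^sup>s\<close> over monic \<open>a\<close> of degree \<open>d\<close> as formal polynomials
  in \<open>z\<^sub>1, \<dots>, z\<^sub>n\<close>, that is, as elements of the Tate algebra. Variables are numbered from 0.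
\<close>

definition at_variable ::
  "('q::finite_field fls alg_closure \<Rightarrow> 'c::complete_nonarch_field) \<Rightarrow> 'q poly \<Rightarrow> nat \<Rightarrow>
   (nat \<Rightarrow>\<^sub>0 nat) \<Rightarrow>\<^sub>0 'c" where
  "at_variable \<iota> a k =
     (\<Sum>j\<le>degree a. Poly_Mapping.single (Poly_Mapping.single k j) (emb_Fq \<iota> (coeff a j)))"

definition L_degree_part ::
  "('q::finite_field fls alg_closure \<Rightarrow> 'c::complete_nonarch_field) \<Rightarrow> ('q poly \<Rightarrow> 'q poly) \<Rightarrow> nat \<Rightarrow>
   int \<Rightarrow> nat \<Rightarrow> (nat \<Rightarrow>\<^sub>0 nat) \<Rightarrow>\<^sub>0 'c" where
  "L_degree_part \<iota> \<mu> n s d =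
     (\<Sum>a\<in>monics d. Poly_Mapping.single 0 (emb_A \<iota> (\<mu> a) / emb_A \<iota> a powi s) *
        (\<Prod>k<n. at_variable \<iota> a k))"

end

theory Submission
  imports Defs
begin

text \<open>
  The coefficients of \<open>L(\<phi>\<^sup>\<or>, z\<^sub>1, \<dots>, z\<^sub>n; x, y)\<close> in \<open>x\<^bsup>-d\<^esup> z\<^sup>j\<close> are sums of \<open>\<mu>(a) \<langle>a\<rangle>\<^sup>y\<close> times coefficients
  of \<open>a\<close>, over \<open>a\<close> monic of degree \<open>d\<close>. Up to an error of size \<open>q\<^bsup>-q\<^sup>N\<^esup>\<close> one may replace \<open>y\<close> by an integer
  less than \<open>q\<^sup>N\<close>; as \<open>a(\<theta>)\<^sup>q = a(\<theta>\<^sup>q)\<close>, the power \<open>\<langle>a\<rangle>\<^sup>y\<close> then becomes a product of at most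
  \<open>(q - 1) N\<close> values of \<open>a\<close>. Hence it suffices that \<open>\<Sum>\<^sub>a \<mu>(a) a(z\<^sub>1) \<dots> a(z\<^sub>m)\<close> vanishes once \<open>d\<close> exceeds a
  linear function of \<open>m\<close>: with \<open>N\<close> proportional to \<open>d\<close> the coefficients then decay faster than any \<open>A\<^bsup>-d\<^esup>\<close>.

  The generating function in \<open>d\<close> of the sums \<open>\<Sum>\<^sub>a \<mu>(a)(t) a(z\<^sub>1) \<dots> a(z\<^sub>m)\<close> is an Euler product. Its factors
  are inverse determinants of matrices over the residue fields, because the characteristic polynomial of
  the Frobenius \<open>\<tau>\<^sup>d\<close> on the Tate module is computed by \<open>det(t - \<phi>\<^sub>\<theta>)\<close> on twisted polynomials modulo \<open>\<tau>\<^sup>d - Y\<close>.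
  By Anderson's trace formula the product is the determinant of a Cartier-linear operator on the
  polynomials of degree less than a linear function of \<open>m\<close>, thus a polynomial of bounded degree.
\<close>

text \<open>Up to the vanishing of the sums, everything happens over the single field F_q-bar: t and
  the z_k are specialised to elements outside the finitely many roots of the primes involved, and
  the polynomial identity is recovered because infinitely many values remain. The trace formula is
  needed only modulo a power of x, so finitely many primes suffice. Admitting poles at all primes of
  degree at most N makes every coefficient of positive index divisible by all X^(q^k) - X with 0 < k
  <= N; such an operator has determinant 1 modulo x^(N+1), while each prime contributes its local
  determinant. The formula wants constant coefficient 1, but t - \<phi>_\<theta> starts with t - X.
  Rescaling \<tau> by t - X and dividing by t - X repairs this, and produces at f the powers of f(t)
  by which D_f differs from det(t - \<phi>_\<theta>). The Tate modules enter D_f for all h at once.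
  Anderson generating functions, expanded at a root of h, compare the Frobenius on the Tate module
  with a matrix that does not involve h; so one polynomial serves all h.\<close>

hide_const (open) Divisibility.prime

section \<open>Finite fields, their algebraic closure, and Frobenius orbits\<close>

abbreviation lift_ac :: "'q::field poly \<Rightarrow> 'q alg_closure poly" where
  "lift_ac \<equiv> map_poly to_ac"

interpretation to_ac: field_hom "to_ac :: 'q::field \<Rightarrow> 'q alg_closure"
  by unfold_locales simp_all

interpretation lift_ac: map_poly_inj_idom_hom "to_ac :: 'q::field \<Rightarrow> 'q alg_closure" ..

lemma card_finite_field_gt_1: "CARD('q::finite_field) > 1"
proof -
  have "card {0, 1::'q} \<le> CARD('q)" by (intro card_mono) auto
  then show ?thesis by simp
qed

lemma poly_all_roots_zero:
  fixes p :: "'q::finite_field poly"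
  assumes "\<And>x. poly p x = 0" "degree p < CARD('q)"
  shows "p = 0"
proof (rule ccontr)
  assume "p \<noteq> 0"
  then have "card {x. poly p x = 0} \<le> degree p" by (rule card_poly_roots_bound)
  moreover have "{x. poly p x = 0} = UNIV" using assms by auto
  ultimately show False using assms by auto
qed

text \<open>The polynomial (1 + X)^q - 1 - X^q has degree below q and vanishes on all of F_q, hence
  is zero. Write q = p^e m with m prime to p. Then (1 + X)^q = (1 + X^(p^e))^m, whose coefficient at
  X^(p^e) is m if m > 1; this is nonzero in F_q, a contradiction.\<close>

lemma card_finite_field_eq_power_CHAR: "\<exists>l>0. CARD('q::finite_field) = CHAR('q) ^ l"
proof -
  let ?p = "CHAR('q)" and ?q = "CARD('q)"
  have p: "prime ?p" by simp
  have q0: "?q > 1" by (rule card_finite_field_gt_1)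
  define P where "P = [:1, 1::'q:] ^ ?q - 1 - monom 1 ?q"
  have "degree P < ?q"
  proof -
    have "degree ([:1, 1::'q:] ^ ?q) = ?q" by (simp add: degree_power_eq)
    moreover have "lead_coeff ([:1, 1::'q:] ^ ?q) = 1" by (simp add: lead_coeff_power)
    ultimately have c: "coeff ([:1, 1::'q:] ^ ?q) ?q = 1" "\<forall>i>?q. coeff ([:1, 1::'q:] ^ ?q) i = 0"
      by (metis, metis coeff_eq_0)
    have "coeff P i = 0" if "i \<ge> ?q" for i
      using that c q0 by (cases "i = ?q") (auto simp: P_def coeff_1)
    then show ?thesis using q0 by (metis degree_lessI not_less zero_less_one dual_order.strict_trans le_degree leading_coeff_0_iff bot_nat_0.not_eq_extremum degree_0)
  qed
  moreover have "poly P x = 0" for x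
    by (simp add: P_def poly_monom finite_field_power_card_eq_same)
  ultimately have P0: "P = 0" by (intro poly_all_roots_zero) auto
  obtain e m where em: "?q = ?p ^ e * m" "\<not> ?p dvd m"
    using multiplicity_decompose'[of ?q ?p] p q0 by (metis not_prime_unit not_one_less_zero)
  have "[:1, 1::'q:] ^ ?q = ([:1,1:] ^ (?p ^ e)) ^ m" by (simp add: em power_mult)
  also have "[:1, 1::'q:] ^ (?p ^ e) = (1 + monom 1 1) ^ (?p ^ e)"
    by (simp add: monom_altdef flip: one_pCons) (simp add: one_pCons)
  also have "\<dots> = 1 + monom 1 (?p ^ e)"
    by (subst freshmans_dream'[where n = e]) (use p in \<open>simp_all add: monom_power\<close>)
  finally have eq: "(1 + monom (1::'q) (?p ^ e)) ^ m = 1 + monom 1 ?q" using P0 by (simp add: P_def algebra_simps)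
  have "m = 1"
  proof (rule ccontr)
    assume m1: "m \<noteq> 1"
    have "m > 0" using em(2) by (intro gr0I) auto
    with m1 have "m > 1" by simp
    have pe: "?p ^ e > 0" using p by (simp add: prime_gt_0_nat)
    have "(1 + monom (1::'q) (?p ^ e)) ^ m = (\<Sum>k\<le>m. of_nat (m choose k) * monom 1 (?p ^ e * k))"
      by (subst add.commute, subst binomial_ring) (simp add: monom_power mult.commute)
    then have "coeff ((1 + monom (1::'q) (?p ^ e)) ^ m) (?p ^ e)
        = (\<Sum>k\<le>m. coeff (of_nat (m choose k) * monom 1 (?p ^ e * k)) (?p ^ e))"
      by (simp add: coeff_sum)
    also have "\<dots> = (\<Sum>k\<le>m. if k = 1 then of_nat m else 0)"
    proof (rule sum.cong)
      fix k
      have "of_nat (m choose k) * monom (1::'q) (?p ^ e * k) = monom (of_nat (m choose k)) (?p ^ e * k)"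
        by (simp add: of_nat_poly smult_monom)
      then show "coeff (of_nat (m choose k) * monom (1::'q) (?p ^ e * k)) (?p ^ e) = (if k = 1 then of_nat m else 0)"
        using pe by auto
    qed simp
    also have "\<dots> = of_nat m" using \<open>m > 1\<close> by simp
    finally have "of_nat m = coeff (1 + monom (1::'q) ?q) (?p ^ e)" by (simp add: eq)
    also have "\<dots> = 0" using pe em \<open>m > 1\<close> by (auto simp: coeff_1)
    finally show False using em(2) by (simp add: of_nat_eq_0_iff_char_dvd)
  qed
  with em q0 show ?thesis by (intro exI[of _ e]) (auto intro: gr0I)
qed

lemma pow_card_add:
  fixes x y :: "'a::comm_ring_1"
  assumes "CHAR('a) = CHAR('q::finite_field)"
  shows "(x + y) ^ (CARD('q) ^ k) = x ^ (CARD('q) ^ k) + y ^ (CARD('q) ^ k)"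
proof -
  obtain l where "CARD('q) = CHAR('q) ^ l" using card_finite_field_eq_power_CHAR by blast
  then have "CARD('q) ^ k = CHAR('a) ^ (l * k)" by (simp add: assms power_mult)
  then show ?thesis by (rule freshmans_dream'[rotated]) (simp add: assms)
qed

lemma pow_card_sum:
  fixes f :: "'b \<Rightarrow> 'a::comm_ring_1"
  assumes "CHAR('a) = CHAR('q::finite_field)"
  shows "sum f A ^ (CARD('q) ^ k) = (\<Sum>x\<in>A. f x ^ (CARD('q) ^ k))"
proof -
  obtain l where "CARD('q) = CHAR('q) ^ l" using card_finite_field_eq_power_CHAR by blast
  then have "CARD('q) ^ k = CHAR('a) ^ (l * k)" by (simp add: assms power_mult)
  then show ?thesis by (rule freshmans_dream_sum'[rotated]) (simp add: assms)
qed

lemma pow_card_diff: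
  fixes x y :: "'a::comm_ring_1"
  assumes "CHAR('a) = CHAR('q::finite_field)"
  shows "(x - y) ^ (CARD('q) ^ k) = x ^ (CARD('q) ^ k) - y ^ (CARD('q) ^ k)"
  using pow_card_add[OF assms, of "x - y" y k] by simp

lemma to_ac_pow_card [simp]: "to_ac (c::'q::finite_field) ^ (CARD('q) ^ k) = to_ac c"
  by (metis finite_field_power_card_power_eq_same to_ac_power)

lemma to_ac_pow_card1 [simp]: "to_ac (c::'q::finite_field) ^ CARD('q) = to_ac c"
  using to_ac_pow_card[of c 1] by simp

text \<open>X^q - X has at most q roots, and F_q already supplies q of them.\<close>

lemma fixed_imp_range_to_ac:
  fixes x :: "'q::finite_field alg_closure"
  assumes "x ^ CARD('q) = x"
  shows "x \<in> range to_ac"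
proof (rule ccontr)
  assume x: "x \<notin> range to_ac"
  define P where "P = monom (1::'q alg_closure) CARD('q) - monom 1 1"
  have q: "CARD('q) > 1" by (rule card_finite_field_gt_1)
  have "degree P = CARD('q)" unfolding P_def
    using q degree_add_eq_left[of "- monom (1::'q alg_closure) 1" "monom 1 CARD('q)"] by (simp add: degree_monom_eq)
  moreover from this have P0: "P \<noteq> 0" using q by auto
  moreover have "insert x (range to_ac) \<subseteq> {x. poly P x = 0}"
    using assms by (auto simp: P_def poly_monom)
  then have "card (insert x (range to_ac)) \<le> card {x. poly P x = 0}"
    by (intro card_mono poly_roots_finite P0)
  ultimately have "card (insert x (range (to_ac :: 'q \<Rightarrow> _))) \<le> CARD('q)"
    using card_poly_roots_bound[of P] by simp
  moreover have "card (insert x (range (to_ac :: 'q \<Rightarrow> _))) = Suc CARD('q)"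
    using x by (simp add: card_image inj_to_ac)
  ultimately show False by simp
qed

lemma poly_lift_ac_pow_card:
  fixes x :: "'q::finite_field alg_closure"
  shows "poly (lift_ac f) (x ^ (CARD('q) ^ k)) = poly (lift_ac f) x ^ (CARD('q) ^ k)"
proof -
  have "poly (lift_ac f) x ^ (CARD('q) ^ k) = (\<Sum>i\<le>degree f. to_ac (coeff f i) * x ^ i) ^ (CARD('q) ^ k)"
    by (simp add: poly_altdef)
  also have "\<dots> = (\<Sum>i\<le>degree f. to_ac (coeff f i) * (x ^ i) ^ (CARD('q) ^ k))"
    by (subst pow_card_sum) (simp_all add: power_mult_distrib)
  also have "\<dots> = poly (lift_ac f) (x ^ (CARD('q) ^ k))"
    by (simp add: poly_altdef mult.commute flip: power_mult)
  finally show ?thesis ..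
qed

lemma lift_ac_descent:
  fixes p :: "'q::finite_field alg_closure poly"
  assumes "\<And>i. coeff p i \<in> range to_ac"
  shows "\<exists>g. p = lift_ac g"
proof
  have "to_ac (of_ac (coeff p i)) = coeff p i" for i using assms to_ac_of_ac by blast
  then show "p = lift_ac (map_poly of_ac p)"
    by (intro poly_eqI) (simp add: coeff_map_poly)
qed

lemma minimal_polynomial_exists:
  fixes \<xi> :: "'q::finite_field alg_closure"
  obtains m where "monic_irreducible m" "poly (lift_ac m) \<xi> = 0"
    "\<And>g. poly (lift_ac g) \<xi> = 0 \<Longrightarrow> m dvd g"
proof -
  define S where "S = {g::'q poly. g \<noteq> 0 \<and> poly (lift_ac g) \<xi> = 0}"
  obtain p where "p \<in> S" using alg_closure_algebraic[of \<xi>] by (auto simp: S_def)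
  then obtain m0 where m0: "m0 \<in> S" "\<And>g. g \<in> S \<Longrightarrow> degree m0 \<le> degree g"
    using arg_min_nat_lemma[of "\<lambda>g. g \<in> S" p degree] by blast
  define m where "m = smult (inverse (lead_coeff m0)) m0"
  have lc: "lead_coeff m0 \<noteq> 0" using m0 by (auto simp: S_def)
  have m: "m \<in> S" "lead_coeff m = 1" "degree m = degree m0"
    using m0 lc by (auto simp: m_def S_def hom_distribs)
  have dv: "m dvd g" if "poly (lift_ac g) \<xi> = 0" for g
  proof -
    have "lift_ac g = lift_ac (g div m) * lift_ac m + lift_ac (g mod m)"
      by (metis div_mult_mod_eq lift_ac.hom_add lift_ac.hom_mult)
    then have "poly (lift_ac g) \<xi> = poly (lift_ac (g div m)) \<xi> * poly (lift_ac m) \<xi> + poly (lift_ac (g mod m)) \<xi>"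
      by (metis poly_add poly_mult)
    then have r: "poly (lift_ac (g mod m)) \<xi> = 0" using that m by (simp add: S_def)
    have "g mod m = 0"
    proof (rule ccontr)
      assume *: "g mod m \<noteq> 0"
      then have "degree (g mod m) < degree m"
        using degree_mod_less'[of m g] m by (auto simp: S_def)
      moreover have "g mod m \<in> S" using * r by (simp add: S_def)
      ultimately show False using m0(2) m(3) by (metis leD)
    qed
    then show ?thesis by auto
  qed
  have "irreducible m"
  proof (rule Factorial_Ring.irreducibleI)
    show "m \<noteq> 0" using m by (auto simp: S_def)
    show "\<not> m dvd 1"
    proof
      assume "m dvd 1"
      then obtain k where "1 = m * k" by (elim dvdE)
      then have "lift_ac 1 = lift_ac m * lift_ac k" by (metis lift_ac.hom_mult)
      then have "poly (lift_ac 1) \<xi> = poly (lift_ac m) \<xi> * poly (lift_ac k) \<xi>" by (metis poly_mult)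
      then show False using m by (simp add: S_def)
    qed
  next
    fix a b assume ab: "m = a * b"
    have nz: "a \<noteq> 0" "b \<noteq> 0" using m ab by (auto simp: S_def)
    have "poly (lift_ac a) \<xi> * poly (lift_ac b) \<xi> = 0" using m ab by (simp add: S_def hom_distribs)
    then consider "poly (lift_ac a) \<xi> = 0" | "poly (lift_ac b) \<xi> = 0" by auto
    then show "a dvd 1 \<or> b dvd 1"
    proof cases
      case 1
      then have "m dvd a" by (rule dv)
      then have "degree m \<le> degree a" using nz by (simp add: dvd_imp_degree_le)
      then have "degree b = 0" using ab nz by (simp add: degree_mult_eq)
      then show ?thesis using nz is_unit_iff_degree by blast
    next
      case 2
      then have "m dvd b" by (rule dv)
      then have "degree m \<le> degree b" using nz by (simp add: dvd_imp_degree_le)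
      then have "degree a = 0" using ab nz by (simp add: degree_mult_eq)
      then show ?thesis using nz is_unit_iff_degree by blast
    qed
  qed
  then show ?thesis using that[of m] m dv by (auto simp: monic_irreducible_def S_def)
qed

lemma monic_irreducible_dvd_eq:
  fixes f g :: "'q::field poly"
  assumes "monic_irreducible f" "monic_irreducible g" "f dvd g"
  shows "f = g"
proof -
  from assms(3) obtain k where k: "g = f * k" by (elim dvdE)
  have "k dvd 1" using assms k by (auto simp: monic_irreducible_def dest: irreducible_multD irreducible_not_unit)
  then obtain c where c: "k = [:c:]" by (metis is_unit_polyE)
  have "lead_coeff g = lead_coeff f * c" by (simp add: k c)
  then have "c = 1" using assms by (simp add: monic_irreducible_def)
  then show ?thesis using k c by simp
qed

text \<open>Reduction modulo f becomes evaluation at a root of f. Primality, coprimality and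
  divisibility are deduced below from this evaluation.\<close>

lemma monic_irreducible_dvd_iff_root:
  fixes f :: "'q::finite_field poly"
  assumes f: "monic_irreducible f" and r: "poly (lift_ac f) \<xi> = 0"
  shows "poly (lift_ac g) \<xi> = 0 \<longleftrightarrow> f dvd g"
proof
  obtain m where m: "monic_irreducible m" "poly (lift_ac m) \<xi> = 0"
    "\<And>g. poly (lift_ac g) \<xi> = 0 \<Longrightarrow> m dvd g" using minimal_polynomial_exists by blast
  have "m = f" using m f r monic_irreducible_dvd_eq by blast
  then show "poly (lift_ac g) \<xi> = 0 \<Longrightarrow> f dvd g" using m by blast
next
  assume "f dvd g"
  then show "poly (lift_ac g) \<xi> = 0" using r by (auto simp: hom_distribs elim!: dvdE)
qed

lemma monic_irreducible_degree_pos: "monic_irreducible (f::'q::field poly) \<Longrightarrow> degree f > 0"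
  by (metis gr0I irreducible_not_unit is_unit_iff_degree monic_irreducible_def not_irreducible_zero)

lemma monic_irreducible_root_exists:
  fixes f :: "'q::field poly"
  assumes "monic_irreducible f"
  shows "\<exists>\<xi>. poly (lift_ac f) \<xi> = 0"
  by (rule alg_closed_imp_poly_has_root) (use monic_irreducible_degree_pos[OF assms] in simp)

lemma residue_root: "monic_irreducible (f::'q::finite_field poly) \<Longrightarrow> poly (lift_ac f) (residue_root f) = 0"
  unfolding residue_root_def using monic_irreducible_root_exists[of f] by (rule someI_ex)

lemma pow_card_inj:
  fixes x y :: "'q::finite_field alg_closure"
  assumes "x ^ (CARD('q) ^ k) = y ^ (CARD('q) ^ k)"
  shows "x = y"
proof -
  have "(x - y) ^ (CARD('q) ^ k) = 0" using assms by (subst pow_card_diff) auto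
  then show ?thesis by simp
qed

lemma prod_linear_dvd:
  fixes p :: "'a::idom poly"
  assumes "finite S" "\<And>x. x \<in> S \<Longrightarrow> poly p x = 0"
  shows "(\<Prod>x\<in>S. [:- x, 1:]) dvd p"
  using assms
proof (induction S arbitrary: p rule: finite_induct)
  case (insert x S)
  then obtain k where k: "p = [:- x, 1:] * k" by (meson dvdE insertI1 poly_eq_0_iff_dvd)
  have "poly k y = 0" if "y \<in> S" for y
    using insert.prems[of y] insert.hyps that by (auto simp: k)
  then have "(\<Prod>x\<in>S. [:- x, 1:]) dvd k" by (rule insert.IH)
  then show ?case unfolding k prod.insert[OF insert.hyps] by (rule mult_dvd_mono[OF dvd_refl])
qed simp

text \<open>Let e be the length of the Frobenius orbit of \<xi>. The product P over the orbit has
  coefficients fixed by the q-power map, hence in F_q, so f divides it. Conversely f vanishes on the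
  whole orbit, so P divides f. Both are monic, whence P = f and e is the degree of f.\<close>

lemma monic_irreducible_orbit:
  fixes f :: "'q::finite_field poly"
  assumes f: "monic_irreducible f" and r: "poly (lift_ac f) \<xi> = 0"
  shows "\<xi> ^ (CARD('q) ^ degree f) = \<xi>"
    and "inj_on (\<lambda>j. \<xi> ^ (CARD('q) ^ j)) {..<degree f}"
    and "lift_ac f = (\<Prod>j<degree f. [:- (\<xi> ^ (CARD('q) ^ j)), 1:])"
    and "\<And>k. k > 0 \<Longrightarrow> \<xi> ^ (CARD('q) ^ k) = \<xi> \<Longrightarrow> degree f \<le> k"
proof -
  let ?o = "\<lambda>j. \<xi> ^ (CARD('q) ^ j)"
  have oo: "?o (i + j) = ?o i ^ (CARD('q) ^ j)" for i j by (simp add: power_add flip: power_mult)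
  have root: "poly (lift_ac f) (?o j) = 0" for j by (simp add: poly_lift_ac_pow_card r)
  have f0: "lift_ac f \<noteq> 0" using f by (auto simp: monic_irreducible_def)
  have "finite (range ?o)"
    by (rule finite_subset[OF _ poly_roots_finite[OF f0]]) (use root in auto)
  then have "\<not> inj ?o" using finite_imageD by blast
  then obtain i j where ij: "i < j" "?o i = ?o j" by (metis inj_onI linorder_neqE_nat)
  then have "?o (0 + i) = ?o ((j - i) + i)" by simp
  then have "?o 0 = ?o (j - i)" unfolding oo using pow_card_inj by blast
  then have ex: "\<exists>e>0. ?o e = \<xi>" using ij by (intro exI[of _ "j - i"]) auto
  define e where "e = (LEAST e. e > 0 \<and> ?o e = \<xi>)"
  have e: "e > 0" "?o e = \<xi>" using LeastI_ex[OF ex] by (auto simp: e_def)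
  have e_le: "e \<le> k" if "k > 0" "?o k = \<xi>" for k using that by (auto simp: e_def intro: Least_le)
  have inj: "inj_on ?o {..<e}"
  proof (rule linorder_inj_onI)
    fix i j assume ij: "i < j" "i \<in> {..<e}" "j \<in> {..<e}"
    show "?o i \<noteq> ?o j"
    proof
      assume eq: "?o i = ?o j"
      then have "?o (0 + i) = ?o ((j - i) + i)" using ij(1) by simp
      then have "?o 0 = ?o (j - i)" unfolding oo using pow_card_inj by blast
      then have "e \<le> j - i" using ij by (intro e_le) auto
      then show False using ij by auto
    qed
  qed auto
  define P where "P = (\<Prod>j<e. [:- ?o j, 1:])"
  have degP: "degree P = e" by (simp add: P_def degree_prod_eq_sum_degree)
  have lcP: "lead_coeff P = 1" by (simp add: P_def lead_coeff_prod)
  have rootP: "poly P \<xi> = 0" 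
    unfolding P_def poly_prod by (rule prod_zero) (use e(1) in \<open>auto intro!: bexI[of _ 0]\<close>)
  \<comment> \<open>\<open>F\<close> raises coefficients to the power q. It sends the factor of
    index j to that of index j + 1, and the orbit closes up after e steps, so \<open>P\<close> is
    fixed.\<close>
  define F :: "'q alg_closure poly \<Rightarrow> 'q alg_closure poly" where "F = map_poly (\<lambda>x. x ^ CARD('q))"
  have c0: "coeff (F p) i = coeff p i ^ CARD('q)" for p i
    using card_finite_field_gt_1[where 'q='q] by (simp add: F_def coeff_map_poly)
  have Fmult: "F (p * r) = F p * F r" for p r
    by (intro poly_eqI) (simp add: c0 coeff_mult pow_card_sum[where 'q='q and k=1, simplified] power_mult_distrib)
  have F1: "F 1 = 1" by (simp add: F_def)
  have "F P = (\<Prod>j<e. F [:- ?o j, 1:])"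
    unfolding P_def by (induction e) (simp_all add: Fmult F1 del: mult_pCons_left mult_pCons_right)
  moreover have "F [:- ?o j, 1:] = [:- ?o (Suc j), 1:]" for j
  proof -
    have "(- x) ^ CARD('q) = - (x ^ CARD('q))" for x :: "'q alg_closure"
      using pow_card_diff[where 'q='q and k=1 and x=0 and y=x] card_finite_field_gt_1[where 'q='q] by simp
    moreover have "?o j ^ CARD('q) = ?o (Suc j)" by (metis power_mult power_Suc2)
    ultimately show ?thesis using card_finite_field_gt_1[where 'q='q]
      by (simp add: F_def map_poly_pCons del: power_Suc)
  qed
  ultimately have "F P = (\<Prod>j<e. [:- ?o (Suc j), 1:])" by simp
  also have "(\<Prod>j<e. [:- ?o (Suc j), 1:]) = (\<Prod>j\<in>{1..<Suc e}. [:- ?o j, 1:])"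
    by (rule prod.reindex_bij_witness[of _ "\<lambda>j. j - 1" Suc]) auto
  also have "\<dots> = P"
  proof -
    have "P = [:- ?o 0, 1:] * (\<Prod>j\<in>{1..<e}. [:- ?o j, 1:])"
      unfolding P_def lessThan_atLeast0 using prod.atLeast_Suc_lessThan[OF e(1), of "\<lambda>j. [:- ?o j, 1:]"] by simp
    moreover have "(\<Prod>j\<in>{1..<Suc e}. [:- ?o j, 1:]) = (\<Prod>j\<in>{1..<e}. [:- ?o j, 1:]) * [:- ?o e, 1:]"
      using e(1) by (simp add: prod.atLeastLessThan_Suc del: mult_pCons_left mult_pCons_right)
    ultimately show ?thesis using e(2) by (simp add: mult.commute del: mult_pCons_left mult_pCons_right)
  qed
  finally have "coeff P i ^ CARD('q) = coeff P i" for i by (metis c0)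
  then obtain g where g: "P = lift_ac g" using lift_ac_descent fixed_imp_range_to_ac by metis
  have "f dvd g" using monic_irreducible_dvd_iff_root[OF f r] rootP g by simp
  then have "lift_ac f dvd P" by (auto simp: g hom_distribs elim!: dvdE)
  moreover have "P \<noteq> 0" using lcP by auto
  ultimately have "degree (lift_ac f) \<le> degree P" by (rule dvd_imp_degree_le)
  then have le: "degree f \<le> e" using degP by simp
  have "P dvd lift_ac f"
  proof -
    have "P = (\<Prod>x\<in>?o ` {..<e}. [:- x, 1:])" unfolding P_def using inj by (simp add: prod.reindex)
    also have "\<dots> dvd lift_ac f" by (rule prod_linear_dvd) (use root in auto)
    finally show ?thesis .
  qed
  then obtain k where k: "lift_ac f = P * k" by (elim dvdE)
  have "degree (lift_ac f) = e + degree k" using k f0 degP by (simp add: degree_mult_eq)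
  then have de: "degree f = e" "degree k = 0" using le by auto
  then obtain c where "k = [:c:]" by (metis degree_0_id)
  moreover have "lead_coeff (lift_ac f) = 1" using f by (simp add: monic_irreducible_def)
  ultimately have "lead_coeff [:c:] = 1" using k lcP by (metis lead_coeff_mult mult_1)
  then have "k = 1" using \<open>k = [:c:]\<close> by (simp split: if_splits)
  then show "lift_ac f = (\<Prod>j<degree f. [:- ?o j, 1:])" using k de by (simp add: P_def)
  show "?o (degree f) = \<xi>" "inj_on ?o {..<degree f}" using e de inj by auto
  show "degree f \<le> k" if "k > 0" "\<xi> ^ (CARD('q) ^ k) = \<xi>" for k using e_le[of k] that de by simp
qed

section \<open>Determinants of Cartier-linear operators\<close>

lemma det_dvd_diff:
  fixes A B :: "'a::comm_ring_1 mat"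
  assumes A: "A \<in> carrier_mat n n" and B: "B \<in> carrier_mat n n"
    and d: "\<And>i j. i < n \<Longrightarrow> j < n \<Longrightarrow> y dvd A $$ (i,j) - B $$ (i,j)"
  shows "y dvd det A - det B"
proof -
  have pr: "y dvd (\<Prod>i\<in>S. f i) - (\<Prod>i\<in>S. g i)" if "finite S" "\<And>i. i \<in> S \<Longrightarrow> y dvd f i - g i"
    for S :: "nat set" and f g :: "nat \<Rightarrow> 'a"
    using that
  proof (induction S rule: finite_induct)
    case (insert x S)
    have "(\<Prod>i\<in>insert x S. f i) - (\<Prod>i\<in>insert x S. g i)
       = (f x - g x) * (\<Prod>i\<in>S. f i) + g x * ((\<Prod>i\<in>S. f i) - (\<Prod>i\<in>S. g i))"
      using insert.hyps by (simp add: algebra_simps)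
    then show ?case using insert by (metis dvd_add dvd_mult dvd_mult2 insertCI)
  qed simp
  have "det A - det B = (\<Sum>p | p permutes {0..<n}. signof p *
      ((\<Prod>i = 0..<n. A $$ (i, p i)) - (\<Prod>i = 0..<n. B $$ (i, p i))))"
    by (simp add: det_def'[OF A] det_def'[OF B] sum_subtractf right_diff_distrib)
  also have "y dvd \<dots>"
    by (intro dvd_sum dvd_mult pr d) (auto dest: permutes_in_image)
  finally show ?thesis .
qed

text \<open>Sylvester's identity. The block matrices whose Schur complements are 1 + AB and 1 + BA
  are conjugate by \<open>S\<close>, which exchanges the two blocks up to sign.\<close>

lemma det_one_plus_mult_comm:
  fixes A B :: "'a::idom mat"
  assumes A: "A \<in> carrier_mat n n" and B: "B \<in> carrier_mat n n"
  shows "det (1\<^sub>m n + A * B) = det (1\<^sub>m n + B * A)"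
proof -
  have *: "det (four_block_mat (1\<^sub>m n) (- A) B (1\<^sub>m n)) = det (1\<^sub>m n + A * B)"
    if A: "A \<in> carrier_mat n n" and B: "B \<in> carrier_mat n n" for A B :: "'a mat"
  proof -
    have "1\<^sub>m n * 1\<^sub>m n - (- A) * B = 1\<^sub>m n + A * B"
      using A B by (intro eq_matI) auto
    then show ?thesis
      using A B by (subst det_four_block_mat[of _ n]) auto
  qed
  define S where "S = four_block_mat (0\<^sub>m n n) (1\<^sub>m n) (- 1\<^sub>m n) (0\<^sub>m n n :: 'a mat)"
  let ?M1 = "four_block_mat (1\<^sub>m n) (- A) B (1\<^sub>m n)" and ?M2 = "four_block_mat (1\<^sub>m n) (- B) A (1\<^sub>m n)"
  have Sc: "S \<in> carrier_mat (n + n) (n + n)" by (auto simp: S_def)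
  have "0\<^sub>m n n * 0\<^sub>m n n - 1\<^sub>m n * (- 1\<^sub>m n) = (1\<^sub>m n :: 'a mat)"
    by (intro eq_matI) auto
  then have dS: "det S = 1"
    unfolding S_def by (subst det_four_block_mat[of _ n]) auto
  have neg: "- A * (- 1\<^sub>m n) = A" using A by (intro eq_matI) auto
  have neg2: "- 1\<^sub>m n * - B = B" using B by (intro eq_matI) auto
  have "?M1 * S = four_block_mat A (1\<^sub>m n) (- 1\<^sub>m n) B"
    unfolding S_def using A B neg
    by (subst mult_four_block_mat[of _ n n _ n _ n _ _ n _ n]) (auto intro!: cong_four_block_mat)
  moreover have "S * ?M2 = four_block_mat A (1\<^sub>m n) (- 1\<^sub>m n) B"
    unfolding S_def using A B neg2
    by (subst mult_four_block_mat[of _ n n _ n _ n _ _ n _ n]) (auto intro!: cong_four_block_mat)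
  ultimately have "det ?M1 * det S = det S * det ?M2"
    using A B Sc by (metis det_mult four_block_carrier_mat one_carrier_mat)
  then show ?thesis using dS *[OF A B] *[OF B A] by simp
qed

lemma det_last_row:
  fixes A :: "'a::idom mat"
  assumes A: "A \<in> carrier_mat (Suc n) (Suc n)"
    and r: "\<And>j. j \<le> n \<Longrightarrow> A $$ (n, j) = (if j = n then 1 else 0)"
  shows "det A = det (mat n n (\<lambda>(i,j). A $$ (i,j)))"
proof -
  have "A = four_block_mat (mat n n (\<lambda>(i,j). A $$ (i,j))) (mat n 1 (\<lambda>(i,j). A $$ (i,n))) (0\<^sub>m 1 n) (1\<^sub>m 1)"
    using A r by (intro eq_matI) (auto simp: less_Suc_eq_le not_less)
  then show ?thesis
    by (metis det_four_block_mat_lower_left_zero det_one mat_carrier mult.right_neutral one_carrier_mat)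
qed

lemma fps_X_power_dvd: "fps_X ^ n dvd (f::'a::comm_ring_1 fps) \<longleftrightarrow> (\<forall>i<n. fps_nth f i = 0)"
proof
  assume "fps_X ^ n dvd f"
  then obtain g where "f = fps_X ^ n * g" by (elim dvdE)
  then show "\<forall>i<n. fps_nth f i = 0" by (simp add: fps_X_power_mult_nth)
next
  assume "\<forall>i<n. fps_nth f i = 0"
  then have "f = fps_X ^ n * fps_shift n f" by (intro fps_ext) (auto simp: fps_X_power_mult_nth)
  then show "fps_X ^ n dvd f" by (metis dvd_triv_left)
qed

text \<open>The Cartier operator on differentials h dX: written in terms of X^m dX/X, it keeps the
  exponents m divisible by e, whence the shift in \<open>e * Suc i - 1\<close>. Coefficients are
  left alone instead of being replaced by e-th roots, so the operator is linear over the
  field.\<close>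

definition cartier :: "nat \<Rightarrow> 'a::zero poly \<Rightarrow> 'a poly" where
  "cartier e h = Abs_poly (\<lambda>i. coeff h (e * Suc i - 1))"

lemma coeff_cartier: "e > 0 \<Longrightarrow> coeff (cartier e h) i = coeff h (e * Suc i - 1)"
proof -
  assume e: "e > 0"
  have "coeff h (e * Suc i - 1) = 0" if "i > degree h" for i
  proof (rule coeff_eq_0)
    have "1 * Suc i \<le> e * Suc i" by (rule mult_le_mono1) (use e in simp)
    then show "degree h < e * Suc i - 1" using that by (cases "e * Suc i") auto
  qed
  then show ?thesis unfolding cartier_def by (subst coeff_Abs_poly[of "degree h"]) auto
qed

lemma cartier_add: "e > 0 \<Longrightarrow> cartier e (g + h) = cartier e g + cartier e h"
  by (intro poly_eqI) (simp add: coeff_cartier)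

lemma cartier_0 [simp]: "e > 0 \<Longrightarrow> cartier e 0 = 0"
  by (intro poly_eqI) (simp add: coeff_cartier)

lemma cartier_smult: "e > 0 \<Longrightarrow> cartier e (smult a h) = smult a (cartier e h)"
  by (intro poly_eqI) (simp add: coeff_cartier)

lemma cartier_sum: "e > 0 \<Longrightarrow> cartier e (\<Sum>i\<in>I. f i) = (\<Sum>i\<in>I. cartier e (f i))"
  by (induction I rule: infinite_finite_induct) (simp_all add: cartier_add)

lemma cartier_cartier:
  assumes "e > 0" "e' > 0"
  shows "cartier e (cartier e' h) = cartier (e' * e) h"
proof (intro poly_eqI)
  fix i
  have "e * Suc i > 0" using assms by simp
  then have "Suc (e * Suc i - 1) = e * Suc i" by linarith
  then show "coeff (cartier e (cartier e' h)) i = coeff (cartier (e' * e) h) i"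
    using assms by (simp add: coeff_cartier mult.assoc del: mult_Suc_right)
qed

abbreviation xsub :: "nat \<Rightarrow> 'a::comm_semiring_1 poly \<Rightarrow> 'a poly" where
  "xsub e p \<equiv> pcompose p (monom 1 e)"

lemma degree_xsub: "degree (xsub e (p::'a::idom poly)) = degree p * e"
  by (simp add: degree_pcompose degree_monom_eq)

lemma cartier_monom_mult:
  assumes "e > 0"
  shows "cartier e (monom 1 e * h) = pCons 0 (cartier e (h::'a::comm_ring_1 poly))"
proof (intro poly_eqI)
  fix i show "coeff (cartier e (monom 1 e * h)) i = coeff (pCons 0 (cartier e h)) i"
  proof (cases i)
    case 0 then show ?thesis using assms by (simp add: coeff_cartier coeff_monom_mult)
  next
    case (Suc j)
    have "e * Suc (Suc j) - 1 - e = e * Suc j - 1" "\<not> e * Suc (Suc j) - 1 < e" using assms by auto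
    then show ?thesis using assms Suc by (simp add: coeff_cartier coeff_monom_mult del: mult_Suc_right)
  qed
qed

text \<open>Projection formula: a factor in X^e leaves the operator as the same polynomial in X. It
  is what reduces compositions to \<open>skew_mult\<close>.\<close>

lemma cartier_xsub_mult:
  assumes "e > 0"
  shows "cartier e (xsub e g * h) = g * cartier e (h::'a::comm_ring_1 poly)"
proof (induction g)
  case (pCons a g)
  have "xsub e (pCons a g) * h = smult a h + monom 1 e * (xsub e g * h)"
    by (simp add: pcompose_pCons algebra_simps)
  then show ?case using assms pCons.IH by (simp add: cartier_add cartier_smult cartier_monom_mult)
qed (use assms in simp)

lemma degree_cartier_less:
  assumes "e > 0" "h = 0 \<or> degree h + 1 \<le> e * n"
  shows "\<forall>i\<ge>n. coeff (cartier e h) i = 0"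
proof (intro allI impI)
  fix i assume "i \<ge> n"
  then have "e * Suc i \<ge> e * n + e" by (metis add.commute mult_Suc_right mult_le_mono2 Suc_le_mono)
  then have "h = 0 \<or> degree h < e * Suc i - 1" using assms by linarith
  then show "coeff (cartier e h) i = 0" using assms by (auto simp: coeff_cartier coeff_eq_0 simp del: mult_Suc_right)
qed

text \<open>
  A sequence \<open>c\<close> stands for the operator \<open>h \<mapsto> \<Sum>\<^sub>k x\<^sup>k \<psi>\<^bsub>q\<^sup>k\<^esub> (c\<^sub>k h)\<close> on polynomials, \<open>\<psi>\<^bsub>e\<^esub> = cartier e\<close> being
  adjoint under the residue pairing to \<open>X \<mapsto> X\<^sup>e\<close>.  The bound of \<open>skew_bdd\<close> makes it preserve
  the polynomials of degree less than \<open>n\<close>, and is stable under composition.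
\<close>

definition op_mat :: "nat \<Rightarrow> (nat \<Rightarrow> 'a::field poly) \<Rightarrow> nat \<Rightarrow> 'a fps mat" where
  "op_mat q c n = mat n n (\<lambda>(i,j). Abs_fps (\<lambda>k. coeff (cartier (q ^ k) (c k * monom 1 j)) i))"

definition skew_bdd :: "nat \<Rightarrow> nat \<Rightarrow> (nat \<Rightarrow> 'a::zero poly) \<Rightarrow> bool" where
  "skew_bdd q n c \<longleftrightarrow> (\<forall>k. degree (c k) \<le> (q ^ k - 1) * n)"

text \<open>Multiplication of twisted power series: moving \<open>c k\<close> inside
  \<open>cartier (q ^ (m - k))\<close> replaces X by X^(q^(m-k)).\<close>

definition skew_mult :: "nat \<Rightarrow> (nat \<Rightarrow> 'a::comm_semiring_1 poly) \<Rightarrow> (nat \<Rightarrow> 'a poly) \<Rightarrow> nat \<Rightarrow> 'a poly" where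
  "skew_mult q c c' m = (\<Sum>k\<le>m. xsub (q ^ (m - k)) (c k) * c' (m - k))"

lemma op_mat_carrier [simp]: "op_mat q c n \<in> carrier_mat n n"
  by (simp add: op_mat_def)

lemma skew_bdd_mono: "skew_bdd q n c \<Longrightarrow> n \<le> n' \<Longrightarrow> skew_bdd q n' c"
  unfolding skew_bdd_def by (meson le_trans mult_le_mono2)

lemma poly_as_sum_less:
  fixes h :: "'a::comm_ring_1 poly"
  assumes "\<forall>i\<ge>n. coeff h i = 0"
  shows "h = (\<Sum>j<n. smult (coeff h j) (monom 1 j))"
proof (intro poly_eqI)
  fix i
  have "coeff (\<Sum>j<n. smult (coeff h j) (monom 1 j)) i = (\<Sum>j<n. if j = i then coeff h j else 0)"
    unfolding coeff_sum by (intro sum.cong) (auto simp: coeff_monom)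
  then show "coeff h i = coeff (\<Sum>j<n. smult (coeff h j) (monom 1 j)) i"
    using assms by auto
qed

lemma sum_coeff_cartier:
  fixes c h :: "'a::comm_ring_1 poly"
  assumes "e > 0" "\<forall>i\<ge>n. coeff h i = 0"
  shows "(\<Sum>j<n. coeff (cartier e (c * monom 1 j)) i * coeff h j) = coeff (cartier e (c * h)) i"
proof -
  have "cartier e (c * h) = cartier e (c * (\<Sum>j<n. smult (coeff h j) (monom 1 j)))"
    using poly_as_sum_less[OF assms(2)] by simp
  also have "\<dots> = (\<Sum>j<n. smult (coeff h j) (cartier e (c * monom 1 j)))"
    using assms(1) by (simp add: sum_distrib_left cartier_sum cartier_smult)
  finally show ?thesis by (simp add: coeff_sum mult.commute)
qed

lemma skew_image_bdd:
  fixes c :: "nat \<Rightarrow> 'a::field poly"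
  assumes q: "q > 0" and c: "skew_bdd q n c" and h: "\<forall>i\<ge>n. coeff h i = 0"
  shows "\<forall>i\<ge>n. coeff (cartier (q ^ k) (c k * h)) i = 0"
proof (rule degree_cartier_less)
  show "c k * h = 0 \<or> degree (c k * h) + 1 \<le> q ^ k * n"
  proof (cases "c k * h = 0")
    case False
    then have "h \<noteq> 0" by auto
    then have "degree h < n" using h by (metis leading_coeff_0_iff not_less)
    moreover have "degree (c k * h) = degree (c k) + degree h" using False by (simp add: degree_mult_eq)
    moreover have "degree (c k) \<le> (q ^ k - 1) * n" using c by (simp add: skew_bdd_def)
    moreover have "(q ^ k - 1) * n + n = q ^ k * n" using q by (simp add: algebra_simps flip: add_mult_distrib)
    ultimately show ?thesis by linarith
  qed simp
qed (use q in simp)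

text \<open>The bound on \<open>c'\<close> keeps the image of the inner operator within degree less
  than n, so cutting down to n by n matrices is compatible with composition.\<close>

lemma op_mat_mult:
  fixes c c' :: "nat \<Rightarrow> 'a::field poly"
  assumes q: "q > 0" and c': "skew_bdd q n c'"
  shows "op_mat q c n * op_mat q c' n = op_mat q (skew_mult q c c') n"
proof (rule eq_matI)
  fix i j assume "i < dim_row (op_mat q (skew_mult q c c') n)" "j < dim_col (op_mat q (skew_mult q c c') n)"
  then have ij: "i < n" "j < n" by (auto simp: op_mat_def)
  have mono: "\<forall>i\<ge>n. coeff (monom (1::'a) j) i = 0" using ij by auto
  have "fps_nth ((op_mat q c n * op_mat q c' n) $$ (i,j)) m = fps_nth (op_mat q (skew_mult q c c') n $$ (i,j)) m" for m
  proof -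
    have "fps_nth ((op_mat q c n * op_mat q c' n) $$ (i,j)) m
      = (\<Sum>l<n. \<Sum>k\<le>m. coeff (cartier (q ^ k) (c k * monom 1 l)) i
            * coeff (cartier (q ^ (m - k)) (c' (m - k) * monom 1 j)) l)"
      using ij by (simp add: op_mat_def scalar_prod_def fps_sum_nth fps_mult_nth lessThan_atLeast0 atMost_atLeast0)
    also have "\<dots> = (\<Sum>k\<le>m. \<Sum>l<n. coeff (cartier (q ^ k) (c k * monom 1 l)) i
            * coeff (cartier (q ^ (m - k)) (c' (m - k) * monom 1 j)) l)"
      by (rule sum.swap)
    also have "\<dots> = (\<Sum>k\<le>m. coeff (cartier (q ^ k) (c k * cartier (q ^ (m - k)) (c' (m - k) * monom 1 j))) i)"
      using q skew_image_bdd[OF q c' mono] by (intro sum.cong refl sum_coeff_cartier) auto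
    also have "\<dots> = (\<Sum>k\<le>m. coeff (cartier (q ^ m) (xsub (q ^ (m - k)) (c k) * c' (m - k) * monom 1 j)) i)"
    proof (intro sum.cong refl)
      fix k assume "k \<in> {..m}"
      then have "q ^ (m - k) * q ^ k = q ^ m" by (simp flip: power_add)
      moreover have "c k * cartier (q ^ (m - k)) (c' (m - k) * monom 1 j)
          = cartier (q ^ (m - k)) (xsub (q ^ (m - k)) (c k) * (c' (m - k) * monom 1 j))"
        using q by (subst cartier_xsub_mult) auto
      ultimately show "coeff (cartier (q ^ k) (c k * cartier (q ^ (m - k)) (c' (m - k) * monom 1 j))) i
        = coeff (cartier (q ^ m) (xsub (q ^ (m - k)) (c k) * c' (m - k) * monom 1 j)) i"
        using q by (simp add: cartier_cartier mult.assoc)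
    qed
    also have "\<dots> = fps_nth (op_mat q (skew_mult q c c') n $$ (i,j)) m"
      using ij q by (simp add: op_mat_def skew_mult_def sum_distrib_right cartier_sum coeff_sum)
    finally show ?thesis .
  qed
  then show "(op_mat q c n * op_mat q c' n) $$ (i,j) = op_mat q (skew_mult q c c') n $$ (i,j)"
    by (rule fps_ext)
qed (auto simp: op_mat_def)

text \<open>For k > 0 the coefficient at X^n of the image of X^j, j <= n, comes from the exponent
  q^k (n + 1) - 1, which lies beyond the degree of c_k X^j. So the last row of the larger matrix is
  that of the identity.\<close>

lemma det_op_mat_Suc:
  assumes q: "q > 1" and c: "skew_bdd q n c" and c0: "c 0 = 1"
  shows "det (op_mat q c (Suc n)) = det (op_mat q c n)"
proof -
  have z: "coeff (cartier (q ^ k) (c k * monom 1 j)) n = 0" if "j \<le> n" "k > 0" for j k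
  proof -
    have q2: "q ^ k > 1" using q that(2) by (rule one_less_power)
    have "degree (c k * monom 1 j) \<le> degree (c k) + j"
      using degree_mult_le[of "c k" "monom 1 j"] by (simp add: degree_monom_eq)
    also have "\<dots> \<le> (q ^ k - 1) * n + n" using c that by (simp add: skew_bdd_def add_mono)
    also have "\<dots> = q ^ k * n" using q2 by (simp add: algebra_simps flip: add_mult_distrib)
    also have "\<dots> < q ^ k * Suc n - 1" using q2 by simp
    finally show ?thesis using q by (simp add: coeff_cartier coeff_eq_0 del: mult_Suc_right)
  qed
  have "op_mat q c (Suc n) $$ (n, j) = (if j = n then 1 else 0)" if "j \<le> n" for j
  proof (rule fps_ext)
    fix k show "fps_nth (op_mat q c (Suc n) $$ (n, j)) k = fps_nth (if j = n then 1 else 0) k"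
      using that z[OF that, of k] c0 by (cases "k = 0") (auto simp: op_mat_def coeff_cartier)
  qed
  then have "det (op_mat q c (Suc n)) = det (mat n n (\<lambda>(i,j). op_mat q c (Suc n) $$ (i,j)))"
    by (intro det_last_row) auto
  also have "mat n n (\<lambda>(i,j). op_mat q c (Suc n) $$ (i,j)) = op_mat q c n"
    by (intro eq_matI) (auto simp: op_mat_def)
  finally show ?thesis .
qed

lemma det_op_mat_stable:
  assumes q: "q > 1" and c: "skew_bdd q n c" and c0: "c 0 = 1" and n: "n \<le> n'"
  shows "det (op_mat q c n') = det (op_mat q c n)"
  using n
proof (induction n' rule: dec_induct)
  case (step n')
  then show ?case using det_op_mat_Suc[OF q skew_bdd_mono[OF c] c0, of n'] by simp
qed simp

lemma det_op_mat_dvd: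
  assumes c0: "c 0 = 1" and z: "\<And>k. 0 < k \<Longrightarrow> k < N \<Longrightarrow> c k = 0" and q: "q > 0"
  shows "fps_X ^ N dvd det (op_mat q c n) - 1"
proof -
  have "fps_X ^ N dvd det (op_mat q c n) - det (1\<^sub>m n)"
  proof (rule det_dvd_diff)
    fix i j assume ij: "i < n" "j < n"
    have "fps_nth (op_mat q c n $$ (i,j) - 1\<^sub>m n $$ (i,j)) k = 0" if "k < N" for k
      using ij that c0 z[of k] q by (cases "k = 0") (auto simp: op_mat_def coeff_cartier)
    then show "fps_X ^ N dvd op_mat q c n $$ (i,j) - 1\<^sub>m n $$ (i,j)" by (simp add: fps_X_power_dvd)
  qed auto
  then show ?thesis by simp
qed

text \<open>
  The two operators are \<open>1 + BA\<close> and \<open>1 + AB\<close> for \<open>A\<close> the multiplication by \<open>X\<close> and \<open>B = x\<^sup>k \<psi>\<^bsub>q\<^sup>k\<^esub> s\<close>.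
\<close>

lemma det_op_mat_commutator:
  fixes s :: "'a::field poly"
  assumes q: "q > 1" and k: "k > 0" and n: "degree s + q ^ k \<le> (q ^ k - 1) * Suc n"
  defines "u \<equiv> (\<lambda>m. if m = 0 then 1 else if m = k then s * monom 1 1 else 0)"
    and "v \<equiv> (\<lambda>m. if m = 0 then 1 else if m = k then s * monom 1 (q ^ k) else 0)"
  shows "det (op_mat q v (Suc n)) = det (op_mat q u (Suc n))"
    and "skew_bdd q (Suc n) u" and "skew_bdd q (Suc n) v"
proof -
  define A where "A = mat (Suc n) (Suc n) (\<lambda>(i,j). if i = Suc j then (1::'a fps) else 0)"
  define B where "B = mat (Suc n) (Suc n) (\<lambda>(i,j). fps_const (coeff (cartier (q ^ k) (s * monom 1 j)) i) * fps_X ^ k)"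
  have AB: "A \<in> carrier_mat (Suc n) (Suc n)" "B \<in> carrier_mat (Suc n) (Suc n)" by (auto simp: A_def B_def)
  have qk: "q ^ k > 1" using q k by (rule one_less_power)
  have d1: "degree (s * monom 1 1) \<le> degree s + 1" "degree (s * monom 1 (q ^ k)) \<le> degree s + q ^ k"
    using degree_mult_le[of s "monom 1 1"] degree_mult_le[of s "monom 1 (q ^ k)"] by (simp_all add: degree_monom_eq)
  have e1: "(q ^ k - 1) * Suc n = (q ^ k - 1) * n + (q ^ k - 1)" by simp
  have un: "skew_bdd q n u"
    unfolding skew_bdd_def u_def using d1 n e1 qk by auto
  then show "skew_bdd q (Suc n) u" by (rule skew_bdd_mono) simp
  show "skew_bdd q (Suc n) v"
    unfolding skew_bdd_def v_def using d1 n by (auto simp del: mult_Suc_right)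
  \<comment> \<open>Row n of BA is therefore zero. So the determinant of 1 + BA does not see column
    n, the only one in which the truncated \<open>A\<close> drops a term of the shift.\<close>
  have Bz: "B $$ (n, j) = 0" if "j \<le> n" for j
  proof -
    have "degree (s * monom 1 j) \<le> degree s + n"
      using degree_mult_le[of s "monom 1 j"] that by (simp add: degree_monom_eq)
    also have "\<dots> + 1 \<le> q ^ k * n"
    proof -
      have "(q ^ k - 1) * n + n = q ^ k * n" using qk by (simp add: algebra_simps flip: add_mult_distrib)
      then show ?thesis using n e1 qk by linarith
    qed
    finally have "degree (s * monom 1 j) + 1 \<le> q ^ k * n" by simp
    then have "coeff (cartier (q ^ k) (s * monom 1 j)) n = 0"
      using degree_cartier_less[of "q ^ k" "s * monom 1 j" n] q by simp
    then show ?thesis using that by (simp add: B_def)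
  qed
  have "1\<^sub>m (Suc n) + A * B = op_mat q v (Suc n)"
  proof (rule eq_matI)
    fix i j assume "i < dim_row (op_mat q v (Suc n))" "j < dim_col (op_mat q v (Suc n))"
    then have ij: "i < Suc n" "j < Suc n" by (auto simp: op_mat_def)
    have "(A * B) $$ (i,j) = (\<Sum>l<Suc n. if i = Suc l then B $$ (l,j) else 0)"
      unfolding lessThan_atLeast0 using ij AB by (auto simp: A_def scalar_prod_def intro!: sum.cong)
    also have "\<dots> = (if i = 0 then 0 else B $$ (i - 1, j))"
      using ij by (cases i) (auto simp: sum.delta')
    also have "\<dots> = fps_const (coeff (cartier (q ^ k) (s * monom 1 (q ^ k) * monom 1 j)) i) * fps_X ^ k"
    proof -
      have "s * monom 1 (q ^ k) * monom 1 j = monom 1 (q ^ k) * (s * monom 1 j)" by (simp add: mult_ac)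
      then have "cartier (q ^ k) (s * monom 1 (q ^ k) * monom 1 j) = pCons 0 (cartier (q ^ k) (s * monom 1 j))"
        by (simp only:) (rule cartier_monom_mult, use q in simp)
      then show ?thesis using ij by (cases i) (auto simp: B_def)
    qed
    finally have AB1: "(A * B) $$ (i,j) = fps_const (coeff (cartier (q ^ k) (s * monom 1 (q ^ k) * monom 1 j)) i) * fps_X ^ k" .
    have "fps_nth ((1\<^sub>m (Suc n) + A * B) $$ (i,j)) m = fps_nth (op_mat q v (Suc n) $$ (i,j)) m" for m
      using ij AB k AB1 q by (auto simp: op_mat_def v_def coeff_cartier fps_X_power_mult_nth simp del: index_mult_mat(1))
    then show "(1\<^sub>m (Suc n) + A * B) $$ (i,j) = op_mat q v (Suc n) $$ (i,j)" by (rule fps_ext)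
  qed (use AB in \<open>auto simp: op_mat_def\<close>)
  moreover have "det (1\<^sub>m (Suc n) + B * A) = det (op_mat q u n)"
  proof -
    have BA: "(B * A) $$ (i,j) = (if j = n then 0 else B $$ (i, Suc j))" if "i \<le> n" "j \<le> n" for i j
    proof -
      have "(B * A) $$ (i,j) = (\<Sum>l<Suc n. B $$ (i,l) * A $$ (l,j))"
        unfolding lessThan_atLeast0 using that AB by (simp add: scalar_prod_def del: sum.op_ivl_Suc)
      also have "\<dots> = (\<Sum>l<Suc n. if l = Suc j then B $$ (i,l) else 0)"
        using that by (intro sum.cong) (auto simp: A_def)
      also have "\<dots> = (if j = n then 0 else B $$ (i, Suc j))"
        using that by (subst sum.delta) auto
      finally show ?thesis .
    qed
    have "det (1\<^sub>m (Suc n) + B * A) = det (mat n n (\<lambda>(i,j). (1\<^sub>m (Suc n) + B * A) $$ (i,j)))"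
    proof (rule det_last_row)
      fix j assume "j \<le> n"
      then show "(1\<^sub>m (Suc n) + B * A) $$ (n,j) = (if j = n then 1 else 0)"
        using AB BA[of n j] Bz by auto
    qed (use AB in auto)
    also have "mat n n (\<lambda>(i,j). (1\<^sub>m (Suc n) + B * A) $$ (i,j)) = op_mat q u n"
    proof (rule eq_matI)
      fix i j assume "i < dim_row (op_mat q u n)" "j < dim_col (op_mat q u n)"
      then have ij: "i < n" "j < n" by (auto simp: op_mat_def)
      have sj: "s * monom 1 (Suc 0) * monom 1 j = s * monom 1 (Suc j)" for j by (simp add: mult_monom mult.assoc)
      have BAij: "(B * A) $$ (i,j) = fps_const (coeff (cartier (q ^ k) (s * monom 1 (Suc j))) i) * fps_X ^ k"
        using BA[of i j] ij by (simp add: B_def)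
      have "fps_nth ((1\<^sub>m (Suc n) + B * A) $$ (i,j)) m = fps_nth (op_mat q u n $$ (i,j)) m" for m
        using ij AB k BAij q by (auto simp: op_mat_def u_def sj coeff_cartier fps_X_power_mult_nth simp del: index_mult_mat(1))
      then show "mat n n (\<lambda>(i,j). (1\<^sub>m (Suc n) + B * A) $$ (i,j)) $$ (i,j) = op_mat q u n $$ (i,j)"
        using ij by (auto intro: fps_ext)
    qed (auto simp: op_mat_def)
    finally show ?thesis .
  qed
  moreover have "det (op_mat q u (Suc n)) = det (op_mat q u n)"
    by (rule det_op_mat_Suc[OF q un]) (simp add: u_def)
  ultimately show "det (op_mat q v (Suc n)) = det (op_mat q u (Suc n))"
    using det_one_plus_mult_comm[OF AB] by simp
qed

lemma skew_mult_two_term: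
  assumes "w 0 = 1" "\<And>j. j \<noteq> 0 \<Longrightarrow> j \<noteq> k \<Longrightarrow> w j = 0" "k > 0"
  shows "skew_mult q w c m = c m + (if k \<le> m then xsub (q ^ (m - k)) (w k) * c (m - k) else 0)"
proof -
  have "skew_mult q w c m = (\<Sum>i\<in>{0, k} \<inter> {..m}. xsub (q ^ (m - i)) (w i) * c (m - i))"
    unfolding skew_mult_def 
  proof (intro sum.mono_neutral_right ballI)
    fix i assume "i \<in> {..m} - {0, k} \<inter> {..m}"
    then have "w i = 0" using assms(2) by auto
    then show "xsub (q ^ (m - i)) (w i) * c (m - i) = 0" by simp
  qed auto
  also have "{0, k} \<inter> {..m} = (if k \<le> m then {0, k} else {0})" by auto
  finally show ?thesis using assms by (auto simp: pcompose_1)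
qed

text \<open>
  If \<open>c\<^sub>k = s (X\<^bsup>q\<^sup>k\<^esup> - X)\<close> is the first nonzero term after \<open>c\<^sub>0\<close>, dividing by the commutator of the
  previous lemma removes it without changing the determinant.
\<close>

lemma det_op_mat_trivial:
  fixes b :: "'a::field poly"
  assumes q: "q > 1" and b: "\<And>k. 0 < k \<Longrightarrow> k \<le> N \<Longrightarrow> (monom 1 (q ^ k) - monom 1 1) dvd b"
    and "c 0 = 1" "\<And>k. k > 0 \<Longrightarrow> b dvd c k" "skew_bdd q n c"
  shows "fps_X ^ Suc N dvd det (op_mat q c n) - 1"
proof -
  have "fps_X ^ Suc N dvd det (op_mat q c n) - 1"
    if "c 0 = 1" "\<And>k. k > 0 \<Longrightarrow> b dvd c k" "skew_bdd q n c" "k \<le> Suc N" "k > 0" "\<And>j. 0 < j \<Longrightarrow> j < k \<Longrightarrow> c j = 0"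
    for c n k
    using that(4,1-3,5-)
  proof (induction k arbitrary: c n rule: inc_induct)
    case base
    then show ?case using q by (intro det_op_mat_dvd) auto
  next
    case (step k)
    have kN: "k \<le> N" using step by simp
    have qk: "q ^ k > 1" using q step.prems(4) by (rule one_less_power)
    obtain s where s: "c k = (monom 1 (q ^ k) - monom 1 1) * s"
      using b[OF step.prems(4) kN] step.prems(2)[OF step.prems(4)] dvd_trans by (metis dvdE)
    \<comment> \<open>Enlarging the space to size n' + 1 does not change the determinant of
      \<open>c\<close>. As q^k - 1 is at least 1, this size also meets the degree condition of the
      commutator lemma.\<close>
    define n' where "n' = n + degree s + q ^ k"
    have "1 * Suc n' \<le> (q ^ k - 1) * Suc n'" by (rule mult_le_mono1) (use qk in simp)
    then have n': "degree s + q ^ k \<le> (q ^ k - 1) * Suc n'" by (simp add: n'_def)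
    define u where "u = (\<lambda>m. if m = 0 then 1 else if m = k then s * monom 1 1 else 0)"
    define v where "v = (\<lambda>m. if m = 0 then 1 else if m = k then s * monom 1 (q ^ k) else 0)"
    note uv = det_op_mat_commutator[OF q step.prems(4) n', folded u_def v_def]
    have cb: "skew_bdd q (Suc n') c" by (rule skew_bdd_mono[OF step.prems(3)]) (simp add: n'_def)
    define w where "w m = skew_mult q u c m" for m
    have w: "w m = c m + (if k \<le> m then xsub (q ^ (m - k)) (u k) * c (m - k) else 0)" for m
      unfolding w_def by (rule skew_mult_two_term) (use step.prems in \<open>auto simp: u_def\<close>)
    \<comment> \<open>The equation v d = u c is solved by recursion on the degree, where degree m
      refers to m - k. The first argument counts recursion steps; \<open>g i m\<close> has reached
      its final value once i > m.\<close>
    define g where "g = rec_nat (\<lambda>_. 0) (\<lambda>i f m. w m - (if k \<le> m then xsub (q ^ (m - k)) (v k) * f (m - k) else 0))"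
    have g_stable: "g i m = g (Suc m) m" if "i > m" for i m
      using that
    proof (induction m arbitrary: i rule: less_induct)
      case (less m)
      obtain i' where i': "i = Suc i'" using less.prems by (cases i) auto
      show ?case
      proof (cases "k \<le> m")
        case True
        have "g i' (m - k) = g (Suc (m - k)) (m - k)" "g m (m - k) = g (Suc (m - k)) (m - k)"
          by (rule less.IH; use less.prems True step.prems(4) i' in simp)+
        then show ?thesis using i' by (simp add: g_def)
      qed (use i' in \<open>simp add: g_def\<close>)
    qed
    define d where "d m = g (Suc m) m" for m
    have d: "d m = w m - (if k \<le> m then xsub (q ^ (m - k)) (v k) * d (m - k) else 0)" for m
    proof (cases "k \<le> m")
      case True
      then have "g m (m - k) = d (m - k)" unfolding d_def by (intro g_stable) (use step.prems(4) in auto)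
      then show ?thesis using True by (simp add: d_def) (simp add: g_def)
    qed (simp add: d_def g_def)
    have vd: "skew_mult q v d m = w m" for m
      by (subst skew_mult_two_term[of v k]) (use step.prems(4) d[of m] in \<open>auto simp: v_def\<close>)
    have d0: "d 0 = 1" using d[of 0] w[of 0] step.prems by simp
    \<comment> \<open>In degree k the equation reads d_k = c_k + s X - s X^(q^k), which vanishes by
      the choice of \<open>s\<close>; lower degrees are inherited from \<open>c\<close>.\<close>
    have dk: "d m = 0" if "0 < m" "m < Suc k" for m
    proof (cases "m = k")
      case True
      have "xsub (Suc 0) p = p" for p :: "'a poly" by (simp add: monom_altdef pcompose_idR)
      then show ?thesis using d[of k] w[of k] d0 step.prems(1,4) True
        by (simp add: s u_def v_def algebra_simps)
    qed (use d[of m] w[of m] step.prems that in auto)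
    have db: "b dvd d m" if "m > 0" for m
      using that
    proof (induction m rule: less_induct)
      case (less m)
      show ?case
      proof (cases "m \<le> k")
        case True then show ?thesis using dk[of m] less.prems by simp
      next
        case False
        then have *: "b dvd c m" "b dvd c (m - k)" "b dvd d (m - k)"
          using step.prems(2,4) less.IH[of "m - k"] by auto
        show ?thesis unfolding d[of m] w[of m] using * False by (auto intro!: dvd_diff dvd_add dvd_mult)
      qed
    qed
    have deg_term: "degree (xsub (q ^ (m - k)) p * r) \<le> (q ^ m - 1) * Suc n'"
      if "k \<le> m" "degree p \<le> (q ^ k - 1) * Suc n'" "degree r \<le> (q ^ (m - k) - 1) * Suc n'" for m and p r :: "'a poly"
    proof -
      have "degree (xsub (q ^ (m - k)) p * r) \<le> degree p * q ^ (m - k) + degree r"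
        by (metis degree_mult_le degree_xsub)
      also have "\<dots> \<le> (q ^ k - 1) * Suc n' * q ^ (m - k) + (q ^ (m - k) - 1) * Suc n'"
        by (intro add_mono mult_le_mono1 that)
      also have "\<dots> = ((q ^ k - 1) * q ^ (m - k) + (q ^ (m - k) - 1)) * Suc n'"
        unfolding add_mult_distrib by (simp only: mult_ac)
      also have "(q ^ k - 1) * q ^ (m - k) + (q ^ (m - k) - 1) = q ^ m - 1"
      proof -
        have "q ^ k * q ^ (m - k) = q ^ m" "q ^ (m - k) \<ge> 1" "q ^ m \<ge> q ^ (m - k)"
          using that q by (simp_all flip: power_add)
        then show ?thesis by (simp add: diff_mult_distrib)
      qed
      finally show ?thesis .
    qed
    have wdeg: "degree (w m) \<le> (q ^ m - 1) * Suc n'" for m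
      using cb uv(2) deg_term[of m "u k" "c (m - k)"]
      unfolding w skew_bdd_def by (cases "k \<le> m") (simp_all add: degree_add_le del: mult_Suc_right)
    have dbdd: "degree (d m) \<le> (q ^ m - 1) * Suc n'" for m
    proof (induction m rule: less_induct)
      case (less m)
      show ?case
      proof (cases "k \<le> m")
        case True
        then have "degree (xsub (q ^ (m - k)) (v k) * d (m - k)) \<le> (q ^ m - 1) * Suc n'"
          using less.IH[of "m - k"] step.prems(4) uv(3) unfolding skew_bdd_def by (intro deg_term) simp_all
        then show ?thesis unfolding d[of m] using wdeg[of m] True by (simp add: degree_diff_le del: mult_Suc_right)
      next
        case False
        then show ?thesis unfolding d[of m] using wdeg[of m] by (simp del: mult_Suc_right)
      qed
    qed
    have sd: "skew_bdd q (Suc n') d" unfolding skew_bdd_def using dbdd by blast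
    have "fps_X ^ Suc N dvd det (op_mat q d (Suc n')) - 1"
      by (rule step.IH[OF d0 db sd]) (use dk in simp_all)
    moreover have "det (op_mat q d (Suc n')) = det (op_mat q c (Suc n'))"
    proof -
      have "op_mat q v (Suc n') * op_mat q d (Suc n') = op_mat q u (Suc n') * op_mat q c (Suc n')"
      proof -
        have "skew_mult q v d = skew_mult q u c" using vd by (auto simp: w_def)
        then show ?thesis using op_mat_mult[OF _ sd, of v] op_mat_mult[OF _ cb, of u] q by simp
      qed
      then have "det (op_mat q v (Suc n')) * det (op_mat q d (Suc n')) = det (op_mat q u (Suc n')) * det (op_mat q c (Suc n'))"
        by (metis det_mult op_mat_carrier)
      moreover have "det (op_mat q u (Suc n')) \<noteq> 0"
      proof
        assume "det (op_mat q u (Suc n')) = 0"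
        moreover have "fps_X ^ 1 dvd det (op_mat q u (Suc n')) - 1"
          by (rule det_op_mat_dvd) (use q in \<open>auto simp: u_def\<close>)
        ultimately show False unfolding fps_X_power_dvd by auto
      qed
      ultimately show ?thesis using uv(1) by simp
    qed
    moreover have "det (op_mat q c (Suc n')) = det (op_mat q c n)"
      using q step.prems by (intro det_op_mat_stable) (auto simp: n'_def)
    ultimately show ?case by simp
  qed
  from this[OF assms(3-5), of 1] show ?thesis by simp
qed

section \<open>The contribution of one closed point\<close>

locale frobenius_orbit =
  fixes q d :: nat and l :: "nat \<Rightarrow> 'a::field" and f :: "'a poly"
  assumes q1: "q > 1" and d0: "d > 0"
    and l_add: "l (j + k) = l j ^ (q ^ k)" and l_period: "l (j + d) = l j"
    and l_inj: "inj_on l {..<d}"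
    and f_eq: "f = (\<Prod>j<d. [:- l j, 1:])"
    and f_frob: "xsub (q ^ k) f = f ^ (q ^ k)"
begin

lemma l_mod: "l (j mod d) = l j"
proof -
  have "l (j mod d + d * m) = l (j mod d)" for m
  proof (induction m)
    case (Suc m)
    then show ?case using l_period[of "j mod d + d * m"] by (simp add: algebra_simps)
  qed simp
  from this[of "j div d"] show ?thesis by simp
qed

definition cofactor :: "nat \<Rightarrow> 'a poly" where
  "cofactor j = (\<Prod>i\<in>{..<d} - {j}. [:- l i, 1:])"

lemma f_cofactor: "j < d \<Longrightarrow> f = [:- l j, 1:] * cofactor j"
  unfolding f_eq cofactor_def by (subst prod.remove[of _ j]) auto

lemma poly_cofactor: "i < d \<Longrightarrow> j < d \<Longrightarrow> poly (cofactor j) (l i) \<noteq> 0 \<longleftrightarrow> i = j"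
  using l_inj by (auto simp: cofactor_def poly_prod dest: inj_onD)

lemma f_nz: "f \<noteq> 0" by (auto simp: f_eq)

lemma degree_f: "degree f = d" by (simp add: f_eq degree_prod_eq_sum_degree)

lemma degree_cofactor: "j < d \<Longrightarrow> degree (cofactor j) = d - 1"
  by (simp add: cofactor_def degree_prod_eq_sum_degree)

lemma poly_f: "poly f (l i) = 0"
  by (subst f_cofactor[of "i mod d"]) (use d0 in \<open>simp_all add: l_mod\<close>)

text \<open>Put e = q^k. Since f^e = f(X^e), the product f^(e-1) f/(X - l_j) is (X^e - l_j^e)/(X -
  l_j) times a cofactor in X^e. The quotient is monic of degree e - 1, so its Cartier image is 1. In
  other words, 1/(X - l_j) is carried to 1/(X - l_(j+k)).\<close>

lemma cartier_cofactor:
  assumes j: "j < d"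
  shows "cartier (q ^ k) (f ^ (q ^ k - 1) * cofactor j) = cofactor ((j + k) mod d)"
proof -
  define e where "e = q ^ k"
  have e: "e > 0" using q1 by (simp add: e_def)
  define j' where "j' = (j + k) mod d"
  have j': "j' < d" using d0 by (simp add: j'_def)
  have lj': "l j' = l j ^ e" by (simp add: j'_def l_mod l_add e_def)
  define S where "S = (\<Sum>i<e. monom (l j ^ (e - Suc i)) i)"
  have "monom 1 1 ^ e - [:l j:] ^ e = (monom 1 1 - [:l j:]) * (\<Sum>i<e. monom 1 1 ^ i * [:l j:] ^ (e - Suc i))"
    using power_diff_sumr2[of "monom 1 1" e "[:l j:]"] by (simp add: mult.commute)
  also have "monom 1 1 ^ e - [:l j:] ^ e = monom 1 e - [:l j ^ e:]"
    by (simp add: monom_power poly_const_pow)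
  also have "monom 1 1 - [:l j:] = [:- l j, 1:]" by (simp add: monom_altdef)
  also have "(\<Sum>i<e. monom 1 1 ^ i * [:l j:] ^ (e - Suc i)) = S"
    by (simp add: S_def monom_power poly_const_pow smult_monom mult.commute)
  finally have S: "monom 1 e - [:l j ^ e:] = [:- l j, 1:] * S" .
  have "[:- l j, 1:] * (f ^ (e - 1) * cofactor j) = f ^ (e - 1) * f"
    by (subst (2) f_cofactor[OF j]) (simp only: mult_ac)
  also have "\<dots> = f ^ e" using e by (rule power_minus_mult)
  also have "\<dots> = xsub e ([:- l j', 1:] * cofactor j')"
    using f_frob[of k] f_cofactor[OF j'] by (simp add: e_def)
  also have "\<dots> = (monom 1 e - [:l j ^ e:]) * xsub e (cofactor j')"
    by (simp add: pcompose_mult pcompose_pCons lj' pcompose_add del: mult_pCons_left)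
  also have "\<dots> = [:- l j, 1:] * (xsub e (cofactor j') * S)"
    unfolding S by (simp only: mult_ac)
  finally have "f ^ (e - 1) * cofactor j = xsub e (cofactor j') * S"
    by (metis mult_cancel_left pCons_eq_0_iff one_neq_zero)
  then have "cartier e (f ^ (e - 1) * cofactor j) = cofactor j' * cartier e S"
    using e by (simp add: cartier_xsub_mult)
  also have "cartier e S = 1"
  proof (intro poly_eqI)
    fix i
    have cS: "coeff S m = (if m < e then l j ^ (e - Suc m) else 0)" for m
      by (simp add: S_def coeff_sum coeff_monom)
    show "coeff (cartier e S) i = coeff 1 i"
    proof (cases i)
      case (Suc i')
      then have "\<not> e * Suc i - 1 < e" using e by auto
      then show ?thesis using e Suc by (simp add: coeff_cartier cS del: mult_Suc_right)
    qed (use e in \<open>simp add: coeff_cartier cS\<close>)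
  qed
  finally show ?thesis by (simp add: e_def j'_def)
qed

text \<open>The action on the span of the 1/(X - l_j) modulo polynomials: multiplication by c_k acts
  at l_j through its value there, and the Cartier operator moves l_j to l_(j+k).\<close>

definition orbit_mat :: "(nat \<Rightarrow> 'a poly) \<Rightarrow> 'a fps mat" where
  "orbit_mat c = mat d d (\<lambda>(i,j). Abs_fps (\<lambda>k. if (j + k) mod d = i then poly (c k) (l j) else 0))"

lemma orbit_mat_carrier [simp]: "orbit_mat c \<in> carrier_mat d d"
  by (simp add: orbit_mat_def)

text \<open>Conjugation by f: since f^(q^k) = f(X^(q^k)), the twisted operator applied to h is f
  times the original one applied to h/f. It describes the action of c on fractions with denominator
  f.\<close>

definition twist :: "(nat \<Rightarrow> 'a poly) \<Rightarrow> nat \<Rightarrow> 'a poly" where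
  "twist c k = c k * f ^ (q ^ k - 1)"

lemma skew_bdd_twist: "skew_bdd q n c \<Longrightarrow> skew_bdd q (n + d) (twist c)"
  unfolding skew_bdd_def twist_def
proof
  fix k assume "\<forall>k. degree (c k) \<le> (q ^ k - 1) * n"
  then have "degree (c k) + degree (f ^ (q ^ k - 1)) \<le> (q ^ k - 1) * n + (q ^ k - 1) * d"
    by (intro add_mono) (simp_all add: degree_power_eq f_nz degree_f)
  then show "degree (c k * f ^ (q ^ k - 1)) \<le> (q ^ k - 1) * (n + d)"
    using degree_mult_le[of "c k" "f ^ (q ^ k - 1)"] by (simp add: distrib_left)
qed

text \<open>Divided by f, these are the simple fractions 1/(X - l_j), followed by the
  monomials.\<close>

definition bas :: "nat \<Rightarrow> 'a poly" where
  "bas j = (if j < d then cofactor j else f * monom 1 (j - d))"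

definition bas_mat :: "nat \<Rightarrow> 'a mat" where
  "bas_mat n = mat (n + d) (n + d) (\<lambda>(i,j). coeff (bas j) i)"

lemma degree_bas: "j < n + d \<Longrightarrow> degree (bas j) < n + d"
  using degree_cofactor[of j] d0 by (auto simp: bas_def degree_mult_eq f_nz degree_monom_eq degree_f)

lemma det_bas_mat: "det (bas_mat n) \<noteq> 0"
proof
  assume "det (bas_mat n) = 0"
  then obtain v where v: "v \<in> carrier_vec (n + d)" "v \<noteq> 0\<^sub>v (n + d)" "bas_mat n *\<^sub>v v = 0\<^sub>v (n + d)"
    using det_0_iff_vec_prod_zero_field[of "bas_mat n" "n + d"] by (auto simp: bas_mat_def)
  define p where "p = (\<Sum>j<n + d. smult (v $ j) (bas j))"
  have "coeff p i = 0" for i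
  proof (cases "i < n + d")
    case True
    have "coeff p i = (bas_mat n *\<^sub>v v) $ i"
      using True v(1) by (simp add: p_def coeff_sum bas_mat_def scalar_prod_def lessThan_atLeast0 mult.commute)
    then show ?thesis using True v by simp
  next
    case False
    have "coeff (smult (v $ j) (bas j)) i = 0" if "j \<in> {..<n + d}" for j
      using degree_bas[of j n] that False by (simp add: coeff_eq_0)
    then show ?thesis unfolding p_def coeff_sum by (intro sum.neutral) blast
  qed
  then have p0: "p = 0" by (simp add: poly_eq_iff)
  have vi: "v $ i = 0" if "i < d" for i
  proof -
    have "poly p (l i) = (\<Sum>j<n + d. if j = i then v $ j * poly (cofactor i) (l i) else 0)"
      unfolding p_def poly_sum
    proof (intro sum.cong refl)
      fix j show "poly (smult (v $ j) (bas j)) (l i) = (if j = i then v $ j * poly (cofactor i) (l i) else 0)"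
        using that poly_cofactor[of i j] poly_f[of i] by (auto simp: bas_def)
    qed
    then have "v $ i * poly (cofactor i) (l i) = 0" using p0 that by simp
    then show ?thesis using poly_cofactor[of i i] that by simp
  qed
  have "p = (\<Sum>j\<in>{d..<n + d}. smult (v $ j) (bas j))"
    unfolding p_def using vi by (intro sum.mono_neutral_right) auto
  also have "\<dots> = (\<Sum>j\<in>{d..<n + d}. f * monom (v $ j) (j - d))"
    by (intro sum.cong refl) (auto simp: bas_def smult_monom simp flip: mult_smult_right)
  also have "\<dots> = f * (\<Sum>j<n. monom (v $ (j + d)) j)"
    unfolding sum_distrib_left by (rule sum.reindex_bij_witness[of _ "\<lambda>j. j + d" "\<lambda>j. j - d"]) auto
  finally have "(\<Sum>j<n. monom (v $ (j + d)) j) = 0" using p0 f_nz by simp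
  moreover have "v $ (i + d) = coeff (\<Sum>j<n. monom (v $ (j + d)) j) i" if "i < n" for i
    using that by (simp add: coeff_sum coeff_monom)
  ultimately have vd: "v $ (i + d) = 0" if "i < n" for i using that by simp
  have "v = 0\<^sub>v (n + d)"
  proof (rule eq_vecI)
    fix i assume "i < dim_vec (0\<^sub>v (n + d) :: 'a vec)"
    then have "i < n + d" by simp
    then show "v $ i = 0\<^sub>v (n + d) $ i" using vi[of i] vd[of "i - d"] by (cases "i < d") simp_all
  qed (use v(1) in simp)
  with v show False by simp
qed

text \<open>Among the fractions with denominator f the polynomials form a stable subspace, and the
  quotient is spanned by the simple fractions. In the basis \<open>bas\<close> the matrix is thus
  block triangular, with \<open>orbit_mat\<close> acting on the quotient.\<close>

lemma det_twist:
  assumes c: "skew_bdd q n c"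
  shows "det (op_mat q (twist c) (n + d)) = det (orbit_mat c) * det (op_mat q c n)"
proof -
  \<comment> \<open>The polynomial part that arises when c_k multiplies the simple fraction at
    l_j.\<close>
  define w where "w k j = (c k * cofactor j - smult (poly (c k) (l j)) (cofactor j)) div f" for k j
  have w: "c k * cofactor j = smult (poly (c k) (l j)) (cofactor j) + f * w k j" if "j < d" for k j
  proof -
    have "[:- l j, 1:] dvd c k - [:poly (c k) (l j):]" by (simp flip: poly_eq_0_iff_dvd)
    then have "f dvd (c k - [:poly (c k) (l j):]) * cofactor j"
      by (subst f_cofactor[OF that]) (rule mult_dvd_mono, auto)
    then have "f dvd c k * cofactor j - smult (poly (c k) (l j)) (cofactor j)"
      by (simp add: left_diff_distrib)
    then show ?thesis by (simp add: w_def)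
  qed
  have wz: "\<forall>i\<ge>n. coeff (cartier (q ^ k) (w k j)) i = 0" if j: "j < d" for k j
  proof (rule degree_cartier_less)
    show "w k j = 0 \<or> degree (w k j) + 1 \<le> q ^ k * n"
    proof (cases "w k j = 0")
      case False
      have "f * w k j = (c k - [:poly (c k) (l j):]) * cofactor j" using w[OF j, of k] by (simp add: left_diff_distrib)
      then have "d + degree (w k j) \<le> degree (c k - [:poly (c k) (l j):]) + (d - 1)"
        using degree_mult_le[of "c k - [:poly (c k) (l j):]" "cofactor j"] degree_mult_eq[OF f_nz False]
        by (simp add: degree_cofactor[OF j] degree_f)
      also have "degree (c k - [:poly (c k) (l j):]) \<le> degree (c k)" by (rule degree_diff_le) auto
      also have "degree (c k) \<le> (q ^ k - 1) * n" using c by (simp add: skew_bdd_def)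
      also have "\<dots> \<le> q ^ k * n" by simp
      finally show ?thesis using d0 by linarith
    qed simp
  qed (use q1 in simp)
  define Z where "Z = mat n d (\<lambda>(i,j). Abs_fps (\<lambda>k. coeff (cartier (q ^ k) (w k j)) i))"
  define W where "W = map_mat fps_const (bas_mat n)"
  define Blk where "Blk = four_block_mat (orbit_mat c) (0\<^sub>m d n) Z (op_mat q c n)"
  have car: "W \<in> carrier_mat (n + d) (n + d)" "Blk \<in> carrier_mat (n + d) (n + d)"
    "Z \<in> carrier_mat n d"
    by (auto simp: W_def bas_mat_def Blk_def Z_def op_mat_def orbit_mat_def)
  have "op_mat q (twist c) (n + d) * W = W * Blk"
  proof (rule eq_matI)
    fix i j assume "i < dim_row (W * Blk)" "j < dim_col (W * Blk)"
    then have ij: "i < n + d" "j < n + d" using car by auto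
    have basz: "\<forall>i\<ge>n + d. coeff (bas j) i = 0" using degree_bas[OF ij(2)] by (auto intro: coeff_eq_0)
    have "fps_nth ((op_mat q (twist c) (n + d) * W) $$ (i,j)) k = fps_nth ((W * Blk) $$ (i,j)) k" for k
    proof -
      have qk: "q ^ k > 0" "q ^ k = Suc (q ^ k - 1)" using q1 by simp_all
      have "fps_nth ((op_mat q (twist c) (n + d) * W) $$ (i,j)) k
          = (\<Sum>m<n + d. coeff (cartier (q ^ k) (twist c k * monom 1 m)) i * coeff (bas j) m)"
        using ij unfolding lessThan_atLeast0
        by (simp add: W_def bas_mat_def op_mat_def scalar_prod_def fps_sum_nth)
      also have "\<dots> = coeff (cartier (q ^ k) (twist c k * bas j)) i"
        by (rule sum_coeff_cartier[OF qk(1) basz])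
      finally have L: "fps_nth ((op_mat q (twist c) (n + d) * W) $$ (i,j)) k = \<dots>" .
      have "fps_nth ((W * Blk) $$ (i,j)) k = (\<Sum>m<d + n. coeff (bas m) i * fps_nth (Blk $$ (m,j)) k)"
        using ij car unfolding lessThan_atLeast0
        by (simp add: W_def bas_mat_def scalar_prod_def fps_sum_nth add.commute)
      also have "\<dots> = (\<Sum>m<d. coeff (cofactor m) i * fps_nth (Blk $$ (m,j)) k)
          + (\<Sum>m<n. coeff (f * monom 1 m) i * fps_nth (Blk $$ (m + d,j)) k)"
      proof -
        have split: "(\<Sum>m<d + n'. h m) = (\<Sum>m<d. h m) + (\<Sum>m<n'. h (m + d))" for h :: "nat \<Rightarrow> 'a" and n'
          by (induction n') (simp_all add: add_ac)
        show ?thesis unfolding split by (simp add: bas_def)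
      qed
      finally have R: "fps_nth ((W * Blk) $$ (i,j)) k = \<dots>" .
      have fexp: "(\<Sum>m<n. coeff (f * monom 1 m) i * coeff g m) = coeff (f * g) i" if "\<forall>i\<ge>n. coeff g i = 0" for g
      proof -
        have "f * g = f * (\<Sum>m<n. smult (coeff g m) (monom 1 m))" using poly_as_sum_less[OF that] by simp
        then show ?thesis by (simp add: sum_distrib_left coeff_sum mult.commute)
      qed
      show ?thesis
      proof (cases "j < d")
        case True
        have "twist c k * bas j = smult (poly (c k) (l j)) (f ^ (q ^ k - 1) * cofactor j) + f ^ (q ^ k) * w k j"
        proof -
          have "twist c k * bas j = f ^ (q ^ k - 1) * (c k * cofactor j)"
            using True by (simp add: twist_def bas_def mult_ac)
          also have "\<dots> = smult (poly (c k) (l j)) (f ^ (q ^ k - 1) * cofactor j) + f ^ (q ^ k - 1) * f * w k j"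
            unfolding w[OF True] by (simp add: distrib_left mult.assoc)
          finally show ?thesis using power_minus_mult[OF qk(1), of f] by simp
        qed
        then have "cartier (q ^ k) (twist c k * bas j)
          = smult (poly (c k) (l j)) (cofactor ((j + k) mod d)) + f * cartier (q ^ k) (w k j)"
          using qk(1) by (simp only: cartier_add cartier_smult cartier_cofactor[OF True] cartier_xsub_mult f_frob[of k, symmetric])
        moreover have "(\<Sum>m<d. coeff (cofactor m) i * fps_nth (Blk $$ (m,j)) k)
          = (\<Sum>m<d. if m = (j + k) mod d then coeff (cofactor m) i * poly (c k) (l j) else 0)"
          using True by (intro sum.cong) (auto simp: Blk_def orbit_mat_def Z_def op_mat_def)
        moreover have "(\<Sum>m<n. coeff (f * monom 1 m) i * fps_nth (Blk $$ (m + d,j)) k)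
          = (\<Sum>m<n. coeff (f * monom 1 m) i * coeff (cartier (q ^ k) (w k j)) m)"
          using True by (intro sum.cong) (auto simp: Blk_def orbit_mat_def Z_def op_mat_def)
        ultimately show ?thesis using L R fexp[OF wz[OF True]] d0 by (simp add: mult.commute)
      next
        case False
        have "twist c k * bas j = f ^ (q ^ k) * (c k * monom 1 (j - d))"
        proof -
          have "twist c k * bas j = f ^ (q ^ k - 1) * f * (c k * monom 1 (j - d))"
            using False by (simp add: twist_def bas_def mult_ac)
          then show ?thesis using power_minus_mult[OF qk(1), of f] by simp
        qed
        then have 1: "cartier (q ^ k) (twist c k * bas j) = f * cartier (q ^ k) (c k * monom 1 (j - d))"
          using qk(1) by (simp only: cartier_xsub_mult f_frob[of k, symmetric])
        have "j - d < n" using False ij by auto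
        then have "\<forall>i\<ge>n. coeff (cartier (q ^ k) (c k * monom 1 (j - d))) i = 0"
          using q1 by (intro skew_image_bdd[OF _ c]) (auto simp: coeff_monom)
        note 2 = fexp[OF this]
        have "(\<Sum>m<d. coeff (cofactor m) i * fps_nth (Blk $$ (m,j)) k) = 0"
          using False ij by (intro sum.neutral) (auto simp: Blk_def orbit_mat_def Z_def op_mat_def)
        moreover have "(\<Sum>m<n. coeff (f * monom 1 m) i * fps_nth (Blk $$ (m + d,j)) k)
          = (\<Sum>m<n. coeff (f * monom 1 m) i * coeff (cartier (q ^ k) (c k * monom 1 (j - d))) m)"
          using False ij by (intro sum.cong) (auto simp: Blk_def orbit_mat_def Z_def op_mat_def)
        ultimately show ?thesis using L R 1 2 by simp
      qed
    qed
    then show "(op_mat q (twist c) (n + d) * W) $$ (i,j) = (W * Blk) $$ (i,j)" by (rule fps_ext)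
  qed (use car in \<open>auto simp: op_mat_def\<close>)
  then have "det (op_mat q (twist c) (n + d)) * det W = det W * det Blk"
    using det_mult[OF op_mat_carrier car(1), of q "twist c"] det_mult[OF car(1,2)] by metis
  moreover have "det W = fps_const (det (bas_mat n))"
  proof -
    interpret comm_ring_hom "fps_const :: 'a \<Rightarrow> 'a fps" by unfold_locales auto
    show ?thesis by (simp add: W_def)
  qed
  moreover have "det Blk = det (orbit_mat c) * det (op_mat q c n)"
    unfolding Blk_def using car(3) by (subst det_four_block_mat_upper_right_zero) auto
  ultimately show ?thesis using det_bas_mat[of n] by simp
qed

end

definition orb :: "'q::finite_field poly \<Rightarrow> nat \<Rightarrow> 'q alg_closure" where
  "orb f j = residue_root f ^ (CARD('q) ^ j)"

lemma orb_add: "orb (f :: 'q::finite_field poly) (j + k) = orb f j ^ (CARD('q) ^ k)"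
  by (simp add: orb_def power_add flip: power_mult)

lemma orb_root: "monic_irreducible f \<Longrightarrow> poly (lift_ac f) (orb f j) = 0"
  by (simp add: orb_def poly_lift_ac_pow_card residue_root)

lemma xsub_lift_ac: "xsub (CARD('q) ^ k) (lift_ac f) = lift_ac (f :: 'q::finite_field poly) ^ (CARD('q) ^ k)"
proof (induction f)
  case (pCons a f)
  have "lift_ac (pCons a f) = [:to_ac a:] + monom 1 1 * lift_ac f"
    by (simp add: monom_altdef hom_distribs)
  then have "lift_ac (pCons a f) ^ (CARD('q) ^ k) = [:to_ac a:] ^ (CARD('q) ^ k) + (monom 1 1 * lift_ac f) ^ (CARD('q) ^ k)"
    by (simp only:) (rule pow_card_add, simp)
  then show ?case using pCons
    by (simp add: power_mult_distrib monom_power poly_const_pow pcompose_pCons hom_distribs)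
qed simp

lemma frobenius_orbit_orb:
  fixes f :: "'q::finite_field poly"
  assumes f: "monic_irreducible f"
  shows "frobenius_orbit CARD('q) (degree f) (orb f) (lift_ac f)"
proof
  note o = monic_irreducible_orbit[OF f residue_root[OF f]]
  show "CARD('q) > 1" by (rule card_finite_field_gt_1)
  show "degree f > 0" by (rule monic_irreducible_degree_pos[OF f])
  show "orb f (j + k) = orb f j ^ (CARD('q) ^ k)" for j k by (rule orb_add)
  show "orb f (j + degree f) = orb f j" for j
    unfolding add.commute[of j] orb_add[of f "degree f"] using o(1) by (simp add: orb_def)
  show "inj_on (orb f) {..<degree f}" using o(2) by (simp add: orb_def[abs_def])
  show "lift_ac f = (\<Prod>j<degree f. [:- orb f j, 1:])" using o(3) by (simp add: orb_def)
  show "xsub (CARD('q) ^ k) (lift_ac f) = lift_ac f ^ (CARD('q) ^ k)" for k by (rule xsub_lift_ac)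
qed

definition local_mat :: "'q::finite_field poly \<Rightarrow> (nat \<Rightarrow> 'q alg_closure poly) \<Rightarrow> 'q alg_closure fps mat" where
  "local_mat f = frobenius_orbit.orbit_mat (degree f) (orb f)"

lemma local_mat_eq: "monic_irreducible f \<Longrightarrow> local_mat f c = mat (degree f) (degree f)
   (\<lambda>(i,j). Abs_fps (\<lambda>k. if (j + k) mod degree f = i then poly (c k) (orb f j) else 0))"
  unfolding local_mat_def by (rule frobenius_orbit.orbit_mat_def[OF frobenius_orbit_orb])

lemma det_diag:
  "det (mat n n (\<lambda>(i,j). if i = j then g i else (0::'a::idom))) = (\<Prod>i<n. g i)" (is "det ?P = _")
proof -
  have "det ?P = prod_list (diag_mat ?P)"
    by (rule det_upper_triangular[of _ n]) auto
  also have "diag_mat ?P = map g [0..<n]" by (auto simp: diag_mat_def)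
  finally show ?thesis by (simp add: prod.distinct_set_conv_list[symmetric] lessThan_atLeast0)
qed

lemma fps_const_prod: "fps_const (\<Prod>i\<in>S. h i) = (\<Prod>i\<in>S. fps_const (h i :: 'a::comm_ring_1))"
  by (induction S rule: infinite_finite_induct) (simp_all flip: fps_const_mult)

lemma det_diag_conj:
  fixes A B :: "'a::idom mat"
  assumes A: "A \<in> carrier_mat n n" and B: "B \<in> carrier_mat n n"
    and g: "\<And>i. i < n \<Longrightarrow> g i \<noteq> 0"
    and eq: "\<And>i j. i < n \<Longrightarrow> j < n \<Longrightarrow> A $$ (i,j) * g j = g i * B $$ (i,j)"
  shows "det A = det B"
proof -
  define P where "P = mat n n (\<lambda>(i,j). if i = j then g i else 0)"
  have P: "P \<in> carrier_mat n n" by (simp add: P_def)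
  have dP: "det P \<noteq> 0" using g by (simp add: P_def det_diag)
  have "A * P = P * B"
  proof (rule eq_matI)
    fix i j assume "i < dim_row (P * B)" "j < dim_col (P * B)"
    then have ij: "i < n" "j < n" using P B by auto
    have "(A * P) $$ (i,j) = (\<Sum>m\<in>{0..<n}. A $$ (i,m) * P $$ (m,j))"
      using ij A P by (simp add: scalar_prod_def)
    also have "\<dots> = (\<Sum>m\<in>{0..<n}. if m = j then A $$ (i,m) * g m else 0)"
      using ij by (intro sum.cong) (auto simp: P_def)
    also have "\<dots> = A $$ (i,j) * g j" using ij by simp
    also have "\<dots> = (\<Sum>m\<in>{0..<n}. if m = i then g i * B $$ (m,j) else 0)" using ij eq by simp
    also have "\<dots> = (\<Sum>m\<in>{0..<n}. P $$ (i,m) * B $$ (m,j))"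
      using ij by (intro sum.cong) (auto simp: P_def)
    also have "\<dots> = (P * B) $$ (i,j)"
      using ij B P by (simp add: scalar_prod_def)
    finally show "(A * P) $$ (i,j) = (P * B) $$ (i,j)" .
  qed (use A B P in auto)
  then have "det A * det P = det P * det B" using det_mult[OF A P] det_mult[OF P B] by metis
  then show ?thesis using dP by simp
qed

text \<open>As g has coefficients in F_q, its value at l_(j+k) is the q^k-th power of its value at
  l_j. So at the roots of f the twist by g is conjugation by the diagonal matrix of the nonzero
  values g(l_j).\<close>

lemma det_local_mat_twist:
  fixes f g :: "'q::finite_field poly"
  assumes f: "monic_irreducible f" and g: "\<not> f dvd g"
  shows "det (local_mat f (\<lambda>k. c k * lift_ac g ^ (CARD('q) ^ k - 1))) = det (local_mat f c)"
proof (rule det_diag_conj[where n = "degree f" and g = "\<lambda>j. fps_const (poly (lift_ac g) (orb f j))"])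
  interpret frobenius_orbit "CARD('q)" "degree f" "orb f" "lift_ac f" by (rule frobenius_orbit_orb[OF f])
  show "fps_const (poly (lift_ac g) (orb f i)) \<noteq> 0" for i
    using monic_irreducible_dvd_iff_root[OF f orb_root[OF f], of g i] g by simp
  fix i j assume ij: "i < degree f" "j < degree f"
  have "x ^ (CARD('q) ^ k - 1) * x = x ^ (CARD('q) ^ k)" for x :: "'q alg_closure" and k
    by (rule power_minus_mult) simp
  moreover have "poly (lift_ac g) (orb f ((j + k) mod degree f)) = poly (lift_ac g) (orb f j) ^ (CARD('q) ^ k)" for k
    by (simp add: l_mod orb_add poly_lift_ac_pow_card)
  ultimately show "local_mat f (\<lambda>k. c k * lift_ac g ^ (CARD('q) ^ k - 1)) $$ (i, j) * fps_const (poly (lift_ac g) (orb f j)) =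
    fps_const (poly (lift_ac g) (orb f i)) * local_mat f c $$ (i, j)"
    using ij f by (auto simp: local_mat_eq fps_eq_iff mult_ac)
qed (use f in \<open>simp_all add: local_mat_eq\<close>)

lemma det_op_mat_prod_twist:
  fixes S :: "'q::finite_field poly set"
  assumes S: "finite S" "\<And>f. f \<in> S \<Longrightarrow> monic_irreducible f"
    and c: "skew_bdd CARD('q) n c"
  shows "skew_bdd CARD('q) (n + (\<Sum>f\<in>S. degree f)) (\<lambda>k. c k * (lift_ac (\<Prod>f\<in>S. f)) ^ (CARD('q) ^ k - 1)) \<and>
    det (op_mat CARD('q) (\<lambda>k. c k * (lift_ac (\<Prod>f\<in>S. f)) ^ (CARD('q) ^ k - 1)) (n + (\<Sum>f\<in>S. degree f)))
      = (\<Prod>f\<in>S. det (local_mat f c)) * det (op_mat CARD('q) c n)"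
  using S
proof (induction S rule: finite_induct)
  case empty
  then show ?case using c by simp
next
  case (insert f S)
  have f: "monic_irreducible f" using insert.prems by simp
  interpret frobenius_orbit "CARD('q)" "degree f" "orb f" "lift_ac f" by (rule frobenius_orbit_orb[OF f])
  define c' where "c' = (\<lambda>k. c k * (lift_ac (\<Prod>f\<in>S. f)) ^ (CARD('q) ^ k - 1))"
  have IH: "skew_bdd CARD('q) (n + (\<Sum>f\<in>S. degree f)) c'"
    "det (op_mat CARD('q) c' (n + (\<Sum>f\<in>S. degree f))) = (\<Prod>f\<in>S. det (local_mat f c)) * det (op_mat CARD('q) c n)"
    using insert by (auto simp: c'_def)
  have nd: "\<not> f dvd (\<Prod>f\<in>S. f)"
  proof
    assume "f dvd (\<Prod>f\<in>S. f)"
    then have "(\<Prod>g\<in>S. poly (lift_ac g) (orb f 0)) = 0"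
      using monic_irreducible_dvd_iff_root[OF f orb_root[OF f], of "\<Prod>f\<in>S. f" 0] by (simp add: hom_distribs poly_prod)
    then obtain g where "g \<in> S" "poly (lift_ac g) (orb f 0) = 0" using insert.hyps by auto
    then have "f dvd g" using monic_irreducible_dvd_iff_root[OF f orb_root[OF f]] by blast
    then have "f = g" using f insert.prems \<open>g \<in> S\<close> monic_irreducible_dvd_eq by blast
    then show False using \<open>g \<in> S\<close> insert.hyps by simp
  qed
  have tw: "(\<lambda>k. c k * (lift_ac (\<Prod>f\<in>insert f S. f)) ^ (CARD('q) ^ k - 1)) = twist c'"
    using insert.hyps by (auto simp: twist_def c'_def hom_distribs power_mult_distrib mult_ac)
  have n: "n + (\<Sum>f\<in>insert f S. degree f) = n + (\<Sum>f\<in>S. degree f) + degree f" using insert.hyps by simp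
  show ?case unfolding tw n
    using skew_bdd_twist[OF IH(1)] det_twist[OF IH(1)] IH(2) det_local_mat_twist[OF f nd, of c] insert.hyps
    by (simp add: c'_def local_mat_def mult_ac)
qed

section \<open>Anderson's trace formula for finitely many primes\<close>

lemma separable_factorization:
  fixes P :: "'a::alg_closed_field poly"
  assumes P: "P \<noteq> 0" and sep: "\<And>a. poly P a = 0 \<Longrightarrow> poly (pderiv P) a \<noteq> 0"
  shows "P = smult (lead_coeff P) (\<Prod>x\<in>{x. poly P x = 0}. [:- x, 1:])"
    and "card {x. poly P x = 0} = degree P"
proof -
  obtain A where A: "size A = degree P" "P = smult (lead_coeff P) (\<Prod>x\<in>#A. [:- x, 1:])"
    using alg_closed_imp_factorization[OF P] by blast
  have roots: "{x. poly P x = 0} = set_mset A"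
  proof -
    have "poly P x = lead_coeff P * (\<Prod>a\<in>#A. x - a)" for x
      by (subst A(2)) (simp add: poly_prod_mset)
    then show ?thesis using P by auto
  qed
  have "count A x \<le> 1" for x
  proof (rule ccontr)
    assume "\<not> count A x \<le> 1"
    then have "{#x, x#} \<subseteq># A" by (simp add: subseteq_mset_def)
    then obtain B where "A = {#x, x#} + B" by (metis subset_mset.le_iff_add)
    then have "P = [:- x, 1:] * ([:- x, 1:] * smult (lead_coeff P) (\<Prod>x\<in>#B. [:- x, 1:]))"
      by (subst A(2)) (simp add: mult_ac)
    then obtain R where R: "P = [:- x, 1:] * ([:- x, 1:] * R)" by blast
    have "poly (pderiv P) x = 0" "poly P x = 0" unfolding R by (simp_all only: pderiv_mult poly_mult poly_add) simp_all
    then show False using sep by blast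
  qed
  then have "A = mset_set (set_mset A)"
    by (intro multiset_eqI) (metis One_nat_def count_eq_zero_iff count_mset_set(1,3) finite_set_mset le_Suc_eq le_zero_eq)
  then have A': "A = mset_set {x. poly P x = 0}" by (simp add: roots)
  show "P = smult (lead_coeff P) (\<Prod>x\<in>{x. poly P x = 0}. [:- x, 1:])"
    by (subst A(2), subst A') (simp add: prod_unfold_prod_mset)
  show "card {x. poly P x = 0} = degree P" using A(1) A' by (metis size_mset_set)
qed

lemma of_nat_card_alg_closure: "of_nat CARD('q) = (0 :: 'q::finite_field alg_closure)"
  using card_finite_field_eq_power_CHAR[where 'q = 'q] by (auto simp: of_nat_eq_0_iff_char_dvd intro: dvd_power)

text \<open>X^(q^k) - X has derivative -1, hence only simple roots, so divisibility by it can be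
  tested at the elements of F_(q^k).\<close>

lemma monom_frob_dvd:
  fixes b :: "'q::finite_field alg_closure poly"
  assumes k: "k > 0" and b: "\<And>\<xi>. \<xi> ^ (CARD('q) ^ k) = \<xi> \<Longrightarrow> poly b \<xi> = 0"
  shows "(monom 1 (CARD('q) ^ k) - monom 1 1) dvd b"
proof -
  let ?e = "CARD('q) ^ k"
  define P where "P = (monom 1 ?e - monom 1 1 :: 'q alg_closure poly)"
  have e: "?e > 1" using card_finite_field_gt_1[where 'q = 'q] k by (rule one_less_power)
  have dP: "degree P = ?e" using degree_add_eq_left[of "- monom (1::'q alg_closure) 1" "monom 1 ?e"] e
    by (simp add: P_def degree_monom_eq)
  then have lP: "lead_coeff P = 1" using e by (simp add: P_def)
  have "of_nat ?e = (0 :: 'q alg_closure)" using k by (simp add: of_nat_card_alg_closure)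
  then have "pderiv P = - 1"
    unfolding P_def pderiv_diff pderiv_monom by (simp only:) (simp add: one_pCons monom_0)
  then have "P = smult (lead_coeff P) (\<Prod>x\<in>{x. poly P x = 0}. [:- x, 1:])"
    using dP e by (intro separable_factorization) auto
  also have "\<dots> = (\<Prod>x\<in>{x. poly P x = 0}. [:- x, 1:])" by (simp add: lP)
  also have "\<dots> dvd b"
    using dP e b by (intro prod_linear_dvd poly_roots_finite) (auto simp: P_def poly_monom)
  finally show ?thesis by (simp add: P_def)
qed

lemma finite_bounded_degree: "finite {p :: 'q::{finite,zero} poly. degree p \<le> N}"
proof -
  have "{p :: 'q poly. degree p \<le> N} \<subseteq> Poly ` {xs. set xs \<subseteq> UNIV \<and> length xs = Suc N}"
  proof
    fix p :: "'q poly" assume "p \<in> {p. degree p \<le> N}"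
    then have "p = Poly (map (coeff p) [0..<Suc N])"
      by (intro poly_eqI) (auto simp: nth_default_def coeff_eq_0 simp del: upt_Suc)
    then show "p \<in> Poly ` {xs. set xs \<subseteq> UNIV \<and> length xs = Suc N}"
      by (intro image_eqI[of _ _ "map (coeff p) [0..<Suc N]"]) auto
  qed
  then show ?thesis by (rule finite_subset) (intro finite_imageI finite_lists_length_eq finite)
qed

definition irreds :: "nat \<Rightarrow> 'q::finite_field poly set" where
  "irreds N = {f. monic_irreducible f \<and> degree f \<le> N}"

lemma finite_irreds: "finite (irreds N)"
  unfolding irreds_def by (rule finite_subset[OF _ finite_bounded_degree[of N]]) auto

lemma fps_nth_prod_eq_0:
  fixes F :: "'b \<Rightarrow> 'a::comm_ring_1 fps"
  assumes "finite S" "\<And>i m. i \<in> S \<Longrightarrow> m > r \<Longrightarrow> fps_nth (F i) m = 0" "m > r * card S"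
  shows "fps_nth (\<Prod>i\<in>S. F i) m = 0"
  using assms
proof (induction S arbitrary: m rule: finite_induct)
  case (insert x S)
  have "fps_nth (F x) i * fps_nth (\<Prod>i\<in>S. F i) (m - i) = 0" if "i \<le> m" for i
  proof (cases "i > r")
    case False
    then have "m - i > r * card S" using insert.prems(2) insert.hyps by auto
    then show ?thesis using insert.IH insert.prems(1) by simp
  qed (use insert.prems in simp)
  then show ?case using insert.hyps by (simp add: fps_mult_nth)
qed simp

text \<open>Each entry is a polynomial in x of degree at most r, so the determinant has degree at
  most r n. With r = \<open>degree \<phi>\<close> this becomes the vanishing bound for the
  sums.\<close>

lemma fps_nth_det_op_mat_eq_0:
  assumes c: "\<And>k. k > r \<Longrightarrow> c k = 0" and q: "q > 0" and m: "m > r * n"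
  shows "fps_nth (det (op_mat q c n)) m = 0"
proof -
  have "fps_nth (signof p * (\<Prod>i = 0..<n. op_mat q c n $$ (i, p i))) m = 0" if "p permutes {0..<n}" for p
  proof -
    have "fps_nth (\<Prod>i = 0..<n. op_mat q c n $$ (i, p i)) m = 0"
      using that c m q by (intro fps_nth_prod_eq_0[where r = r]) (auto simp: op_mat_def dest: permutes_in_image)
    moreover have "signof p * y = y \<or> signof p * y = - y" for y :: "'a fps" by (auto simp: sign_def)
    ultimately show ?thesis by (metis fps_neg_nth neg_0_equal_iff_equal)
  qed
  then show ?thesis unfolding det_def'[OF op_mat_carrier] fps_sum_nth by (intro sum.neutral) simp
qed

text \<open>Every element of F_(q^k) with 0 < k <= N is a root of a prime of degree at most N, so
  the product b of these primes is divisible by X^(q^k) - X. The twist by b makes all coefficients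
  of positive index divisible by b, and \<open>det_op_mat_trivial\<close> applies.\<close>

lemma trace_formula:
  fixes c :: "nat \<Rightarrow> 'q::finite_field alg_closure poly"
  assumes c: "skew_bdd CARD('q) n c" and c0: "c 0 = 1"
  shows "fps_X ^ Suc N dvd (\<Prod>f\<in>irreds N. det (local_mat f c)) * det (op_mat CARD('q) c n) - 1"
proof -
  define S where "S = (irreds N :: 'q poly set)"
  define b where "b = lift_ac (\<Prod>f\<in>S. f)"
  have finite: "finite S" unfolding S_def by (rule finite_irreds)
  have I: "monic_irreducible f" if "f \<in> S" for f using that by (simp add: irreds_def S_def)
  have T: "skew_bdd CARD('q) (n + (\<Sum>f\<in>S. degree f)) (\<lambda>k. c k * b ^ (CARD('q) ^ k - 1)) \<and>
    det (op_mat CARD('q) (\<lambda>k. c k * b ^ (CARD('q) ^ k - 1)) (n + (\<Sum>f\<in>S. degree (f :: 'q poly))))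
      = (\<Prod>f\<in>S. det (local_mat f c)) * det (op_mat CARD('q) c n)"
    unfolding b_def by (rule det_op_mat_prod_twist[OF finite _ c]) (rule I)
  have "fps_X ^ Suc N dvd det (op_mat CARD('q) (\<lambda>k. c k * b ^ (CARD('q) ^ k - 1)) (n + (\<Sum>f\<in>S. degree f))) - 1"
  proof (rule det_op_mat_trivial)
    show "CARD('q) > 1" by (rule card_finite_field_gt_1)
    show "c 0 * b ^ (CARD('q) ^ 0 - 1) = 1" using c0 by simp
    show "skew_bdd CARD('q) (n + (\<Sum>f\<in>S. degree f)) (\<lambda>k. c k * b ^ (CARD('q) ^ k - 1))"
      using T by (rule conjunct1)
    show "b dvd c k * b ^ (CARD('q) ^ k - 1)" if "k > 0" for k
    proof -
      have "CARD('q) ^ k > 1" using card_finite_field_gt_1[where 'q = 'q] that by (rule one_less_power)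
      then show ?thesis by (intro dvd_mult dvd_power) simp
    qed
    show "(monom 1 (CARD('q) ^ k) - monom 1 1) dvd b" if "0 < k" "k \<le> N" for k
    proof (rule monom_frob_dvd[OF that(1)])
      fix \<xi> :: "'q alg_closure" assume \<xi>: "\<xi> ^ (CARD('q) ^ k) = \<xi>"
      obtain f where f: "monic_irreducible f" "poly (lift_ac f) \<xi> = 0"
        using minimal_polynomial_exists[of \<xi>] by blast
      have "degree f \<le> k" by (rule monic_irreducible_orbit(4)[OF f that(1) \<xi>])
      then have "f \<in> S" using f that by (simp add: irreds_def S_def)
      then show "poly b \<xi> = 0" using f(2) finite by (auto simp: b_def hom_distribs poly_prod intro!: prod_zero)
    qed
  qed
  then show ?thesis unfolding conjunct2[OF T] unfolding S_def .
qed

section \<open>The local factors of a Drinfeld module\<close>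

text \<open>
  The matrix of \<open>t - \<phi>\<^sub>\<theta>\<close> in the basis \<open>1, \<tau>, \<dots>, \<tau>\<^bsup>d-1\<^esup>\<close> of the twisted polynomials over \<open>\<bbbF>\<^sub>q[Y]\<close>,
  \<open>Y = \<tau>\<^sup>d\<close>, over the algebraic closure of the residue field. The inner variable is \<open>t\<close>, the outer one \<open>Y\<close>.
\<close>

definition qmat :: "'q::finite_field poly poly \<Rightarrow> 'q poly \<Rightarrow> 'q alg_closure poly poly mat" where
  "qmat \<phi> f = mat (degree f) (degree f) (\<lambda>(i,j). (if i = j then [:[:0, 1:]:] else 0) -
     (\<Sum>k\<le>degree \<phi>. if (j + k) mod degree f = i
        then monom [:poly (lift_ac (coeff \<phi> k)) (orb f j):] ((j + k) div degree f) else 0))"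

definition qpoly :: "'q::finite_field poly poly \<Rightarrow> 'q poly \<Rightarrow> 'q alg_closure poly poly" where
  "qpoly \<phi> f = det (qmat \<phi> f)"

text \<open>Formally t - \<phi>_\<theta> with \<tau> replaced by x (t - X) g \<tau>, divided by t -
  X in order that the coefficient of index 0 be 1. The polynomial g will be the product of the z_k -
  X.\<close>

definition fam :: "'q::finite_field poly poly \<Rightarrow> 'q alg_closure \<Rightarrow> 'q alg_closure poly \<Rightarrow> nat \<Rightarrow> 'q alg_closure poly" where
  "fam \<phi> t g k = (if k = 0 then 1 else
     - lift_ac (coeff \<phi> k) * g * (\<Prod>l\<in>{1..<k}. xsub (CARD('q) ^ l) ([:t, -1:] * g)))"

lemma fam_0: "fam \<phi> t g 0 = 1" by (simp add: fam_def)

lemma fam_gt: "k > degree \<phi> \<Longrightarrow> fam \<phi> t g k = 0" by (simp add: fam_def coeff_eq_0)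

text \<open>The k-th coefficient has degree at most \<Delta> + m + (m + 1)(q + ... + q^(k-1)), and 1
  + q + ... + q^(k-1) is at most q^k - 1. That the size is linear in m makes the vanishing bound
  linear in the number of factors.\<close>

lemma skew_bdd_fam:
  fixes \<phi> :: "'q::finite_field poly poly"
  assumes \<phi>: "\<And>k. degree (coeff \<phi> k) \<le> \<Delta>" and g: "degree g \<le> m"
  shows "skew_bdd CARD('q) (\<Delta> + m + 1) (fam \<phi> t g)"
  unfolding skew_bdd_def
proof
  fix k
  let ?q = "CARD('q)"
  show "degree (fam \<phi> t g k) \<le> (?q ^ k - 1) * (\<Delta> + m + 1)"
  proof (cases "k = 0")
    case False
    have q: "?q > 1" by (rule card_finite_field_gt_1)
    have dg: "degree ([:t, -1:] * g) \<le> m + 1"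
      using degree_mult_le[of "[:t, -1:]" g] g by simp
    have sum: "(\<Sum>l<k. ?q ^ l) \<le> ?q ^ k - 1" for k
    proof (induction k)
      case (Suc k)
      have "?q ^ k * 2 \<le> ?q ^ k * ?q" using q by (intro mult_le_mono) auto
      moreover have "?q ^ k \<ge> 1" using q by simp
      moreover have "?q ^ Suc k = ?q ^ k * ?q" by simp
      ultimately have "(\<Sum>l<k. ?q ^ l) + ?q ^ k \<le> ?q ^ Suc k - 1" using Suc by linarith
      then show ?case by simp
    qed simp
    have "degree (\<Prod>l\<in>{1..<k}. xsub (?q ^ l) ([:t, -1:] * g)) \<le> (\<Sum>l\<in>{1..<k}. degree (xsub (?q ^ l) ([:t, -1:] * g)))"
      using degree_prod_sum_le[of "{1..<k}" "\<lambda>l. xsub (?q ^ l) ([:t, -1:] * g)"] by (simp add: o_def)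
    also have "\<dots> \<le> (\<Sum>l\<in>{1..<k}. (m + 1) * ?q ^ l)"
      unfolding degree_xsub using dg by (intro sum_mono mult_le_mono1)
    finally have 1: "degree (\<Prod>l\<in>{1..<k}. xsub (?q ^ l) ([:t, -1:] * g)) \<le> (\<Sum>l\<in>{1..<k}. (m + 1) * ?q ^ l)" .
    have "(\<Sum>l<k. (m + 1) * ?q ^ l) = (m + 1) + (\<Sum>l\<in>{1..<k}. (m + 1) * ?q ^ l)"
      unfolding lessThan_atLeast0 using False by (subst sum.atLeast_Suc_lessThan) auto
    moreover have "(\<Sum>l<k. (m + 1) * ?q ^ l) \<le> (m + 1) * (?q ^ k - 1)"
      using sum[of k] by (simp add: sum_distrib_left[symmetric] mult_le_mono2 del: add_Suc_right)
    ultimately have 2: "m + degree (\<Prod>l\<in>{1..<k}. xsub (?q ^ l) ([:t, -1:] * g)) \<le> (m + 1) * (?q ^ k - 1)"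
      using 1 by linarith
    have "1 * \<Delta> \<le> (?q ^ k - 1) * \<Delta>"
      using one_less_power[OF q, of k] False by (intro mult_le_mono1) auto
    then have 3: "degree (- lift_ac (coeff \<phi> k)) \<le> (?q ^ k - 1) * \<Delta>" using \<phi>[of k] by (simp only: degree_minus to_ac.degree_map_poly_hom mult_1)
    have "degree (fam \<phi> t g k) \<le> degree (- lift_ac (coeff \<phi> k)) + degree g
        + degree (\<Prod>l\<in>{1..<k}. xsub (?q ^ l) ([:t, -1:] * g))"
      using False unfolding fam_def
      by (simp del: degree_minus mult_minus_left) (meson add_le_mono1 degree_mult_le le_trans)
    also have "\<dots> \<le> (?q ^ k - 1) * \<Delta> + (m + 1) * (?q ^ k - 1)"
      using 2 3 g by linarith
    also have "\<dots> = (?q ^ k - 1) * (\<Delta> + m + 1)" by (simp only: distrib_left distrib_right mult_ac add_ac mult_1)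
    finally show ?thesis .
  qed (simp add: fam_def)
qed

text \<open>
  Multiplying the columns of the local matrix by \<open>t - \<lambda>\<^sub>j\<close> turns \<open>1 - \<Sum> \<phi>\<^sub>k g\<tau>((t - X)g\<tau>)\<^bsup>k-1\<^esup>x\<^sup>k\<close> into \<open>t - \<phi>\<^sub>\<theta>\<close>
  with \<open>\<tau>\<close> replaced by \<open>x(t - X)g\<tau>\<close>, which is diagonally conjugate to a weighted cyclic shift.
\<close>

lemma local_det_fam:
  fixes f :: "'q::finite_field poly"
  assumes f: "monic_irreducible f" and \<phi>0: "coeff \<phi> 0 = [:0, 1:]"
    and t: "\<And>j. t \<noteq> orb f j" and g: "\<And>j. poly g (orb f j) \<noteq> 0"
  defines "Y \<equiv> fps_const (poly (lift_ac f) t * (\<Prod>j<degree f. poly g (orb f j))) * fps_X ^ degree f"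
  shows "fps_const (poly (lift_ac f) t) * det (local_mat f (fam \<phi> t g))
    = (\<Sum>i\<le>degree (qpoly \<phi> f). fps_const (poly (coeff (qpoly \<phi> f) i) t) * Y ^ i)"
proof -
  interpret frobenius_orbit "CARD('q)" "degree f" "orb f" "lift_ac f" by (rule frobenius_orbit_orb[OF f])
  \<comment> \<open>The inner variable is specialised to the element \<open>t\<close>, the outer one
    to \<open>Y\<close>.\<close>
  define ev :: "'q alg_closure poly poly \<Rightarrow> 'q alg_closure fps"
    where "ev P = poly (map_poly (\<lambda>p. fps_const (poly p t)) P) Y" for P
  interpret ct: comm_ring_hom "\<lambda>p. fps_const (poly p t)"
    by unfold_locales auto
  interpret cp: map_poly_comm_ring_hom "\<lambda>p. fps_const (poly p t)" ..
  interpret ev: comm_ring_hom ev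
    by unfold_locales (auto simp: ev_def hom_distribs)
  have ev_monom: "ev (monom p k) = fps_const (poly p t) * Y ^ k" for p k
    by (simp add: ev_def poly_monom)
  have ev_const: "ev [:p:] = fps_const (poly p t)" for p
    using ev_monom[of p 0] by (simp add: monom_0)
  \<comment> \<open>\<open>\<gamma> j\<close> is the weight of one Frobenius step starting at l_j.
    Conjugation by the partial products \<open>G\<close> cancels the weights except for complete
    turns around the orbit, each of which contributes \<open>Y\<close>.\<close>
  define \<gamma> where "\<gamma> j = fps_X * fps_const ((t - orb f j) * poly g (orb f j))" for j
  define G where "G j = (\<Prod>l<j. \<gamma> l)" for j
  have \<gamma>_period: "\<gamma> (j + degree f) = \<gamma> j" for j by (simp add: \<gamma>_def l_period)
  have G_nz: "G j \<noteq> 0" for j using t g by (auto simp: G_def \<gamma>_def)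
  have G_add: "G (j + k) = G j * (\<Prod>l<k. \<gamma> (j + l))" for j k
    by (induction k) (simp_all add: G_def mult_ac)
  have ft: "poly (lift_ac f) t = (\<Prod>j<degree f. t - orb f j)"
    by (subst f_eq) (simp add: poly_prod)
  have GY: "G (degree f) = Y"
    by (simp add: G_def \<gamma>_def Y_def ft prod.distrib fps_const_prod mult.commute flip: fps_const_mult)
  have G_d: "G (j + degree f) = Y * G j" for j
  proof (induction j)
    case (Suc j)
    then show ?case using \<gamma>_period[of j] by (simp add: G_def mult_ac)
  qed (simp add: GY, simp add: G_def)
  have G_dm: "G (i + degree f * m) = Y ^ m * G i" for i m
  proof (induction m)
    case (Suc m)
    then show ?case using G_d[of "i + degree f * m"] by (simp add: algebra_simps)
  qed simp
  have G_mod: "G m = Y ^ (m div degree f) * G (m mod degree f)" for m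
    using G_dm[of "m mod degree f" "m div degree f"] by simp
  define M where "M = mat (degree f) (degree f) (\<lambda>(i,j). local_mat f (fam \<phi> t g) $$ (i,j) * fps_const (t - orb f j))"
  have Mc: "M \<in> carrier_mat (degree f) (degree f)" by (simp add: M_def)
  define T where "T = mat (degree f) (degree f) (\<lambda>(i,j). if i = j then fps_const (t - orb f i) else 0)"
  have Tc: "T \<in> carrier_mat (degree f) (degree f)" by (simp add: T_def)
  have Lc: "local_mat f (fam \<phi> t g) \<in> carrier_mat (degree f) (degree f)" by (simp add: local_mat_def)
  have dT: "det T = fps_const (poly (lift_ac f) t)" by (simp add: T_def det_diag ft fps_const_prod)
  have "local_mat f (fam \<phi> t g) * T = M"
  proof (rule eq_matI)
    fix i j assume "i < dim_row M" "j < dim_col M"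
    then have ij: "i < degree f" "j < degree f" using Mc by auto
    have "(local_mat f (fam \<phi> t g) * T) $$ (i,j) = (\<Sum>m\<in>{0..<degree f}. local_mat f (fam \<phi> t g) $$ (i,m) * T $$ (m,j))"
      using ij Lc Tc by (simp add: scalar_prod_def)
    also have "\<dots> = (\<Sum>m\<in>{0..<degree f}. if m = j then local_mat f (fam \<phi> t g) $$ (i,m) * fps_const (t - orb f j) else 0)"
      using ij by (intro sum.cong) (auto simp: T_def)
    finally show "(local_mat f (fam \<phi> t g) * T) $$ (i,j) = M $$ (i,j)" using ij by (simp add: M_def)
  qed (use Mc Tc Lc in auto)
  then have dM: "det M = det (local_mat f (fam \<phi> t g)) * fps_const (poly (lift_ac f) t)"
    using det_mult[OF Lc Tc] dT by simp
  have "det M = det (map_mat ev (qmat \<phi> f))"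
  proof (rule det_diag_conj[OF Mc])
    show "map_mat ev (qmat \<phi> f) \<in> carrier_mat (degree f) (degree f)" by (simp add: qmat_def)
    show "G i \<noteq> 0" for i by (rule G_nz)
    fix i j assume ij: "i < degree f" "j < degree f"
    define a where "a k = (if (j + k) mod degree f = i then poly (fam \<phi> t g k) (orb f j) * (t - orb f j) else 0)" for k
    have Mij: "M $$ (i,j) = (\<Sum>k\<le>degree \<phi>. fps_const (a k) * fps_X ^ k)"
    proof (rule fps_ext)
      fix n
      have "fps_nth (\<Sum>k\<le>degree \<phi>. fps_const (a k) * fps_X ^ k) n = (\<Sum>k\<le>degree \<phi>. if n = k then a k else 0)"
        unfolding fps_sum_nth by (intro sum.cong) (auto simp: fps_X_power_nth)
      then show "fps_nth (M $$ (i,j)) n = fps_nth (\<Sum>k\<le>degree \<phi>. fps_const (a k) * fps_X ^ k) n"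
        using ij f by (auto simp: M_def local_mat_eq a_def fam_gt)
    qed
    have trm: "fps_const (a k) * fps_X ^ k * G j = G i * (if (j + k) mod degree f = i then
        (if k = 0 then fps_const t else 0) - fps_const (poly (lift_ac (coeff \<phi> k)) (orb f j)) * Y ^ ((j + k) div degree f) else 0)" for k
    proof (cases "(j + k) mod degree f = i")
      case True
      show ?thesis
      proof (cases "k = 0")
        case k0: True
        then show ?thesis using True ij by (simp add: a_def fam_0 \<phi>0 mult.commute flip: fps_const_sub)
      next
        case False
        have "poly (\<Prod>l\<in>{1..<k}. xsub (CARD('q) ^ l) ([:t, -1:] * g)) (orb f j)
            = (\<Prod>l\<in>{1..<k}. (t - orb f (j + l)) * poly g (orb f (j + l)))"
          by (simp add: poly_prod poly_pcompose poly_monom orb_add left_diff_distrib)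
        then have "a k = - poly (lift_ac (coeff \<phi> k)) (orb f j) *
          ((t - orb f j) * poly g (orb f j) * (\<Prod>l\<in>{1..<k}. (t - orb f (j + l)) * poly g (orb f (j + l))))"
          using True False by (simp add: a_def fam_def)
        also have "(t - orb f j) * poly g (orb f j) * (\<Prod>l\<in>{1..<k}. (t - orb f (j + l)) * poly g (orb f (j + l)))
          = (\<Prod>l<k. (t - orb f (j + l)) * poly g (orb f (j + l)))"
          unfolding lessThan_atLeast0 using False by (subst (2) prod.atLeast_Suc_lessThan) auto
        finally have "fps_const (a k) * fps_X ^ k = - fps_const (poly (lift_ac (coeff \<phi> k)) (orb f j)) * (\<Prod>l<k. \<gamma> (j + l))"
          by (simp only:) (simp add: \<gamma>_def prod.distrib fps_const_prod mult_ac flip: fps_const_mult fps_const_neg)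
        then have "fps_const (a k) * fps_X ^ k * G j = - fps_const (poly (lift_ac (coeff \<phi> k)) (orb f j)) * G (j + k)"
          by (simp add: G_add mult_ac)
        then show ?thesis using True False G_mod[of "j + k"] by (simp add: mult_ac flip: fps_const_neg)
      qed
    qed (simp add: a_def)
    have "map_mat ev (qmat \<phi> f) $$ (i,j) = (if i = j then fps_const t else 0) -
      (\<Sum>k\<le>degree \<phi>. if (j + k) mod degree f = i then fps_const (poly (lift_ac (coeff \<phi> k)) (orb f j)) * Y ^ ((j + k) div degree f) else 0)"
      using ij by (simp add: qmat_def ev.hom_minus ev.hom_sum ev_const ev_monom if_distrib[of ev] cong: if_cong)
    also have "(if i = j then fps_const t else 0) = (\<Sum>k\<le>degree \<phi>. if (j + k) mod degree f = i then (if k = 0 then fps_const t else 0) else 0)"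
    proof -
      have "(\<Sum>k\<le>degree \<phi>. if (j + k) mod degree f = i then (if k = 0 then fps_const t else 0) else 0)
         = (\<Sum>k\<le>degree \<phi>. if k = 0 then (if i = j then fps_const t else 0) else 0)"
        using ij by (intro sum.cong) auto
      then show ?thesis by simp
    qed
    finally have "G i * map_mat ev (qmat \<phi> f) $$ (i,j) = (\<Sum>k\<le>degree \<phi>. G i * (if (j + k) mod degree f = i then
        (if k = 0 then fps_const t else 0) - fps_const (poly (lift_ac (coeff \<phi> k)) (orb f j)) * Y ^ ((j + k) div degree f) else 0))"
      unfolding sum_subtractf[symmetric] by (simp only:) (subst sum_distrib_left, intro sum.cong refl arg_cong[where f = "\<lambda>x. G i * x"], auto)
    then show "M $$ (i,j) * G j = G i * map_mat ev (qmat \<phi> f) $$ (i,j)"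
      unfolding Mij sum_distrib_right trm by simp
  qed
  also have "\<dots> = ev (qpoly \<phi> f)" by (simp add: qpoly_def)
  also have "\<dots> = (\<Sum>i\<le>degree (qpoly \<phi> f). fps_const (poly (coeff (qpoly \<phi> f) i) t) * Y ^ i)"
  proof -
    have "degree (map_poly (\<lambda>p. fps_const (poly p t)) (qpoly \<phi> f)) \<le> degree (qpoly \<phi> f)" by (rule degree_map_poly_le)
    then show ?thesis unfolding ev_def poly_altdef
      by (subst sum.mono_neutral_left[of "{..degree (qpoly \<phi> f)}"]) (auto simp: coeff_map_poly coeff_eq_0 not_le)
  qed
  finally show ?thesis using dM by (simp add: mult.commute)
qed

section \<open>The Euler product\<close>

lemma infinite_alg_closed: "infinite (UNIV :: 'a::alg_closed_field set)"
proof
  assume fin: "finite (UNIV :: 'a set)"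
  define P where "P = (\<Prod>x\<in>UNIV. [:- x, 1:]) + (1 :: 'a poly)"
  have "degree (\<Prod>x\<in>UNIV. [:- x, 1 :: 'a:]) = card (UNIV :: 'a set)"
    by (simp add: degree_prod_eq_sum_degree)
  moreover have "card (UNIV :: 'a set) > 0" using fin by (simp add: card_gt_0_iff)
  ultimately have "degree P > 0" unfolding P_def by (subst degree_add_eq_left) auto
  then obtain y where "poly P y = 0" using alg_closed_imp_poly_has_root by blast
  moreover have "poly P y = 1" using fin by (simp add: P_def poly_prod prod_zero_iff)
  ultimately show False by simp
qed

lemma root_of_multiple: "c dvd a \<Longrightarrow> poly (lift_ac c) \<xi> = 0 \<Longrightarrow> poly (lift_ac a) \<xi> = 0"
  by (auto simp: hom_distribs elim!: dvdE)

lemma monic_factor_exists: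
  fixes a :: "'q::finite_field poly"
  assumes a: "lead_coeff a = 1" "degree a > 0"
  obtains f where "monic_irreducible f" "f dvd a"
proof -
  obtain \<xi> where \<xi>: "poly (lift_ac a) \<xi> = 0"
    using alg_closed_imp_poly_has_root[of "lift_ac a"] a by auto
  obtain f where "monic_irreducible f" "poly (lift_ac f) \<xi> = 0" "\<And>g. poly (lift_ac g) \<xi> = 0 \<Longrightarrow> f dvd g"
    using minimal_polynomial_exists[of \<xi>] by blast
  with \<xi> that show ?thesis by blast
qed

lemma prime_power_factor:
  fixes a :: "'q::finite_field poly"
  assumes f: "monic_irreducible f" and a: "lead_coeff a = 1"
  obtains i a' where "a = f ^ i * a'" "\<not> f dvd a'" "lead_coeff a' = 1"
proof -
  have "\<exists>i a'. a = f ^ i * a' \<and> \<not> f dvd a' \<and> lead_coeff a' = 1" using a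
  proof (induction "degree a" arbitrary: a rule: less_induct)
    case less
    show ?case
    proof (cases "f dvd a")
      case True
      then obtain b where b: "a = f * b" by (elim dvdE)
      then have lb: "lead_coeff b = 1" using less.prems f by (simp add: lead_coeff_mult monic_irreducible_def)
      then have "b \<noteq> 0" "f \<noteq> 0" using f by (auto simp: monic_irreducible_def)
      then have "degree b < degree a" using monic_irreducible_degree_pos[OF f] by (simp add: b degree_mult_eq)
      then obtain i a' where "b = f ^ i * a'" "\<not> f dvd a'" "lead_coeff a' = 1" using less.hyps lb by blast
      then show ?thesis by (intro exI[of _ "Suc i"] exI[of _ a']) (simp add: b)
    next
      case False
      then show ?thesis using less.prems by (intro exI[of _ 0] exI[of _ a]) auto
    qed
  qed
  with that show ?thesis by blast
qed

lemma coprime_power_irreducible: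
  fixes f :: "'q::finite_field poly"
  assumes f: "monic_irreducible f" and a: "\<not> f dvd a"
  shows "coprime (f ^ i) a"
proof (rule coprimeI)
  fix c assume c: "c dvd f ^ i" "c dvd a"
  show "is_unit c"
  proof (rule ccontr)
    assume nu: "\<not> is_unit c"
    have "c \<noteq> 0" using c f by (auto simp: monic_irreducible_def)
    then have "degree c > 0" using nu is_unit_iff_degree by blast
    then obtain \<xi> where \<xi>: "poly (lift_ac c) \<xi> = 0" using alg_closed_imp_poly_has_root[of "lift_ac c"] by auto
    have "poly (lift_ac (f ^ i)) \<xi> = 0" "poly (lift_ac a) \<xi> = 0" using c \<xi> root_of_multiple by blast+
    then have "poly (lift_ac f) \<xi> = 0" by (simp add: hom_distribs)
    then show False using monic_irreducible_dvd_iff_root[OF f] \<open>poly (lift_ac a) \<xi> = 0\<close> a by blast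
  qed
qed

lemma finite_monics: "finite (monics d :: 'q::finite_field poly set)"
  by (rule finite_subset[OF _ finite_bounded_degree[of d]]) (auto simp: monics_def)

definition smooth :: "'q::finite_field poly set \<Rightarrow> nat \<Rightarrow> 'q poly set" where
  "smooth S d = {a \<in> monics d. \<forall>f. monic_irreducible f \<and> f dvd a \<longrightarrow> f \<in> S}"

definition euler_factor :: "('q::finite_field poly \<Rightarrow> 'k::comm_ring_1) \<Rightarrow> 'q poly \<Rightarrow> 'k fps" where
  "euler_factor \<nu> f = Abs_fps (\<lambda>m. if degree f dvd m then \<nu> (f ^ (m div degree f)) else 0)"

lemma smooth_insert_bij:
  fixes f :: "'q::finite_field poly"
  assumes f: "monic_irreducible f" and S: "f \<notin> S"
  shows "bij_betw (\<lambda>(m, a). f ^ (m div degree f) * a)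
    (SIGMA m:{m. m \<le> d \<and> degree f dvd m}. smooth S (d - m)) (smooth (insert f S) d)"
proof -
  have df: "degree f > 0" by (rule monic_irreducible_degree_pos[OF f])
  have lf: "lead_coeff f = 1" and f0: "f \<noteq> 0" using f by (auto simp: monic_irreducible_def)
  have pr: "g = f \<or> g dvd b" if g: "monic_irreducible g" "g dvd f ^ i * b" for g b and i
  proof -
    obtain \<xi> where \<xi>: "poly (lift_ac g) \<xi> = 0" using monic_irreducible_root_exists[OF g(1)] by blast
    then have "poly (lift_ac (f ^ i * b)) \<xi> = 0" using g(2) \<xi> root_of_multiple by blast
    then have "poly (lift_ac f) \<xi> = 0 \<or> poly (lift_ac b) \<xi> = 0" by (auto simp: hom_distribs)
    then show ?thesis using monic_irreducible_dvd_iff_root[OF g(1) \<xi>] monic_irreducible_dvd_eq[OF g(1) f] by blast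
  qed
  have nd: "\<not> f dvd a" if "a \<in> smooth S e" for a e using that f S by (auto simp: smooth_def)
  show ?thesis
    unfolding bij_betw_def
  proof
    show "inj_on (\<lambda>(m, a). f ^ (m div degree f) * a) (SIGMA m:{m. m \<le> d \<and> degree f dvd m}. smooth S (d - m))"
    proof (rule inj_onI, clarify)
      fix m a m' a'
      assume *: "degree f dvd m" "a \<in> smooth S (d - m)" "degree f dvd m'" "a' \<in> smooth S (d - m')"
        "f ^ (m div degree f) * a = f ^ (m' div degree f) * a'"
      have le: "j \<le> i" if "f ^ i * b = f ^ j * b'" "\<not> f dvd b" for i j and b b' :: "'q poly"
      proof (rule ccontr)
        assume "\<not> j \<le> i"
        then have "f ^ j = f ^ i * (f * f ^ (j - i - 1))" by (metis Suc_diff_1 Suc_eq_plus1 diff_diff_left le_add_diff_inverse less_imp_le not_less power_Suc power_add zero_less_diff)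
        then have "f ^ i * b = f ^ i * (f * (f ^ (j - i - 1) * b'))" using that by (simp add: mult.assoc)
        then have "b = f * (f ^ (j - i - 1) * b')" using f0 by simp
        then show False using that(2) by (metis dvd_triv_left)
      qed
      have "m div degree f = m' div degree f"
        using le[OF *(5) nd[OF *(2)]] le[OF *(5)[symmetric] nd[OF *(4)]] by simp
      then have "m = m'" using *(1,3) by (metis dvd_div_mult_self)
      then show "m = m' \<and> a = a'" using *(5) f0 by simp
    qed
    show "(\<lambda>(m, a). f ^ (m div degree f) * a) ` (SIGMA m:{m. m \<le> d \<and> degree f dvd m}. smooth S (d - m)) = smooth (insert f S) d"
    proof (intro equalityI subsetI)
      fix x assume "x \<in> (\<lambda>(m, a). f ^ (m div degree f) * a) ` (SIGMA m:{m. m \<le> d \<and> degree f dvd m}. smooth S (d - m))"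
      then obtain m a where ma: "m \<le> d" "degree f dvd m" "a \<in> smooth S (d - m)" "x = f ^ (m div degree f) * a" by auto
      have la: "lead_coeff a = 1" "degree a = d - m" using ma by (auto simp: smooth_def monics_def)
      then have "a \<noteq> 0" by auto
      then have "degree x = d" using ma f0 la by (simp add: degree_mult_eq degree_power_eq)
      moreover have "lead_coeff x = 1" using ma(4) lf la by (simp only: lead_coeff_mult lead_coeff_power) simp
      moreover have "g \<in> insert f S" if "monic_irreducible g" "g dvd x" for g
        using pr[OF that(1), of "m div degree f" a] that ma by (auto simp: smooth_def)
      ultimately show "x \<in> smooth (insert f S) d" by (auto simp: smooth_def monics_def)
    next
      fix x assume x: "x \<in> smooth (insert f S) d"
      then have lx: "lead_coeff x = 1" "degree x = d" by (auto simp: smooth_def monics_def)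
      obtain i a where ia: "x = f ^ i * a" "\<not> f dvd a" "lead_coeff a = 1" using prime_power_factor[OF f lx(1)] by blast
      then have "a \<noteq> 0" by auto
      then have dx: "d = i * degree f + degree a" using ia(1) lx f0 by (simp add: degree_mult_eq degree_power_eq mult.commute)
      have "a \<in> smooth S (d - i * degree f)"
        using x ia dx by (auto simp: smooth_def monics_def)
      then show "x \<in> (\<lambda>(m, a). f ^ (m div degree f) * a) ` (SIGMA m:{m. m \<le> d \<and> degree f dvd m}. smooth S (d - m))"
        using dx df ia(1) by (intro image_eqI[of _ _ "(i * degree f, a)"]) auto
    qed
  qed
qed

text \<open>Unique factorisation, splitting off the power of one prime at a time. The product stays
  finite: if S contains all primes of degree at most d, the sum already runs over all monic
  polynomials of degree d.\<close>

lemma prod_euler_factor: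
  fixes \<nu> :: "'q::finite_field poly \<Rightarrow> 'k::comm_ring_1"
  assumes mult: "\<And>a b. lead_coeff a = 1 \<Longrightarrow> lead_coeff b = 1 \<Longrightarrow> coprime a b \<Longrightarrow> \<nu> (a * b) = \<nu> a * \<nu> b"
    and one: "\<nu> 1 = 1"
    and S: "finite S" "\<And>f. f \<in> S \<Longrightarrow> monic_irreducible f"
  shows "fps_nth (\<Prod>f\<in>S. euler_factor \<nu> f) d = (\<Sum>a\<in>smooth S d. \<nu> a)"
  using S
proof (induction S arbitrary: d rule: finite_induct)
  case empty
  have "smooth {} d = (if d = 0 then {1} else {} :: 'q poly set)"
  proof -
    have "smooth {} d = {}" if "d > 0"
      using monic_factor_exists that by (fastforce simp: smooth_def monics_def)
    moreover have "smooth {} 0 = {1 :: 'q poly}"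
    proof -
      have "a = 1" if "coeff a 0 = 1" "degree a = 0" for a :: "'q poly"
        using that by (metis degree_0_id one_pCons)
      then show ?thesis by (auto simp: smooth_def monics_def dest!: monic_irreducible_degree_pos)
    qed
    ultimately show ?thesis by auto
  qed
  then show ?case using one by simp
next
  case (insert f S)
  have f: "monic_irreducible f" using insert.prems by simp
  have fin: "finite (smooth S e)" for e by (rule finite_subset[OF _ finite_monics[of e]]) (auto simp: smooth_def)
  have "fps_nth (\<Prod>f\<in>insert f S. euler_factor \<nu> f) d
      = (\<Sum>m = 0..d. (if degree f dvd m then \<nu> (f ^ (m div degree f)) else 0) * (\<Sum>a\<in>smooth S (d - m). \<nu> a))"
    using insert by (simp add: fps_mult_nth euler_factor_def)
  also have "\<dots> = (\<Sum>m\<in>{m. m \<le> d \<and> degree f dvd m}. \<Sum>a\<in>smooth S (d - m). \<nu> (f ^ (m div degree f)) * \<nu> a)"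
    by (rule sum.mono_neutral_cong_right) (auto simp: sum_distrib_left)
  also have "\<dots> = (\<Sum>(m, a)\<in>(SIGMA m:{m. m \<le> d \<and> degree f dvd m}. smooth S (d - m)). \<nu> (f ^ (m div degree f)) * \<nu> a)"
    by (rule sum.Sigma) (use fin in auto)
  also have "\<dots> = (\<Sum>(m, a)\<in>(SIGMA m:{m. m \<le> d \<and> degree f dvd m}. smooth S (d - m)). \<nu> (f ^ (m div degree f) * a))"
  proof (intro sum.cong refl, clarify)
    fix m a assume a: "a \<in> smooth S (d - m)"
    then have "\<not> f dvd a" "lead_coeff a = 1" using f insert.hyps by (auto simp: smooth_def monics_def)
    moreover have "lead_coeff (f ^ (m div degree f)) = 1" using f by (simp add: lead_coeff_power monic_irreducible_def)
    ultimately show "\<nu> (f ^ (m div degree f)) * \<nu> a = \<nu> (f ^ (m div degree f) * a)"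
      using coprime_power_irreducible[OF f] mult by metis
  qed
  also have "\<dots> = (\<Sum>a\<in>smooth (insert f S) d. \<nu> a)"
    using sum.reindex_bij_betw[OF smooth_insert_bij[OF f insert.hyps(2), of d], of \<nu>]
    by (simp add: case_prod_beta')
  finally show ?case .
qed

lemma smooth_irreds: "d \<le> N \<Longrightarrow> smooth (irreds N) d = monics d"
proof -
  assume d: "d \<le> N"
  have "degree f \<le> N" if "f dvd a" "a \<in> monics d" for f a :: "'q::finite_field poly"
    using dvd_imp_degree_le[OF that(1)] that(2) d by (cases "a = 0") (auto simp: monics_def)
  then show ?thesis by (auto simp: smooth_def irreds_def)
qed

lemma degree_coeff_mult_le:
  fixes P R :: "'a::comm_ring_1 poly poly"
  assumes "\<And>i. degree (coeff P i) \<le> a" "\<And>i. degree (coeff R i) \<le> b"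
  shows "degree (coeff (P * R) i) \<le> a + b"
  unfolding coeff_mult
  by (intro degree_sum_le) (auto intro: le_trans[OF degree_mult_le] add_mono assms)

text \<open>The entries of \<open>qmat\<close> have degree at most 1 in the inner variable. The
  bound controls the coefficients of D_f and thereby the degree of \<mu>.\<close>

lemma degree_coeff_qpoly:
  fixes f :: "'q::finite_field poly"
  shows "degree (coeff (qpoly \<phi> f) i) \<le> degree f"
proof -
  define M where "M = qmat \<phi> f"
  have M: "M \<in> carrier_mat (degree f) (degree f)" by (simp add: M_def qmat_def)
  have ent: "degree (coeff (M $$ (a, b)) i) \<le> 1" if "a < degree f" "b < degree f" for a b i
  proof -
    have "degree (coeff (\<Sum>k\<le>degree \<phi>. if (b + k) mod degree f = a
        then monom [:poly (lift_ac (coeff \<phi> k)) (orb f b):] ((b + k) div degree f) else 0) i) \<le> 1"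
      unfolding coeff_sum by (rule degree_sum_le) (auto simp: coeff_monom)
    moreover have "degree (coeff (if a = b then [:[:0, 1:]:] else 0 :: 'q alg_closure poly poly) i) \<le> 1"
      by (cases i) auto
    ultimately have "degree (coeff (if a = b then [:[:0, 1:]:] else 0 :: 'q alg_closure poly poly) i
      - coeff (\<Sum>k\<le>degree \<phi>. if (b + k) mod degree f = a
        then monom [:poly (lift_ac (coeff \<phi> k)) (orb f b):] ((b + k) div degree f) else 0) i) \<le> 1"
      by (intro degree_diff_le)
    moreover have "M $$ (a, b) = (if a = b then [:[:0, 1:]:] else 0) - (\<Sum>k\<le>degree \<phi>. if (b + k) mod degree f = a
        then monom [:poly (lift_ac (coeff \<phi> k)) (orb f b):] ((b + k) div degree f) else 0)"
      using that by (simp only: M_def qmat_def index_mat prod.case)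
    ultimately show ?thesis by (simp only: coeff_diff)
  qed
  have "degree (coeff (\<Prod>a\<in>S. M $$ (a, p a)) i) \<le> card S" if "finite S" "S \<subseteq> {0..<degree f}" "p permutes {0..<degree f}" for S p i
    using that
  proof (induction S arbitrary: i rule: finite_induct)
    case empty
    show ?case by (cases i) (auto simp: coeff_1)
  next
    case (insert x S)
    have "p x < degree f" using insert.prems by (auto dest: permutes_in_image)
    then have "degree (coeff (M $$ (x, p x) * (\<Prod>a\<in>S. M $$ (a, p a))) i) \<le> 1 + card S"
      using insert by (intro degree_coeff_mult_le ent) auto
    then show ?case using insert.hyps by simp
  qed
  from this[of "{0..<degree f}"] have
    "degree (coeff (\<Prod>a = 0..<degree f. M $$ (a, p a)) i) \<le> degree f" if "p permutes {0..<degree f}" for p i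
    using that by simp
  then have "degree (coeff (signof p * (\<Prod>a = 0..<degree f. M $$ (a, p a))) i) \<le> degree f" if "p permutes {0..<degree f}" for p
    using that by (cases "sign p = 1") (simp_all add: sign_def split: if_splits)
  then show ?thesis
    unfolding qpoly_def M_def[symmetric] det_def'[OF M] coeff_sum by (intro degree_sum_le) (auto simp: finite_permutations)
qed

text \<open>
  The hypothesis \<open>E\<close> compares the Euler factor, defined through the Tate modules, with \<^const>\<open>qpoly\<close>:
  it says \<open>f D\<^sub>f(Y) = q(f Y)\<close>.
\<close>

locale dual_L =
  fixes \<phi> :: "'q::finite_field poly poly" and \<mu> :: "'q poly \<Rightarrow> 'q poly"
  assumes \<phi>0: "coeff \<phi> 0 = [:0, 1:]" and \<mu>: "is_dual_mu \<phi> \<mu>"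
    and E: "\<And>f i. monic_irreducible f \<Longrightarrow>
      lift_ac (f * coeff (euler_D \<phi> f) i) = coeff (qpoly \<phi> f) i * lift_ac f ^ i"
begin

lemma \<mu>_euler: "monic_irreducible f \<Longrightarrow>
  (\<Sum>i\<le>n. \<mu> (f ^ i) * coeff (euler_D \<phi> f) (n - i)) = (if n = 0 then 1 else 0)"
proof -
  assume "monic_irreducible f"
  then have "Abs_fps (\<lambda>i. \<mu> (f ^ i)) * fps_of_poly (euler_D \<phi> f) = 1" using \<mu> by (simp add: is_dual_mu_def)
  then have "fps_nth (Abs_fps (\<lambda>i. \<mu> (f ^ i)) * fps_of_poly (euler_D \<phi> f)) n = fps_nth 1 n" by simp
  then show ?thesis by (simp add: fps_mult_nth atMost_atLeast0)
qed

definition gpoly :: "nat \<Rightarrow> (nat \<Rightarrow> 'q alg_closure) \<Rightarrow> 'q alg_closure poly" where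
  "gpoly m z = (\<Prod>k<m. [:z k, -1:])"

text \<open>The summand with all variables specialised in the algebraic closure of F_q:
  \<open>t\<close> stands for \<theta> inside the values of \<mu>, apart from the variables
  \<open>z k\<close> of the factors a(z_k).\<close>

definition \<nu> :: "'q alg_closure \<Rightarrow> nat \<Rightarrow> (nat \<Rightarrow> 'q alg_closure) \<Rightarrow> 'q poly \<Rightarrow> 'q alg_closure" where
  "\<nu> t m z a = poly (lift_ac (\<mu> a)) t * (\<Prod>k<m. poly (lift_ac a) (z k))"

text \<open>Put F = f(t), let Y be the product of the f(z_k) and d the degree of f. By
  \<open>local_det_fam\<close>, F times the local determinant is \<open>qpoly\<close> at F Y x^d,
  which \<open>E\<close> turns into F D_f(Y x^d). As t is not a root of f, the factor F
  cancels.\<close>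

lemma euler_factor_mult_local_det:
  assumes f: "monic_irreducible f" and t: "\<And>j. t \<noteq> orb f j" and z: "\<And>k j. k < m \<Longrightarrow> z k \<noteq> orb f j"
  shows "euler_factor (\<nu> t m z) f * det (local_mat f (fam \<phi> t (gpoly m z))) = 1"
proof -
  interpret frobenius_orbit "CARD('q)" "degree f" "orb f" "lift_ac f" by (rule frobenius_orbit_orb[OF f])
  define F where "F = poly (lift_ac f) t"
  define e where "e i = poly (lift_ac (coeff (euler_D \<phi> f) i)) t" for i
  define Y where "Y = (\<Prod>k<m. poly (lift_ac f) (z k))"
  define Q where "Q = qpoly \<phi> f"
  have F: "F \<noteq> 0" unfolding F_def by (subst f_eq) (use t in \<open>simp add: poly_prod\<close>)
  have g: "poly (gpoly m z) (orb f j) \<noteq> 0" for j using z by (force simp: gpoly_def poly_prod)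
  have "(\<Prod>j<degree f. poly (gpoly m z) (orb f j)) = (\<Prod>j<degree f. \<Prod>k<m. z k - orb f j)"
    by (simp add: gpoly_def poly_prod)
  also have "\<dots> = (\<Prod>k<m. \<Prod>j<degree f. z k - orb f j)" by (rule prod.swap)
  also have "\<dots> = Y" unfolding Y_def by (subst f_eq) (simp add: poly_prod)
  finally have gY: "(\<Prod>j<degree f. poly (gpoly m z) (orb f j)) = Y" .
  have Fe: "F * e i = poly (coeff Q i) t * F ^ i" for i
    using arg_cong[OF E[OF f, of i], of "\<lambda>p. poly p t"] by (simp add: F_def e_def Q_def hom_distribs)
  have e0: "e i = 0" if "i > degree Q" for i using Fe[of i] F that by (simp add: coeff_eq_0)
  let ?X = "fps_X ^ degree f :: 'q alg_closure fps"
  have dX: "fps_nth ?X 0 = 0" using d0 by simp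
  define A where "A = Abs_fps (\<lambda>i. poly (lift_ac (\<mu> (f ^ i))) t * Y ^ i)"
  define B where "B = Abs_fps (\<lambda>i. e i * Y ^ i)"
  have "fps_const F * det (local_mat f (fam \<phi> t (gpoly m z)))
      = (\<Sum>i\<le>degree Q. fps_const (poly (coeff Q i) t) * (fps_const (F * Y) * ?X) ^ i)"
    using local_det_fam[OF f \<phi>0 t g] by (simp only: gY F_def Q_def)
  also have "\<dots> = (\<Sum>i\<le>degree Q. fps_const F * (fps_const (e i * Y ^ i) * ?X ^ i))"
  proof (intro sum.cong refl)
    fix i
    have "poly (coeff Q i) t * (F * Y) ^ i = F * (e i * Y ^ i)" using Fe[of i] by (simp add: power_mult_distrib mult_ac)
    then show "fps_const (poly (coeff Q i) t) * (fps_const (F * Y) * ?X) ^ i = fps_const F * (fps_const (e i * Y ^ i) * ?X ^ i)"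
      by (simp add: power_mult_distrib mult.assoc[symmetric])
  qed
  finally have D: "det (local_mat f (fam \<phi> t (gpoly m z))) = (\<Sum>i\<le>degree Q. fps_const (e i * Y ^ i) * ?X ^ i)"
    using F by (simp flip: sum_distrib_left)
  also have "\<dots> = B oo ?X"
  proof (rule fps_ext)
    fix n
    have "fps_nth (\<Sum>i\<le>degree Q. fps_const (e i * Y ^ i) * ?X ^ i) n
        = (\<Sum>i\<le>degree Q. if n = degree f * i then e i * Y ^ i else 0)"
      unfolding fps_sum_nth by (intro sum.cong) (auto simp: fps_X_power_nth simp flip: power_mult)
    also have "\<dots> = (if degree f dvd n then e (n div degree f) * Y ^ (n div degree f) else 0)"
    proof (cases "degree f dvd n")
      case True
      then have *: "n = degree f * i \<longleftrightarrow> i = n div degree f" for i using d0 by auto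
      show ?thesis using True e0[of "n div degree f"] by (simp add: *)
    next
      case False
      then show ?thesis by (subst sum.neutral) auto
    qed
    finally show "fps_nth (\<Sum>i\<le>degree Q. fps_const (e i * Y ^ i) * ?X ^ i) n = fps_nth (B oo ?X) n"
      using d0 by (simp add: fps_nth_compose_X_power B_def)
  qed
  finally have D: "det (local_mat f (fam \<phi> t (gpoly m z))) = B oo ?X" .
  have "euler_factor (\<nu> t m z) f = A oo ?X"
    using d0 by (intro fps_ext) (simp add: fps_nth_compose_X_power euler_factor_def A_def \<nu>_def Y_def hom_distribs prod_power_distrib)
  then have "euler_factor (\<nu> t m z) f * det (local_mat f (fam \<phi> t (gpoly m z))) = (A * B) oo ?X"
    using D fps_compose_mult_distrib[OF dX, of A B] by simp
  also have "A * B = 1"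
  proof (rule fps_ext)
    fix n
    have "fps_nth (A * B) n = (\<Sum>i\<le>n. Y ^ n * (poly (lift_ac (\<mu> (f ^ i))) t * e (n - i)))"
      unfolding fps_mult_nth A_def B_def atMost_atLeast0
      by (intro sum.cong refl) (simp add: mult_ac flip: power_add)
    also have "\<dots> = Y ^ n * poly (lift_ac (\<Sum>i\<le>n. \<mu> (f ^ i) * coeff (euler_D \<phi> f) (n - i))) t"
      by (simp add: sum_distrib_left e_def hom_distribs poly_sum)
    finally show "fps_nth (A * B) n = fps_nth 1 n" unfolding \<mu>_euler[OF f] by simp
  qed
  finally show ?thesis by simp
qed

text \<open>Euler factors and local determinants are inverse to each other, so modulo x^(d+1) the
  generating function equals the global determinant. The latter is a polynomial in x of degree at
  most \<open>degree \<phi>\<close> times the matrix size \<Delta> + m + 1.\<close>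

lemma sum_\<nu>_eq_0:
  assumes \<Delta>: "\<And>k. degree (coeff \<phi> k) \<le> \<Delta>" and d: "d > degree \<phi> * (\<Delta> + m + 1)"
    and t: "\<And>f j. f \<in> irreds d \<Longrightarrow> t \<noteq> orb f j" and z: "\<And>f k j. f \<in> irreds d \<Longrightarrow> k < m \<Longrightarrow> z k \<noteq> orb f j"
  shows "(\<Sum>a\<in>monics d. \<nu> t m z a) = 0"
proof -
  let ?c = "fam \<phi> t (gpoly m z)"
  let ?n = "\<Delta> + m + 1"
  let ?P = "\<Prod>f\<in>irreds d. det (local_mat f ?c)" and ?Z = "\<Prod>f\<in>irreds d. euler_factor (\<nu> t m z) f"
  let ?W = "det (op_mat CARD('q) ?c ?n)"
  have "degree (gpoly m z) \<le> m"
    using degree_prod_sum_le[of "{..<m}" "\<lambda>k. [:z k, -1:]"] by (simp add: gpoly_def o_def)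
  then have bd: "skew_bdd CARD('q) ?n ?c" by (rule skew_bdd_fam[OF \<Delta>])
  have "fps_X ^ Suc d dvd ?Z * (?P * ?W - 1)"
    by (intro dvd_mult trace_formula[OF bd] fam_0)
  moreover have "?Z * ?P = 1"
    unfolding prod.distrib[symmetric]
    by (intro prod.neutral ballI euler_factor_mult_local_det) (use t z in \<open>auto simp: irreds_def\<close>)
  then have "?Z * (?P * ?W - 1) = ?W - ?Z" by (simp add: right_diff_distrib mult.assoc[symmetric])
  ultimately have "fps_nth ?W d = fps_nth ?Z d" by (simp add: fps_X_power_dvd del: power_Suc)
  moreover have "fps_nth ?W d = 0"
    by (rule fps_nth_det_op_mat_eq_0[OF _ _ d]) (simp_all add: fam_gt)
  moreover have "fps_nth ?Z d = (\<Sum>a\<in>smooth (irreds d) d. \<nu> t m z a)"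
  proof (rule prod_euler_factor)
    fix a b :: "'q poly" assume "lead_coeff a = 1" "lead_coeff b = 1" "coprime a b"
    then have "\<mu> (a * b) = \<mu> a * \<mu> b" using \<mu> by (simp add: is_dual_mu_def)
    then show "\<nu> t m z (a * b) = \<nu> t m z a * \<nu> t m z b" by (simp add: \<nu>_def hom_distribs prod.distrib)
  next
    show "\<nu> t m z 1 = 1" using \<mu> by (simp add: \<nu>_def is_dual_mu_def)
  qed (use finite_irreds in \<open>auto simp: irreds_def\<close>)
  ultimately show ?thesis by (simp add: smooth_irreds)
qed

lemma degree_coeff_euler_D:
  assumes f: "monic_irreducible f"
  shows "degree (coeff (euler_D \<phi> f) i) \<le> degree f * i"
proof (cases "coeff (euler_D \<phi> f) i = 0")
  case False
  have f0: "f \<noteq> 0" using f by (auto simp: monic_irreducible_def)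
  have "degree (lift_ac (f * coeff (euler_D \<phi> f) i)) \<le> degree (coeff (qpoly \<phi> f) i) + degree (lift_ac f ^ i)"
    unfolding E[OF f] by (rule degree_mult_le)
  also have "\<dots> \<le> degree f + degree f * i"
    using degree_coeff_qpoly[of \<phi> f i] f0 by (simp add: degree_power_eq)
  finally show ?thesis using False f0 by (simp add: degree_mult_eq)
qed simp

lemma coeff_euler_D_0: "monic_irreducible f \<Longrightarrow> coeff (euler_D \<phi> f) 0 = 1"
  using \<mu>_euler[of f 0] \<mu> by (simp add: is_dual_mu_def)

lemma degree_\<mu>_power:
  assumes f: "monic_irreducible f"
  shows "degree (\<mu> (f ^ n)) \<le> degree f * n"
proof (induction n rule: less_induct)
  case (less n)
  show ?case
  proof (cases "n = 0")
    case True
    then show ?thesis using \<mu> by (simp add: is_dual_mu_def)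
  next
    case False
    have "(\<Sum>i\<le>n. \<mu> (f ^ i) * coeff (euler_D \<phi> f) (n - i))
        = \<mu> (f ^ n) + (\<Sum>i<n. \<mu> (f ^ i) * coeff (euler_D \<phi> f) (n - i))"
      by (simp add: lessThan_Suc_atMost[symmetric] coeff_euler_D_0[OF f])
    then have "\<mu> (f ^ n) = - (\<Sum>i<n. \<mu> (f ^ i) * coeff (euler_D \<phi> f) (n - i))"
      using \<mu>_euler[OF f, of n] False by (simp add: eq_neg_iff_add_eq_0)
    moreover have "degree (\<Sum>i<n. \<mu> (f ^ i) * coeff (euler_D \<phi> f) (n - i)) \<le> degree f * n"
    proof (rule degree_sum_le)
      fix i assume i: "i \<in> {..<n}"
      have "degree (\<mu> (f ^ i) * coeff (euler_D \<phi> f) (n - i)) \<le> degree f * i + degree f * (n - i)"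
        using degree_mult_le less[of i] degree_coeff_euler_D[OF f, of "n - i"] i by (meson add_mono le_trans lessThan_iff)
      then show "degree (\<mu> (f ^ i) * coeff (euler_D \<phi> f) (n - i)) \<le> degree f * n"
        using i by (simp flip: distrib_left)
    qed simp
    ultimately show ?thesis by simp
  qed
qed

text \<open>Prime powers are settled by the recursion against D_f, the general case by
  multiplicativity. At the infinite place this bounds \<mu>(a) by q^(deg a).\<close>

lemma degree_\<mu>: "lead_coeff a = 1 \<Longrightarrow> degree (\<mu> a) \<le> degree a"
proof (induction "degree a" arbitrary: a rule: less_induct)
  case less
  show ?case
  proof (cases "degree a = 0")
    case True
    then have "a = 1" using less.prems by (metis degree_0_id one_pCons)
    then show ?thesis using \<mu> by (simp add: is_dual_mu_def)
  next
    case False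
    then obtain f where f: "monic_irreducible f" "f dvd a" using monic_factor_exists less.prems by blast
    obtain i a' where ia: "a = f ^ i * a'" "\<not> f dvd a'" "lead_coeff a' = 1" using prime_power_factor[OF f(1) less.prems] by blast
    have i: "i \<noteq> 0" using f(2) ia(1,2) by (intro notI) auto
    have f0: "f \<noteq> 0" "a' \<noteq> 0" using f ia by (auto simp: monic_irreducible_def)
    have da: "degree a = degree f * i + degree a'" using ia(1) f0 by (simp add: degree_mult_eq degree_power_eq mult.commute)
    then have "degree a' < degree a" using i monic_irreducible_degree_pos[OF f(1)] by simp
    then have "degree (\<mu> a') \<le> degree a'" using less.hyps ia by blast
    moreover have "\<mu> a = \<mu> (f ^ i) * \<mu> a'"
      using \<mu> coprime_power_irreducible[OF f(1) ia(2)] ia f(1)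
      by (simp add: is_dual_mu_def lead_coeff_power monic_irreducible_def)
    ultimately show ?thesis
      using degree_mult_le[of "\<mu> (f ^ i)" "\<mu> a'"] degree_\<mu>_power[OF f(1), of i] da by simp
  qed
qed

text \<open>The vanishing is known for t and z_k off the finite set \<open>Z\<close>. Its complement
  is infinite, so the sum vanishes as a polynomial in each variable, and coefficients can be
  extracted one variable at a time.\<close>

theorem sum_\<mu>_coeff_eq_0:
  assumes \<Delta>: "\<And>k. degree (coeff \<phi> k) \<le> \<Delta>" and d: "d > degree \<phi> * (\<Delta> + m + 1)"
  shows "(\<Sum>a\<in>monics d. smult (\<Prod>k<m. coeff a (j k)) (\<mu> a)) = 0"
proof -
  define Z where "Z = (\<Union>f\<in>irreds d :: 'q poly set. {x. poly (lift_ac f) x = 0})"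
  have Z: "finite Z"
    unfolding Z_def using finite_irreds by (intro finite_UN_I poly_roots_finite) (auto simp: irreds_def monic_irreducible_def)
  have inf: "infinite (- Z)"
    using Z infinite_alg_closed finite_Diff2[of Z UNIV] by (simp add: Compl_eq_Diff_UNIV)
  have poly0: "p = 0" if "\<And>x. x \<notin> Z \<Longrightarrow> poly p x = 0" for p :: "'q alg_closure poly"
  proof (rule ccontr)
    assume "p \<noteq> 0"
    then have "finite {x. poly p x = 0}" by (rule poly_roots_finite)
    moreover have "- Z \<subseteq> {x. poly p x = 0}" using that by auto
    ultimately show False using inf finite_subset by blast
  qed
  have gen: "orb f i \<in> Z" if "f \<in> irreds d" for f i using that orb_root[of f i] by (auto simp: Z_def irreds_def)
  \<comment> \<open>After s steps the first s evaluations have been replaced by coefficients of a;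
    the variable t is treated last.\<close>
  have P: "(\<Sum>a\<in>monics d. poly (lift_ac (\<mu> a)) t * (\<Prod>k<s. to_ac (coeff a (j k))) * (\<Prod>k\<in>{s..<m}. poly (lift_ac a) (z k))) = 0"
    if "s \<le> m" "t \<notin> Z" "\<And>k. k < m \<Longrightarrow> z k \<notin> Z" for s t z
    using that
  proof (induction s arbitrary: z)
    case 0
    have "(\<Sum>a\<in>monics d. \<nu> t m z a) = 0"
      using 0 gen by (intro sum_\<nu>_eq_0[OF \<Delta> d]) metis+
    then show ?case by (simp add: \<nu>_def lessThan_atLeast0)
  next
    case (Suc s)
    define c where "c a = poly (lift_ac (\<mu> a)) t * (\<Prod>k<s. to_ac (coeff a (j k))) * (\<Prod>k\<in>{Suc s..<m}. poly (lift_ac a) (z k))" for a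
    have "(\<Sum>a\<in>monics d. smult (c a) (lift_ac a)) = 0"
    proof (rule poly0)
      fix x assume x: "x \<notin> Z"
      have "(\<Sum>a\<in>monics d. poly (lift_ac (\<mu> a)) t * (\<Prod>k<s. to_ac (coeff a (j k))) * (\<Prod>k\<in>{s..<m}. poly (lift_ac a) ((z(s := x)) k))) = 0"
        by (rule Suc.IH) (use Suc.prems x in auto)
      moreover have "(\<Prod>k\<in>{s..<m}. poly (lift_ac a) ((z(s := x)) k)) = poly (lift_ac a) x * (\<Prod>k\<in>{Suc s..<m}. poly (lift_ac a) (z k))" for a
        using Suc.prems(1) by (subst prod.atLeast_Suc_lessThan) auto
      ultimately show "poly (\<Sum>a\<in>monics d. smult (c a) (lift_ac a)) x = 0"
        by (simp add: poly_sum c_def mult_ac)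
    qed
    then have "coeff (\<Sum>a\<in>monics d. smult (c a) (lift_ac a)) (j s) = 0" by simp
    then show ?case by (simp add: coeff_sum c_def mult_ac)
  qed
  obtain z0 where z0: "z0 \<notin> Z" using inf by (metis Compl_iff finite.emptyI ex_in_conv)
  have "(\<Sum>a\<in>monics d. smult (\<Prod>k<m. to_ac (coeff a (j k))) (lift_ac (\<mu> a))) = 0"
  proof (rule poly0)
    fix t assume "t \<notin> Z"
    from P[OF le_refl this, of "\<lambda>_. z0"] z0
    show "poly (\<Sum>a\<in>monics d. smult (\<Prod>k<m. to_ac (coeff a (j k))) (lift_ac (\<mu> a))) t = 0"
      by (simp add: poly_sum mult.commute)
  qed
  then have "lift_ac (\<Sum>a\<in>monics d. smult (\<Prod>k<m. coeff a (j k)) (\<mu> a)) = 0"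
    by (simp add: hom_distribs)
  then show ?thesis by simp
qed

end

section \<open>Characteristic polynomials of Frobenius\<close>

text \<open>The coordinates of \<open>\<tau>\<^sup>m\<close> in the basis \<open>1, \<dots>, \<tau>\<^bsup>k-1\<^esup>\<close> over the polynomials in \<open>t = \<Sum>\<^sub>i b\<^sub>i \<tau>\<^sup>i\<close>.\<close>

function tcoord :: "(nat \<Rightarrow> nat \<Rightarrow> 'a::field) \<Rightarrow> nat \<Rightarrow> nat \<Rightarrow> nat \<Rightarrow> 'a poly" where
  "tcoord b k m l = (if m < k \<or> k = 0 then (if m = l then 1 else 0)
     else smult (inverse (b k (m - k))) ([:0, 1:] * tcoord b k (m - k) l
       - (\<Sum>i<k. smult (b i (m - k)) (tcoord b k (m - k + i) l))))"
  by auto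
termination by (relation "Wellfounded.measure (\<lambda>(b, k, m, l). m)") auto

declare tcoord.simps [simp del]

lemma tcoord_less: "m < k \<Longrightarrow> tcoord b k m l = (if m = l then 1 else 0)"
  by (simp add: tcoord.simps)

lemma tcoord_rel:
  assumes "k > 0" "b k m \<noteq> 0"
  shows "[:0, 1:] * tcoord b k m l = (\<Sum>i\<le>k. smult (b i m) (tcoord b k (m + i) l))"
proof -
  have "smult (b k m) (tcoord b k (m + k) l) = [:0, 1:] * tcoord b k m l - (\<Sum>i<k. smult (b i m) (tcoord b k (m + i) l))"
    using assms by (subst tcoord.simps) simp
  then show ?thesis by (simp add: lessThan_Suc_atMost[symmetric])
qed

definition tau_mat :: "(nat \<Rightarrow> nat \<Rightarrow> 'a::field) \<Rightarrow> nat \<Rightarrow> nat \<Rightarrow> 'a poly mat" where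
  "tau_mat b k d = mat k k (\<lambda>(i,j). tcoord b k (d + i) j)"

text \<open>
  Both sides come from the square matrix of the \<open>d + k\<close> relations \<open>t \<tau>\<^sup>r = \<Sum>\<^sub>i b\<^sub>i \<tau>\<^bsup>r+i\<^esup>\<close> (\<open>r < d\<close>) and
  \<open>\<tau>\<^bsup>d+r\<^esup> = Y \<tau>\<^sup>r\<close> (\<open>r < k\<close>) between \<open>1, \<dots>, \<tau>\<^bsup>d+k-1\<^esup>\<close>: eliminating the last \<open>k\<close> elements through the second
  kind leaves the matrix of \<open>t\<close>, eliminating the last \<open>d\<close> through the first kind leaves that of \<open>Y\<close>.
\<close>

lemma det_t_eq_char_poly:
  fixes b :: "nat \<Rightarrow> nat \<Rightarrow> 'a::field"
  assumes d: "d > 0" and k: "k > 0" and kD: "k \<le> D"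
    and bz: "\<And>s j. s > k \<Longrightarrow> b s j = 0" and bk: "\<And>j. b k j \<noteq> 0"
  defines "qm \<equiv> mat d d (\<lambda>(i,j). (if i = j then [:[:0, 1:]:] else 0) -
     (\<Sum>s\<le>D. if (j + s) mod d = i then monom [:b s j:] ((j + s) div d) else 0))"
  shows "\<exists>c. c \<noteq> 0 \<and> det qm = smult [:c:] (char_poly (tau_mat b k d))"
proof -
  let ?t = "[:[:0, 1:]:] :: 'a poly poly" and ?Y = "[:0, 1:] :: 'a poly poly"
  define S where "S r c = (if r < d then (if c = r then ?t else 0) - (\<Sum>i\<le>k. if c = r + i then [:[:b i r:]:] else 0)
     else (if c = r - d then ?Y else 0) - (if c = r then 1 else 0))" for r c
  define Sm where "Sm = mat (d + k) (d + k) (\<lambda>(r,c). S r c)"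
  have Sc: "Sm \<in> carrier_mat (d + k) (d + k)" by (simp add: Sm_def)
  have S_sum_low: "(\<Sum>c<d + k. S r c * g c) = ?t * g r - (\<Sum>i\<le>k. [:[:b i r:]:] * g (r + i))" if r: "r < d" for r and g :: "nat \<Rightarrow> 'a poly poly"
  proof -
    have "(\<Sum>c<d + k. S r c * g c) = (\<Sum>c<d + k. if c = r then ?t * g c else 0)
        - (\<Sum>c<d + k. \<Sum>i\<le>k. if c = r + i then [:[:b i r:]:] * g c else 0)"
      unfolding sum_subtractf[symmetric]
    proof (intro sum.cong refl)
      fix c
      have "(\<Sum>i\<le>k. if c = r + i then [:[:b i r:]:] else 0) * g c = (\<Sum>i\<le>k. if c = r + i then [:[:b i r:]:] * g c else 0)"
        unfolding sum_distrib_right by (intro sum.cong) auto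
      then show "S r c * g c = (if c = r then ?t * g c else 0) - (\<Sum>i\<le>k. if c = r + i then [:[:b i r:]:] * g c else 0)"
        using r by (simp add: S_def left_diff_distrib)
    qed
    also have "(\<Sum>c<d + k. \<Sum>i\<le>k. if c = r + i then [:[:b i r:]:] * g c else 0)
        = (\<Sum>i\<le>k. \<Sum>c<d + k. if c = r + i then [:[:b i r:]:] * g c else 0)" by (rule sum.swap)
    also have "\<dots> = (\<Sum>i\<le>k. [:[:b i r:]:] * g (r + i))" using r by (intro sum.cong) auto
    finally show ?thesis using r by simp
  qed
  have S_sum_high: "(\<Sum>c<d + k. S (d + r) c * g c) = ?Y * g r - g (d + r)" if r: "r < k" for r and g :: "nat \<Rightarrow> 'a poly poly"
  proof -
    have "(\<Sum>c<d + k. S (d + r) c * g c) = (\<Sum>c<d + k. if c = r then ?Y * g c else 0) - (\<Sum>c<d + k. if c = d + r then g c else 0)"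
      unfolding sum_subtractf[symmetric] using d by (intro sum.cong refl) (simp add: S_def)
    then show ?thesis using r by simp
  qed
  have mult_entry: "(Sm * C) $$ (r, j) = (\<Sum>c<d + k. S r c * C $$ (c, j))"
    if "C \<in> carrier_mat (d + k) (d + k)" "r < d + k" "j < d + k" for C r j
    using that by (simp add: Sm_def scalar_prod_def lessThan_atLeast0)

  \<comment> \<open>\<open>C1\<close> substitutes \<tau>^c = Y^(c div d) \<tau>^(c mod d). This
    annihilates the relations of the second kind and turns those of the first kind into the
    transposed matrix of t.\<close>
  define E where "E c j = (if c mod d = j then monom (1 :: 'a poly) (c div d) else 0)" for c j
  define C1 where "C1 = four_block_mat (1\<^sub>m d) (0\<^sub>m d k) (mat k d (\<lambda>(i,j). E (d + i) j)) (1\<^sub>m k)"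
  have C1c: "C1 \<in> carrier_mat (d + k) (d + k)" by (auto simp: C1_def)
  have dC1: "det C1 = 1" unfolding C1_def by (subst det_four_block_mat_upper_right_zero[of _ d]) auto
  define S22 where "S22 = mat k k (\<lambda>(i,j). S (d + i) (d + j))"
  have "Sm * C1 = four_block_mat (transpose_mat qm) (mat d k (\<lambda>(i,j). S i (d + j))) (0\<^sub>m k d) S22" (is "_ = ?R")
  proof (rule eq_matI)
    fix r j assume "r < dim_row ?R" "j < dim_col ?R"
    then have rj: "r < d + k" "j < d + k" by (auto simp: qm_def S22_def)
    show "(Sm * C1) $$ (r, j) = ?R $$ (r, j)"
    proof (cases "j < d")
      case True
      have C1e: "C1 $$ (c, j) = E c j" if "c < d + k" for c
        using that True rj d by (auto simp: C1_def E_def mod_if)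
      have *: "(Sm * C1) $$ (r, j) = (\<Sum>c<d + k. S r c * E c j)"
        unfolding mult_entry[OF C1c rj] using C1e by (intro sum.cong) auto
      show ?thesis
      proof (cases "r < d")
        case r: True
        have "(\<Sum>i\<le>k. [:[:b i r:]:] * E (r + i) j) = (\<Sum>s\<le>D. if (r + s) mod d = j then monom [:b s r:] ((r + s) div d) else 0)"
          using kD bz by (intro sum.mono_neutral_cong_left) (auto simp: E_def smult_monom)
        then show ?thesis using * r True d unfolding S_sum_low[OF r] by (simp add: qm_def E_def)
      next
        case False
        then have r': "r - d < k" "r = d + (r - d)" using rj by auto
        have "?Y * E (r - d) j - E (d + (r - d)) j = 0"
          using d by (simp add: E_def monom_Suc)
        then show ?thesis using * S_sum_high[OF r'(1), of "\<lambda>c. E c j"] r' False True by (simp add: qm_def S22_def)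
      qed
    next
      case False
      then have "C1 $$ (c, j) = (if c = j then 1 else 0)" if "c < d + k" for c
        using that rj by (auto simp: C1_def)
      then have "(Sm * C1) $$ (r, j) = (\<Sum>c<d + k. if c = j then S r c else 0)"
        unfolding mult_entry[OF C1c rj] by (intro sum.cong) auto
      then show ?thesis using rj False by (simp add: qm_def S22_def)
    qed
  qed (auto simp: Sm_def C1_def qm_def S22_def)
  then have "det Sm = det ?R" using det_mult[OF Sc C1c] dC1 by simp
  also have "\<dots> = det (transpose_mat qm) * det S22"
    by (rule det_four_block_mat_lower_left_zero[of _ d _ k]) (auto simp: qm_def S22_def)
  also have "det (transpose_mat qm) = det qm" by (rule det_transpose[of _ d]) (simp add: qm_def)
  also have "det S22 = prod_list (diag_mat S22)"
    by (rule det_lower_triangular[of k]) (use d in \<open>auto simp: S22_def S_def\<close>)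
  also have "diag_mat S22 = map (\<lambda>_. - 1) [0..<k]" using d by (auto simp: diag_mat_def S22_def S_def)
  also have "prod_list (map (\<lambda>_. - 1 :: 'a poly poly) [0..<k]) = (- 1) ^ k" by (simp add: map_replicate_const prod_list_replicate)
  finally have e1: "det Sm = det qm * (- 1) ^ k" .

  \<comment> \<open>\<open>C2\<close> substitutes the coordinates \<open>tcoord\<close> for the
    elements from index k on, and moves the first k columns to the end. \<open>C3\<close> is its
    inverse, so both determinants are nonzero constants.\<close>
  define C2 where "C2 = four_block_mat (0\<^sub>m k d) (1\<^sub>m k) (1\<^sub>m d) (mat d k (\<lambda>(i,j). [:tcoord b k (k + i) j:]))"
  define C3 where "C3 = four_block_mat (- mat d k (\<lambda>(i,j). [:tcoord b k (k + i) j:])) (1\<^sub>m d) (1\<^sub>m k) (0\<^sub>m k d)"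
  have C2c: "C2 \<in> carrier_mat (d + k) (d + k)" by (auto simp: C2_def)
  have C3c: "C3 \<in> carrier_mat (d + k) (d + k)" by (auto simp: C3_def)
  have "C2 * C3 = four_block_mat (1\<^sub>m k) (0\<^sub>m k d) (0\<^sub>m d k) (1\<^sub>m d)"
    unfolding C2_def C3_def
    by (subst mult_four_block_mat[of _ k d _ k _ d _ _ k _ d]) (auto intro!: cong_four_block_mat eq_matI)
  then have "C2 * C3 = 1\<^sub>m (d + k)" by (simp add: add.commute)
  then have u: "det C2 * det C3 = 1" using det_mult[OF C2c C3c] by simp
  define S12 where "S12 = mat d d (\<lambda>(i,j). S i (k + j))"
  have "Sm * C2 = four_block_mat S12 (0\<^sub>m d k) (mat k d (\<lambda>(i,j). S (d + i) (k + j))) (char_poly_matrix (tau_mat b k d))" (is "_ = ?R")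
  proof (rule eq_matI)
    fix r j assume "r < dim_row ?R" "j < dim_col ?R"
    then have rj: "r < d + k" "j < d + k" by (auto simp: S12_def tau_mat_def char_poly_matrix_def)
    show "(Sm * C2) $$ (r, j) = ?R $$ (r, j)"
    proof (cases "j < d")
      case True
      then have "C2 $$ (c, j) = (if c = k + j then 1 else 0)" if "c < d + k" for c
        using that rj by (auto simp: C2_def)
      then have "(Sm * C2) $$ (r, j) = (\<Sum>c<d + k. if c = k + j then S r c else 0)"
        unfolding mult_entry[OF C2c rj] by (intro sum.cong) auto
      then show ?thesis using rj True by (auto simp: tau_mat_def S12_def char_poly_matrix_def)
    next
      case False
      then have j': "j - d < k" using rj by auto
      have C2e: "C2 $$ (c, j) = [:tcoord b k c (j - d):]" if "c < d + k" for c
        using that False rj k by (auto simp: C2_def tcoord_less one_pCons)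
      have *: "(Sm * C2) $$ (r, j) = (\<Sum>c<d + k. S r c * [:tcoord b k c (j - d):])"
        unfolding mult_entry[OF C2c rj] using C2e by (intro sum.cong) auto
      show ?thesis
      proof (cases "r < d")
        case r: True
        have "(\<Sum>i\<le>k. [:[:b i r:]:] * [:tcoord b k (r + i) (j - d):]) = [:\<Sum>i\<le>k. smult (b i r) (tcoord b k (r + i) (j - d)):]"
          by (simp add: sum_to_poly)
        then show ?thesis using * r False rj tcoord_rel[where b = b and k = k and m = r and l = "j - d", OF k bk] unfolding S_sum_low[OF r] by (simp add: S12_def tau_mat_def char_poly_matrix_def)
      next
        case r: False
        then have r': "r - d < k" "r = d + (r - d)" using rj by auto
        show ?thesis using * S_sum_high[OF r'(1), of "\<lambda>c. [:tcoord b k c (j - d):]"] r' r False j'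
          by (auto simp: S12_def tau_mat_def char_poly_matrix_def tcoord_less)
      qed
    qed
  qed (auto simp: Sm_def C2_def S12_def tau_mat_def char_poly_matrix_def)
  then have "det Sm * det C2 = det ?R" using det_mult[OF Sc C2c] by simp
  also have "\<dots> = det S12 * det (char_poly_matrix (tau_mat b k d))"
    by (rule det_four_block_mat_upper_right_zero[of _ d _ k]) (auto simp: S12_def tau_mat_def)
  also have "det S12 = prod_list (diag_mat S12)"
    by (rule det_lower_triangular[of d]) (use k in \<open>auto simp: S12_def S_def intro!: sum.neutral\<close>)
  also have "diag_mat S12 = map (\<lambda>r. - [:[:b k r:]:]) [0..<d]" using k by (auto simp: diag_mat_def S12_def S_def)
  also have "prod_list (map (\<lambda>r. - [:[:b k r:]:]) [0..<d]) = [:[:\<Prod>r<d. - b k r:]:]"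
    by (induction d) (simp_all add: lessThan_Suc one_pCons mult.commute)
  finally have e2: "det Sm * det C2 = [:[:\<Prod>r<d. - b k r:]:] * char_poly (tau_mat b k d)" by (simp add: char_poly_def)
  have "det C3 dvd 1" using u by (metis dvd_triv_right)
  then obtain c1 where c1: "det C3 = [:c1:]" "c1 dvd 1" unfolding is_unit_poly_iff by blast
  then obtain c' where "c1 = [:c':]" "c' dvd 1" unfolding is_unit_poly_iff by blast
  with c1 have c': "det C3 = [:[:c':]:]" "c' \<noteq> 0" by auto
  have "det qm = (det Sm * det C2) * det C3 * (- 1) ^ k"
  proof -
    have "(- 1) ^ k * (- 1) ^ k = (1 :: 'a poly poly)" by (simp flip: power_mult_distrib)
    then show ?thesis using u unfolding e1 by (simp add: mult_ac)
  qed
  also have "\<dots> = [:[:\<Prod>r<d. - b k r:]:] * [:[:c':]:] * (- 1) ^ k * char_poly (tau_mat b k d)"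
    unfolding e2 c' by (simp only: mult_ac)
  also have "(- 1) ^ k = [:[:(- 1) ^ k :: 'a:]:]"
    by (induction k) (simp_all add: one_pCons)
  finally have "det qm = smult [:(\<Prod>r<d. - b k r) * c' * (- 1) ^ k:] (char_poly (tau_mat b k d))"
    by simp
  moreover have "(\<Prod>r<d. - b k r) * c' * (- 1) ^ k \<noteq> 0" using bk c' by simp
  ultimately show ?thesis by blast
qed

section \<open>Torsion points and Tate modules of the reduction\<close>

locale reduction =
  fixes \<phi> :: "'q::finite_field poly poly" and f :: "'q poly"
  assumes \<phi>0: "coeff \<phi> 0 = [:0, 1:]" and f: "monic_irreducible f" and rk: "reduced_rank \<phi> f > 0"
begin

abbreviation "k \<equiv> reduced_rank \<phi> f"
abbreviation "d \<equiv> degree f"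
abbreviation "T \<equiv> reduced_theta \<phi> f"
abbreviation "act \<equiv> reduced_action \<phi> f"

definition a where "a i = residue f (coeff \<phi> i)"

lemma q1: "CARD('q) > 1" by (rule card_finite_field_gt_1)

lemma a_eq_0_iff: "a i = 0 \<longleftrightarrow> f dvd coeff \<phi> i"
  unfolding a_def residue_def by (rule monic_irreducible_dvd_iff_root[OF f residue_root[OF f]])

lemma a_k: "a k \<noteq> 0" and k_le: "k \<le> degree \<phi>" and a_gt: "i > k \<Longrightarrow> a i = 0"
proof -
  let ?S = "{i \<in> {1..degree \<phi>}. \<not> f dvd coeff \<phi> i}"
  have k: "k = Max (insert 0 ?S)" by (simp add: reduced_rank_def)
  have "Max (insert 0 ?S) \<in> insert 0 ?S" by (rule Max_in) auto
  then have "k \<in> ?S" using k rk by (metis (no_types, lifting) insert_iff less_numeral_extra(3))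
  then show "a k \<noteq> 0" "k \<le> degree \<phi>" by (auto simp: a_eq_0_iff)
  show "a i = 0" if "i > k"
  proof (rule ccontr)
    assume "a i \<noteq> 0"
    then have "\<not> f dvd coeff \<phi> i" by (simp add: a_eq_0_iff)
    moreover from this have "i \<le> degree \<phi>" by (metis coeff_eq_0 dvd_0_right not_less)
    ultimately have "i \<le> Max (insert 0 ?S)" using that by (intro Max_ge) auto
    then show False using that k by linarith
  qed
qed

lemma a_0: "a 0 = residue_root f" by (simp add: a_def residue_def \<phi>0 hom_distribs)

lemma a_period: "a i ^ (CARD('q) ^ d) = a i"
  unfolding a_def residue_def by (metis monic_irreducible_orbit(1)[OF f residue_root[OF f]] poly_lift_ac_pow_card)

lemma T_eq: "T x = (\<Sum>i\<le>k. a i * x ^ (CARD('q) ^ i))"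
  unfolding reduced_theta_def a_def[symmetric]
  by (rule sum.mono_neutral_right) (use k_le a_gt in auto)

lemma T_add: "T (x + y) = T x + T y"
  by (simp add: T_eq pow_card_add distrib_left sum.distrib)

lemma T_0 [simp]: "T 0 = 0" by (simp add: T_eq power_0_left)

lemma T_scale: "T (to_ac c * x) = to_ac c * T x"
  by (simp add: T_eq power_mult_distrib sum_distrib_left mult_ac)

lemma T_frob: "T (x ^ (CARD('q) ^ d)) = T x ^ (CARD('q) ^ d)"
  by (simp add: T_eq pow_card_sum power_mult_distrib a_period mult.commute flip: power_mult)

lemma Tn_add: "(T ^^ j) (x + y) = (T ^^ j) x + (T ^^ j) y"
  by (induction j) (simp_all add: T_add)

lemma Tn_scale: "(T ^^ j) (to_ac c * x) = to_ac c * (T ^^ j) x"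
  by (induction j) (simp_all add: T_scale)

lemma Tn_0 [simp]: "(T ^^ j) 0 = 0" by (induction j) simp_all

lemma Tn_frob: "(T ^^ j) (x ^ (CARD('q) ^ d)) = ((T ^^ j) x) ^ (CARD('q) ^ d)"
  by (induction j) (simp_all add: T_frob)

lemma act_expand: "n \<ge> degree p \<Longrightarrow> act p x = (\<Sum>j\<le>n. to_ac (coeff p j) * (T ^^ j) x)"
  unfolding reduced_action_def by (rule sum.mono_neutral_left) (auto simp: coeff_eq_0)

lemma act_0 [simp]: "act 0 x = 0" by (simp add: reduced_action_def)

lemma act_pCons: "act (pCons c p) x = to_ac c * x + act p (T x)"
proof -
  have "act (pCons c p) x = (\<Sum>j\<le>Suc (degree p). to_ac (coeff (pCons c p) j) * (T ^^ j) x)"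
    by (rule act_expand) (simp add: degree_pCons_le)
  also have "\<dots> = to_ac c * x + (\<Sum>j\<le>degree p. to_ac (coeff p j) * (T ^^ Suc j) x)"
    by (subst sum.atMost_Suc_shift) simp
  also have "(\<Sum>j\<le>degree p. to_ac (coeff p j) * (T ^^ Suc j) x) = act p (T x)"
    by (simp add: reduced_action_def funpow_swap1)
  finally show ?thesis .
qed

lemma act_add_right: "act p (x + y) = act p x + act p y"
  by (simp add: reduced_action_def Tn_add distrib_left sum.distrib)

lemma act_zero_right [simp]: "act p 0 = 0" by (simp add: reduced_action_def)

lemma act_diff_right: "act p (x - y) = act p x - act p y"
  using act_add_right[of p "x - y" y] by simp

lemma act_sum_right: "act p (\<Sum>i\<in>I. g i) = (\<Sum>i\<in>I. act p (g i))"
  by (induction I rule: infinite_finite_induct) (simp_all add: act_add_right)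

lemma act_T: "act p (T x) = T (act p x)"
  by (induction p arbitrary: x) (simp_all add: act_pCons T_add T_scale)

lemma act_add: "act (p + r) x = act p x + act r x"
proof (induction p arbitrary: r x)
  case (pCons c p)
  obtain e r' where "r = pCons e r'" by (cases r)
  then show ?case using pCons.IH[of r' "T x"] by (simp add: act_pCons algebra_simps)
qed simp

lemma act_smult: "act (smult c p) x = to_ac c * act p x"
  by (induction p arbitrary: x) (simp_all add: act_pCons algebra_simps)

lemma act_diff: "act (p - r) x = act p x - act r x"
  using act_add[of "p - r" r x] by simp

lemma act_mult: "act (p * r) x = act p (act r x)"
  by (induction p arbitrary: x) (simp_all add: act_add act_smult act_pCons act_T)

lemma act_comm: "act p (act r x) = act r (act p x)"
  unfolding act_mult[symmetric] by (simp only: mult.commute)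

lemma act_1 [simp]: "act 1 x = x" by (simp add: one_pCons act_pCons)

lemma act_frob: "act p (x ^ (CARD('q) ^ d)) = act p x ^ (CARD('q) ^ d)"
  by (simp add: reduced_action_def Tn_frob pow_card_sum power_mult_distrib)

lemma act_dvd: "h dvd p \<Longrightarrow> act h x = 0 \<Longrightarrow> act p x = 0"
  by (metis act_mult act_zero_right dvdE mult.commute)

lemma act_mod: "act h x = 0 \<Longrightarrow> act (p mod h) x = act p x"
  using act_add[of "p div h * h" "p mod h" x] by (simp add: act_mult)

definition thp where "thp = (\<Sum>i\<le>k. monom (a i) (CARD('q) ^ i))"

definition tpow where "tpow j = ((\<lambda>p. pcompose thp p) ^^ j) [:0, 1:]"

lemma poly_tpow: "poly (tpow j) x = (T ^^ j) x"
  by (induction j) (simp_all add: tpow_def poly_pcompose thp_def poly_sum poly_monom T_eq)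

lemma degree_thp: "degree thp = CARD('q) ^ k"
proof -
  have "thp = monom (a k) (CARD('q) ^ k) + (\<Sum>i<k. monom (a i) (CARD('q) ^ i))"
    by (simp add: thp_def lessThan_Suc_atMost[symmetric] add.commute)
  moreover have "degree (\<Sum>i<k. monom (a i) (CARD('q) ^ i)) < CARD('q) ^ k"
  proof (cases k)
    case (Suc k')
    have "degree (\<Sum>i<k. monom (a i) (CARD('q) ^ i)) \<le> CARD('q) ^ k'"
      by (rule degree_sum_le) (use Suc q1 in \<open>auto intro!: le_trans[OF degree_monom_le] power_increasing\<close>)
    moreover have "CARD('q) ^ k' < CARD('q) ^ k" using Suc q1 by (intro power_strict_increasing) auto
    ultimately show ?thesis by linarith
  qed (use rk in simp)
  ultimately show ?thesis using a_k by (simp add: degree_add_eq_left degree_monom_eq)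
qed

lemma degree_tpow: "degree (tpow j) = CARD('q) ^ (k * j)"
  by (induction j) (simp_all add: tpow_def degree_pcompose degree_thp power_add)

text \<open>Terms with a positive power of \<tau> have exponent divisible by q and derivative zero;
  only the coefficient of \<tau>^0, the residue of \<theta>, survives.\<close>

lemma pderiv_tpow: "pderiv (tpow j) = [:residue_root f ^ j:]"
proof (induction j)
  case 0
  show ?case by (simp add: tpow_def pderiv_pCons one_pCons)
next
  case (Suc j)
  have "pderiv thp = (\<Sum>i\<le>k. if i = 0 then [:a 0:] else 0)"
    unfolding thp_def pderiv_sum pderiv_monom
    by (intro sum.cong refl) (auto simp: of_nat_card_alg_closure monom_0)
  then have "pderiv thp = [:residue_root f:]" by (simp add: a_0)
  then show ?case using Suc
    by (simp add: tpow_def pderiv_pcompose pcompose_const mult.commute)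
qed

text \<open>The additive polynomial of the operator \<Sum> p_j \<tau>^i \<phi>_\<theta>^j, with p_j
  in the algebraic closure. For p nonzero its degree q^(k deg p + i) tells different i apart, which
  later yields a nonvanishing determinant.\<close>

definition prp :: "'q alg_closure poly \<Rightarrow> nat \<Rightarrow> 'q alg_closure poly" where
  "prp p i = (\<Sum>j\<le>degree p. smult (coeff p j) (tpow j ^ (CARD('q) ^ i)))"

lemma degree_prp:
  assumes "p \<noteq> 0"
  shows "degree (prp p i) = CARD('q) ^ (k * degree p + i)"
proof -
  have t: "tpow j \<noteq> 0" for j
  proof
    assume "tpow j = 0"
    then have "degree (tpow j) = 0" by simp
    then show False by (simp add: degree_tpow)
  qed
  have dt: "degree (tpow j ^ (CARD('q) ^ i)) = CARD('q) ^ (k * j + i)" for j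
    by (simp add: degree_power_eq[OF t] degree_tpow power_add mult.commute)
  have eq: "prp p i = smult (lead_coeff p) (tpow (degree p) ^ (CARD('q) ^ i)) + (\<Sum>j<degree p. smult (coeff p j) (tpow j ^ (CARD('q) ^ i)))"
    by (simp add: prp_def lessThan_Suc_atMost[symmetric] add.commute)
  have lt: "degree (\<Sum>j<n. smult (coeff p j) (tpow j ^ (CARD('q) ^ i))) < CARD('q) ^ (k * n + i)" for n
  proof (cases n)
    case (Suc m)
    have "degree (\<Sum>j<n. smult (coeff p j) (tpow j ^ (CARD('q) ^ i))) \<le> CARD('q) ^ (k * m + i)"
    proof (rule degree_sum_le)
      fix j assume "j \<in> {..<n}"
      then have "CARD('q) ^ (k * j + i) \<le> CARD('q) ^ (k * m + i)" using Suc q1 by (intro power_increasing) auto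
      then show "degree (smult (coeff p j) (tpow j ^ (CARD('q) ^ i))) \<le> CARD('q) ^ (k * m + i)"
        using degree_smult_le[of "coeff p j" "tpow j ^ (CARD('q) ^ i)"] dt[of j] by linarith
    qed simp
    moreover have "CARD('q) ^ (k * m + i) < CARD('q) ^ (k * n + i)" using Suc q1 rk by (intro power_strict_increasing) auto
    ultimately show ?thesis by linarith
  qed simp
  show ?thesis unfolding eq using lt[of "degree p"] assms by (subst degree_add_eq_left) (simp_all add: dt)
qed

definition actp where "actp p = prp (lift_ac p) 0"

lemma actp_eq: "actp p = (\<Sum>j\<le>degree p. smult (to_ac (coeff p j)) (tpow j))"
  by (simp add: actp_def prp_def)

lemma poly_actp: "poly (actp p) x = act p x"
  by (simp add: actp_eq poly_sum poly_tpow reduced_action_def)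

lemma degree_actp:
  assumes "p \<noteq> 0"
  shows "degree (actp p) = CARD('q) ^ (k * degree p)"
  using degree_prp[of "lift_ac p" 0] assms by (simp add: actp_def)

lemma pderiv_actp: "pderiv (actp p) = [:poly (lift_ac p) (residue_root f):]"
  by (simp add: actp_eq pderiv_sum pderiv_smult pderiv_tpow sum_to_poly poly_altdef)

definition tors where "tors p = {x. act p x = 0}"

text \<open>The polynomial \<open>actp p\<close> has constant derivative, the residue of p modulo f,
  which is nonzero here. So its roots are simple, and there are as many of them as its
  degree.\<close>

lemma card_tors:
  assumes "\<not> f dvd p"
  shows "card (tors p) = CARD('q) ^ (k * degree p)" "finite (tors p)"
proof -
  have p: "p \<noteq> 0" using assms by auto
  have nz: "poly (lift_ac p) (residue_root f) \<noteq> 0"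
    using assms monic_irreducible_dvd_iff_root[OF f residue_root[OF f]] by simp
  have "degree (actp p) > 0" using q1 by (simp add: degree_actp[OF p])
  then have nz': "actp p \<noteq> 0" by auto
  have "card {x. poly (actp p) x = 0} = degree (actp p)"
    by (rule separable_factorization(2)[OF nz']) (simp add: pderiv_actp nz)
  then show "card (tors p) = CARD('q) ^ (k * degree p)" by (simp add: tors_def poly_actp degree_actp[OF p])
  show "finite (tors p)" using poly_roots_finite[OF nz'] by (simp add: tors_def poly_actp)
qed

lemma act_surj:
  assumes "p \<noteq> 0"
  shows "\<exists>y. act p y = x"
proof -
  have "degree (actp p) > 0" using q1 by (simp add: degree_actp[OF assms])
  then have "degree (actp p + [:-x:]) > 0" by (subst degree_add_eq_left) auto
  then obtain y where "poly (actp p + [:-x:]) y = 0" using alg_closed_imp_poly_has_root by blast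
  then show ?thesis by (auto simp: poly_actp)
qed

end

lemma card_degree_less: "card {p :: 'q::finite_field poly. \<forall>i\<ge>n. coeff p i = 0} = CARD('q) ^ n
  \<and> finite {p :: 'q poly. \<forall>i\<ge>n. coeff p i = 0}"
proof (induction n)
  case 0
  have "{p :: 'q poly. \<forall>i\<ge>0. coeff p i = 0} = {0}" by (auto simp: poly_eq_iff)
  then show ?case by simp
next
  case (Suc n)
  have "bij_betw (\<lambda>(c, p). pCons c p) (UNIV \<times> {p :: 'q poly. \<forall>i\<ge>n. coeff p i = 0}) {p. \<forall>i\<ge>Suc n. coeff p i = 0}"
    unfolding bij_betw_def
  proof
    show "(\<lambda>(c, p). pCons c p) ` (UNIV \<times> {p :: 'q poly. \<forall>i\<ge>n. coeff p i = 0}) = {p. \<forall>i\<ge>Suc n. coeff p i = 0}"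
    proof (intro equalityI subsetI)
      fix p :: "'q poly" assume p: "p \<in> {p. \<forall>i\<ge>Suc n. coeff p i = 0}"
      obtain c r where cr: "p = pCons c r" by (cases p)
      have "coeff r i = 0" if "i \<ge> n" for i using p that coeff_pCons_Suc[of c r i] by (auto simp: cr)
      then show "p \<in> (\<lambda>(c, p). pCons c p) ` (UNIV \<times> {p. \<forall>i\<ge>n. coeff p i = 0})" by (auto simp: cr)
    qed (auto simp: coeff_pCons split: nat.splits)
  qed (auto simp: inj_on_def)
  then show ?case using Suc bij_betw_same_card bij_betw_finite by (fastforce simp: card_cartesian_product)
qed

lemma poly_mod_eq_iff: "p mod h = r mod h \<longleftrightarrow> h dvd p - (r :: 'a::field poly)"
proof
  assume eq: "p mod h = r mod h"
  have "p - r = (p div h * h + p mod h) - (r div h * h + r mod h)" by (simp only: div_mult_mod_eq)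
  also have "\<dots> = (p div h - r div h) * h" unfolding eq by (simp only: left_diff_distrib add_diff_cancel_right)
  finally show "h dvd p - r" by simp
next
  assume "h dvd p - r"
  then obtain s where "p - r = h * s" by (elim dvdE)
  then have "p = r + s * h" by (simp add: algebra_simps)
  then show "p mod h = r mod h" by simp
qed

lemma degree_less_iff:
  fixes h :: "'a::field poly"
  assumes h: "h \<noteq> 0" "degree h > 0"
  shows "\<forall>i\<ge>degree h. coeff (p mod h) i = 0"
proof (intro allI impI)
  fix i assume i: "i \<ge> degree h"
  show "coeff (p mod h) i = 0"
    using degree_mod_less[OF h(1), of p] i by (auto intro: coeff_eq_0)
qed

locale reduction_at = reduction \<phi> f for \<phi> :: "'q::finite_field poly poly" and f :: "'q poly" +
  fixes h :: "'q poly"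
  assumes h: "monic_irreducible h" and hf: "h \<noteq> f"

begin

lemma act_uminus: "act (- p) x = - act p x"
  using act_add[of p "- p" x] by (simp add: eq_neg_iff_add_eq_0 add.commute)

lemma h_nz: "h \<noteq> 0" using h by (auto simp: monic_irreducible_def)

lemma dh: "degree h > 0" by (rule monic_irreducible_degree_pos[OF h])

lemma f_ndvd: "\<not> f dvd h" using monic_irreducible_dvd_eq[OF f h] hf by auto

lemma h_prime: "h dvd p * r \<Longrightarrow> h dvd p \<or> h dvd r"
proof -
  obtain \<xi> where \<xi>: "poly (lift_ac h) \<xi> = 0" using monic_irreducible_root_exists[OF h] by blast
  assume "h dvd p * r"
  then have "poly (lift_ac p) \<xi> = 0 \<or> poly (lift_ac r) \<xi> = 0"
    using root_of_multiple[OF _ \<xi>, of "p * r"] by (simp add: hom_distribs)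
  then show ?thesis using monic_irreducible_dvd_iff_root[OF h \<xi>] by blast
qed

text \<open>Multiplication by \<alpha> is injective on the finite set of residues modulo h, hence
  reaches 1.\<close>

lemma inverse_mod_h:
  assumes "\<not> h dvd \<alpha>"
  shows "\<exists>\<beta> \<gamma>. \<beta> * \<alpha> = 1 + \<gamma> * h"
proof -
  let ?R = "{p :: 'q poly. \<forall>i\<ge>degree h. coeff p i = 0}"
  have R: "p mod h \<in> ?R" for p using degree_less_iff[OF h_nz dh] by blast
  have Rmod: "p mod h = p" if "p \<in> ?R" for p
  proof (rule mod_poly_less)
    show "degree p < degree h"
    proof (rule ccontr)
      assume "\<not> degree p < degree h"
      then have "lead_coeff p = 0" using that by simp
      then show False using \<open>\<not> degree p < degree h\<close> dh by simp
    qed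
  qed
  have "inj_on (\<lambda>\<beta>. (\<beta> * \<alpha>) mod h) ?R"
  proof (rule inj_onI)
    fix \<beta> \<beta>' assume *: "\<beta> \<in> ?R" "\<beta>' \<in> ?R" "(\<beta> * \<alpha>) mod h = (\<beta>' * \<alpha>) mod h"
    then have "h dvd (\<beta> - \<beta>') * \<alpha>" by (simp add: poly_mod_eq_iff left_diff_distrib)
    then have "h dvd \<beta> - \<beta>'" using h_prime assms by blast
    then have "\<beta> mod h = \<beta>' mod h" by (simp add: poly_mod_eq_iff)
    then show "\<beta> = \<beta>'" using Rmod[OF *(1)] Rmod[OF *(2)] by simp
  qed
  then have "(\<lambda>\<beta>. (\<beta> * \<alpha>) mod h) ` ?R = ?R"
    using card_degree_less[of "degree h", where 'q = 'q] R by (intro endo_inj_surj) auto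
  moreover have "1 \<in> ?R" using dh by (auto simp: coeff_1)
  ultimately have "1 \<in> (\<lambda>\<beta>. (\<beta> * \<alpha>) mod h) ` ?R" by simp
  then obtain \<beta> where "(\<beta> * \<alpha>) mod h = 1" by auto
  then have "\<beta> * \<alpha> = 1 + (\<beta> * \<alpha>) div h * h" using div_mult_mod_eq[of "\<beta> * \<alpha>" h] by (simp add: add.commute)
  then show ?thesis by blast
qed

text \<open>Linear independence over the field A/h inside the h-torsion, expressed with coefficients
  in A.\<close>

definition indep :: "nat \<Rightarrow> (nat \<Rightarrow> 'q alg_closure) \<Rightarrow> bool" where
  "indep m v \<longleftrightarrow> (\<forall>i<m. v i \<in> tors h) \<and>
     (\<forall>\<alpha>. (\<Sum>i<m. act (\<alpha> i) (v i)) = 0 \<longrightarrow> (\<forall>i<m. h dvd \<alpha> i))"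

lemma comb_mod: "(\<And>i. i < m \<Longrightarrow> v i \<in> tors h) \<Longrightarrow> (\<Sum>i<m. act (\<alpha> i mod h) (v i)) = (\<Sum>i<m. act (\<alpha> i) (v i))"
  by (intro sum.cong refl act_mod) (simp add: tors_def)

lemma tors_comb: "(\<And>i. i < m \<Longrightarrow> v i \<in> tors p) \<Longrightarrow> (\<Sum>i<m. act (\<alpha> i) (v i)) \<in> tors p"
  by (auto simp: tors_def act_sum_right act_comm[of p] intro!: sum.neutral)

definition combs :: "nat \<Rightarrow> (nat \<Rightarrow> 'q alg_closure) \<Rightarrow> 'q alg_closure set" where
  "combs m v = (\<lambda>\<alpha>. \<Sum>i<m. act (\<alpha> i) (v i)) ` ({..<m} \<rightarrow>\<^sub>E {p. \<forall>i\<ge>degree h. coeff p i = 0})"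

lemma in_combs:
  assumes "\<And>i. i < m \<Longrightarrow> v i \<in> tors h"
  shows "(\<Sum>i<m. act (\<alpha> i) (v i)) \<in> combs m v"
proof -
  have "(\<Sum>i<m. act (\<alpha> i) (v i)) = (\<Sum>i<m. act ((\<lambda>i\<in>{..<m}. \<alpha> i mod h) i) (v i))"
    using comb_mod[where m = m and v = v and \<alpha> = \<alpha>, OF assms] by simp
  then show ?thesis unfolding combs_def
    by (intro image_eqI[of _ _ "\<lambda>i\<in>{..<m}. \<alpha> i mod h"]) (use degree_less_iff[OF h_nz dh] in auto)
qed

lemma card_coeffs:
  fixes m :: nat
  shows "card ({..<m} \<rightarrow>\<^sub>E {p :: 'q poly. \<forall>i\<ge>degree h. coeff p i = 0}) = CARD('q) ^ (m * degree h)"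
  using card_degree_less[of "degree h", where 'q = 'q] by (simp add: card_PiE prod_constant mult.commute flip: power_mult)

lemma finite_coeffs:
  fixes m :: nat
  shows "finite ({..<m} \<rightarrow>\<^sub>E {p :: 'q poly. \<forall>i\<ge>degree h. coeff p i = 0})"
  using card_degree_less[of "degree h", where 'q = 'q] by (intro finite_PiE) simp_all

text \<open>The h-torsion has q^(k deg h) elements, more than fewer than k vectors can span over
  A/h, so a further vector exists. A relation involving it could be solved for it by inverting its
  coefficient modulo h.\<close>

lemma indep_exists: "m \<le> k \<Longrightarrow> \<exists>v. indep m v"
proof (induction m)
  case 0
  then show ?case by (auto simp: indep_def)
next
  case (Suc m)
  then obtain v where v: "indep m v" by auto
  have "card (combs m v) \<le> CARD('q) ^ (m * degree h)"
    unfolding combs_def card_coeffs[symmetric] by (rule card_image_le[OF finite_coeffs])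
  also have "\<dots> < CARD('q) ^ (k * degree h)" using Suc.prems dh q1 by (intro power_strict_increasing) auto
  finally have "card (combs m v) < card (tors h)" by (simp add: card_tors(1)[OF f_ndvd])
  then have "\<not> tors h \<subseteq> combs m v"
    using card_mono[of "combs m v" "tors h"] finite_imageI[OF finite_coeffs] by (auto simp: combs_def)
  then obtain w where w: "w \<in> tors h" "w \<notin> combs m v" by blast
  let ?v = "v(m := w)"
  have vt: "?v i \<in> tors h" if "i < Suc m" for i using v w that by (auto simp: indep_def less_Suc_eq)
  have "\<forall>i<Suc m. h dvd \<alpha> i" if \<alpha>: "(\<Sum>i<Suc m. act (\<alpha> i) (?v i)) = 0" for \<alpha>
  proof -
    have s: "(\<Sum>i<m. act (\<alpha> i) (v i)) + act (\<alpha> m) w = 0" using \<alpha> by simp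
    have "h dvd \<alpha> m"
    proof (rule ccontr)
      assume "\<not> h dvd \<alpha> m"
      then obtain \<beta> \<gamma> where b: "\<beta> * \<alpha> m = 1 + \<gamma> * h" using inverse_mod_h by blast
      have "act \<beta> (act (\<alpha> m) w) = act (1 + \<gamma> * h) w" by (simp only: act_mult[symmetric] b)
      also have "\<dots> = w" using w by (simp add: act_add act_mult tors_def)
      finally have "act \<beta> (act (\<alpha> m) w) = w" .
      moreover have "act (\<alpha> m) w = (\<Sum>i<m. act (- \<alpha> i) (v i))"
        using s by (simp add: act_uminus sum_negf eq_neg_iff_add_eq_0 add.commute)
      ultimately have "w = (\<Sum>i<m. act (\<beta> * - \<alpha> i) (v i))"
        by (simp only: act_sum_right act_mult)
      moreover have "(\<Sum>i<m. act (\<beta> * - \<alpha> i) (v i)) \<in> combs m v"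
        by (rule in_combs) (use v in \<open>auto simp: indep_def\<close>)
      ultimately show False using w by simp
    qed
    moreover from this have "act (\<alpha> m) w = 0" using w by (simp add: act_dvd tors_def)
    then have "\<forall>i<m. h dvd \<alpha> i" using s v by (simp add: indep_def)
    ultimately show ?thesis by (auto simp: less_Suc_eq)
  qed
  then show ?case using vt by (intro exI[of _ ?v]) (simp add: indep_def)
qed

lemma indep_spans:
  assumes v: "indep k v"
  shows "combs k v = tors h"
proof -
  have vt: "\<And>i. i < k \<Longrightarrow> v i \<in> tors h" using v by (auto simp: indep_def)
  have "inj_on (\<lambda>\<alpha>. \<Sum>i<k. act (\<alpha> i) (v i)) ({..<k} \<rightarrow>\<^sub>E {p. \<forall>i\<ge>degree h. coeff p i = 0})"
  proof (rule inj_onI)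
    fix \<alpha> \<beta> assume *: "\<alpha> \<in> {..<k} \<rightarrow>\<^sub>E {p :: 'q poly. \<forall>i\<ge>degree h. coeff p i = 0}"
      "\<beta> \<in> {..<k} \<rightarrow>\<^sub>E {p :: 'q poly. \<forall>i\<ge>degree h. coeff p i = 0}"
      "(\<Sum>i<k. act (\<alpha> i) (v i)) = (\<Sum>i<k. act (\<beta> i) (v i))"
    then have "(\<Sum>i<k. act (\<alpha> i - \<beta> i) (v i)) = 0" by (simp add: act_diff sum_subtractf)
    then have dv: "\<forall>i<k. h dvd \<alpha> i - \<beta> i"
      using v[unfolded indep_def, THEN conjunct2, THEN spec, of "\<lambda>i. \<alpha> i - \<beta> i"] by blast
    show "\<alpha> = \<beta>"
    proof (rule PiE_ext[OF *(1,2)])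
      fix i assume i: "i \<in> {..<k}"
      then have "\<forall>j\<ge>degree h. coeff (\<alpha> i - \<beta> i) j = 0" using *(1,2) by (auto simp: PiE_iff)
      then have "\<alpha> i - \<beta> i = 0 \<or> degree (\<alpha> i - \<beta> i) < degree h" by (metis leading_coeff_0_iff not_less)
      then have "\<alpha> i - \<beta> i = 0" using dv i dvd_imp_degree_le[of h "\<alpha> i - \<beta> i"] by fastforce
      then show "\<alpha> i = \<beta> i" by simp
    qed
  qed
  then have "card (combs k v) = card (tors h)"
    unfolding combs_def by (simp add: card_image card_coeffs card_tors(1)[OF f_ndvd])
  moreover have "combs k v \<subseteq> tors h" using tors_comb[OF vt] by (auto simp: combs_def)
  ultimately show ?thesis using card_tors(2)[OF f_ndvd] by (intro card_subset_eq)
qed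

text \<open>Index 0 belongs to the torsion of h^0 = 1 and carries 0; the given h-torsion point sits
  at index 1, and from there preimages under h are chosen.\<close>

definition lift_seq :: "'q alg_closure \<Rightarrow> nat \<Rightarrow> 'q alg_closure" where
  "lift_seq w = rec_nat 0 (\<lambda>n y. if n = 0 then w else SOME z. act h z = y)"

lemma lift_seq: "lift_seq w 0 = 0" "lift_seq w (Suc 0) = w"
  "w \<in> tors h \<Longrightarrow> act h (lift_seq w (Suc n)) = lift_seq w n"
proof -
  show 0: "lift_seq w 0 = 0" "lift_seq w (Suc 0) = w" by (simp_all add: lift_seq_def)
  show "act h (lift_seq w (Suc n)) = lift_seq w n" if "w \<in> tors h"
  proof (cases n)
    case 0
    then show ?thesis using that \<open>lift_seq w 0 = 0\<close> \<open>lift_seq w (Suc 0) = w\<close> by (simp add: tors_def)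
  next
    case (Suc m)
    have "lift_seq w (Suc (Suc m)) = (SOME z. act h z = lift_seq w (Suc m))" by (simp add: lift_seq_def)
    then show ?thesis using someI_ex[OF act_surj[OF h_nz]] Suc by simp
  qed
qed

lemma tors_seq:
  assumes "x 0 = 0" "\<And>n. act h (x (Suc n)) = x n"
  shows "act (h ^ n) (x (n + m)) = x m"
proof (induction n)
  case (Suc n)
  have "act (h ^ Suc n) (x (Suc n + m)) = act (h ^ n) (act h (x (Suc (n + m))))"
    by (simp only: power_Suc2 act_mult add_Suc)
  then show ?case using Suc assms by simp
qed simp

lemma tate_iff: "x \<in> tate_module \<phi> f h \<longleftrightarrow> x 0 = 0 \<and> (\<forall>n. act h (x (Suc n)) = x n)"
proof
  assume x: "x \<in> tate_module \<phi> f h"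
  then have "act (h ^ 0) (x 0) = 0" unfolding tate_module_def by blast
  then show "x 0 = 0 \<and> (\<forall>n. act h (x (Suc n)) = x n)" using x by (simp add: tate_module_def)
next
  assume "x 0 = 0 \<and> (\<forall>n. act h (x (Suc n)) = x n)"
  then show "x \<in> tate_module \<phi> f h" using tors_seq[of x _ 0] by (simp add: tate_module_def)
qed

lemma adic_mod: "\<alpha> \<in> adic_completion h \<Longrightarrow> \<alpha> n mod h ^ n = \<alpha> n"
proof -
  assume "\<alpha> \<in> adic_completion h"
  then have "\<alpha> n = \<alpha> (Suc n) mod h ^ n" unfolding adic_completion_def by blast
  then show ?thesis by (metis mod_mod_trivial)
qed

lemma act_adic_Suc:
  assumes "\<alpha> \<in> adic_completion h" "act (h ^ n) y = 0"
  shows "act (\<alpha> (Suc n)) y = act (\<alpha> n) y"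
proof -
  have "\<alpha> n = \<alpha> (Suc n) mod h ^ n" using assms(1) unfolding adic_completion_def by blast
  then show ?thesis using act_mod[OF assms(2), of "\<alpha> (Suc n)"] by simp
qed

text \<open>A basis of the h-torsion, lifted along h, is a basis of the h^n-torsion over A/h^n for
  every n. Independence \<open>K\<close> and generation \<open>G\<close> pass from n to n + 1 by
  applying h^n, which leads back to the h-torsion.\<close>

theorem tate_basis_exists: "\<exists>e. is_tate_basis \<phi> f h k e"
proof -
  obtain v where v: "indep k v" using indep_exists by blast
  then have vt: "\<And>i. i < k \<Longrightarrow> v i \<in> tors h" by (auto simp: indep_def)
  define e where "e i = lift_seq (v i)" for i
  have e1: "e i 0 = 0" "e i (Suc 0) = v i" for i by (simp_all add: e_def lift_seq)
  have eS: "act h (e i (Suc n)) = e i n" if "i < k" for i n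
    using lift_seq(3)[OF vt[OF that]] by (simp add: e_def)
  have et: "e i \<in> tate_module \<phi> f h" if "i < k" for i using e1 eS that by (simp add: tate_iff)
  have ehn: "act (h ^ n) (e i n) = 0" if "i < k" for i n using et[OF that] by (simp add: tate_module_def)
  have ehS: "act (h ^ n) (e i (Suc n)) = v i" if "i < k" for i n
    using tors_seq[of "e i" n "Suc 0"] e1 eS that by simp
  have K: "\<forall>i<k. h ^ n dvd \<alpha> i" if "(\<Sum>i<k. act (\<alpha> i) (e i n)) = 0" for n \<alpha>
    using that
  proof (induction n arbitrary: \<alpha>)
    case (Suc n)
    have "act (h ^ n) (\<Sum>i<k. act (\<alpha> i) (e i (Suc n))) = (\<Sum>i<k. act (\<alpha> i) (v i))"
      unfolding act_sum_right by (intro sum.cong refl) (subst act_comm, simp add: ehS)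
    then have "(\<Sum>i<k. act (\<alpha> i) (v i)) = 0" using Suc.prems by simp
    then have "\<forall>i<k. h dvd \<alpha> i" using v by (simp add: indep_def)
    then have \<alpha>: "\<alpha> i = (\<alpha> i div h) * h" if "i < k" for i using that by simp
    have "(\<Sum>i<k. act (\<alpha> i div h) (e i n)) = (\<Sum>i<k. act (\<alpha> i) (e i (Suc n)))"
    proof (intro sum.cong refl)
      fix i assume "i \<in> {..<k}"
      then have "i < k" by simp
      have "act (\<alpha> i) (e i (Suc n)) = act ((\<alpha> i div h) * h) (e i (Suc n))" using \<alpha>[OF \<open>i < k\<close>] by simp
      then show "act (\<alpha> i div h) (e i n) = act (\<alpha> i) (e i (Suc n))" by (simp only: act_mult eS[OF \<open>i < k\<close>])
    qed
    then have "\<forall>i<k. h ^ n dvd \<alpha> i div h" using Suc by simp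
    then have "h ^ n * h dvd (\<alpha> i div h) * h" if "i < k" for i using that by (intro mult_dvd_mono) auto
    then show ?case unfolding power_Suc2 using \<alpha> by metis
  qed simp
  have G: "\<exists>\<alpha>. x = (\<Sum>i<k. act (\<alpha> i) (e i n))" if "act (h ^ n) x = 0" for n x
    using that
  proof (induction n arbitrary: x)
    case (Suc n)
    have "act h (act (h ^ n) x) = 0" using Suc.prems by (simp add: act_mult)
    then have "act (h ^ n) x \<in> combs k v" using indep_spans[OF v] by (simp add: tors_def)
    then obtain \<alpha> where \<alpha>: "act (h ^ n) x = (\<Sum>i<k. act (\<alpha> i) (v i))" by (auto simp: combs_def)
    have "act (h ^ n) (\<Sum>i<k. act (\<alpha> i) (e i (Suc n))) = (\<Sum>i<k. act (\<alpha> i) (v i))"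
      unfolding act_sum_right by (intro sum.cong refl) (subst act_comm, simp add: ehS)
    then have "act (h ^ n) (x - (\<Sum>i<k. act (\<alpha> i) (e i (Suc n)))) = 0" using \<alpha> by (simp add: act_diff_right)
    then obtain \<beta> where \<beta>: "x - (\<Sum>i<k. act (\<alpha> i) (e i (Suc n))) = (\<Sum>i<k. act (\<beta> i) (e i n))" using Suc.IH by blast
    also have "\<dots> = (\<Sum>i<k. act (\<beta> i * h) (e i (Suc n)))" by (intro sum.cong refl) (simp add: act_mult eS)
    finally have "x = (\<Sum>i<k. act (\<alpha> i + \<beta> i * h) (e i (Suc n)))" by (simp add: act_add sum.distrib algebra_simps)
    then show ?case by (intro exI[of _ "\<lambda>i. \<alpha> i + \<beta> i * h"])
  qed (simp add: exI[of _ "\<lambda>_. 0"])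
  have bij: "bij_betw (adic_combination \<phi> f k e) ({..<k} \<rightarrow>\<^sub>E adic_completion h) (tate_module \<phi> f h)"
    unfolding bij_betw_def
  proof
    show "inj_on (adic_combination \<phi> f k e) ({..<k} \<rightarrow>\<^sub>E adic_completion h)"
    proof (rule inj_onI)
      fix \<alpha> \<beta> assume *: "\<alpha> \<in> {..<k} \<rightarrow>\<^sub>E adic_completion h" "\<beta> \<in> {..<k} \<rightarrow>\<^sub>E adic_completion h"
        "adic_combination \<phi> f k e \<alpha> = adic_combination \<phi> f k e \<beta>"
      show "\<alpha> = \<beta>"
      proof (rule PiE_ext[OF *(1,2)], rule ext)
        fix i n assume i: "i \<in> {..<k}"
        have "(\<Sum>i<k. act (\<alpha> i n - \<beta> i n) (e i n)) = 0"
          using fun_cong[OF *(3), of n] by (simp add: adic_combination_def act_diff sum_subtractf)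
        then have "h ^ n dvd \<alpha> i n - \<beta> i n" using K[where \<alpha> = "\<lambda>i. \<alpha> i n - \<beta> i n" and n = n] i by simp
        then have "\<alpha> i n mod h ^ n = \<beta> i n mod h ^ n" by (simp add: poly_mod_eq_iff)
        moreover have "\<alpha> i \<in> adic_completion h" "\<beta> i \<in> adic_completion h" using *(1,2) i by auto
        ultimately show "\<alpha> i n = \<beta> i n" by (simp add: adic_mod)
      qed
    qed
    show "adic_combination \<phi> f k e ` ({..<k} \<rightarrow>\<^sub>E adic_completion h) = tate_module \<phi> f h"
    proof (intro equalityI subsetI)
      fix x assume "x \<in> adic_combination \<phi> f k e ` ({..<k} \<rightarrow>\<^sub>E adic_completion h)"
      then obtain \<alpha> where \<alpha>: "\<alpha> \<in> {..<k} \<rightarrow>\<^sub>E adic_completion h" "x = adic_combination \<phi> f k e \<alpha>" by blast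
      have "act h (x (Suc n)) = x n" for n
      proof -
        have "act h (act (\<alpha> i (Suc n)) (e i (Suc n))) = act (\<alpha> i n) (e i n)" if "i < k" for i
        proof -
          have "act h (act (\<alpha> i (Suc n)) (e i (Suc n))) = act (\<alpha> i (Suc n)) (e i n)"
            using eS[OF that] by (subst act_comm) simp
          also have "\<dots> = act (\<alpha> i n) (e i n)" using \<alpha>(1) ehn[OF that] that by (intro act_adic_Suc) auto
          finally show ?thesis .
        qed
        then show ?thesis by (simp add: \<alpha>(2) adic_combination_def act_sum_right)
      qed
      then show "x \<in> tate_module \<phi> f h" by (simp add: tate_iff \<alpha>(2) adic_combination_def e1)
    next
      fix x assume x: "x \<in> tate_module \<phi> f h"
      then have "\<forall>n. \<exists>\<alpha>. x n = (\<Sum>i<k. act (\<alpha> i) (e i n))" using G by (simp add: tate_module_def)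
      then obtain \<gamma> where \<gamma>: "\<And>n. x n = (\<Sum>i<k. act (\<gamma> n i) (e i n))" by metis
      define \<alpha> where "\<alpha> = (\<lambda>i\<in>{..<k}. \<lambda>n. \<gamma> n i mod h ^ n)"
      have x\<alpha>: "x n = (\<Sum>i<k. act (\<alpha> i n) (e i n))" for n
        unfolding \<gamma> \<alpha>_def by (intro sum.cong refl) (simp add: act_mod ehn)
      have "\<alpha> i n = \<alpha> i (Suc n) mod h ^ n" if i: "i < k" for i n
      proof -
        have "x n = act h (x (Suc n))" using x by (simp add: tate_iff)
        also have "\<dots> = (\<Sum>i<k. act (\<alpha> i (Suc n)) (e i n))"
          unfolding x\<alpha>[of "Suc n"] act_sum_right
          by (intro sum.cong refl) (subst act_comm, simp add: eS)
        finally have "(\<Sum>i<k. act (\<alpha> i (Suc n) - \<alpha> i n) (e i n)) = 0"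
          using x\<alpha>[of n] by (simp add: act_diff sum_subtractf)
        then have "h ^ n dvd \<alpha> i (Suc n) - \<alpha> i n" using K[where \<alpha> = "\<lambda>i. \<alpha> i (Suc n) - \<alpha> i n" and n = n] i by simp
        then have "\<alpha> i (Suc n) mod h ^ n = \<alpha> i n mod h ^ n" by (simp add: poly_mod_eq_iff)
        then show ?thesis using i by (simp add: \<alpha>_def)
      qed
      then have "\<alpha> \<in> {..<k} \<rightarrow>\<^sub>E adic_completion h" by (auto simp: \<alpha>_def adic_completion_def)
      moreover have "x = adic_combination \<phi> f k e \<alpha>" using x\<alpha> by (auto simp: adic_combination_def)
      ultimately show "x \<in> adic_combination \<phi> f k e ` ({..<k} \<rightarrow>\<^sub>E adic_completion h)" by blast
    qed
  qed
  then show ?thesis using et by (auto simp: is_tate_basis_def)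
qed

end

section \<open>Anderson generating functions and the matrix of Frobenius\<close>

lemma mat_mult_entry:
  "A \<in> carrier_mat n n \<Longrightarrow> B \<in> carrier_mat n n \<Longrightarrow> i < n \<Longrightarrow> j < n \<Longrightarrow>
    (A * B) $$ (i,j) = (\<Sum>l<n. A $$ (i,l) * B $$ (l,j))"
  by (simp add: scalar_prod_def lessThan_atLeast0)

context reduction
begin

lemma poly_prp: "poly (prp p i) x = (\<Sum>j\<le>degree p. coeff p j * ((T ^^ j) x) ^ (CARD('q) ^ i))"
  by (simp add: prp_def poly_sum poly_tpow)

definition pr :: "'q alg_closure poly \<Rightarrow> nat \<Rightarrow> 'q alg_closure \<Rightarrow> 'q alg_closure" where
  "pr p i x = poly (prp p i) x"

lemma pr_expand: "n \<ge> degree p \<Longrightarrow> pr p i x = (\<Sum>j\<le>n. coeff p j * ((T ^^ j) x) ^ (CARD('q) ^ i))"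
  unfolding pr_def poly_prp by (rule sum.mono_neutral_left) (auto simp: coeff_eq_0)

lemma pr_0 [simp]: "pr 0 i x = 0" by (simp add: pr_def poly_prp)

lemma pr_pCons: "pr (pCons c p) i x = c * x ^ (CARD('q) ^ i) + pr p i (T x)"
proof -
  have "pr (pCons c p) i x = (\<Sum>j\<le>Suc (degree p). coeff (pCons c p) j * ((T ^^ j) x) ^ (CARD('q) ^ i))"
    by (rule pr_expand) (simp add: degree_pCons_le)
  also have "\<dots> = c * x ^ (CARD('q) ^ i) + (\<Sum>j\<le>degree p. coeff p j * ((T ^^ Suc j) x) ^ (CARD('q) ^ i))"
    by (subst sum.atMost_Suc_shift) simp
  also have "(\<Sum>j\<le>degree p. coeff p j * ((T ^^ Suc j) x) ^ (CARD('q) ^ i)) = pr p i (T x)"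
    by (simp add: pr_def poly_prp funpow_swap1)
  finally show ?thesis .
qed

lemma pr_add: "pr (p + r) i x = pr p i x + pr r i x"
proof (induction p arbitrary: r x)
  case (pCons c p)
  obtain e r' where "r = pCons e r'" by (cases r)
  then show ?case using pCons.IH[of r' "T x"] by (simp add: pr_pCons algebra_simps)
qed simp

lemma pr_smult: "pr (smult c p) i x = c * pr p i x"
  by (induction p arbitrary: x) (simp_all add: pr_pCons algebra_simps)

lemma pr_add_right: "pr p i (x + y) = pr p i x + pr p i y"
  by (simp add: pr_def poly_prp Tn_add pow_card_add distrib_left sum.distrib)

lemma pr_zero_right [simp]: "pr p i 0 = 0" by (simp add: pr_def poly_prp power_0_left)

lemma pr_sum_right: "pr p i (\<Sum>j\<in>I. g j) = (\<Sum>j\<in>I. pr p i (g j))"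
  by (induction I rule: infinite_finite_induct) (simp_all add: pr_add_right)

lemma pr_scale: "pr p i (to_ac c * x) = to_ac c * pr p i x"
  by (simp add: pr_def poly_prp Tn_scale power_mult_distrib sum_distrib_left mult.left_commute)

text \<open>Elements of F_q commute with \<tau>, so a factor from F_q[t] can be moved onto the
  point, where it acts through the Drinfeld module.\<close>

lemma pr_act: "pr (lift_ac s * p) i x = pr p i (act s x)"
proof (induction s arbitrary: x)
  case (pCons c s)
  have "lift_ac (pCons c s) * p = smult (to_ac c) p + pCons 0 (lift_ac s * p)" by (simp add: hom_distribs)
  then show ?case using pCons by (simp add: pr_add pr_smult pr_pCons act_pCons pr_add_right pr_scale)
qed simp

text \<open>The commutation rule \<tau>^m a_i = a_i^(q^m) \<tau>^m. These are the coefficients of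
  the relation for t \<tau>^m.\<close>

definition b where "b i m = a i ^ (CARD('q) ^ m)"

definition chiN where "chiN = char_poly (tau_mat b k d)"

lemma bk: "b k j \<noteq> 0" using a_k by (simp add: b_def)

lemma pr_T: "pr p i (T x) = (\<Sum>l\<le>k. b l i * pr p (i + l) x)"
proof -
  have e: "((T ^^ j) (T x)) ^ (CARD('q) ^ i) = (\<Sum>l\<le>k. b l i * ((T ^^ j) x) ^ (CARD('q) ^ (i + l)))" for j
  proof -
    have "((T ^^ j) (T x)) ^ (CARD('q) ^ i) = (T ((T ^^ j) x)) ^ (CARD('q) ^ i)" by (simp add: funpow_swap1)
    also have "\<dots> = (\<Sum>l\<le>k. (a l * ((T ^^ j) x) ^ (CARD('q) ^ l)) ^ (CARD('q) ^ i))"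
      unfolding T_eq by (rule pow_card_sum) simp
    finally show ?thesis by (simp add: b_def power_mult_distrib power_add mult.commute flip: power_mult)
  qed
  have "pr p i (T x) = (\<Sum>j\<le>degree p. \<Sum>l\<le>k. b l i * (coeff p j * ((T ^^ j) x) ^ (CARD('q) ^ (i + l))))"
    unfolding pr_def poly_prp e by (simp add: sum_distrib_left mult.left_commute)
  also have "\<dots> = (\<Sum>l\<le>k. \<Sum>j\<le>degree p. b l i * (coeff p j * ((T ^^ j) x) ^ (CARD('q) ^ (i + l))))" by (rule sum.swap)
  finally show ?thesis by (simp add: pr_def poly_prp sum_distrib_left)
qed

lemma pr_frob: "pr p i (x ^ (CARD('q) ^ d)) = pr p (d + i) x"
  by (simp add: pr_def poly_prp Tn_frob power_add flip: power_mult)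

end

locale reduction_root = reduction_at \<phi> f h for \<phi> :: "'q::finite_field poly poly" and f h :: "'q poly" +
  fixes \<rho> :: "'q alg_closure"
  assumes \<rho>: "poly (lift_ac h) \<rho> = 0"
begin

definition H where "H = lift_ac h div [:- \<rho>, 1:]"

lemma H: "lift_ac h = [:- \<rho>, 1:] * H"
  using \<rho> unfolding H_def by (metis dvd_mult_div_cancel poly_eq_0_iff_dvd)

lemma H_nz: "H \<noteq> 0" and degree_H: "degree h = Suc (degree H)"
proof -
  have "lift_ac h \<noteq> 0" using h_nz by simp
  then show "H \<noteq> 0" using H by auto
  then have "degree ([:- \<rho>, 1:] * H) = Suc (degree H)" by (subst degree_mult_eq) auto
  then show "degree h = Suc (degree H)" using H by (metis to_ac.degree_map_poly_hom)
qed

text \<open>Taylor expansion at \<rho>: the power series variable stands for t - \<rho>.\<close>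

definition sh :: "'q alg_closure poly \<Rightarrow> 'q alg_closure fps" where
  "sh p = fps_of_poly (pcompose p [:\<rho>, 1:])"

sublocale sh: comm_ring_hom sh
  by unfold_locales (simp_all add: sh_def pcompose_add pcompose_mult fps_of_poly_add fps_of_poly_mult)

lemma sh_pCons: "sh (pCons c p) = fps_const c + (fps_const \<rho> + fps_X) * sh p"
proof -
  have "fps_of_poly [:\<rho>, 1:] = fps_const \<rho> + fps_X" by (simp add: fps_of_poly_pCons)
  then show ?thesis by (simp add: sh_def pcompose_pCons fps_of_poly_add fps_of_poly_mult)
qed

text \<open>
  The Anderson generating functions of a point \<open>x\<close> of the Tate module, expanded in \<open>t - \<rho>\<close>; multiplication
  by \<open>t\<close> on the left corresponds to the action of \<open>\<phi>\<^sub>\<theta>\<close> on \<open>x\<close>.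
\<close>

definition om :: "(nat \<Rightarrow> 'q alg_closure) \<Rightarrow> nat \<Rightarrow> 'q alg_closure fps" where
  "om x i = Abs_fps (\<lambda>m. pr (H ^ Suc m) i (x (Suc m)))"

text \<open>Since (t - \<rho>) H = h, an extra factor t - \<rho> turns H^(m+1) into h H^m, and the
  action of h lowers the level of the Tate module element by one. So t - \<rho> acts as a shift of
  the power series coefficients.\<close>

lemma om_mult:
  assumes x: "x \<in> tate_module \<phi> f h"
  shows "sh p * om x i = Abs_fps (\<lambda>m. pr (p * H ^ Suc m) i (x (Suc m)))"
proof (induction p)
  case 0
  show ?case by (simp add: fps_eq_iff)
next
  case (pCons c p)
  let ?W = "\<lambda>p. Abs_fps (\<lambda>m. pr (p * H ^ Suc m) i (x (Suc m)))"
  have "?W (pCons c p) = fps_const c * om x i + (fps_const \<rho> + fps_X) * ?W p"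
  proof (rule fps_ext)
    fix m
    have "pCons c p * H ^ Suc m = smult c (H ^ Suc m) + (smult \<rho> (p * H ^ Suc m) + [:- \<rho>, 1:] * H * (p * H ^ m))"
      by (simp add: algebra_simps)
    then have "pr (pCons c p * H ^ Suc m) i (x (Suc m))
       = c * pr (H ^ Suc m) i (x (Suc m)) + (\<rho> * pr (p * H ^ Suc m) i (x (Suc m)) + pr (lift_ac h * (p * H ^ m)) i (x (Suc m)))"
      by (simp only: pr_add pr_smult H)
    moreover have "pr (lift_ac h * (p * H ^ m)) i (x (Suc m)) = fps_nth (fps_X * ?W p) m"
    proof (cases m)
      case 0
      then show ?thesis using x by (simp add: pr_act tate_iff)
    next
      case (Suc m')
      then show ?thesis using x by (simp add: pr_act tate_iff del: power_Suc)
    qed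
    ultimately show "fps_nth (?W (pCons c p)) m = fps_nth (fps_const c * om x i + (fps_const \<rho> + fps_X) * ?W p) m"
      by (simp add: om_def distrib_right del: power_Suc)
  qed
  then show ?case using pCons by (simp add: sh_pCons distrib_right mult.assoc)
qed

lemma om_rel:
  assumes x: "x \<in> tate_module \<phi> f h"
  shows "sh [:0, 1:] * om x i = (\<Sum>l\<le>k. fps_const (b l i) * om x (i + l))"
proof (rule fps_ext)
  fix m
  have "fps_nth (sh [:0, 1:] * om x i) m = pr ([:0, 1:] * H ^ Suc m) i (x (Suc m))"
    unfolding om_mult[OF x] by simp
  also have "\<dots> = pr (H ^ Suc m) i (T (x (Suc m)))" by (simp add: pr_pCons del: power_Suc)
  also have "\<dots> = (\<Sum>l\<le>k. b l i * pr (H ^ Suc m) (i + l) (x (Suc m)))" by (rule pr_T)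
  finally show "fps_nth (sh [:0, 1:] * om x i) m = fps_nth (\<Sum>l\<le>k. fps_const (b l i) * om x (i + l)) m"
    by (simp add: fps_sum_nth om_def del: power_Suc)
qed

lemma sh_const: "sh [:c:] = fps_const c" by (simp add: sh_pCons)

lemma sh_smult: "sh (smult c p) = fps_const c * sh p"
  using sh.hom_mult[of "[:c:]" p] by (simp add: sh_const)

text \<open>By \<open>om_rel\<close> the generating functions satisfy the relations that define
  \<open>tcoord\<close>, so the first k of them determine all others, with the same
  coefficients.\<close>

lemma om_tcoord:
  assumes x: "x \<in> tate_module \<phi> f h"
  shows "om x m = (\<Sum>l<k. sh (tcoord b k m l) * om x l)"
proof (induction m rule: less_induct)
  case (less m)
  show ?case
  proof (cases "m < k")
    case True
    have "(\<Sum>l<k. sh (tcoord b k m l) * om x l) = (\<Sum>l<k. if l = m then om x l else 0)"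
      using True by (intro sum.cong) (auto simp: tcoord_less)
    then show ?thesis using True by simp
  next
    case False
    define r where "r = m - k"
    have m: "m = r + k" "r < m" using False rk by (auto simp: r_def)
    have "(\<Sum>i\<le>k. fps_const (b i r) * om x (r + i)) = sh [:0, 1:] * om x r" by (rule om_rel[OF x, symmetric])
    also have "\<dots> = (\<Sum>l<k. sh ([:0, 1:] * tcoord b k r l) * om x l)"
      by (subst less.IH[OF m(2)]) (simp only: sum_distrib_left sh.hom_mult mult.assoc)
    also have "\<dots> = (\<Sum>l<k. \<Sum>i\<le>k. fps_const (b i r) * (sh (tcoord b k (r + i) l) * om x l))"
      unfolding tcoord_rel[where b = b and k = k and m = r, OF rk bk] by (simp add: sh.hom_sum sh_smult sum_distrib_right mult.assoc)
    also have "\<dots> = (\<Sum>i\<le>k. fps_const (b i r) * (\<Sum>l<k. sh (tcoord b k (r + i) l) * om x l))"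
      by (subst sum.swap) (simp add: sum_distrib_left)
    finally have eq: "(\<Sum>i\<le>k. fps_const (b i r) * om x (r + i)) = (\<Sum>i\<le>k. fps_const (b i r) * (\<Sum>l<k. sh (tcoord b k (r + i) l) * om x l))" .
    have "(\<Sum>i<k. fps_const (b i r) * om x (r + i)) = (\<Sum>i<k. fps_const (b i r) * (\<Sum>l<k. sh (tcoord b k (r + i) l) * om x l))"
    proof (intro sum.cong refl)
      fix i assume "i \<in> {..<k}"
      then have "r + i < m" using m by simp
      from less.IH[OF this] show "fps_const (b i r) * om x (r + i) = fps_const (b i r) * (\<Sum>l<k. sh (tcoord b k (r + i) l) * om x l)" by simp
    qed
    then have "fps_const (b k r) * om x (r + k) = fps_const (b k r) * (\<Sum>l<k. sh (tcoord b k (r + k) l) * om x l)"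
      using eq by (simp add: lessThan_Suc_atMost[symmetric])
    then show ?thesis using bk[of r] m by simp
  qed
qed

lemma om_frobenius: "om (frobenius f x) i = om x (d + i)"
  by (simp add: om_def frobenius_def pr_frob)

lemma adic_mod_le:
  assumes "\<alpha> \<in> adic_completion h" "m \<le> n"
  shows "\<alpha> m = \<alpha> n mod h ^ m"
  using assms(2)
proof (induction n rule: dec_induct)
  case base
  show ?case using adic_mod[OF assms(1)] by simp
next
  case (step n)
  have "\<alpha> n = \<alpha> (Suc n) mod h ^ n" using assms(1) unfolding adic_completion_def by blast
  moreover have "h ^ m dvd h ^ n" using step by (simp add: le_imp_power_dvd)
  ultimately have "\<alpha> n mod h ^ m = \<alpha> (Suc n) mod h ^ m" by (metis mod_mod_cancel)
  then show ?case using step.IH by simp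
qed

text \<open>The coefficient of index m < n sees the points only at level m + 1 <= n, where \<alpha>
  may be replaced by its representative modulo h^n.\<close>

lemma om_adic_combination:
  assumes e: "\<And>l. l < k \<Longrightarrow> e l \<in> tate_module \<phi> f h" and \<alpha>: "\<And>l. l < k \<Longrightarrow> \<alpha> l \<in> adic_completion h"
  shows "fps_X ^ n dvd om (adic_combination \<phi> f k e \<alpha>) i - (\<Sum>l<k. sh (lift_ac (\<alpha> l n)) * om (e l) i)"
  unfolding fps_X_power_dvd
proof (intro allI impI)
  fix m assume m: "m < n"
  have "fps_nth (om (adic_combination \<phi> f k e \<alpha>) i) m = (\<Sum>l<k. pr (H ^ Suc m) i (act (\<alpha> l (Suc m)) (e l (Suc m))))"
    by (simp add: om_def adic_combination_def pr_sum_right del: power_Suc)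
  also have "\<dots> = (\<Sum>l<k. fps_nth (sh (lift_ac (\<alpha> l n)) * om (e l) i) m)"
  proof (intro sum.cong refl)
    fix l assume "l \<in> {..<k}"
    then have l: "l < k" by simp
    have "act (h ^ Suc m) (e l (Suc m)) = 0" using e[OF l] by (simp add: tate_module_def del: power_Suc)
    moreover have "\<alpha> l (Suc m) = \<alpha> l n mod h ^ Suc m" using m by (intro adic_mod_le[OF \<alpha>[OF l]]) simp
    ultimately have "act (\<alpha> l (Suc m)) (e l (Suc m)) = act (\<alpha> l n) (e l (Suc m))" by (simp only: act_mod)
    then show "pr (H ^ Suc m) i (act (\<alpha> l (Suc m)) (e l (Suc m))) = fps_nth (sh (lift_ac (\<alpha> l n)) * om (e l) i) m"
      unfolding om_mult[OF e[OF l]] by (simp add: pr_act del: power_Suc)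
  qed
  finally show "fps_nth (om (adic_combination \<phi> f k e \<alpha>) i - (\<Sum>l<k. sh (lift_ac (\<alpha> l n)) * om (e l) i)) m = 0"
    by (simp add: fps_sum_nth)
qed

text \<open>
  Nonvanishing at \<open>t = \<rho>\<close>: a relation would be an additive polynomial vanishing on the \<open>h\<close>-torsion, but of
  degree less than the number of its points.
\<close>

lemma det_om_nz:
  assumes e: "is_tate_basis \<phi> f h k e"
  shows "fps_nth (det (mat k k (\<lambda>(i,j). om (e j) i))) 0 \<noteq> 0"
proof
  interpret n0: comm_ring_hom "\<lambda>F :: 'q alg_closure fps. fps_nth F 0" by unfold_locales auto
  define A where "A = mat k k (\<lambda>(j,i). pr H i (e j 1))"
  have A: "A \<in> carrier_mat k k" by (simp add: A_def)
  assume "fps_nth (det (mat k k (\<lambda>(i,j). om (e j) i))) 0 = 0"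
  then have "det (map_mat (\<lambda>F. fps_nth F 0) (mat k k (\<lambda>(i,j). om (e j) i))) = 0" by simp
  also have "map_mat (\<lambda>F. fps_nth F 0) (mat k k (\<lambda>(i,j). om (e j) i)) = transpose_mat A"
    by (intro eq_matI) (auto simp: A_def om_def)
  finally have "det A = 0" using det_transpose[OF A] by simp
  then obtain v where v: "v \<in> carrier_vec k" "v \<noteq> 0\<^sub>v k" "A *\<^sub>v v = 0\<^sub>v k"
    using det_0_iff_vec_prod_zero_field[OF A] by blast
  define mp where "mp = (\<Sum>i<k. smult (v $ i) (prp H i))"
  have mp: "poly mp y = (\<Sum>i<k. v $ i * pr H i y)" for y by (simp add: mp_def poly_sum pr_def)
  have v0: "poly mp (e j 1) = 0" if "j < k" for j
  proof -
    have "(A *\<^sub>v v) $ j = (\<Sum>i<k. pr H i (e j 1) * v $ i)"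
      unfolding lessThan_atLeast0 using that v(1) by (simp add: A_def scalar_prod_def)
    then show ?thesis using that v(3) by (simp add: mp mult.commute)
  qed
  have et: "e i \<in> tate_module \<phi> f h" if "i < k" for i using e that by (simp add: is_tate_basis_def)
  have eh: "act h (e i (Suc 0)) = 0" if "i < k" for i using et[OF that] by (simp add: tate_iff)
  have lin: "pr H i (act p y) = poly (lift_ac p) \<rho> * pr H i y" if "act h y = 0" for p i y
  proof -
    have "[:- \<rho>, 1:] dvd lift_ac p - [:poly (lift_ac p) \<rho>:]" by (simp flip: poly_eq_0_iff_dvd)
    then obtain s where "lift_ac p - [:poly (lift_ac p) \<rho>:] = [:- \<rho>, 1:] * s" by (elim dvdE)
    then have "lift_ac p = [:poly (lift_ac p) \<rho>:] + [:- \<rho>, 1:] * s" by (simp only: diff_eq_eq add.commute)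
    then have "lift_ac p * H = ([:poly (lift_ac p) \<rho>:] + [:- \<rho>, 1:] * s) * H" by (rule arg_cong)
    also have "\<dots> = smult (poly (lift_ac p) \<rho>) H + lift_ac h * s"
      unfolding H distrib_right by (simp only: mult_ac) simp
    finally have "lift_ac p * H = smult (poly (lift_ac p) \<rho>) H + lift_ac h * s" .
    then have "pr (lift_ac p * H) i y = poly (lift_ac p) \<rho> * pr H i y + pr s i (act h y)"
      by (simp only: pr_add pr_smult pr_act)
    then show ?thesis using that by (simp add: pr_act)
  qed
  have van: "poly mp y = 0" if y: "y \<in> tors h" for y
  proof -
    have "lift_seq y \<in> tate_module \<phi> f h" using lift_seq[of y] y by (simp add: tate_iff)
    then obtain \<alpha> where \<alpha>: "lift_seq y = adic_combination \<phi> f k e \<alpha>"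
      using e unfolding is_tate_basis_def bij_betw_def by blast
    have "y = lift_seq y (Suc 0)" by (simp add: lift_seq)
    also have "\<dots> = (\<Sum>i<k. act (\<alpha> i 1) (e i 1))" unfolding \<alpha> by (simp add: adic_combination_def)
    finally have "poly mp y = (\<Sum>i<k. v $ i * (\<Sum>l<k. poly (lift_ac (\<alpha> l 1)) \<rho> * pr H i (e l 1)))"
      unfolding mp by (simp add: pr_sum_right lin eh)
    also have "\<dots> = (\<Sum>i<k. \<Sum>l<k. poly (lift_ac (\<alpha> l 1)) \<rho> * (v $ i * pr H i (e l 1)))"
      by (simp add: sum_distrib_left mult.left_commute)
    also have "\<dots> = (\<Sum>l<k. \<Sum>i<k. poly (lift_ac (\<alpha> l 1)) \<rho> * (v $ i * pr H i (e l 1)))" by (rule sum.swap)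
    also have "\<dots> = (\<Sum>l<k. poly (lift_ac (\<alpha> l 1)) \<rho> * poly mp (e l 1))" by (simp add: mp sum_distrib_left)
    finally show ?thesis using v0 by simp
  qed
  have "\<exists>i<k. v $ i \<noteq> 0"
  proof (rule ccontr)
    assume "\<not> (\<exists>i<k. v $ i \<noteq> 0)"
    then have "v = 0\<^sub>v k" using v(1) by (intro eq_vecI) auto
    then show False using v(2) by simp
  qed
  then have ne: "{i. i < k \<and> v $ i \<noteq> 0} \<noteq> {}" by blast
  \<comment> \<open>The polynomials \<open>prp H i\<close> have strictly increasing degrees, so the
    largest i with a nonzero coefficient decides the leading term of \<open>mp\<close>.\<close>
  define i0 where "i0 = Max {i. i < k \<and> v $ i \<noteq> 0}"
  have i0: "i0 < k" "v $ i0 \<noteq> 0" using Max_in[OF _ ne] by (auto simp: i0_def)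
  have i0_max: "v $ i = 0" if "i > i0" "i < k" for i
  proof (rule ccontr)
    assume "v $ i \<noteq> 0"
    then have "i \<le> i0" unfolding i0_def using that by (intro Max_ge) auto
    then show False using that by simp
  qed
  have cz: "coeff (prp H i) (CARD('q) ^ (k * degree H + i0)) = 0" if "i < i0" for i
  proof (rule coeff_eq_0)
    show "degree (prp H i) < CARD('q) ^ (k * degree H + i0)"
      unfolding degree_prp[OF H_nz] using that q1 by (intro power_strict_increasing) auto
  qed
  have "coeff mp (CARD('q) ^ (k * degree H + i0))
     = (\<Sum>i<k. if i = i0 then v $ i * coeff (prp H i) (CARD('q) ^ (k * degree H + i0)) else 0)"
    unfolding mp_def coeff_sum
  proof (intro sum.cong refl)
    fix i assume "i \<in> {..<k}"
    then show "coeff (smult (v $ i) (prp H i)) (CARD('q) ^ (k * degree H + i0))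
      = (if i = i0 then v $ i * coeff (prp H i) (CARD('q) ^ (k * degree H + i0)) else 0)"
      using cz[of i] i0_max[of i] by (cases i i0 rule: linorder_cases) auto
  qed
  also have "\<dots> = v $ i0 * lead_coeff (prp H i0)" using i0 by (simp add: degree_prp[OF H_nz])
  also have "\<dots> \<noteq> 0"
  proof -
    have "degree (prp H i0) \<noteq> 0" using q1 by (simp add: degree_prp[OF H_nz])
    then show ?thesis using i0 by auto
  qed
  finally have mp0: "mp \<noteq> 0" by auto
  have "degree mp < CARD('q) ^ (k * degree h)"
  proof -
    have "degree mp \<le> CARD('q) ^ (k * degree H + (k - 1))"
      unfolding mp_def
    proof (rule degree_sum_le)
      fix i assume "i \<in> {..<k}"
      then have "degree (prp H i) \<le> CARD('q) ^ (k * degree H + (k - 1))"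
        unfolding degree_prp[OF H_nz] using q1 by (intro power_increasing) auto
      then show "degree (smult (v $ i) (prp H i)) \<le> CARD('q) ^ (k * degree H + (k - 1))"
        using degree_smult_le le_trans by blast
    qed simp
    also have "\<dots> < CARD('q) ^ (k * degree h)"
      using q1 rk by (intro power_strict_increasing) (auto simp: degree_H)
    finally show ?thesis .
  qed
  moreover have "card (tors h) \<le> card {y. poly mp y = 0}"
    using van by (intro card_mono poly_roots_finite mp0) auto
  ultimately show False
    using card_poly_roots_bound[OF mp0] card_tors(1)[OF f_ndvd] by simp
qed

text \<open>\<open>Om\<close> intertwines, modulo (t - \<rho>)^n, the matrix of \<tau>^d in the
  basis 1, ..., \<tau>^(k-1) with the matrix of Frobenius on the Tate module. Its determinant is a
  unit by \<open>det_om_nz\<close>, so the characteristic polynomials are congruent.\<close>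

lemma frobenius_congruence:
  assumes e: "is_tate_basis \<phi> f h k e" and M: "\<forall>i<k. \<forall>j<k. M i j \<in> adic_completion h"
    and Fr: "\<forall>j<k. frobenius f (e j) = adic_combination \<phi> f k e (\<lambda>i. M i j)"
  shows "fps_X ^ n dvd sh (coeff chiN m - lift_ac (coeff (char_poly (mat k k (\<lambda>(i,j). M i j n))) m))"
proof -
  let ?X = "[:fps_X ^ n:] :: 'q alg_closure fps poly"
  define Om where "Om = mat k k (\<lambda>(i,j). om (e j) i)"
  define N where "N = map_mat sh (tau_mat b k d)"
  define Mn where "Mn = mat k k (\<lambda>(i,j). M i j n)"
  define Mh where "Mh = map_mat sh (map_mat lift_ac Mn)"
  define OmC where "OmC = map_mat (\<lambda>x. [:x:]) Om"
  have c: "Om \<in> carrier_mat k k" "N \<in> carrier_mat k k" "Mh \<in> carrier_mat k k" "OmC \<in> carrier_mat k k" "Mn \<in> carrier_mat k k"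
    "tau_mat b k d \<in> carrier_mat k k"
    by (auto simp: Om_def N_def Mh_def OmC_def Mn_def tau_mat_def)
  have et: "e i \<in> tate_module \<phi> f h" if "i < k" for i using e that by (simp add: is_tate_basis_def)
  have key: "fps_X ^ n dvd (N * Om) $$ (i,j) - (Om * Mh) $$ (i,j)" if ij: "i < k" "j < k" for i j
  proof -
    have "(N * Om) $$ (i,j) = (\<Sum>l<k. sh (tcoord b k (d + i) l) * om (e j) l)"
      unfolding lessThan_atLeast0 using ij by (simp add: N_def Om_def tau_mat_def scalar_prod_def)
    also have "\<dots> = om (e j) (d + i)" by (rule om_tcoord[OF et[OF ij(2)], symmetric])
    also have "\<dots> = om (adic_combination \<phi> f k e (\<lambda>i. M i j)) i" using Fr ij by (simp flip: om_frobenius)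
    finally have "(N * Om) $$ (i,j) = \<dots>" .
    moreover have "(Om * Mh) $$ (i,j) = (\<Sum>l<k. sh (lift_ac (M l j n)) * om (e l) i)"
      unfolding lessThan_atLeast0 using ij by (simp add: Mh_def Mn_def Om_def scalar_prod_def mult.commute)
    ultimately show ?thesis using om_adic_combination[where e = e and \<alpha> = "\<lambda>i. M i j" and n = n and i = i, OF et] M ij by simp
  qed
  have ent: "(char_poly_matrix N * OmC) $$ (i,j) = [:0, 1:] * [:Om $$ (i,j):] - [:(N * Om) $$ (i,j):]"
    "(OmC * char_poly_matrix Mh) $$ (i,j) = [:0, 1:] * [:Om $$ (i,j):] - [:(Om * Mh) $$ (i,j):]" if ij: "i < k" "j < k" for i j
  proof -
    have cp: "char_poly_matrix A $$ (r,s) = (if r = s then [:0, 1:] else 0) - [:A $$ (r,s):]"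
      if "A \<in> carrier_mat k k" "r < k" "s < k" for A :: "'q alg_closure fps mat" and r s
      using that by (auto simp: char_poly_matrix_def)
    have "(char_poly_matrix N * OmC) $$ (i,j) = (\<Sum>l<k. char_poly_matrix N $$ (i,l) * [:Om $$ (l,j):])"
      using ij c mat_mult_entry[OF char_poly_matrix_closed[OF c(2)] c(4) ij] by (simp add: OmC_def)
    also have "\<dots> = (\<Sum>l<k. (if l = i then [:0, 1:] * [:Om $$ (l,j):] else 0) - [:N $$ (i,l) * Om $$ (l,j):])"
      using ij c by (intro sum.cong) (auto simp: cp algebra_simps)
    also have "\<dots> = [:0, 1:] * [:Om $$ (i,j):] - [:\<Sum>l<k. N $$ (i,l) * Om $$ (l,j):]"
      using ij by (simp add: sum_subtractf sum_to_poly)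
    also have "(\<Sum>l<k. N $$ (i,l) * Om $$ (l,j)) = (N * Om) $$ (i,j)"
      unfolding lessThan_atLeast0 using ij c by (simp add: scalar_prod_def)
    finally show "(char_poly_matrix N * OmC) $$ (i,j) = [:0, 1:] * [:Om $$ (i,j):] - [:(N * Om) $$ (i,j):]" .
    have "(OmC * char_poly_matrix Mh) $$ (i,j) = (\<Sum>l<k. [:Om $$ (i,l):] * char_poly_matrix Mh $$ (l,j))"
      using ij c mat_mult_entry[OF c(4) char_poly_matrix_closed[OF c(3)] ij] by (simp add: OmC_def)
    also have "\<dots> = (\<Sum>l<k. (if l = j then [:0, 1:] * [:Om $$ (i,l):] else 0) - [:Om $$ (i,l) * Mh $$ (l,j):])"
      using ij c by (intro sum.cong) (auto simp: cp algebra_simps)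
    also have "\<dots> = [:0, 1:] * [:Om $$ (i,j):] - [:\<Sum>l<k. Om $$ (i,l) * Mh $$ (l,j):]"
      using ij by (simp add: sum_subtractf sum_to_poly)
    also have "(\<Sum>l<k. Om $$ (i,l) * Mh $$ (l,j)) = (Om * Mh) $$ (i,j)"
      unfolding lessThan_atLeast0 using ij c by (simp add: scalar_prod_def)
    finally show "(OmC * char_poly_matrix Mh) $$ (i,j) = [:0, 1:] * [:Om $$ (i,j):] - [:(Om * Mh) $$ (i,j):]" .
  qed
  have "?X dvd det (OmC * char_poly_matrix Mh) - det (char_poly_matrix N * OmC)"
  proof (rule det_dvd_diff[of _ k])
    fix i j assume ij: "i < k" "j < k"
    have "(OmC * char_poly_matrix Mh) $$ (i,j) - (char_poly_matrix N * OmC) $$ (i,j) = [:(N * Om) $$ (i,j) - (Om * Mh) $$ (i,j):]"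
      unfolding ent[OF ij] by simp
    then show "?X dvd (OmC * char_poly_matrix Mh) $$ (i,j) - (char_poly_matrix N * OmC) $$ (i,j)"
      using key[OF ij] by (auto simp: const_poly_dvd_iff coeff_pCons split: nat.splits)
  qed (rule mult_carrier_mat[OF c(4) char_poly_matrix_closed[OF c(3)]] mult_carrier_mat[OF char_poly_matrix_closed[OF c(2)] c(4)])+
  also have "det (OmC * char_poly_matrix Mh) = det OmC * char_poly Mh"
    unfolding char_poly_def using c by (intro det_mult) auto
  also have "det (char_poly_matrix N * OmC) = char_poly N * det OmC"
    unfolding char_poly_def using c by (intro det_mult) auto
  finally have dv: "?X dvd det OmC * (char_poly Mh - char_poly N)" by (simp add: algebra_simps)
  have "det OmC = [:det Om:]"
  proof -
    interpret cc: comm_ring_hom "\<lambda>x :: 'q alg_closure fps. [:x:]" by unfold_locales (auto simp: one_pCons)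
    show ?thesis unfolding OmC_def by simp
  qed
  moreover have "det Om dvd 1" using det_om_nz[OF e] by (simp add: Om_def)
  ultimately have "det OmC dvd 1" by (simp add: is_unit_const_poly_iff)
  then have "?X dvd char_poly Mh - char_poly N" using dv by (simp add: dvd_mult_unit_iff')
  then have "fps_X ^ n dvd coeff (char_poly Mh - char_poly N) m" by (simp add: const_poly_dvd_iff)
  moreover have "char_poly N = map_poly sh chiN"
    unfolding N_def chiN_def by (rule sh.char_poly_hom[OF c(6)])
  moreover have "char_poly Mh = map_poly sh (map_poly lift_ac (char_poly Mn))"
    unfolding Mh_def using c by (simp add: sh.char_poly_hom[of _ k] lift_ac.char_poly_hom[of _ k])
  ultimately have "fps_X ^ n dvd sh (lift_ac (coeff (char_poly Mn) m)) - sh (coeff chiN m)" by (simp add: coeff_map_poly)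
  then have "fps_X ^ n dvd - (sh (lift_ac (coeff (char_poly Mn) m)) - sh (coeff chiN m))" by (simp only: dvd_minus_iff)
  then show ?thesis unfolding Mn_def by (simp add: sh.hom_minus)
qed

end

section \<open>Descent of the characteristic polynomial to A and comparison with the Euler
  factor\<close>

lemma inj_lift_ac: "inj (lift_ac :: 'q::field poly \<Rightarrow> _)"
  by (rule injI) simp

lemma monic_irreducible_linear: "monic_irreducible [:- c, 1 :: 'q::finite_field:]"
  unfolding monic_irreducible_def by (simp add: irreducible_linear_field_poly)

context reduction_root
begin

lemma linear_power_dvd:
  assumes "fps_X ^ n dvd sh p"
  shows "[:- \<rho>, 1:] ^ n dvd p"
proof -
  define r where "r = pcompose p [:\<rho>, 1:]"
  have "\<forall>i<n. coeff r i = 0" using assms by (simp add: sh_def fps_X_power_dvd r_def)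
  then have "monom 1 n dvd r" by (simp only: monom_1_dvd_iff')
  then obtain s where s: "r = monom 1 n * s" by (elim dvdE)
  have "p = pcompose r [:- \<rho>, 1:]"
    by (simp add: r_def pcompose_assoc[symmetric] pcompose_pCons pcompose_idR)
  also have "\<dots> = [:- \<rho>, 1:] ^ n * pcompose s [:- \<rho>, 1:]"
    unfolding s pcompose_mult by (subst monom_altdef) (simp add: pcompose_hom.hom_power pcompose_pCons)
  finally show ?thesis by simp
qed

lemma H_root: "poly H \<rho> \<noteq> 0"
proof -
  note o = monic_irreducible_orbit[OF h \<rho>]
  let ?P = "\<Prod>j\<in>{Suc 0..<degree h}. [:- (\<rho> ^ (CARD('q) ^ j)), 1:]"
  have "lift_ac h = [:- \<rho>, 1:] * ?P"
    unfolding o(3) lessThan_atLeast0 using prod.atLeast_Suc_lessThan[OF dh, of "\<lambda>j. [:- (\<rho> ^ (CARD('q) ^ j)), 1:]"] by simp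
  then have "[:- \<rho>, 1:] * H = [:- \<rho>, 1:] * ?P" using H by simp
  moreover have "[:- \<rho>, 1:] \<noteq> 0" by simp
  ultimately have HP: "H = ?P" using mult_left_cancel by blast
  have "\<rho> \<noteq> \<rho> ^ (CARD('q) ^ j)" if "j \<in> {Suc 0..<degree h}" for j
    using inj_onD[OF o(2), of 0 j] that by force
  then show ?thesis unfolding HP poly_prod by simp
qed

text \<open>A polynomial over F_q vanishing at \<rho> is divisible by h. As \<rho> is a simple root
  of h, dividing by h uses up just one factor t - \<rho>.\<close>

lemma power_dvd_descent: "[:- \<rho>, 1:] ^ n dvd lift_ac g \<Longrightarrow> h ^ n dvd g"
proof (induction n arbitrary: g)
  case (Suc n)
  have "[:- \<rho>, 1:] dvd lift_ac g" using Suc.prems unfolding power_Suc by (rule dvd_mult_left)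
  then have "h dvd g" using monic_irreducible_dvd_iff_root[OF h \<rho>] by (simp add: poly_eq_0_iff_dvd)
  then obtain g' where g': "g = h * g'" by (elim dvdE)
  have "[:- \<rho>, 1:] * [:- \<rho>, 1:] ^ n dvd [:- \<rho>, 1:] * (H * lift_ac g')"
    using Suc.prems by (simp only: g' lift_ac.hom_mult H power_Suc mult.assoc)
  then have dv: "[:- \<rho>, 1:] ^ n dvd H * lift_ac g'" by (subst (asm) dvd_mult_cancel_left) auto
  have "[:- \<rho>, 1:] ^ n dvd lift_ac g'"
  proof (cases "g' = 0")
    case False
    then have nz: "H * lift_ac g' \<noteq> 0" using H_nz by simp
    have "Polynomial.order \<rho> (H * lift_ac g') = Polynomial.order \<rho> (lift_ac g')"
      using order_mult[OF nz] H_root by (simp add: order_0I)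
    then show ?thesis using dv nz by (simp add: order_divides)
  qed simp
  then have "h ^ n dvd g'" by (rule Suc.IH)
  then show ?case unfolding g' by simp
qed simp

end

context reduction_at
begin

lemma frobenius_matrix_exists:
  assumes e: "is_tate_basis \<phi> f h k e"
  shows "\<exists>M. (\<forall>i<k. \<forall>j<k. M i j \<in> adic_completion h) \<and>
    (\<forall>j<k. frobenius f (e j) = adic_combination \<phi> f k e (\<lambda>i. M i j))"
proof -
  have "\<exists>\<alpha>. \<alpha> \<in> {..<k} \<rightarrow>\<^sub>E adic_completion h \<and> frobenius f (e j) = adic_combination \<phi> f k e \<alpha>" if "j < k" for j
  proof -
    have "e j \<in> tate_module \<phi> f h" using e that by (simp add: is_tate_basis_def)
    then have "frobenius f (e j) \<in> tate_module \<phi> f h"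
      by (simp add: tate_iff frobenius_def act_frob power_0_left)
    then show ?thesis using e unfolding is_tate_basis_def bij_betw_def by blast
  qed
  then have "\<forall>j. \<exists>\<alpha>. j < k \<longrightarrow> \<alpha> \<in> {..<k} \<rightarrow>\<^sub>E adic_completion h \<and> frobenius f (e j) = adic_combination \<phi> f k e \<alpha>"
    by blast
  from choice[OF this] obtain \<alpha> where
    "\<And>j. j < k \<Longrightarrow> \<alpha> j \<in> {..<k} \<rightarrow>\<^sub>E adic_completion h \<and> frobenius f (e j) = adic_combination \<phi> f k e (\<alpha> j)"
    by blast
  then show ?thesis by (intro exI[of _ "\<lambda>i j. \<alpha> j i"]) (auto simp: PiE_iff)
qed

text \<open>Existence and uniqueness at once. Congruences modulo all powers of h determine an
  element of A, and the lift of P satisfies them by comparison with \<tau>^d. Since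
  \<open>chiN\<close> does not involve h, the same P answers for every h.\<close>

lemma is_frobenius_charpoly_iff:
  assumes P: "chiN = map_poly lift_ac P"
  shows "is_frobenius_charpoly \<phi> f h P' \<longleftrightarrow> P' = P"
proof -
  obtain \<rho> where "poly (lift_ac h) \<rho> = 0" using monic_irreducible_root_exists[OF h] by blast
  then interpret reduction_root \<phi> f h \<rho> by unfold_locales
  have cong: "h ^ n dvd coeff (char_poly (mat k k (\<lambda>(i,j). M i j n))) m - coeff P m"
    if "is_tate_basis \<phi> f h k e" "\<forall>i<k. \<forall>j<k. M i j \<in> adic_completion h"
      "\<forall>j<k. frobenius f (e j) = adic_combination \<phi> f k e (\<lambda>i. M i j)" for e M n m
  proof -
    have "fps_X ^ n dvd sh (lift_ac (coeff P m - coeff (char_poly (mat k k (\<lambda>(i,j). M i j n))) m))"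
      using frobenius_congruence[OF that, of n m] by (simp add: P coeff_map_poly hom_distribs)
    then have "h ^ n dvd coeff P m - coeff (char_poly (mat k k (\<lambda>(i,j). M i j n))) m"
      by (intro power_dvd_descent linear_power_dvd)
    then show ?thesis by (simp add: dvd_diff_commute)
  qed
  show ?thesis
  proof
    assume "is_frobenius_charpoly \<phi> f h P'"
    then obtain e M where eM: "is_tate_basis \<phi> f h k e" "\<forall>i<k. \<forall>j<k. M i j \<in> adic_completion h"
      "\<forall>j<k. frobenius f (e j) = adic_combination \<phi> f k e (\<lambda>i. M i j)"
      "\<And>n m. h ^ n dvd coeff (char_poly (mat k k (\<lambda>(i,j). M i j n))) m - coeff P' m"
      unfolding is_frobenius_charpoly_def Let_def by blast
    show "P' = P"
    proof (rule poly_eqI)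
      fix m
      define z where "z = coeff P' m - coeff P m"
      have "h ^ n dvd z" for n
        using dvd_diff[OF cong[OF eM(1-3), of n m] eM(4)[of n m]] by (simp add: z_def)
      then have "h ^ Suc (degree z) dvd z" .
      moreover have "degree z < degree (h ^ Suc (degree z))"
      proof -
        have "1 * Suc (degree z) \<le> degree h * Suc (degree z)" by (rule mult_le_mono1) (use dh in simp)
        then show ?thesis unfolding degree_power_eq[OF h_nz] by (simp only: mult_1 Suc_le_eq)
      qed
      ultimately have "z = 0" using dvd_imp_degree_le[of "h ^ Suc (degree z)" z] by linarith
      then show "coeff P' m = coeff P m" by (simp add: z_def)
    qed
  next
    assume "P' = P"
    obtain e where e: "is_tate_basis \<phi> f h k e" using tate_basis_exists by blast
    obtain M where "\<forall>i<k. \<forall>j<k. M i j \<in> adic_completion h"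
      "\<forall>j<k. frobenius f (e j) = adic_combination \<phi> f k e (\<lambda>i. M i j)" using frobenius_matrix_exists[OF e] by blast
    then show "is_frobenius_charpoly \<phi> f h P'"
      unfolding is_frobenius_charpoly_def Let_def \<open>P' = P\<close> using e cong by blast
  qed
qed

end

context reduction
begin

text \<open>
  The coefficients lie in \<open>\<bbbF>\<^sub>q[t]\<close>: for \<open>h\<close> linear, \<open>\<rho> \<in> \<bbbF>\<^sub>q\<close>, and they are approximated \<open>(t - \<rho>)\<close>-adically
  by polynomials over \<open>\<bbbF>\<^sub>q\<close>.
\<close>

lemma chiN_descent: "\<exists>P. chiN = map_poly lift_ac P"
proof -
  \<comment> \<open>A linear h different from f is wanted; of t and t - 1 at least one
    qualifies.\<close>
  have "\<exists>c. [:- c, 1:] \<noteq> f" by (cases "f = [:- 0, 1:]") (auto intro: exI[of _ 0] exI[of _ 1])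
  then obtain c where c: "[:- c, 1:] \<noteq> f" by blast
  define h where "h = [:- c, 1:]"
  define \<rho> where "\<rho> = to_ac c"
  interpret reduction_root \<phi> f h \<rho>
    by unfold_locales (use c in \<open>simp_all add: h_def \<rho>_def monic_irreducible_linear hom_distribs\<close>)
  obtain e where e: "is_tate_basis \<phi> f h k e" using tate_basis_exists by blast
  obtain M where M: "\<forall>i<k. \<forall>j<k. M i j \<in> adic_completion h"
    "\<forall>j<k. frobenius f (e j) = adic_combination \<phi> f k e (\<lambda>i. M i j)" using frobenius_matrix_exists[OF e] by blast
  have "\<exists>g. coeff chiN m = lift_ac g" for m
  proof -
    define p where "p = coeff chiN m"
    \<comment> \<open>This precision covers every coefficient of the expansion of \<open>p\<close>
      at \<rho>.\<close>
    define n where "n = Suc (degree p)"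
    define g where "g = coeff (char_poly (mat k k (\<lambda>(i,j). M i j n))) m"
    have "fps_X ^ n dvd sh p - sh (lift_ac g)"
      using frobenius_congruence[OF e M, of n m] by (simp add: p_def g_def sh.hom_minus)
    then have eq: "coeff (pcompose p [:\<rho>, 1:]) i = coeff (pcompose (lift_ac g) [:\<rho>, 1:]) i" if "i < n" for i
      using that by (simp add: fps_X_power_dvd sh_def)
    have lg: "pcompose (lift_ac r) [:\<rho>, 1:] = lift_ac (pcompose r [:c, 1:])"
      "pcompose (lift_ac r) [:- \<rho>, 1:] = lift_ac (pcompose r [:- c, 1:])" for r
      by (simp_all add: \<rho>_def hom_distribs)
    have "coeff (pcompose p [:\<rho>, 1:]) i \<in> range to_ac" for i
    proof (cases "i < n")
      case True
      then show ?thesis unfolding eq[OF True] lg by simp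
    next
      case False
      then have "degree (pcompose p [:\<rho>, 1:]) < i" by (simp add: degree_pcompose n_def)
      then have "coeff (pcompose p [:\<rho>, 1:]) i = to_ac 0" by (simp add: coeff_eq_0)
      then show ?thesis by blast
    qed
    then obtain g2 where g2: "pcompose p [:\<rho>, 1:] = lift_ac g2" using lift_ac_descent by blast
    have "p = pcompose (pcompose p [:\<rho>, 1:]) [:- \<rho>, 1:]"
      by (simp add: pcompose_assoc[symmetric] pcompose_pCons pcompose_idR)
    also have "\<dots> = lift_ac (pcompose g2 [:- c, 1:])" unfolding g2 lg ..
    finally show ?thesis unfolding p_def by blast
  qed
  have c: "lift_ac (the_inv lift_ac (coeff chiN m)) = coeff chiN m" for m
  proof -
    obtain g where g: "coeff chiN m = lift_ac g" using \<open>\<And>m. \<exists>g. coeff chiN m = lift_ac g\<close> by blast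
    show ?thesis unfolding g the_inv_f_f[OF inj_lift_ac] ..
  qed
  have "the_inv (lift_ac :: 'q poly \<Rightarrow> _) 0 = 0" using the_inv_f_f[OF inj_lift_ac, of 0] by simp
  then have "chiN = map_poly lift_ac (map_poly (the_inv lift_ac) chiN)"
    by (intro poly_eqI) (simp add: coeff_map_poly c)
  then show ?thesis by blast
qed

lemma frobenius_charpoly_lift: "map_poly lift_ac (frobenius_charpoly \<phi> f) = chiN"
proof -
  obtain P where P: "chiN = map_poly lift_ac P" using chiN_descent by blast
  have iff: "is_frobenius_charpoly \<phi> f h P' \<longleftrightarrow> P' = P" if "monic_irreducible h" "h \<noteq> f" for h P'
  proof -
    interpret reduction_at \<phi> f h by unfold_locales (use that in auto)
    show ?thesis by (rule is_frobenius_charpoly_iff[OF P])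
  qed
  have "\<exists>c. [:- c, 1:] \<noteq> f" by (cases "f = [:- 0, 1:]") (auto intro: exI[of _ 0] exI[of _ 1])
  then obtain c where c: "[:- c, 1:] \<noteq> f" by blast
  have "frobenius_charpoly \<phi> f = P"
    unfolding frobenius_charpoly_def
  proof (rule the_equality)
    show "\<forall>h. monic_irreducible h \<and> h \<noteq> f \<longrightarrow> is_frobenius_charpoly \<phi> f h P" by (simp add: iff)
    fix P' assume "\<forall>h. monic_irreducible h \<and> h \<noteq> f \<longrightarrow> is_frobenius_charpoly \<phi> f h P'"
    then have "is_frobenius_charpoly \<phi> f [:- c, 1:] P'" using monic_irreducible_linear c by blast
    then show "P' = P" unfolding iff[OF monic_irreducible_linear c] .
  qed
  then show ?thesis by (simp add: P)
qed

lemma b_orb: "b s j = poly (lift_ac (coeff \<phi> s)) (orb f j)"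
  by (simp add: b_def a_def residue_def orb_def poly_lift_ac_pow_card)

lemma tau_mat_carrier: "tau_mat b k d \<in> carrier_mat k k"
  by (simp add: tau_mat_def)

lemma qpoly_chiN: "\<exists>c. c \<noteq> 0 \<and> qpoly \<phi> f = smult [:c:] chiN"
proof -
  have "d > 0" by (rule monic_irreducible_degree_pos[OF f])
  from det_t_eq_char_poly[where b = b, OF this rk k_le _ bk]
  have "\<exists>c. c \<noteq> 0 \<and> det (mat d d (\<lambda>(i,j). (if i = j then [:[:0, 1:]:] else 0) -
     (\<Sum>s\<le>degree \<phi>. if (j + s) mod d = i then monom [:b s j:] ((j + s) div d) else 0))) = smult [:c:] chiN"
    unfolding chiN_def by (simp add: b_def a_gt power_0_left)
  then show ?thesis by (simp only: qpoly_def qmat_def b_orb)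
qed

text \<open>At Y = 0 the terms that wrap around the orbit disappear, and \<open>qmat\<close> becomes
  lower triangular with diagonal t - l_j; the product over j is f. This fixes the constant between
  \<open>qpoly\<close> and the characteristic polynomial.\<close>

lemma qpoly_coeff_0: "coeff (qpoly \<phi> f) 0 = lift_ac f"
proof -
  interpret frobenius_orbit "CARD('q)" "degree f" "orb f" "lift_ac f" by (rule frobenius_orbit_orb[OF f])
  interpret c0: comm_ring_hom "\<lambda>P :: 'q alg_closure poly poly. coeff P 0"
    by unfold_locales (auto simp: coeff_mult)
  let ?A = "map_mat (\<lambda>P. coeff P 0) (qmat \<phi> f)"
  have A: "?A \<in> carrier_mat d d" by (simp add: qmat_def)
  have ent: "?A $$ (i,j) = (if i = j then [:0, 1:] else 0) - (\<Sum>s\<le>degree \<phi>. if j + s = i then [:b s j:] else 0)"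
    if "i < d" "j < d" for i j
  proof -
    have "(\<Sum>s\<le>degree \<phi>. coeff (if (j + s) mod d = i then monom [:b s j:] ((j + s) div d) else 0) 0)
        = (\<Sum>s\<le>degree \<phi>. if j + s = i then [:b s j:] else 0)"
      using that d0 by (intro sum.cong) (auto simp: coeff_monom div_eq_0_iff)
    then show ?thesis using that unfolding b_orb by (simp add: qmat_def coeff_sum)
  qed
  have "coeff (qpoly \<phi> f) 0 = det ?A" by (simp add: qpoly_def)
  also have "\<dots> = prod_list (diag_mat ?A)"
  proof (rule det_lower_triangular[OF _ A])
    fix i j assume ij: "i < j" "j < d"
    then show "?A $$ (i,j) = 0" using ent[of i j] by (simp add: sum.neutral)
  qed
  also have "diag_mat ?A = map (\<lambda>j. [:- orb f j, 1:]) [0..<d]"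
  proof -
    have "?A $$ (j,j) = [:- orb f j, 1:]" if "j < d" for j
    proof -
      have "(\<Sum>s\<le>degree \<phi>. if j + s = j then [:b s j:] else 0) = [:orb f j:]"
        using \<phi>0 by (simp add: b_orb)
      then show ?thesis using ent[OF that that] by simp
    qed
    then show ?thesis using A by (auto simp: diag_mat_def)
  qed
  finally show ?thesis by (simp add: f_eq prod.distinct_set_conv_list[symmetric] lessThan_atLeast0)
qed

text \<open>\<open>qpoly\<close> is c times the characteristic polynomial. Its constant coefficient
  f gives c p_0 = f, so c lies in F_q and equals c(f). For i > 0 both sides are then c p_i
  f^i.\<close>

lemma euler_D_qpoly: "lift_ac (f * coeff (euler_D \<phi> f) i) = coeff (qpoly \<phi> f) i * lift_ac f ^ i"
proof -
  let ?P = "frobenius_charpoly \<phi> f"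
  obtain c where c: "c \<noteq> 0" "qpoly \<phi> f = smult [:c:] chiN" using qpoly_chiN by blast
  have lf: "lead_coeff f = 1" using f by (simp add: monic_irreducible_def)
  have Q: "coeff (qpoly \<phi> f) i = smult c (lift_ac (coeff ?P i))" for i
    by (simp add: c(2) frobenius_charpoly_lift[symmetric] coeff_map_poly)
  then have "lift_ac f = smult c (lift_ac (coeff ?P 0))" using qpoly_coeff_0 by simp
  then have "coeff (lift_ac f) d = coeff (smult c (lift_ac (coeff ?P 0))) d" by simp
  then have "c * to_ac (coeff (coeff ?P 0) d) = 1" using lf by simp
  then have "c = to_ac (inverse (coeff (coeff ?P 0) d))" 
    using inverse_unique[of "to_ac (coeff (coeff ?P 0) d)" c] by (simp add: mult.commute)
  then obtain c' where c': "c = to_ac c'" by blast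
  have c'0: "c' \<noteq> 0" using c c' by auto
  have "lift_ac f = lift_ac (smult c' (coeff ?P 0))" using qpoly_coeff_0 Q[of 0] by (simp add: c' hom_distribs)
  then have f_eq: "f = smult c' (coeff ?P 0)" by (simp only: lift_ac.eq_iff)
  define p0 where "p0 = coeff ?P 0"
  have f_P: "f = smult c' p0" unfolding p0_def by (rule f_eq)
  have lp: "1 = c' * coeff p0 d" using arg_cong[OF f_P, of "\<lambda>p. coeff p d"] lf by simp
  have "frobenius_const \<phi> f = c'"
    unfolding frobenius_const_def p0_def[symmetric]
  proof (rule the_equality)
    show "c' \<noteq> 0 \<and> p0 = smult (inverse c') f" unfolding f_P using c'0 by simp
    fix c2 assume c2: "c2 \<noteq> 0 \<and> p0 = smult (inverse c2) f"
    then have "coeff p0 d = inverse c2" using lf by simp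
    then show "c2 = c'" using c2 lp by (simp add: field_simps)
  qed
  note fc = this
  have degP: "coeff ?P i = 0" if "i > k" for i
  proof -
    have "degree chiN = k" using degree_monic_char_poly[OF tau_mat_carrier] by (simp add: chiN_def)
    then have "lift_ac (coeff ?P i) = 0" using that by (simp add: frobenius_charpoly_lift[symmetric] coeff_map_poly[symmetric] coeff_eq_0)
    then show ?thesis by simp
  qed
  have "coeff (\<Sum>j = 1..k. monom (smult c' (coeff ?P j * f ^ (j - 1))) j) i
     = (\<Sum>j = 1..k. if j = i then smult c' (coeff ?P j * f ^ (j - 1)) else 0)"
    unfolding coeff_sum by (intro sum.cong) (auto simp: coeff_monom)
  then have D: "coeff (euler_D \<phi> f) i = (if i = 0 then 1 else smult c' (coeff ?P i * f ^ (i - 1)))"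
    using rk degP[of i] by (auto simp: euler_D_def fc coeff_1)
  show ?thesis
  proof (cases i)
    case 0
    then show ?thesis using D qpoly_coeff_0 by simp
  next
    case (Suc j)
    then show ?thesis using D by (simp add: Q c' hom_distribs mult_ac)
  qed
qed

end

text \<open>The remaining case is reduced rank 0: there \<phi>_\<theta> reduces to its constant
  term, \<open>qmat\<close> is diagonal and \<open>qpoly\<close> is f, in accordance with D_f =
  1.\<close>

theorem euler_D_eq_qpoly:
  fixes \<phi> :: "'q::finite_field poly poly"
  assumes \<phi>0: "coeff \<phi> 0 = [:0, 1:]" and f: "monic_irreducible f"
  shows "lift_ac (f * coeff (euler_D \<phi> f) i) = coeff (qpoly \<phi> f) i * lift_ac f ^ i"
proof (cases "reduced_rank \<phi> f = 0")
  case False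
  then interpret reduction \<phi> f by unfold_locales (use assms in auto)
  show ?thesis by (rule euler_D_qpoly)
next
  case True
  interpret frobenius_orbit "CARD('q)" "degree f" "orb f" "lift_ac f" by (rule frobenius_orbit_orb[OF f])
  have z: "poly (lift_ac (coeff \<phi> s)) (orb f j) = 0" if "s > 0" for s j
  proof -
    have "f dvd coeff \<phi> s"
    proof (rule ccontr)
      assume nd: "\<not> f dvd coeff \<phi> s"
      then have "s \<le> degree \<phi>" by (metis coeff_eq_0 dvd_0_right not_less)
      then have "s \<le> reduced_rank \<phi> f" unfolding reduced_rank_def using nd that by (intro Max_ge) auto
      then show False using True that by simp
    qed
    then show ?thesis using monic_irreducible_dvd_iff_root[OF f orb_root[OF f]] by blast
  qed
  have "qmat \<phi> f = mat (degree f) (degree f) (\<lambda>(i,j). if i = j then [:[:- orb f i, 1:]:] else 0)"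
  proof (rule eq_matI)
    fix i j assume "i < dim_row (mat (degree f) (degree f) (\<lambda>(i,j). if i = j then [:[:- orb f i, 1:]:] else 0))"
      "j < dim_col (mat (degree f) (degree f) (\<lambda>(i,j). if i = j then [:[:- orb f i, 1:]:] else 0))"
    then have ij: "i < degree f" "j < degree f" by auto
    have "(\<Sum>s\<le>degree \<phi>. if (j + s) mod degree f = i then monom [:poly (lift_ac (coeff \<phi> s)) (orb f j):] ((j + s) div degree f) else 0)
        = (\<Sum>s\<le>degree \<phi>. if s = 0 then (if i = j then [:[:orb f j:]:] else 0) else 0)"
      using ij by (intro sum.cong) (auto simp: z \<phi>0 monom_0 hom_distribs)
    then show "qmat \<phi> f $$ (i, j) = mat (degree f) (degree f) (\<lambda>(i,j). if i = j then [:[:- orb f i, 1:]:] else 0) $$ (i, j)"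
      using ij by (simp add: qmat_def)
  qed (auto simp: qmat_def)
  then have "qpoly \<phi> f = (\<Prod>i<degree f. [:[:- orb f i, 1:]:])" by (simp add: qpoly_def det_diag)
  also have "\<dots> = [:\<Prod>i<n. [:- orb f i, 1:]:]" if "n = degree f" for n
    unfolding that[symmetric] by (induction n) (simp_all add: one_pCons mult.commute)
  finally have "qpoly \<phi> f = [:lift_ac f:]" by (simp add: f_eq)
  then show ?thesis using True by (cases i) (simp_all add: euler_D_def coeff_1)
qed

section \<open>Non-archimedean series\<close>

lemma vabs_0 [simp]: "vabs (0 :: 'c::complete_nonarch_field) = 0"
  using dist_vabs[of "0::'c" 0] by simp

lemma vabs_ge_0 [simp]: "vabs (x :: 'c::complete_nonarch_field) \<ge> 0"
  using dist_vabs[of x 0] zero_le_dist[of x 0] by simp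

lemma vabs_eq_0_iff [simp]: "vabs (x :: 'c::complete_nonarch_field) = 0 \<longleftrightarrow> x = 0"
  using dist_vabs[of x 0] dist_eq_0_iff[of x 0] by simp

lemma vabs_1 [simp]: "vabs (1 :: 'c::complete_nonarch_field) = 1"
proof -
  have "vabs (1 :: 'c) * vabs (1 :: 'c) = vabs (1 :: 'c)" using vabs_mult[of "1::'c" 1] by simp
  moreover have "vabs (1 :: 'c) \<noteq> 0" by simp
  ultimately show ?thesis by simp
qed

lemma vabs_uminus [simp]: "vabs (- x) = vabs (x :: 'c::complete_nonarch_field)"
proof -
  have "vabs (- 1 :: 'c) * vabs (- 1 :: 'c) = 1" using vabs_mult[of "- 1::'c" "- 1"] by simp
  then have "vabs (- 1 :: 'c) = 1"
    using vabs_ge_0[of "- 1 :: 'c"] by (simp add: square_eq_1_iff)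
  then show ?thesis using vabs_mult[of "- 1" x] by simp
qed

lemma vabs_diff_commute: "vabs (x - y) = vabs (y - x :: 'c::complete_nonarch_field)"
  using vabs_uminus[of "x - y"] by simp

lemma vabs_diff_le_max: "vabs (x - y :: 'c::complete_nonarch_field) \<le> max (vabs x) (vabs y)"
  using vabs_add_le_max[of x "- y"] by simp

lemma vabs_power: "vabs (x ^ n) = vabs (x :: 'c::complete_nonarch_field) ^ n"
  by (induction n) (simp_all add: vabs_mult)

lemma vabs_prod: "vabs (\<Prod>i\<in>I. f i :: 'c::complete_nonarch_field) = (\<Prod>i\<in>I. vabs (f i))"
  by (induction I rule: infinite_finite_induct) (simp_all add: vabs_mult)

lemma vabs_inverse: "vabs (inverse x) = inverse (vabs (x :: 'c::complete_nonarch_field))"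
proof (cases "x = 0")
  case False
  then have "vabs x * vabs (inverse x) = 1" using vabs_mult[of x "inverse x"] by simp
  then show ?thesis using inverse_unique by metis
qed simp

lemma vabs_add_le: "vabs x \<le> B \<Longrightarrow> vabs y \<le> B \<Longrightarrow> vabs (x + y :: 'c::complete_nonarch_field) \<le> B"
  using vabs_add_le_max[of x y] by simp

lemma vabs_diff_le: "vabs x \<le> B \<Longrightarrow> vabs y \<le> B \<Longrightarrow> vabs (x - y :: 'c::complete_nonarch_field) \<le> B"
  using vabs_diff_le_max[of x y] by simp

lemma vabs_sum_le:
  assumes "B \<ge> 0" "\<And>i. i \<in> I \<Longrightarrow> vabs (f i) \<le> B"
  shows "vabs (\<Sum>i\<in>I. f i :: 'c::complete_nonarch_field) \<le> B"
  using assms by (induction I rule: infinite_finite_induct) (auto intro: vabs_add_le)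

lemma vabs_of_nat_le: "vabs (of_nat n :: 'c::complete_nonarch_field) \<le> 1"
  by (induction n) (auto intro: vabs_add_le)

lemma limit_vabs_le:
  fixes f :: "nat \<Rightarrow> 'c::complete_nonarch_field"
  assumes "f \<longlonglongrightarrow> L" "\<And>n. n \<ge> N \<Longrightarrow> vabs (f n - c) \<le> B"
  shows "vabs (L - c) \<le> B"
proof -
  have "(\<lambda>n. dist (f n) c) \<longlonglongrightarrow> dist L c" by (rule tendsto_dist[OF assms(1) tendsto_const])
  moreover have "\<exists>N. \<forall>n\<ge>N. dist (f n) c \<le> B" unfolding dist_vabs using assms(2) by blast
  ultimately have "dist L c \<le> B" by (rule LIMSEQ_le_const2)
  then show ?thesis by (simp only: dist_vabs)
qed

lemma nonarch_summable:
  fixes f :: "nat \<Rightarrow> 'c::complete_nonarch_field"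
  assumes f: "(\<lambda>n. vabs (f n)) \<longlonglongrightarrow> 0"
  shows "summable f"
proof -
  have "Cauchy (\<lambda>n. \<Sum>i<n. f i)"
  proof (rule metric_CauchyI)
    fix e :: real assume e: "e > 0"
    obtain N where "\<forall>n\<ge>N. norm (vabs (f n) - 0) < e / 2"
      using LIMSEQ_D[OF f half_gt_zero[OF e]] by blast
    then have N: "vabs (f n) < e / 2" if "n \<ge> N" for n
      using that by (simp only: real_norm_def diff_0_right abs_of_nonneg[OF vabs_ge_0])
    have le: "vabs ((\<Sum>i<m. f i) - (\<Sum>i<n. f i)) \<le> e / 2" if "N \<le> n" "n \<le> m" for m n
    proof -
      have "(\<Sum>i<m. f i) - (\<Sum>i<n. f i) = (\<Sum>i\<in>{..<m} - {..<n}. f i)"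
        using that by (subst sum_diff) auto
      moreover have "vabs (\<Sum>i\<in>{..<m} - {..<n}. f i) \<le> e / 2"
      proof (rule vabs_sum_le)
        show "vabs (f i) \<le> e / 2" if "i \<in> {..<m} - {..<n}" for i
          by (rule less_imp_le[OF N]) (use that \<open>N \<le> n\<close> in auto)
      qed (use e in simp)
      ultimately show ?thesis by (simp only:)
    qed
    show "\<exists>M. \<forall>m\<ge>M. \<forall>n\<ge>M. dist (\<Sum>i<m. f i) (\<Sum>i<n. f i) < e"
    proof (intro exI[of _ N] allI impI)
      fix m n assume "N \<le> m" "N \<le> n"
      then have "vabs ((\<Sum>i<m. f i) - (\<Sum>i<n. f i)) \<le> e / 2"
        by (metis le vabs_diff_commute nat_le_linear)
      then show "dist (\<Sum>i<m. f i) (\<Sum>i<n. f i) < e" using e by (simp add: dist_vabs)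
    qed
  qed
  then have "convergent (\<lambda>n. \<Sum>i<n. f i)" by (rule Cauchy_convergent)
  then show ?thesis by (auto simp: summable_def sums_def convergent_def)
qed

lemma suminf_vabs_le:
  fixes f :: "nat \<Rightarrow> 'c::complete_nonarch_field"
  assumes f: "summable f" and B: "\<And>n. n \<ge> N \<Longrightarrow> vabs (f n) \<le> B"
  shows "vabs (suminf f - (\<Sum>i<N. f i)) \<le> B"
proof (rule limit_vabs_le)
  obtain s where s: "f sums s" using f by (auto simp: summable_def)
  then have "suminf f = s" unfolding suminf_def sums_def by (intro the_equality) (auto intro: LIMSEQ_unique)
  then show "(\<lambda>n. \<Sum>i<n. f i) \<longlonglongrightarrow> suminf f" using s by (simp add: sums_def)
  fix n assume "n \<ge> N"
  then have "(\<Sum>i<n. f i) - (\<Sum>i<N. f i) = (\<Sum>i\<in>{..<n} - {..<N}. f i)" by (subst sum_diff) auto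
  moreover have "vabs (\<Sum>i\<in>{..<n} - {..<N}. f i) \<le> B"
  proof (rule vabs_sum_le)
    show "B \<ge> 0" using B[of N] vabs_ge_0[of "f N"] by linarith
  qed (use B in auto)
  ultimately show "vabs ((\<Sum>i<n. f i) - (\<Sum>i<N. f i)) \<le> B" by (simp only:)
qed

text \<open>The sums over the finite sets where the absolute value is at least 1/(n+1) form a Cauchy
  sequence. Enlarging such a set changes the sum by at most 1/(n+1), so the limit is the unordered
  sum.\<close>

lemma nonarch_has_sum:
  fixes f :: "'i \<Rightarrow> 'c::complete_nonarch_field"
  assumes fin: "\<And>\<epsilon>. \<epsilon> > 0 \<Longrightarrow> finite {i. vabs (f i) \<ge> \<epsilon>}"
  shows "f summable_on UNIV"
    and "finite F \<Longrightarrow> (\<And>i. i \<notin> F \<Longrightarrow> vabs (f i) \<le> B) \<Longrightarrow> B \<ge> 0 \<Longrightarrow> vabs (infsum f UNIV - sum f F) \<le> B"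
proof -
  define A where "A n = {i. vabs (f i) \<ge> inverse (real (Suc n))}" for n
  have A: "finite (A n)" for n unfolding A_def by (rule fin) simp
  have sub: "vabs (sum f F' - sum f F) \<le> B" if "finite F'" "finite F" "F \<subseteq> F'" "\<And>i. i \<notin> F \<Longrightarrow> vabs (f i) \<le> B" "B \<ge> 0" for F F' B
  proof -
    have "sum f F' - sum f F = sum f (F' - F)" using that by (simp add: sum_diff)
    then show ?thesis using that by (auto intro!: vabs_sum_le)
  qed
  have out: "vabs (f i) \<le> inverse (real (Suc n))" if "i \<notin> A n" for i n using that by (auto simp: A_def)
  have mono: "A n \<subseteq> A m" if "n \<le> m" for n m
  proof
    fix i assume "i \<in> A n"
    moreover have "inverse (real (Suc m)) \<le> inverse (real (Suc n))" using that by (intro le_imp_inverse_le) auto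
    ultimately show "i \<in> A m" unfolding A_def mem_Collect_eq by (rule order_trans[rotated])
  qed
  have step: "vabs (sum f (A m) - sum f (A n)) \<le> inverse (real (Suc n))" if "n \<le> m" for m n
    using sub[OF A A mono[OF that] out] by simp
  have inv0: "\<exists>N. inverse (real (Suc N)) < e" if "e > 0" for e :: real using reals_Archimedean[OF that] .
  have "Cauchy (\<lambda>n. sum f (A n))"
  proof (rule metric_CauchyI)
    fix e :: real assume "e > 0"
    then obtain N where N: "inverse (real (Suc N)) < e" using inv0 by blast
    show "\<exists>M. \<forall>m\<ge>M. \<forall>n\<ge>M. dist (sum f (A m)) (sum f (A n)) < e"
    proof (intro exI[of _ N] allI impI)
      fix m n assume mn: "N \<le> m" "N \<le> n"
      have "vabs ((sum f (A m) - sum f (A N)) - (sum f (A n) - sum f (A N))) \<le> inverse (real (Suc N))"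
        by (intro vabs_diff_le step mn)
      then show "dist (sum f (A m)) (sum f (A n)) < e" using N by (simp add: dist_vabs)
    qed
  qed
  then obtain S where S: "(\<lambda>n. sum f (A n)) \<longlonglongrightarrow> S" using Cauchy_convergent by (auto simp: convergent_def)
  have SA: "vabs (S - sum f (A n)) \<le> inverse (real (Suc n))" for n
    by (rule limit_vabs_le[OF S step])
  have hs: "(f has_sum S) UNIV"
    unfolding has_sum_def tendsto_iff
  proof (intro allI impI)
    fix e :: real assume "e > 0"
    then obtain N where N: "inverse (real (Suc N)) < e" using inv0 by blast
    have "dist (sum f F) S < e" if "finite F" "A N \<subseteq> F" for F
    proof -
      have "vabs ((sum f F - sum f (A N)) - (S - sum f (A N))) \<le> inverse (real (Suc N))"
        by (intro vabs_diff_le SA sub that A out) auto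
      then show ?thesis using N by (simp add: dist_vabs)
    qed
    then show "\<forall>\<^sub>F F in finite_subsets_at_top UNIV. dist (sum f F) S < e"
      unfolding eventually_finite_subsets_at_top using A by (intro exI[of _ "A N"]) auto
  qed
  then show "f summable_on UNIV" by (auto simp: summable_on_def)
  have inf: "infsum f UNIV = S" using hs by (rule infsumI)
  show "vabs (infsum f UNIV - sum f F) \<le> B" if F: "finite F" "\<And>i. i \<notin> F \<Longrightarrow> vabs (f i) \<le> B" "B \<ge> 0"
  proof (rule field_le_epsilon)
    fix e :: real assume e: "e > 0"
    then obtain N where N: "inverse (real (Suc N)) < e" using inv0 by blast
    have "vabs (S - sum f (A N \<union> F)) \<le> inverse (real (Suc N))"
    proof -
      have "vabs ((S - sum f (A N)) - (sum f (A N \<union> F) - sum f (A N))) \<le> inverse (real (Suc N))"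
        by (intro vabs_diff_le SA sub A out) (use A F in auto)
      then show ?thesis by simp
    qed
    moreover have "vabs (sum f (A N \<union> F) - sum f F) \<le> B" by (rule sub) (use A F in auto)
    ultimately have "vabs ((S - sum f (A N \<union> F)) + (sum f (A N \<union> F) - sum f F)) \<le> B + e"
      using N e F(3) by (intro vabs_add_le) linarith+
    then show "vabs (infsum f UNIV - sum f F) \<le> B + e" by (simp add: inf)
  qed
qed

section \<open>Powers of one-units\<close>

locale C_infinity =
  fixes \<iota> :: "'q::finite_field fls alg_closure \<Rightarrow> 'c::complete_nonarch_field"
  assumes C: "is_C_infinity \<iota>"
begin

abbreviation "\<theta> \<equiv> theta \<iota>"
abbreviation "em \<equiv> emb_Fq \<iota>"

lemma \<iota>: "\<iota> 1 = 1" "\<iota> (x + y) = \<iota> x + \<iota> y" "\<iota> (x * y) = \<iota> x * \<iota> y"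
  "f \<noteq> 0 \<Longrightarrow> vabs (\<iota> (to_ac f)) = real CARD('q) powi (- fls_subdegree f)"
  using C unfolding is_C_infinity_def by blast+

lemma \<iota>_0: "\<iota> 0 = 0" using \<iota>(2)[of 0 0] by (metis add.right_neutral add_left_cancel)

sublocale em: field_hom em
proof
  show "em (x + y) = em x + em y" for x y by (simp only: emb_Fq_def fls_plus_const[symmetric] to_ac_add \<iota>)
  show "em (x * y) = em x * em y" for x y by (simp only: emb_Fq_def fls_const_mult_const[symmetric] to_ac_mult \<iota>)
qed (simp_all add: emb_Fq_def \<iota> \<iota>_0)

lemma CHAR_c: "CHAR('c) = CHAR('q)"
proof (rule CHAR_eqI)
  have "of_nat CHAR('q) = em (of_nat CHAR('q))" by (simp only: em.hom_of_nat)
  then show "of_nat CHAR('q) = (0 :: 'c)" by simp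
  show "CHAR('q) dvd n" if "of_nat n = (0 :: 'c)" for n
  proof -
    have "em (of_nat n) = 0" using that by (simp only: em.hom_of_nat)
    then show ?thesis by (simp add: of_nat_eq_0_iff_char_dvd)
  qed
qed

lemma q1: "CARD('q) > 1" by (rule card_finite_field_gt_1)

lemma vabs_em: "vabs (em c) = (if c = 0 then 0 else 1)"
  using \<iota>(4)[of "fls_const c"] by (auto simp: emb_Fq_def \<iota>_0)

lemma vabs_em_le: "vabs (em c) \<le> 1" by (simp add: vabs_em)

lemma vabs_theta: "vabs \<theta> = real CARD('q)"
  using \<iota>(4)[of fls_X_inv] by (simp add: theta_def)

lemma theta_nz: "\<theta> \<noteq> 0" using vabs_theta q1 by auto

lemma eval_at_expand: "degree a \<le> n \<Longrightarrow> eval_at \<iota> a z = (\<Sum>j\<le>n. em (coeff a j) * z ^ j)"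
  unfolding eval_at_def poly_altdef
  by (rule sum.mono_neutral_cong_left) (auto simp: coeff_eq_0)

lemma vabs_emb_A_le: "degree a \<le> n \<Longrightarrow> vabs (emb_A \<iota> a) \<le> real CARD('q) ^ n"
  unfolding emb_A_def
proof (subst eval_at_expand, assumption, rule vabs_sum_le)
  fix j assume j: "j \<in> {..n}"
  have "vabs (em (coeff a j) * \<theta> ^ j) = vabs (em (coeff a j)) * real CARD('q) ^ j"
    by (simp only: vabs_mult vabs_power vabs_theta)
  also have "\<dots> \<le> 1 * real CARD('q) ^ j" by (rule mult_right_mono[OF vabs_em_le]) simp
  also have "\<dots> \<le> real CARD('q) ^ n" using j q1 by (simp add: power_increasing)
  finally show "vabs (em (coeff a j) * \<theta> ^ j) \<le> real CARD('q) ^ n" .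
qed simp

lemma emb_A_hom: "emb_A \<iota> (a + b) = emb_A \<iota> a + emb_A \<iota> b" "emb_A \<iota> 0 = 0"
  "emb_A \<iota> (smult c a) = em c * emb_A \<iota> a"
  by (simp_all only: emb_A_def eval_at_def em.map_poly_hom_add em.map_poly_hom_smult poly_add poly_smult
    map_poly_0 poly_0)

lemma emb_A_sum: "emb_A \<iota> (\<Sum>i\<in>I. f i) = (\<Sum>i\<in>I. emb_A \<iota> (f i))"
  by (induction I rule: infinite_finite_induct) (simp_all add: emb_A_hom)

lemma emb_A_monom: "emb_A \<iota> (monom 1 d) = \<theta> ^ d"
  by (simp only: emb_A_def eval_at_def poly_monom em.map_poly_hom_monom em.hom_one mult_1_left)

lemma vabs_one_unit:
  assumes a: "a \<in> monics d"
  shows "vabs (one_unit \<iota> a - 1) \<le> 1 / real CARD('q)"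
proof (cases "a - monom 1 d = 0")
  case True
  then have "a = monom 1 d" by (simp only: right_minus_eq)
  moreover have "\<theta> ^ d * inverse \<theta> ^ d = 1" using theta_nz by (simp add: power_inverse)
  ultimately have "one_unit \<iota> a = 1" by (simp only: one_unit_def emb_A_monom degree_monom_eq[OF one_neq_zero])
  then show ?thesis by simp
next
  case False
  have d: "degree a = d" using a unfolding monics_def by blast
  have "lead_coeff a = 1" using a unfolding monics_def by blast
  then have d': "coeff a d = 1" by (simp only: d)
  have "degree (a - monom 1 d) \<le> d"
    using degree_diff_le_max[of a "monom 1 d"] degree_monom_le[of "1::'q" d] unfolding d by simp
  moreover have "degree (a - monom 1 d) \<noteq> d"
  proof
    assume *: "degree (a - monom 1 d) = d"
    have "coeff (a - monom 1 d) d = 0" by (simp add: d')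
    then have "lead_coeff (a - monom 1 d) = 0" by (simp only: *)
    then show False using False by (simp only: leading_coeff_0_iff)
  qed
  ultimately obtain d' where d': "d = Suc d'" "degree (a - monom 1 d) \<le> d'"
    by (cases d) auto
  have "\<theta> ^ d * inverse \<theta> ^ d = 1" using theta_nz by (simp add: power_inverse)
  moreover have "emb_A \<iota> a = emb_A \<iota> (a - monom 1 d) + \<theta> ^ d"
    using emb_A_hom(1)[of "a - monom 1 d" "monom 1 d"] by (simp only: emb_A_monom diff_add_cancel)
  ultimately have eq: "one_unit \<iota> a - 1 = emb_A \<iota> (a - monom 1 d) * inverse \<theta> ^ d"
    by (simp only: one_unit_def d distrib_right add_diff_cancel_right')
  have p: "x ^ d' * inverse x ^ d = 1 / x" if "x > 0" for x :: real
    using that unfolding d'(1) by (simp add: field_simps)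
  have "vabs (emb_A \<iota> (a - monom 1 d)) * inverse (real CARD('q)) ^ d
      \<le> real CARD('q) ^ d' * inverse (real CARD('q)) ^ d"
    by (rule mult_right_mono[OF vabs_emb_A_le[OF d'(2)]]) simp
  also have "\<dots> = 1 / real CARD('q)" by (rule p) (use q1 in simp)
  finally show ?thesis by (simp only: eq vabs_mult vabs_power vabs_inverse vabs_theta)
qed

end

lemma padic_ints_Suc:
  assumes p: "p > 1" and y: "y \<in> padic_ints p"
  shows "0 \<le> y n" "nat (y 0) = 0" "padic_digit p y n < p"
    "nat (y (Suc n)) = nat (y n) + p ^ n * padic_digit p y n"
proof -
  have Y: "y k = y (Suc k) mod int p ^ k" for k using y unfolding adic_completion_def by blast
  have pos: "int p ^ k > 0" for k using p by simp
  have ge: "0 \<le> y k" for k by (subst Y) (rule pos_mod_sign[OF pos])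
  have lt: "y k < int p ^ k" for k by (subst Y) (rule pos_mod_bound[OF pos])
  show "0 \<le> y n" by (rule ge)
  show "nat (y 0) = 0" using lt[of 0] ge[of 0] by simp
  have d: "int (padic_digit p y n) = y (Suc n) div int p ^ n"
    using pos_imp_zdiv_nonneg_iff[OF pos, of "y (Suc n)" n] ge[of "Suc n"] by (simp add: padic_digit_def)
  have eq: "y (Suc n) = y n + int p ^ n * int (padic_digit p y n)"
    unfolding d by (subst Y[of n]) (simp only: mod_mult_div_eq)
  then have "int p ^ n * int (padic_digit p y n) < int p ^ n * int p"
    using lt[of "Suc n"] ge[of n] by (simp add: mult.commute)
  then show "padic_digit p y n < p" using pos[of n] by simp
  have "nat (y (Suc n)) = nat (y n) + nat (int p ^ n * int (padic_digit p y n))"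
    unfolding eq by (rule nat_add_distrib[OF ge]) simp
  also have "nat (int p ^ n * int (padic_digit p y n)) = p ^ n * padic_digit p y n"
    by (simp only: of_nat_power[symmetric] of_nat_mult[symmetric] nat_int)
  finally show "nat (y (Suc n)) = nat (y n) + p ^ n * padic_digit p y n" .
qed

lemma padic_binomial_eq_prod:
  assumes p: "p > 1" and i: "i < p ^ N"
  shows "padic_binomial p y i = (\<Prod>j<N. padic_digit p y j choose (i div p ^ j mod p))"
proof -
  have big: "i div p ^ j = 0" if "j \<ge> N \<or> j > i" for j
  proof -
    have "i < p ^ j"
    proof (cases "j \<ge> N")
      case True
      then show ?thesis using less_le_trans[OF i power_increasing[of N j p]] p by simp
    next
      case False
      then show ?thesis using that p power_gt_expt[of p j] by simp
    qed
    then show ?thesis by simp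
  qed
  define M where "M = max (Suc i) N"
  have "padic_binomial p y i = (\<Prod>j<M. padic_digit p y j choose (i div p ^ j mod p))"
    unfolding padic_binomial_def by (rule prod.mono_neutral_left) (auto simp: M_def big)
  also have "\<dots> = (\<Prod>j<N. padic_digit p y j choose (i div p ^ j mod p))"
    by (rule prod.mono_neutral_right) (auto simp: M_def big)
  finally show ?thesis .
qed

lemma sum_choose_less:
  fixes x :: "'a::comm_semiring_1"
  assumes "d < p"
  shows "(\<Sum>m<p. of_nat (d choose m) * x ^ m) = (1 + x) ^ d"
proof -
  have "(1 + x) ^ d = (\<Sum>m\<le>d. of_nat (d choose m) * x ^ m)"
    using binomial_ring[of x 1 d] by (simp add: add.commute)
  also have "\<dots> = (\<Sum>m<p. of_nat (d choose m) * x ^ m)"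
  proof (rule sum.mono_neutral_left)
    show "\<forall>m\<in>{..<p} - {..d}. of_nat (d choose m) * x ^ m = 0"
      by (intro ballI) (simp add: binomial_eq_0 not_le)
  qed (use assms in auto)
  finally show ?thesis ..
qed

text \<open>An index below p^N is a string of N digits, so the sum factors into one binomial sum per
  digit.\<close>

lemma sum_digit_binomials:
  fixes u :: "'a::comm_ring_1"
  assumes p: "p > 1" and c: "\<And>j. c j < p"
  shows "(\<Sum>i<p ^ N. of_nat (\<Prod>j<N. c j choose (i div p ^ j mod p)) * u ^ i) = (\<Prod>j<N. (1 + u ^ (p ^ j)) ^ c j)"
proof (induction N)
  case (Suc N)
  define B where "B N i = (\<Prod>j<N. c j choose (i div p ^ j mod p))" for N i
  have B: "B (Suc N) (m * p ^ N + i) = B N i * (c N choose m)" if "m < p" "i < p ^ N" for m i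
  proof -
    have "(m * p ^ N + i) div p ^ j mod p = i div p ^ j mod p" if "j < N" for j
    proof -
      obtain k where k: "N = j + Suc k" using less_imp_Suc_add[OF \<open>j < N\<close>] by auto
      have "m * p ^ N = p ^ j * (p * (m * p ^ k))" by (simp add: k power_add mult_ac)
      then have "(m * p ^ N + i) div p ^ j = p * (m * p ^ k) + i div p ^ j"
        using p by (simp only:) simp
      then show ?thesis by simp
    qed
    moreover have "(m * p ^ N + i) div p ^ N mod p = m" using that p by simp
    ultimately show ?thesis unfolding B_def prod.lessThan_Suc
      by (intro arg_cong2[where f = "(*)"] prod.cong) simp_all
  qed
  have "(\<Sum>i<p ^ Suc N. of_nat (B (Suc N) i) * u ^ i)
      = (\<Sum>m<p. \<Sum>i\<in>{m * p ^ N..<m * p ^ N + p ^ N}. of_nat (B (Suc N) i) * u ^ i)"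
    by (simp add: sum.nat_group)
  also have "\<dots> = (\<Sum>m<p. of_nat (c N choose m) * (u ^ (p ^ N)) ^ m * (\<Sum>i<p ^ N. of_nat (B N i) * u ^ i))"
  proof (rule sum.cong[OF refl])
    fix m assume m: "m \<in> {..<p}"
    have "(\<Sum>i\<in>{m * p ^ N..<m * p ^ N + p ^ N}. of_nat (B (Suc N) i) * u ^ i)
        = (\<Sum>i<p ^ N. of_nat (B (Suc N) (m * p ^ N + i)) * u ^ (m * p ^ N + i))"
      by (rule sum.reindex_bij_witness[of _ "\<lambda>i. m * p ^ N + i" "\<lambda>i. i - m * p ^ N"]) auto
    also have "\<dots> = (\<Sum>i<p ^ N. of_nat (c N choose m) * (u ^ (p ^ N)) ^ m * (of_nat (B N i) * u ^ i))"
    proof (rule sum.cong[OF refl])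
      fix i assume i: "i \<in> {..<p ^ N}"
      have "u ^ (m * p ^ N + i) = (u ^ (p ^ N)) ^ m * u ^ i"
        by (simp only: power_add power_mult[symmetric] mult.commute)
      then show "of_nat (B (Suc N) (m * p ^ N + i)) * u ^ (m * p ^ N + i)
          = of_nat (c N choose m) * (u ^ (p ^ N)) ^ m * (of_nat (B N i) * u ^ i)"
        using m i by (simp only: B lessThan_iff of_nat_mult mult_ac)
    qed
    finally show "(\<Sum>i\<in>{m * p ^ N..<m * p ^ N + p ^ N}. of_nat (B (Suc N) i) * u ^ i)
        = of_nat (c N choose m) * (u ^ (p ^ N)) ^ m * (\<Sum>i<p ^ N. of_nat (B N i) * u ^ i)"
      by (simp only: sum_distrib_left)
  qed
  also have "\<dots> = (\<Sum>m<p. of_nat (c N choose m) * (u ^ (p ^ N)) ^ m) * (\<Sum>i<p ^ N. of_nat (B N i) * u ^ i)"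
    by (simp only: sum_distrib_right)
  also have "\<dots> = (1 + u ^ (p ^ N)) ^ c N * (\<Prod>j<N. (1 + u ^ (p ^ j)) ^ c j)"
    using Suc.IH by (simp only: sum_choose_less[OF c] B_def)
  finally show ?case by (simp only: B_def prod.lessThan_Suc mult.commute)
qed simp

text \<open>In characteristic p, (1 + u)^(p^j) = 1 + u^(p^j), so the digitwise product is a single
  power. Cut off at p^N, the binomial series is exactly an integer power, with exponent y mod
  p^N.\<close>

lemma sum_padic_binomial:
  fixes u :: "'a::comm_ring_1"
  assumes p: "prime CHAR('a)" and y: "y \<in> padic_ints CHAR('a)"
  shows "(\<Sum>i<CHAR('a) ^ N. of_nat (padic_binomial CHAR('a) y i) * u ^ i) = (1 + u) ^ nat (y N)"
proof -
  have p1: "CHAR('a) > 1" using prime_gt_1_nat[OF p] .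
  note y = padic_ints_Suc[OF p1 y]
  have "(\<Sum>i<CHAR('a) ^ N. of_nat (padic_binomial CHAR('a) y i) * u ^ i)
      = (\<Prod>j<N. (1 + u ^ (CHAR('a) ^ j)) ^ padic_digit CHAR('a) y j)"
    unfolding sum_digit_binomials[where c = "padic_digit CHAR('a) y", OF p1 y(3), symmetric]
    by (rule sum.cong[OF refl]) (simp only: padic_binomial_eq_prod[OF p1] lessThan_iff)
  also have "\<dots> = (\<Prod>j<N. (1 + u) ^ (CHAR('a) ^ j * padic_digit CHAR('a) y j))"
    by (simp only: freshmans_dream'[OF p refl] power_mult power_one)
  also have "\<dots> = (1 + u) ^ nat (y N)"
    by (induction N) (simp_all only: prod.lessThan_Suc y(2,4) power_add lessThan_0 prod.empty power_0)
  finally show ?thesis .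
qed

lemma vabs_power_minus_1_le:
  fixes w :: "'c::complete_nonarch_field"
  assumes "vabs (w - 1) \<le> e" "e \<le> 1"
  shows "vabs (w ^ n - 1) \<le> e"
proof (induction n)
  case 0
  have "0 \<le> e" using assms(1) vabs_ge_0[of "w - 1"] by (rule order_trans[rotated])
  then show ?case by simp
next
  case (Suc n)
  have "vabs (w - 1 + 1) \<le> 1" by (rule vabs_add_le) (use assms in auto)
  then have "vabs (w * (w ^ n - 1)) \<le> 1 * e"
    unfolding vabs_mult by (intro mult_mono Suc) auto
  then have "vabs (w * (w ^ n - 1) + (w - 1)) \<le> e" using assms by (intro vabs_add_le) auto
  then show ?case by (simp add: algebra_simps)
qed

context C_infinity
begin

lemma p_prime: "prime CHAR('q)"
  by (rule prime_CHAR_semidom) (rule finite_imp_CHAR_pos, simp)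

lemma p1: "CHAR('q) > 1" using p_prime by (rule prime_gt_1_nat)

lemma inv_q: "1 / real CARD('q) < 1" "0 < 1 / real CARD('q)" using q1 by auto

lemma one_unit_power_term_le:
  assumes "a \<in> monics d"
  shows "vabs (of_nat m * (one_unit \<iota> a - 1) ^ i) \<le> (1 / real CARD('q)) ^ i"
proof -
  have "vabs (of_nat m :: 'c) * vabs (one_unit \<iota> a - 1) ^ i \<le> 1 * (1 / real CARD('q)) ^ i"
    by (intro mult_mono power_mono vabs_of_nat_le vabs_one_unit[OF assms]) auto
  then show ?thesis by (simp only: vabs_mult vabs_power mult_1_left)
qed

lemma one_unit_power_approx:
  assumes a: "a \<in> monics d" and y: "y \<in> padic_ints CHAR('q)"
  shows "vabs (one_unit_power \<iota> a y - one_unit \<iota> a ^ nat (y N)) \<le> (1 / real CARD('q)) ^ (CHAR('q) ^ N)"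
proof -
  define f where "f i = of_nat (padic_binomial CHAR('q) y i) * (one_unit \<iota> a - 1) ^ i" for i
  have le: "vabs (f i) \<le> (1 / real CARD('q)) ^ i" for i
    unfolding f_def by (rule one_unit_power_term_le[OF a])
  have "(\<lambda>i. (1 / real CARD('q)) ^ i) \<longlonglongrightarrow> 0" using inv_q by (intro LIMSEQ_power_zero) simp
  then have "(\<lambda>i. vabs (f i)) \<longlonglongrightarrow> 0"
    by (rule Lim_null_comparison[rotated]) (use le in auto)
  then have s: "summable f" by (rule nonarch_summable)
  have "vabs (suminf f - (\<Sum>i<CHAR('q) ^ N. f i)) \<le> (1 / real CARD('q)) ^ (CHAR('q) ^ N)"
  proof (rule suminf_vabs_le[OF s])
    fix i assume "CHAR('q) ^ N \<le> i"
    then have "(1 / real CARD('q)) ^ i \<le> (1 / real CARD('q)) ^ (CHAR('q) ^ N)"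
      using inv_q by (intro power_decreasing) auto
    then show "vabs (f i) \<le> (1 / real CARD('q)) ^ (CHAR('q) ^ N)" using le[of i] by linarith
  qed
  moreover have "(\<Sum>i<CHAR('q) ^ N. f i) = one_unit \<iota> a ^ nat (y N)"
    using sum_padic_binomial[where 'a = 'c and y = y and N = N and u = "one_unit \<iota> a - 1"] p_prime y
    by (simp add: CHAR_c f_def)
  ultimately show ?thesis unfolding one_unit_power_def f_def by simp
qed

lemma one_unit_power_cong:
  assumes a: "a \<in> monics d" and y: "y0 \<in> padic_ints CHAR('q)" "y1 \<in> padic_ints CHAR('q)" "y0 N = y1 N"
  shows "vabs (one_unit_power \<iota> a y0 - one_unit_power \<iota> a y1) \<le> (1 / real CARD('q)) ^ (CHAR('q) ^ N)"
proof -
  have "vabs ((one_unit_power \<iota> a y0 - one_unit \<iota> a ^ nat (y0 N))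
      - (one_unit_power \<iota> a y1 - one_unit \<iota> a ^ nat (y0 N))) \<le> (1 / real CARD('q)) ^ (CHAR('q) ^ N)"
    using one_unit_power_approx[OF a y(1), of N] one_unit_power_approx[OF a y(2), of N]
    unfolding y(3) by (rule vabs_diff_le)
  then show ?thesis by simp
qed

lemma eq_0_if_small:
  assumes "\<And>N. N \<ge> N0 \<Longrightarrow> vabs (x :: 'c) \<le> (1 / real CARD('q)) ^ (CHAR('q) ^ N)"
  shows "x = 0"
proof -
  have "(\<lambda>i. (1 / real CARD('q)) ^ i) \<longlonglongrightarrow> 0" using inv_q by (intro LIMSEQ_power_zero) simp
  moreover have "vabs x \<le> (1 / real CARD('q)) ^ i" if "i \<ge> N0" for i
  proof -
    have "(1 / real CARD('q)) ^ (CHAR('q) ^ i) \<le> (1 / real CARD('q)) ^ i"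
      using inv_q power_gt_expt[OF p1[unfolded One_nat_def], of i] by (intro power_decreasing) auto
    then show ?thesis using assms[OF that] by linarith
  qed
  then have "\<exists>N. \<forall>i\<ge>N. vabs x \<le> (1 / real CARD('q)) ^ i" by blast
  ultimately have "vabs x \<le> 0" by (rule LIMSEQ_le_const)
  then show ?thesis by (metis vabs_eq_0_iff vabs_ge_0 antisym)
qed

lemma padic_of_int_mem: "padic_of_int CHAR('q) k \<in> padic_ints CHAR('q)"
proof -
  have "k mod int CHAR('q) ^ n = k mod (int CHAR('q) * int CHAR('q) ^ n) mod int CHAR('q) ^ n" for n
    by (rule mod_mod_cancel[symmetric]) simp
  then show ?thesis unfolding padic_of_int_def adic_completion_def power_Suc mem_Collect_eq by (rule allI)
qed

text \<open>For k >= 0 the residues of k modulo p^N are eventually k. For k < 0 let t be such a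
  residue: t + |k| is a multiple of p^N, so w^t w^|k| is a power of w^(p^N), which lies within
  q^(-p^N) of 1. Hence the limit of the w^t is the inverse of w^|k|.\<close>

lemma one_unit_power_padic_of_int:
  assumes a: "a \<in> monics d"
  shows "one_unit_power \<iota> a (padic_of_int CHAR('q) k) = one_unit \<iota> a powi k"
proof (cases "k \<ge> 0")
  case True
  have "one_unit_power \<iota> a (padic_of_int CHAR('q) k) - one_unit \<iota> a powi k = 0"
  proof (rule eq_0_if_small)
    fix N assume "N \<ge> nat k"
    then have "nat k < CHAR('q) ^ N" using power_gt_expt[OF p1[unfolded One_nat_def], of N] by linarith
    then have "int (nat k) < int (CHAR('q) ^ N)" by (simp only: of_nat_less_iff)
    then have "k < int CHAR('q) ^ N" using True by simp
    then have "padic_of_int CHAR('q) k N = k" using True by (simp add: padic_of_int_def)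
    then show "vabs (one_unit_power \<iota> a (padic_of_int CHAR('q) k) - one_unit \<iota> a powi k) \<le> (1 / real CARD('q)) ^ (CHAR('q) ^ N)"
      using one_unit_power_approx[OF a padic_of_int_mem, of k N] True by (simp add: power_int_def)
  qed
  then show ?thesis by simp
next
  case False
  define m where "m = nat (- k)"
  let ?w = "one_unit \<iota> a" and ?v = "one_unit_power \<iota> a (padic_of_int CHAR('q) k)"
  have u: "vabs (?w - 1) \<le> 1 / real CARD('q)" by (rule vabs_one_unit[OF a])
  have w1: "vabs ?w \<le> 1" using vabs_add_le[of "?w - 1" 1 1] u inv_q by simp
  have wnz: "?w \<noteq> 0" using u inv_q by auto
  have "?v * ?w ^ m - 1 = 0"
  proof (rule eq_0_if_small)
    fix N :: nat
    define t where "t = k mod int CHAR('q) ^ N"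
    have t0: "t \<ge> 0" unfolding t_def using p1 by simp
    have "int CHAR('q) ^ N dvd t - k" unfolding t_def by (simp add: mod_eq_dvd_iff[symmetric])
    then have "int (CHAR('q) ^ N) dvd int (nat t + m)" using False t0 by (simp add: m_def)
    then obtain M where M: "nat t + m = CHAR('q) ^ N * M" unfolding of_nat_dvd_iff by (elim dvdE)
    have "?w ^ (CHAR('q) ^ N) - 1 = (?w - 1) ^ (CHAR('q) ^ N)"
      using freshmans_dream'[where 'a = 'c, of "CHAR('q) ^ N" N "?w - 1" 1] p_prime by (simp add: CHAR_c)
    then have "vabs (?w ^ (CHAR('q) ^ N) - 1) \<le> (1 / real CARD('q)) ^ (CHAR('q) ^ N)"
      using power_mono[OF u, of "CHAR('q) ^ N"] by (simp add: vabs_power)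
    then have "vabs ((?w ^ (CHAR('q) ^ N)) ^ M - 1) \<le> (1 / real CARD('q)) ^ (CHAR('q) ^ N)"
      by (rule vabs_power_minus_1_le) (use inv_q in \<open>simp add: power_le_one\<close>)
    then have 1: "vabs (?w ^ nat t * ?w ^ m - 1) \<le> (1 / real CARD('q)) ^ (CHAR('q) ^ N)"
      by (simp only: power_mult[symmetric] M[symmetric] power_add)
    have "vabs (?v - ?w ^ nat t) \<le> (1 / real CARD('q)) ^ (CHAR('q) ^ N)"
      using one_unit_power_approx[OF a padic_of_int_mem, of k N] by (simp only: padic_of_int_def t_def)
    then have "vabs (?v - ?w ^ nat t) * vabs ?w ^ m \<le> (1 / real CARD('q)) ^ (CHAR('q) ^ N) * 1"
      by (rule mult_mono) (use w1 in \<open>auto intro: power_le_one\<close>)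
    then have "vabs ((?v - ?w ^ nat t) * ?w ^ m) \<le> (1 / real CARD('q)) ^ (CHAR('q) ^ N)"
      by (simp only: vabs_mult vabs_power mult_1_right)
    from vabs_add_le[OF this 1] show "vabs (?v * ?w ^ m - 1) \<le> (1 / real CARD('q)) ^ (CHAR('q) ^ N)"
      by (simp add: left_diff_distrib)
  qed
  then have "?v = inverse (?w ^ m)" using wnz by (simp add: field_simps)
  then show ?thesis using False by (simp add: m_def power_int_def power_inverse)
qed

end

section \<open>Decay of the coefficients\<close>

lemma padic_ints_less:
  assumes "p > 1" "y \<in> padic_ints p"
  shows "nat (y n) < p ^ n"
proof -
  have "y n = y (Suc n) mod int p ^ n" using assms(2) unfolding adic_completion_def by blast
  moreover have "int p ^ n > 0" using assms(1) by simp
  ultimately have "y n < int p ^ n" using pos_mod_bound[of "int p ^ n" "y (Suc n)"] by simp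
  then have "y n < int (p ^ n)" by (simp only: of_nat_power)
  then have "nat (y n) < nat (int (p ^ n))" using assms(1) by (simp only: zless_nat_conj) simp
  then show ?thesis by (simp only: nat_int)
qed

lemma square_le_two_power: "4 \<le> (n::nat) \<Longrightarrow> n * n \<le> 2 ^ n"
proof (induction n rule: dec_induct)
  case (step n)
  have "4 * n \<le> n * n" using step(1) by (rule mult_right_mono) simp
  then have "Suc n * Suc n \<le> 2 * (n * n)" using step(1) unfolding mult_Suc mult_Suc_right by linarith
  then show ?case using step.IH by simp
qed simp

text \<open>A threshold beyond which the number of digits gives exponential gain over a prescribed
  linear loss; from 4 on, squares are bounded by powers of 2.\<close>

lemma linear_le_exponential:
  fixes M t :: nat
  shows "4 + 2 * M + t \<le> N \<Longrightarrow> M * Suc N + t \<le> 2 ^ N"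
proof -
  assume N: "4 + 2 * M + t \<le> N"
  then have "M * 1 \<le> M * N" "t * 1 \<le> t * N" by (intro mult_left_mono; simp)+
  then have "M * Suc N + t \<le> (2 * M + t) * N" unfolding mult_Suc_right add_mult_distrib by linarith
  also have "\<dots> \<le> N * N" using N by (intro mult_right_mono) auto
  also have "\<dots> \<le> 2 ^ N" using N by (intro square_le_two_power) simp
  finally show ?thesis .
qed

locale dual_L_series = C_infinity \<iota> + dual_L \<phi> \<mu>
  for \<iota> :: "'q::finite_field fls alg_closure \<Rightarrow> 'c::complete_nonarch_field"
    and \<phi> :: "'q poly poly" and \<mu> :: "'q poly \<Rightarrow> 'q poly"
begin

lemma degree_monics: "a \<in> monics d \<Longrightarrow> degree a = d" unfolding monics_def by blast

text \<open>With \<open>f\<close> a one-unit power this is the coefficient of z^j x^(-d) in the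
  L-series. The weight is left free so that truncations, differences in y and products of
  evaluations are covered too.\<close>

definition coeff_sum :: "nat \<Rightarrow> (nat \<Rightarrow> nat) \<Rightarrow> ('q poly \<Rightarrow> 'c) \<Rightarrow> nat \<Rightarrow> 'c" where
  "coeff_sum n j f d = (\<Sum>a\<in>monics d. emb_A \<iota> (\<mu> a) * (\<Prod>k<n. em (coeff a (j k))) * f a)"

lemma vabs_coeff_sum_le:
  assumes f: "\<And>a. a \<in> monics d \<Longrightarrow> vabs (f a) \<le> B" and B: "B \<ge> 0"
  shows "vabs (coeff_sum n j f d) \<le> real CARD('q) ^ d * B"
  unfolding coeff_sum_def
proof (rule vabs_sum_le)
  fix a :: "'q poly" assume a: "a \<in> monics d"
  then have "lead_coeff a = 1" unfolding monics_def by blast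
  then have "degree (\<mu> a) \<le> d" using degree_\<mu>[of a] degree_monics[OF a] by simp
  then have 1: "vabs (emb_A \<iota> (\<mu> a)) \<le> real CARD('q) ^ d" by (rule vabs_emb_A_le)
  have 2: "vabs (\<Prod>k<n. em (coeff a (j k))) \<le> 1"
    unfolding vabs_prod by (intro prod_le_1) (simp add: vabs_em_le)
  have "vabs (emb_A \<iota> (\<mu> a)) * vabs (\<Prod>k<n. em (coeff a (j k))) * vabs (f a) \<le> real CARD('q) ^ d * 1 * B"
    by (intro mult_mono 1 2 f a) auto
  then show "vabs (emb_A \<iota> (\<mu> a) * (\<Prod>k<n. em (coeff a (j k))) * f a) \<le> real CARD('q) ^ d * B"
    by (simp only: vabs_mult mult_1_right)
qed (use B in simp)

lemma coeff_sum_diff: "coeff_sum n j f d - coeff_sum n j g d = coeff_sum n j (\<lambda>a. f a - g a) d"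
  unfolding coeff_sum_def by (simp add: sum_subtractf right_diff_distrib)

lemma coeff_sum_mult: "coeff_sum n j (\<lambda>a. f a * c) d = coeff_sum n j f d * c"
  unfolding coeff_sum_def by (simp add: sum_distrib_right mult.assoc)

lemma coeff_sum_eq_0:
  assumes "k < n" "j k > d"
  shows "coeff_sum n j f d = 0"
  unfolding coeff_sum_def
proof (intro sum.neutral ballI)
  fix a :: "'q poly" assume "a \<in> monics d"
  then have "em (coeff a (j k)) = 0" using assms(2) by (simp add: degree_monics coeff_eq_0)
  then have "(\<Prod>k<n. em (coeff a (j k))) = 0" using assms(1) by (intro prod_zero) auto
  then show "emb_A \<iota> (\<mu> a) * (\<Prod>k<n. em (coeff a (j k))) * f a = 0" by simp
qed

text \<open>Expanding an evaluation \<open>a(w)\<close> into monomials turns it into one more coefficient of \<open>a\<close>.\<close>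

lemma coeff_sum_evals_eq_0:
  assumes \<Delta>: "\<And>k. degree (coeff \<phi> k) \<le> \<Delta>"
  shows "d > degree \<phi> * (\<Delta> + (n + length ws) + 1) \<Longrightarrow>
    coeff_sum n j (\<lambda>a. prod_list (map (eval_at \<iota> a) ws)) d = 0"
proof (induction ws arbitrary: n j)
  case Nil
  have "coeff_sum n j (\<lambda>a. prod_list (map (eval_at \<iota> a) [])) d
      = emb_A \<iota> (\<Sum>a\<in>monics d. smult (\<Prod>k<n. coeff a (j k)) (\<mu> a))"
    unfolding coeff_sum_def emb_A_sum emb_A_hom(3) em.hom_prod by (simp add: mult.commute)
  also have "\<dots> = 0" using sum_\<mu>_coeff_eq_0[OF \<Delta>, of n d j] Nil by (simp add: emb_A_hom(2))
  finally show ?case .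
next
  case (Cons w ws)
  have "coeff_sum n j (\<lambda>a. prod_list (map (eval_at \<iota> a) (w # ws))) d
      = (\<Sum>a\<in>monics d. \<Sum>i\<le>d. w ^ i * (emb_A \<iota> (\<mu> a) * (\<Prod>k<Suc n. em (coeff a ((j(n := i)) k)))
          * prod_list (map (eval_at \<iota> a) ws)))"
    unfolding coeff_sum_def
  proof (rule sum.cong[OF refl])
    fix a :: "'q poly" assume "a \<in> monics d"
    then have w: "eval_at \<iota> a w = (\<Sum>i\<le>d. em (coeff a i) * w ^ i)"
      by (intro eval_at_expand) (simp add: degree_monics)
    have "(\<Prod>k<Suc n. em (coeff a ((j(n := i)) k))) = (\<Prod>k<n. em (coeff a (j k))) * em (coeff a i)" for i
      by simp
    then show "emb_A \<iota> (\<mu> a) * (\<Prod>k<n. em (coeff a (j k))) * prod_list (map (eval_at \<iota> a) (w # ws))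
        = (\<Sum>i\<le>d. w ^ i * (emb_A \<iota> (\<mu> a) * (\<Prod>k<Suc n. em (coeff a ((j(n := i)) k)))
            * prod_list (map (eval_at \<iota> a) ws)))"
      by (simp only: list.map prod_list.Cons w sum_distrib_left sum_distrib_right mult_ac)
  qed
  also have "\<dots> = (\<Sum>i\<le>d. w ^ i * coeff_sum (Suc n) (j(n := i)) (\<lambda>a. prod_list (map (eval_at \<iota> a) ws)) d)"
    unfolding coeff_sum_def sum_distrib_left by (rule sum.swap)
  also have "\<dots> = 0" using Cons.prems by (intro sum.neutral ballI) (simp add: Cons.IH)
  finally show ?case .
qed

lemma eval_at_pow_card: "eval_at \<iota> a (z ^ (CARD('q) ^ N)) = eval_at \<iota> a z ^ (CARD('q) ^ N)"
proof -
  obtain l where l: "CARD('q) = CHAR('q) ^ l" using card_finite_field_eq_power_CHAR by blast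
  have "CARD('q) ^ N = CHAR('c) ^ (l * N)" by (simp add: l CHAR_c power_mult)
  moreover have "prime CHAR('c)" using p_prime by (simp only: CHAR_c)
  ultimately have "eval_at \<iota> a z ^ (CARD('q) ^ N) = (\<Sum>i\<le>degree a. (em (coeff a i) * z ^ i) ^ (CARD('q) ^ N))"
    unfolding eval_at_expand[OF order_refl] by (intro freshmans_dream_sum')
  also have "\<dots> = (\<Sum>i\<le>degree a. em (coeff a i) * (z ^ (CARD('q) ^ N)) ^ i)"
  proof (rule sum.cong[OF refl])
    fix i
    have "em (coeff a i) ^ (CARD('q) ^ N) = em (coeff a i)"
      by (simp only: em.hom_power[symmetric] finite_field_power_card_power_eq_same[OF refl])
    then show "(em (coeff a i) * z ^ i) ^ (CARD('q) ^ N) = em (coeff a i) * (z ^ (CARD('q) ^ N)) ^ i"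
      by (simp only: power_mult_distrib power_mult[symmetric] mult.commute)
  qed
  finally show ?thesis unfolding eval_at_expand[OF order_refl] by (rule sym)
qed

text \<open>The base-\<open>q\<close> digits of the exponent \<open>k\<close>, combined with \<open>a(\<theta>)\<^sup>q = a(\<theta>\<^sup>q)\<close>.\<close>

lemma emb_A_power_as_evals:
  "k < CARD('q) ^ N \<Longrightarrow>
    \<exists>ws. length ws \<le> (CARD('q) - 1) * N \<and> (\<forall>a. emb_A \<iota> a ^ k = prod_list (map (eval_at \<iota> a) ws))"
proof (induction N arbitrary: k)
  case 0
  then show ?case by (intro exI[of _ "[]"]) simp
next
  case (Suc N)
  let ?Q = "CARD('q) ^ N"
  have "k mod ?Q < ?Q" by simp
  then obtain ws where ws: "length ws \<le> (CARD('q) - 1) * N"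
    "emb_A \<iota> a ^ (k mod ?Q) = prod_list (map (eval_at \<iota> a) ws)" for a
    using Suc.IH by blast
  have "k div ?Q < CARD('q)" using Suc.prems by (simp add: less_mult_imp_div_less)
  then have "k div ?Q \<le> CARD('q) - 1" by simp
  moreover have "emb_A \<iota> a ^ k = prod_list (map (eval_at \<iota> a) (replicate (k div ?Q) (\<theta> ^ ?Q) @ ws))" for a
  proof -
    have "emb_A \<iota> a ^ k = emb_A \<iota> a ^ (?Q * (k div ?Q) + k mod ?Q)" by simp
    also have "\<dots> = eval_at \<iota> a (\<theta> ^ ?Q) ^ (k div ?Q) * prod_list (map (eval_at \<iota> a) ws)"
      by (simp only: power_add power_mult ws eval_at_pow_card) (simp only: emb_A_def)
    finally show ?thesis by (simp add: prod_list_replicate)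
  qed
  moreover have "(CARD('q) - 1) * Suc N = (CARD('q) - 1) + (CARD('q) - 1) * N" by (rule mult_Suc_right)
  ultimately show ?case using ws(1)
    by (intro exI[of _ "replicate (k div ?Q) (\<theta> ^ ?Q) @ ws"]) (simp only: length_append length_replicate, simp)
qed

lemma vabs_coeff_sum_one_unit_power_le:
  assumes \<Delta>: "\<And>k. degree (coeff \<phi> k) \<le> \<Delta>" and y: "y \<in> padic_ints CHAR('q)"
    and d: "d > degree \<phi> * (\<Delta> + (n + (CARD('q) - 1) * N) + 1)"
  shows "vabs (coeff_sum n j (\<lambda>a. one_unit_power \<iota> a y) d)
    \<le> real CARD('q) ^ d * (1 / real CARD('q)) ^ (CARD('q) ^ N)"
proof -
  obtain l where l: "CARD('q) = CHAR('q) ^ l" using card_finite_field_eq_power_CHAR by blast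
  have Q: "CHAR('q) ^ (l * N) = CARD('q) ^ N" by (simp add: l power_mult)
  define k where "k = nat (y (l * N))"
  have "k < CARD('q) ^ N" using padic_ints_less[OF p1 y, of "l * N"] by (simp only: k_def Q)
  then obtain ws where ws: "length ws \<le> (CARD('q) - 1) * N"
    "emb_A \<iota> a ^ k = prod_list (map (eval_at \<iota> a) ws)" for a
    using emb_A_power_as_evals by blast
  have "degree \<phi> * (\<Delta> + (n + length ws) + 1) \<le> degree \<phi> * (\<Delta> + (n + (CARD('q) - 1) * N) + 1)"
    using ws(1) by (intro mult_left_mono) auto
  then have "coeff_sum n j (\<lambda>a. prod_list (map (eval_at \<iota> a) ws)) d = 0"
    using d by (intro coeff_sum_evals_eq_0[OF \<Delta>]) linarith
  \<comment> \<open>In degree d the powers of a(\<theta>) and of the one-unit of a differ by a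
    constant factor, so the vanishing carries over.\<close>
  then have "coeff_sum n j (\<lambda>a. emb_A \<iota> a ^ k * (inverse \<theta> ^ d) ^ k) d = 0"
    unfolding coeff_sum_mult ws(2) by simp
  also have "coeff_sum n j (\<lambda>a. emb_A \<iota> a ^ k * (inverse \<theta> ^ d) ^ k) d = coeff_sum n j (\<lambda>a. one_unit \<iota> a ^ k) d"
    unfolding coeff_sum_def one_unit_def power_mult_distrib
    by (rule sum.cong[OF refl]) (simp only: degree_monics)
  finally have "coeff_sum n j (\<lambda>a. one_unit_power \<iota> a y) d
      = coeff_sum n j (\<lambda>a. one_unit_power \<iota> a y - one_unit \<iota> a ^ k) d"
    unfolding coeff_sum_diff[symmetric] by simp
  also have "vabs \<dots> \<le> real CARD('q) ^ d * (1 / real CARD('q)) ^ (CARD('q) ^ N)"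
    by (intro vabs_coeff_sum_le) (use one_unit_power_approx[OF _ y, of _ _ "l * N"] in \<open>auto simp only: k_def Q\<close>, simp)
  finally show ?thesis .
qed

lemma coeff_sum_decay:
  fixes A \<epsilon> :: real and n :: nat
  assumes A: "A \<ge> 1" and \<epsilon>: "\<epsilon> > 0"
  shows "\<exists>D. \<forall>d\<ge>D. \<forall>y\<in>padic_ints CHAR('q). \<forall>j.
    vabs (coeff_sum n j (\<lambda>a. one_unit_power \<iota> a y) d) * A ^ d \<le> \<epsilon>"
proof -
  let ?q = "CARD('q)"
  define \<Delta> where "\<Delta> = Max ((\<lambda>k. degree (coeff \<phi> k)) ` {..degree \<phi>})"
  have \<Delta>: "degree (coeff \<phi> k) \<le> \<Delta>" for k
  proof (cases "k \<le> degree \<phi>")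
    case True
    then show ?thesis unfolding \<Delta>_def by (intro Max_ge) auto
  qed (simp add: coeff_eq_0)
  \<comment> \<open>For N >= 1 the degree bound
    \<open>degree \<phi> * (\<Delta> + (n + (q - 1) * N) + 1)\<close> lies below E N. So in degree d
    one can afford N = d div E digits.\<close>
  define E where "E = degree \<phi> * (\<Delta> + n + 1 + ?q) + 1"
  have q1': "real ?q > 1" using q1 by simp
  obtain s where s: "A < real ?q ^ s" using real_arch_pow[OF q1'] by blast
  obtain t where t: "(1 / real ?q) ^ t < \<epsilon>" using real_arch_pow_inv[OF \<epsilon> inv_q(1)] by blast
  \<comment> \<open>The growth to be beaten is q^d from \<mu> and A^d <= q^(s d), and q^(-t)
    accounts for \<epsilon>. So q^N has to reach (s + 1) d + t, where (s + 1) d <= M (N +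
    1).\<close>
  define M where "M = (s + 1) * E"
  show ?thesis
  proof (intro exI[of _ "E * (4 + 2 * M + t)"] allI impI ballI)
    fix d y j
    assume d: "E * (4 + 2 * M + t) \<le> d" and y: "y \<in> padic_ints CHAR('q)"
    define N where "N = d div E"
    have E: "E > 0" by (simp add: E_def)
    have N: "4 + 2 * M + t \<le> N" unfolding N_def using d E by (simp add: less_eq_div_iff_mult_less_eq mult.commute)
    then have "M * Suc N + t \<le> 2 ^ N" by (rule linear_le_exponential)
    also have "(2::nat) ^ N \<le> ?q ^ N" using q1 by (intro power_mono) auto
    finally have le: "M * Suc N + t \<le> ?q ^ N" .
    have "d < Suc N * E" using dividend_less_div_times[OF E, of d] by (simp add: N_def)
    then have "(s + 1) * d \<le> M * Suc N" unfolding M_def 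
      unfolding mult.assoc by (intro mult_left_mono) (simp_all only: mult.commute less_imp_le zero_le)
    then have le: "(d + s * d) + t \<le> ?q ^ N" using le by simp
    have "\<Delta> + (n + (?q - 1) * N) + 1 \<le> (\<Delta> + n + 1) * N + ?q * N"
    proof -
      have "(\<Delta> + n + 1) * 1 \<le> (\<Delta> + n + 1) * N" using N by (intro mult_left_mono) simp_all
      moreover have "(?q - 1) * N \<le> ?q * N" by simp
      ultimately have "(\<Delta> + n + 1) * 1 + (?q - 1) * N \<le> (\<Delta> + n + 1) * N + ?q * N" by (rule add_mono)
      then show ?thesis by (simp only: mult_1_right mult_1_left add_ac)
    qed
    then have "degree \<phi> * (\<Delta> + (n + (?q - 1) * N) + 1) \<le> degree \<phi> * ((\<Delta> + n + 1) * N + ?q * N)"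
      by (rule mult_left_mono) simp
    also have "\<dots> < E * N" using N by (simp add: E_def algebra_simps)
    also have "\<dots> \<le> d" by (simp add: N_def)
    finally have d': "d > degree \<phi> * (\<Delta> + (n + (?q - 1) * N) + 1)" .
    have pow: "x ^ k * x' ^ (k + t) = (x * x') ^ k * x' ^ t" for x x' :: real and k
      by (simp add: power_add power_mult_distrib)
    have "vabs (coeff_sum n j (\<lambda>a. one_unit_power \<iota> a y) d) * A ^ d
        \<le> (real ?q ^ d * (1 / real ?q) ^ (?q ^ N)) * (real ?q ^ s) ^ d"
      using A s by (intro mult_mono power_mono vabs_coeff_sum_one_unit_power_le[OF \<Delta> y d']) auto
    also have "\<dots> = real ?q ^ (d + s * d) * (1 / real ?q) ^ (?q ^ N)"
      by (simp only: power_add power_mult mult.assoc) (simp only: mult_ac)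
    also have "\<dots> \<le> real ?q ^ (d + s * d) * (1 / real ?q) ^ ((d + s * d) + t)"
      using inv_q le by (intro mult_left_mono power_decreasing) auto
    also have "\<dots> = (real ?q * (1 / real ?q)) ^ (d + s * d) * (1 / real ?q) ^ t"
      by (rule pow)
    also have "\<dots> = (1 / real ?q) ^ t" using q1 by simp
    finally show "vabs (coeff_sum n j (\<lambda>a. one_unit_power \<iota> a y) d) * A ^ d \<le> \<epsilon>" using t by linarith
  qed
qed

end

section \<open>Analytic continuation\<close>

definition exponent_box :: "nat \<Rightarrow> nat \<Rightarrow> (nat \<Rightarrow>\<^sub>0 nat) set" where
  "exponent_box n D = {m. Poly_Mapping.keys m \<subseteq> {..<n} \<and> (\<forall>k. Poly_Mapping.lookup m k \<le> D)}"

definition exponent_of :: "nat \<Rightarrow> (nat \<Rightarrow> nat) \<Rightarrow> (nat \<Rightarrow>\<^sub>0 nat)" where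
  "exponent_of n g = Abs_poly_mapping (\<lambda>k. if k < n then g k else 0)"

lemma lookup_exponent_of: "Poly_Mapping.lookup (exponent_of n g) k = (if k < n then g k else 0)"
proof -
  have "finite {k. (if k < n then g k else 0) \<noteq> 0}" by (rule finite_subset[of _ "{..<n}"]) auto
  then show ?thesis by (simp add: exponent_of_def)
qed

lemma keys_exponent_of: "Poly_Mapping.keys (exponent_of n g) \<subseteq> {..<n}"
  by (auto simp: in_keys_iff lookup_exponent_of split: if_splits)

lemma lookup_eq_0: "Poly_Mapping.keys m \<subseteq> {..<n} \<Longrightarrow> \<not> k < n \<Longrightarrow> Poly_Mapping.lookup m k = 0"
  by (metis in_keys_iff lessThan_iff subsetD)

lemma exponent_box_eq: "exponent_box n D = exponent_of n ` PiE {..<n} (\<lambda>_. {..D})"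
proof (intro equalityI subsetI)
  fix m assume m: "m \<in> exponent_box n D"
  have "m = exponent_of n (restrict (Poly_Mapping.lookup m) {..<n})"
    by (rule poly_mapping_eqI) (use m lookup_eq_0[of m n] in \<open>simp add: lookup_exponent_of exponent_box_def\<close>)
  moreover have "restrict (Poly_Mapping.lookup m) {..<n} \<in> PiE {..<n} (\<lambda>_. {..D})" using m by (simp add: exponent_box_def)
  ultimately show "m \<in> exponent_of n ` PiE {..<n} (\<lambda>_. {..D})" by (rule image_eqI)
next
  fix m assume "m \<in> exponent_of n ` PiE {..<n} (\<lambda>_. {..D})"
  then show "m \<in> exponent_box n D"
    using keys_exponent_of by (auto simp: exponent_box_def lookup_exponent_of PiE_mem)
qed

lemma finite_exponent_box: "finite (exponent_box n D)"
  unfolding exponent_box_eq by (intro finite_imageI finite_PiE) auto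

lemma prod_sum_exponent_box:
  fixes f :: "nat \<Rightarrow> nat \<Rightarrow> 'a::comm_semiring_1"
  shows "(\<Prod>k<n. \<Sum>j\<le>D. f k j) = (\<Sum>m\<in>exponent_box n D. \<Prod>k<n. f k (Poly_Mapping.lookup m k))"
proof -
  have inj: "inj_on (exponent_of n) (PiE {..<n} (\<lambda>_. {..D}))"
  proof (rule inj_onI)
    fix g h assume g: "g \<in> PiE {..<n} (\<lambda>_. {..D})" and h: "h \<in> PiE {..<n} (\<lambda>_. {..D})"
      and eq: "exponent_of n g = exponent_of n h"
    show "g = h"
    proof (rule PiE_ext[OF g h])
      fix k assume "k \<in> {..<n}"
      then show "g k = h k" using arg_cong[OF eq, of "\<lambda>m. Poly_Mapping.lookup m k"] by (simp add: lookup_exponent_of)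
    qed
  qed
  have "(\<Prod>k<n. \<Sum>j\<le>D. f k j) = (\<Sum>g\<in>PiE {..<n} (\<lambda>_. {..D}). \<Prod>k<n. f k (g k))"
    by (rule prod_sum_PiE) auto
  then show ?thesis
    unfolding exponent_box_eq by (simp add: sum.reindex[OF inj] lookup_exponent_of)
qed

text \<open>The exponents with \<open>d < N\<close> and \<open>m \<le> d\<close> componentwise in \<open>z\<^sup>m u\<^sup>d\<close>, where \<open>u\<close> has index \<open>n\<close>.\<close>

definition exponent_cone :: "nat \<Rightarrow> nat \<Rightarrow> (nat \<Rightarrow>\<^sub>0 nat) set" where
  "exponent_cone n N = (\<lambda>(d, m). m + Poly_Mapping.single n d) ` (SIGMA d:{..<N}. exponent_box n d)"

lemma finite_exponent_cone: "finite (exponent_cone n N)"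
  unfolding exponent_cone_def by (intro finite_imageI finite_SigmaI finite_exponent_box) auto

lemma lookup_cone:
  assumes "m \<in> exponent_box n d"
  shows "Poly_Mapping.lookup (m + Poly_Mapping.single n d) k = (if k = n then d else Poly_Mapping.lookup m k)"
  using lookup_eq_0[of m n n] assms by (auto simp: exponent_box_def lookup_add lookup_single when_def)

lemma exponent_cone_inj: "inj_on (\<lambda>(d, m). m + Poly_Mapping.single n d) (SIGMA d:{..<N}. exponent_box n d)"
proof (rule inj_onI, clarify)
  fix d m d' m' assume m: "m \<in> exponent_box n d" "m' \<in> exponent_box n d'"
    and eq: "m + Poly_Mapping.single n d = m' + Poly_Mapping.single n d'"
  have "d = d'" using arg_cong[OF eq, of "\<lambda>m. Poly_Mapping.lookup m n"] m by (simp add: lookup_cone)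
  then show "d = d' \<and> m = m'" using eq by simp
qed

lemma sum_exponent_cone:
  "(\<Sum>m\<in>exponent_cone n N. f m) = (\<Sum>d<N. \<Sum>m\<in>exponent_box n d. f (m + Poly_Mapping.single n d))"
  unfolding exponent_cone_def sum.reindex[OF exponent_cone_inj]
  by (subst sum.Sigma) (auto simp: finite_exponent_box case_prod_unfold)

lemma mem_exponent_cone:
  assumes m: "Poly_Mapping.keys m \<subseteq> {..n}" "\<And>k. k < n \<Longrightarrow> Poly_Mapping.lookup m k \<le> Poly_Mapping.lookup m n" "Poly_Mapping.lookup m n < N"
  shows "m \<in> exponent_cone n N"
proof -
  have "Poly_Mapping.lookup m k = 0" if "k > n" for k using m(1) that by (metis atMost_iff in_keys_iff not_le subsetD)
  then have "m = exponent_of n (Poly_Mapping.lookup m) + Poly_Mapping.single n (Poly_Mapping.lookup m n)"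
    by (intro poly_mapping_eqI) (auto simp: lookup_add lookup_exponent_of lookup_single when_def)
  moreover have "exponent_of n (Poly_Mapping.lookup m) \<in> exponent_box n (Poly_Mapping.lookup m n)"
    unfolding exponent_box_def using m(2) keys_exponent_of by (simp add: lookup_exponent_of)
  ultimately show ?thesis unfolding exponent_cone_def using m(3)
    by (intro image_eqI[of _ _ "(Poly_Mapping.lookup m n, exponent_of n (Poly_Mapping.lookup m))"]) auto
qed

lemma exponent_cone_lookup_less: "m \<in> exponent_cone n N \<Longrightarrow> Poly_Mapping.lookup m n < N"
  unfolding exponent_cone_def by (auto simp: lookup_cone)

lemma exponent_cone_mono: "N \<le> N' \<Longrightarrow> exponent_cone n N \<subseteq> exponent_cone n N'"
  unfolding exponent_cone_def by (intro image_mono Sigma_mono) auto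

lemma ps_term_eq_prod:
  assumes "Poly_Mapping.keys m \<subseteq> {..<n}"
  shows "ps_term c w m = c m * (\<Prod>k<n. w k ^ Poly_Mapping.lookup m k)"
  unfolding ps_term_def
  by (intro arg_cong2[where f = "(*)"] refl prod.mono_neutral_left) (use assms in \<open>auto simp: in_keys_iff\<close>)

lemma vabs_ps_term_le:
  assumes m: "Poly_Mapping.keys m \<subseteq> {..<n}" "\<And>k. k < n \<Longrightarrow> Poly_Mapping.lookup m k \<le> d"
    and w: "\<And>k. k < n \<Longrightarrow> vabs (w k) \<le> B" and B: "B \<ge> 1"
  shows "vabs (ps_term c w m) \<le> vabs (c m) * (B ^ n) ^ d"
proof -
  have "(\<Prod>k<n. vabs (w k) ^ Poly_Mapping.lookup m k) \<le> (\<Prod>k<n. B ^ d)"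
  proof (rule prod_mono)
    fix k assume "k \<in> {..<n}"
    then have "vabs (w k) ^ Poly_Mapping.lookup m k \<le> B ^ Poly_Mapping.lookup m k" "B ^ Poly_Mapping.lookup m k \<le> B ^ d"
      using m(2)[of k] w[of k] B by (auto intro: power_mono power_increasing)
    then show "0 \<le> vabs (w k) ^ Poly_Mapping.lookup m k \<and> vabs (w k) ^ Poly_Mapping.lookup m k \<le> B ^ d" by (auto intro: order_trans)
  qed
  also have "\<dots> = (B ^ n) ^ d" by (simp add: power_mult[symmetric] mult.commute)
  finally show ?thesis unfolding ps_term_eq_prod[OF m(1)] vabs_mult vabs_prod vabs_power
    by (rule mult_left_mono) simp
qed

lemma padic_dist_less_imp_eq:
  assumes p: "p > 1" and "padic_dist p y0 y1 < inverse (real p ^ N)"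
  shows "y0 (Suc N) = y1 (Suc N)"
proof (rule ccontr)
  assume *: "y0 (Suc N) \<noteq> y1 (Suc N)"
  define L where "L = (LEAST n. y0 (Suc n) \<noteq> y1 (Suc n))"
  have "L \<le> N" unfolding L_def using * by (rule Least_le)
  then have "inverse (real p ^ N) \<le> inverse (real p ^ L)" using p by (intro le_imp_inverse_le power_increasing) auto
  moreover have "padic_dist p y0 y1 = inverse (real p ^ L)" using * by (auto simp: padic_dist_def L_def)
  ultimately show False using assms(2) by simp
qed

lemma prod_single:
  "(\<Prod>k\<in>I. Poly_Mapping.single (x k) (c k :: 'c::comm_semiring_1)) = Poly_Mapping.single (\<Sum>k\<in>I. x k :: 'b::comm_monoid_add) (\<Prod>k\<in>I. c k)"
  by (induction I rule: infinite_finite_induct) (simp_all add: mult_single)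

lemma sum_single_lookup:
  assumes "Poly_Mapping.keys m \<subseteq> {..<n}"
  shows "(\<Sum>k<n. Poly_Mapping.single k (Poly_Mapping.lookup m k)) = (m :: nat \<Rightarrow>\<^sub>0 nat)"
  by (rule poly_mapping_eqI) (use lookup_eq_0[OF assms] in \<open>auto simp: lookup_sum lookup_single when_def\<close>)

context dual_L_series
begin

lemma sum_exponent_box_coeff_sum:
  "(\<Sum>m\<in>exponent_box n d. coeff_sum n (Poly_Mapping.lookup m) f d * (\<Prod>k<n. z k ^ Poly_Mapping.lookup m k))
    = (\<Sum>a\<in>monics d. emb_A \<iota> (\<mu> a) * (\<Prod>k<n. eval_at \<iota> a (z k)) * f a)"
proof -
  have "(\<Sum>m\<in>exponent_box n d. coeff_sum n (Poly_Mapping.lookup m) f d * (\<Prod>k<n. z k ^ Poly_Mapping.lookup m k))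
      = (\<Sum>m\<in>exponent_box n d. \<Sum>a\<in>monics d.
          emb_A \<iota> (\<mu> a) * f a * (\<Prod>k<n. em (coeff a (Poly_Mapping.lookup m k)) * z k ^ Poly_Mapping.lookup m k))"
    unfolding coeff_sum_def sum_distrib_right prod.distrib by (simp only: mult_ac)
  also have "\<dots> = (\<Sum>a\<in>monics d. emb_A \<iota> (\<mu> a) * f a *
      (\<Sum>m\<in>exponent_box n d. \<Prod>k<n. em (coeff a (Poly_Mapping.lookup m k)) * z k ^ Poly_Mapping.lookup m k))"
    unfolding sum_distrib_left by (rule sum.swap)
  also have "\<dots> = (\<Sum>a\<in>monics d. emb_A \<iota> (\<mu> a) * (\<Prod>k<n. eval_at \<iota> a (z k)) * f a)"
  proof (rule sum.cong[OF refl])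
    fix a :: "'q poly" assume "a \<in> monics d"
    then have "eval_at \<iota> a (z k) = (\<Sum>j\<le>d. em (coeff a j) * z k ^ j)" for k
      by (intro eval_at_expand) (simp add: degree_monics)
    then show "emb_A \<iota> (\<mu> a) * f a * (\<Sum>m\<in>exponent_box n d. \<Prod>k<n. em (coeff a (Poly_Mapping.lookup m k)) * z k ^ Poly_Mapping.lookup m k)
        = emb_A \<iota> (\<mu> a) * (\<Prod>k<n. eval_at \<iota> a (z k)) * f a"
      by (simp only: prod_sum_exponent_box mult_ac)
  qed
  finally show ?thesis .
qed

definition L_coeff :: "nat \<Rightarrow> (nat \<Rightarrow> int) \<Rightarrow> (nat \<Rightarrow>\<^sub>0 nat) \<Rightarrow> 'c" where
  "L_coeff n y m = (if Poly_Mapping.keys m \<subseteq> {..<Suc n}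
     then coeff_sum n (Poly_Mapping.lookup m) (\<lambda>a. one_unit_power \<iota> a y) (Poly_Mapping.lookup m n) else 0)"

text \<open>A polynomial of degree d has no coefficients beyond d. So the exponent of u dominates
  all others, and convergence in all variables is governed by it alone.\<close>

lemma L_coeff_nonzero:
  assumes "L_coeff n y m \<noteq> 0"
  shows "Poly_Mapping.keys m \<subseteq> {..<Suc n}" "k < Suc n \<Longrightarrow> Poly_Mapping.lookup m k \<le> Poly_Mapping.lookup m n"
proof -
  show "Poly_Mapping.keys m \<subseteq> {..<Suc n}" using assms by (metis L_coeff_def)
  show "Poly_Mapping.lookup m k \<le> Poly_Mapping.lookup m n" if "k < Suc n"
  proof (rule ccontr)
    assume "\<not> Poly_Mapping.lookup m k \<le> Poly_Mapping.lookup m n"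
    moreover from this have "k < n" using that by (cases "k = n") auto
    ultimately show False using assms coeff_sum_eq_0[where k = k and n = n and j = "Poly_Mapping.lookup m" and d = "Poly_Mapping.lookup m n"]
      by (simp add: L_coeff_def split: if_splits)
  qed
qed

text \<open>At points bounded by B a monomial of the support is at most (B^(n+1))^d, which the
  coefficients outweigh. The threshold is uniform in y and w, and both convergence and continuity in
  y rest on this.\<close>

lemma ps_term_L_coeff_tail:
  assumes B: "B \<ge> 1" and \<epsilon>: "\<epsilon> > 0"
  shows "\<exists>D. \<forall>y\<in>padic_ints CHAR('q). \<forall>w. (\<forall>k<Suc n. vabs (w k) \<le> B) \<longrightarrow>
    (\<forall>m. m \<notin> exponent_cone n D \<longrightarrow> vabs (ps_term (L_coeff n y) w m) \<le> \<epsilon>)"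
proof -
  obtain D where D: "vabs (coeff_sum n j (\<lambda>a. one_unit_power \<iota> a y) d) * (B ^ Suc n) ^ d \<le> \<epsilon>"
    if "d \<ge> D" "y \<in> padic_ints CHAR('q)" for d y j
    using coeff_sum_decay[of "B ^ Suc n" \<epsilon> n] \<epsilon> one_le_power[OF B, of "Suc n"] by blast
  show ?thesis
  proof (intro exI[of _ D] ballI allI impI)
    fix y m and w :: "nat \<Rightarrow> 'c" assume y: "y \<in> padic_ints CHAR('q)" and w: "\<forall>k<Suc n. vabs (w k) \<le> B"
      and m: "m \<notin> exponent_cone n D"
    show "vabs (ps_term (L_coeff n y) w m) \<le> \<epsilon>"
    proof (cases "L_coeff n y m = 0")
      case True
      then show ?thesis using \<epsilon> by (simp add: ps_term_def)
    next
      case False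
      note nz = L_coeff_nonzero[OF False]
      have "D \<le> Poly_Mapping.lookup m n"
        using m mem_exponent_cone[of m n D] nz by (force simp: lessThan_Suc_atMost not_less)
      then have "vabs (L_coeff n y m) * (B ^ Suc n) ^ Poly_Mapping.lookup m n \<le> \<epsilon>"
        using D[OF _ y] nz(1) by (simp add: L_coeff_def)
      moreover have "vabs (ps_term (L_coeff n y) w m) \<le> vabs (L_coeff n y m) * (B ^ Suc n) ^ Poly_Mapping.lookup m n"
        by (rule vabs_ps_term_le[OF nz _ B]) (use w in auto)
      ultimately show ?thesis by linarith
    qed
  qed
qed

lemma ps_eval_L_coeff:
  assumes y: "y \<in> padic_ints CHAR('q)" and w: "\<forall>k<Suc n. vabs (w k) \<le> B" and B: "B \<ge> 1"
  shows "ps_term (L_coeff n y) w summable_on UNIV"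
    and "\<epsilon> > 0 \<Longrightarrow> (\<And>m. m \<notin> exponent_cone n D \<Longrightarrow> vabs (ps_term (L_coeff n y) w m) \<le> \<epsilon>) \<Longrightarrow>
      vabs (ps_eval (L_coeff n y) w - sum (ps_term (L_coeff n y) w) (exponent_cone n D)) \<le> \<epsilon>"
proof -
  have fin: "finite {m. vabs (ps_term (L_coeff n y) w m) \<ge> \<epsilon>}" if \<epsilon>: "\<epsilon> > 0" for \<epsilon>
  proof -
    have "\<epsilon> / 2 > 0" using \<epsilon> by simp
    then obtain D where D: "m \<notin> exponent_cone n D \<Longrightarrow> vabs (ps_term (L_coeff n y) w m) \<le> \<epsilon> / 2" for m
      using ps_term_L_coeff_tail[OF B, of "\<epsilon> / 2" n] y w by blast
    have "{m. vabs (ps_term (L_coeff n y) w m) \<ge> \<epsilon>} \<subseteq> exponent_cone n D"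
    proof
      fix m assume m: "m \<in> {m. vabs (ps_term (L_coeff n y) w m) \<ge> \<epsilon>}"
      show "m \<in> exponent_cone n D"
      proof (rule ccontr)
        assume "m \<notin> exponent_cone n D"
        from D[OF this] m \<epsilon> show False by simp
      qed
    qed
    then show ?thesis using finite_exponent_cone by (rule finite_subset)
  qed
  show "ps_term (L_coeff n y) w summable_on UNIV" using fin by (rule nonarch_has_sum(1))
  show "vabs (ps_eval (L_coeff n y) w - sum (ps_term (L_coeff n y) w) (exponent_cone n D)) \<le> \<epsilon>"
    if "\<epsilon> > 0" "\<And>m. m \<notin> exponent_cone n D \<Longrightarrow> vabs (ps_term (L_coeff n y) w m) \<le> \<epsilon>"
    unfolding ps_eval_def
    by (rule nonarch_has_sum(2)[OF fin finite_exponent_cone that(2)]) (use that(1) in auto)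
qed

lemma everywhere_convergent_L_coeff:
  assumes "y \<in> padic_ints CHAR('q)"
  shows "everywhere_convergent (Suc n) (L_coeff n y)"
  unfolding everywhere_convergent_def in_vars_def
proof (intro conjI allI impI)
  fix w :: "nat \<Rightarrow> 'c"
  have "vabs (w k) \<le> 1 + (\<Sum>k<Suc n. vabs (w k))" if "k < Suc n" for k
    using member_le_sum[of k "{..<Suc n}" "\<lambda>k. vabs (w k)"] that by simp
  moreover have "0 \<le> (\<Sum>k<Suc n. vabs (w k))" by (intro sum_nonneg) simp
  ultimately show "ps_term (L_coeff n y) w summable_on UNIV"
    by (intro ps_eval_L_coeff(1)[OF assms, where B = "1 + (\<Sum>k<Suc n. vabs (w k))"]) auto
qed (rule L_coeff_nonzero(1))

definition L_value :: "nat \<Rightarrow> (nat \<Rightarrow> 'c) \<Rightarrow> 'c \<Rightarrow> (nat \<Rightarrow> int) \<Rightarrow> 'c" where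
  "L_value n z x y = ps_eval (L_coeff n y) (z(n := inverse x))"

text \<open>The cones are cut off by the exponent of u, so summing the power series along them runs
  through the partial sums of the L-series.\<close>

lemma sum_exponent_cone_L_coeff:
  "sum (ps_term (L_coeff n y) (z(n := inverse x))) (exponent_cone n N) = (\<Sum>d<N. L_term \<iota> \<mu> n z x y d)"
  unfolding sum_exponent_cone
proof (rule sum.cong[OF refl])
  fix d
  have "(\<Sum>m\<in>exponent_box n d. ps_term (L_coeff n y) (z(n := inverse x)) (m + Poly_Mapping.single n d))
      = (\<Sum>m\<in>exponent_box n d. coeff_sum n (Poly_Mapping.lookup m) (\<lambda>a. one_unit_power \<iota> a y) d
          * (\<Prod>k<n. z k ^ Poly_Mapping.lookup m k) * inverse x ^ d)"
  proof (rule sum.cong[OF refl])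
    fix m assume m: "m \<in> exponent_box n d"
    have keys: "Poly_Mapping.keys (m + Poly_Mapping.single n d) \<subseteq> {..<Suc n}"
      using keys_add[of m "Poly_Mapping.single n d"] m by (force simp: exponent_box_def split: if_splits)
    have "coeff_sum n (Poly_Mapping.lookup (m + Poly_Mapping.single n d)) f d = coeff_sum n (Poly_Mapping.lookup m) f d" for f
      unfolding coeff_sum_def by (intro sum.cong refl) (simp add: lookup_cone[OF m])
    then have "L_coeff n y (m + Poly_Mapping.single n d) = coeff_sum n (Poly_Mapping.lookup m) (\<lambda>a. one_unit_power \<iota> a y) d"
      using keys by (simp add: L_coeff_def lookup_cone[OF m])
    then show "ps_term (L_coeff n y) (z(n := inverse x)) (m + Poly_Mapping.single n d)
        = coeff_sum n (Poly_Mapping.lookup m) (\<lambda>a. one_unit_power \<iota> a y) d * (\<Prod>k<n. z k ^ Poly_Mapping.lookup m k) * inverse x ^ d"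
      unfolding ps_term_eq_prod[OF keys] by (simp add: lookup_cone[OF m])
  qed
  also have "\<dots> = L_term \<iota> \<mu> n z x y d"
    unfolding sum_distrib_right[symmetric] sum_exponent_box_coeff_sum L_term_def by (rule mult.commute)
  finally show "(\<Sum>m\<in>exponent_box n d. ps_term (L_coeff n y) (z(n := inverse x)) (m + Poly_Mapping.single n d))
      = L_term \<iota> \<mu> n z x y d" .
qed

lemma sums_if_vabs_le:
  fixes f :: "nat \<Rightarrow> 'c"
  assumes "\<And>\<epsilon>. \<epsilon> > 0 \<Longrightarrow> \<exists>D. \<forall>N\<ge>D. vabs (S - (\<Sum>d<N. f d)) \<le> \<epsilon>"
  shows "f sums S"
  unfolding sums_def
proof (rule metric_LIMSEQ_I)
  fix e :: real assume e: "e > 0"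
  then obtain D where D: "vabs (S - (\<Sum>d<N. f d)) \<le> e / 2" if "N \<ge> D" for N
    using assms[of "e / 2"] by auto
  show "\<exists>D. \<forall>N\<ge>D. dist (\<Sum>d<N. f d) S < e"
  proof (intro exI[of _ D] allI impI)
    fix N assume "D \<le> N"
    from D[OF this] e show "dist (\<Sum>d<N. f d) S < e"
      unfolding dist_vabs vabs_diff_commute[of "\<Sum>d<N. f d" S] by linarith
  qed
qed

lemma L_term_sums:
  assumes y: "y \<in> padic_ints CHAR('q)"
  shows "L_term \<iota> \<mu> n z x y sums L_value n z x y"
proof (rule sums_if_vabs_le)
  fix \<epsilon> :: real assume \<epsilon>: "\<epsilon> > 0"
  define w where "w = z(n := inverse x)"
  define B where "B = 1 + (\<Sum>k<Suc n. vabs (w k))"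
  have w: "\<forall>k<Suc n. vabs (w k) \<le> B"
    unfolding B_def using member_le_sum[of _ "{..<Suc n}" "\<lambda>k. vabs (w k)"] by force
  have B: "B \<ge> 1" unfolding B_def using sum_nonneg[of "{..<Suc n}" "\<lambda>k. vabs (w k)"] by simp
  obtain D where D: "m \<notin> exponent_cone n D \<Longrightarrow> vabs (ps_term (L_coeff n y) w m) \<le> \<epsilon>" for m
    using ps_term_L_coeff_tail[OF B \<epsilon>, of n] y w by blast
  show "\<exists>D. \<forall>N\<ge>D. vabs (L_value n z x y - (\<Sum>d<N. L_term \<iota> \<mu> n z x y d)) \<le> \<epsilon>"
  proof (intro exI[of _ D] allI impI)
    fix N assume "D \<le> N"
    then have "exponent_cone n D \<subseteq> exponent_cone n N" by (rule exponent_cone_mono)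
    then have "vabs (ps_term (L_coeff n y) w m) \<le> \<epsilon>" if "m \<notin> exponent_cone n N" for m
      using D that by blast
    from ps_eval_L_coeff(2)[OF y w B \<epsilon> this]
    show "vabs (L_value n z x y - (\<Sum>d<N. L_term \<iota> \<mu> n z x y d)) \<le> \<epsilon>"
      unfolding w_def sum_exponent_cone_L_coeff L_value_def .
  qed
qed

text \<open>The series converges for every nonzero x, so the continuation is its own sum and radius
  0 serves for every polydisc.\<close>

lemma continues_L_value: "continues_L_series \<iota> \<mu> n (L_value n)"
  unfolding continues_L_series_def
proof (intro conjI allI impI)
  show "\<exists>R. \<forall>z x y. (\<forall>k<n. vabs (z k) \<le> B) \<and> R < vabs x \<and> x \<noteq> 0 \<and> y \<in> padic_ints CHAR('q)
      \<longrightarrow> summable (L_term \<iota> \<mu> n z x y)" for B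
    using sums_summable[OF L_term_sums] by (intro exI[of _ 0]) blast
  show "L_value n z x y = suminf (L_term \<iota> \<mu> n z x y)"
    if "x \<noteq> 0 \<and> y \<in> padic_ints CHAR('q) \<and> summable (L_term \<iota> \<mu> n z x y)" for z x y
    using that sums_unique[OF L_term_sums] by blast
qed

text \<open>Outside a finite cone both power series are uniformly small. On the cone, y enters only
  through one-unit powers, which differ by at most q^(-p^(N+1)) when y_0 and y_1 agree modulo
  p^(N+1).\<close>

lemma goss_entire_L_value: "goss_entire CHAR('q) n (L_value n)"
  unfolding goss_entire_def
proof (intro exI[of _ "L_coeff n"] conjI allI impI ballI)
  fix H :: "(nat \<Rightarrow> 'c) set" and \<epsilon> :: real
  assume "\<exists>B. \<forall>w\<in>H. \<forall>k\<le>n. vabs (w k) \<le> B" and \<epsilon>: "\<epsilon> > 0"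
  then obtain B0 where B0: "vabs (w k) \<le> B0" if "w \<in> H" "k \<le> n" for w k by blast
  define B where "B = max 1 B0"
  have B: "B \<ge> 1" by (simp add: B_def)
  have H: "\<forall>k<Suc n. vabs (w k) \<le> B" if "w \<in> H" for w using B0[OF that] by (auto simp: B_def less_Suc_eq_le le_max_iff_disj)
  have e2: "\<epsilon> / 2 > 0" using \<epsilon> by simp
  obtain D where D: "vabs (ps_term (L_coeff n y) w m) \<le> \<epsilon> / 2"
    if "y \<in> padic_ints CHAR('q)" "\<forall>k<Suc n. vabs (w k) \<le> B" "m \<notin> exponent_cone n D" for y w m
    using ps_term_L_coeff_tail[OF B e2, of n] by blast
  \<comment> \<open>For d < D this bounds both growth factors on the cone, q^d from \<mu> and
    (B^(n+1))^d from the monomial.\<close>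
  define A where "A = (real CARD('q) * B ^ Suc n) ^ D"
  have A1: "real CARD('q) * B ^ Suc n \<ge> 1 * 1" using B q1 by (intro mult_mono one_le_power) auto
  then have A: "A \<ge> 1" unfolding A_def by (intro one_le_power) simp
  obtain N where N: "(1 / real CARD('q)) ^ N < \<epsilon> / 2 / A"
    using real_arch_pow_inv[OF _ inv_q(1), of "\<epsilon> / 2 / A"] A e2 by auto
  have "(1 / real CARD('q)) ^ (CHAR('q) ^ Suc N) \<le> (1 / real CARD('q)) ^ N"
    using inv_q power_gt_expt[OF p1[unfolded One_nat_def], of "Suc N"] by (intro power_decreasing) auto
  then have small: "A * (1 / real CARD('q)) ^ (CHAR('q) ^ Suc N) \<le> \<epsilon> / 2"
  proof -
    have "A * (1 / real CARD('q)) ^ N \<le> \<epsilon> / 2" using N A by (simp add: field_simps)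
    moreover have "A * (1 / real CARD('q)) ^ (CHAR('q) ^ Suc N) \<le> A * (1 / real CARD('q)) ^ N"
      using A by (intro mult_left_mono \<open>(1 / real CARD('q)) ^ (CHAR('q) ^ Suc N) \<le> (1 / real CARD('q)) ^ N\<close>) simp
    ultimately show ?thesis by linarith
  qed
  show "\<exists>\<delta>>0. \<forall>y0\<in>padic_ints CHAR('q). \<forall>y1\<in>padic_ints CHAR('q). padic_dist CHAR('q) y0 y1 < \<delta> \<longrightarrow>
    (\<forall>w\<in>H. vabs (ps_eval (L_coeff n y0) w - ps_eval (L_coeff n y1) w) < \<epsilon>)"
  proof (intro exI[of _ "inverse (real CHAR('q) ^ N)"] conjI ballI impI)
    show "0 < inverse (real CHAR('q) ^ N)" using p1 by simp
    fix y0 y1 w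
    assume y: "y0 \<in> padic_ints CHAR('q)" "y1 \<in> padic_ints CHAR('q)"
      and "padic_dist CHAR('q) y0 y1 < inverse (real CHAR('q) ^ N)" and w: "w \<in> H"
    then have eq: "y0 (Suc N) = y1 (Suc N)" by (intro padic_dist_less_imp_eq[OF p1])
    let ?S = "\<lambda>y. sum (ps_term (L_coeff n y) w) (exponent_cone n D)"
    have tail: "vabs (ps_eval (L_coeff n y) w - ?S y) \<le> \<epsilon> / 2" if "y \<in> padic_ints CHAR('q)" for y
      by (rule ps_eval_L_coeff(2)[OF that H[OF w] B e2 D[OF that H[OF w]]])
    have "vabs (?S y0 - ?S y1) \<le> \<epsilon> / 2"
      unfolding sum_subtractf[symmetric]
    proof (rule vabs_sum_le)
      fix m assume m: "m \<in> exponent_cone n D"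
      define d where "d = Poly_Mapping.lookup m n"
      define c where "c m = L_coeff n y0 m - L_coeff n y1 m" for m
      have "vabs (ps_term c w m) \<le> \<epsilon> / 2"
      proof (cases "c m = 0")
        case True
        then show ?thesis using e2 by (simp add: ps_term_def)
      next
        case False
        then have nonzero: "L_coeff n y0 m \<noteq> 0 \<or> L_coeff n y1 m \<noteq> 0" by (auto simp: c_def)
        have keys: "Poly_Mapping.keys m \<subseteq> {..<Suc n}" using nonzero L_coeff_nonzero(1) by blast
        have "Poly_Mapping.lookup m k \<le> d" if "k < Suc n" for k
          using nonzero L_coeff_nonzero(2)[OF _ that] unfolding d_def by blast
        note nz = keys this
        have "c m = coeff_sum n (Poly_Mapping.lookup m) (\<lambda>a. one_unit_power \<iota> a y0 - one_unit_power \<iota> a y1) d"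
          using nz(1) by (simp add: c_def L_coeff_def d_def coeff_sum_diff)
        also have "vabs \<dots> \<le> real CARD('q) ^ d * (1 / real CARD('q)) ^ (CHAR('q) ^ Suc N)"
          by (rule vabs_coeff_sum_le[OF one_unit_power_cong[OF _ y eq]]) simp_all
        finally have c: "vabs (c m) \<le> real CARD('q) ^ d * (1 / real CARD('q)) ^ (CHAR('q) ^ Suc N)" .
        have "vabs (ps_term c w m) \<le> vabs (c m) * (B ^ Suc n) ^ d"
          by (rule vabs_ps_term_le[OF nz _ B]) (use H[OF w] in auto)
        also have "\<dots> \<le> (real CARD('q) ^ d * (1 / real CARD('q)) ^ (CHAR('q) ^ Suc N)) * (B ^ Suc n) ^ d"
          using B by (intro mult_right_mono c) auto
        also have "\<dots> = (real CARD('q) * B ^ Suc n) ^ d * (1 / real CARD('q)) ^ (CHAR('q) ^ Suc N)"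
          by (simp only: power_mult_distrib mult_ac)
        also have "\<dots> \<le> A * (1 / real CARD('q)) ^ (CHAR('q) ^ Suc N)"
          unfolding A_def using exponent_cone_lookup_less[OF m] A1
          by (intro mult_right_mono power_increasing) (auto simp: d_def)
        finally show ?thesis using small by linarith
      qed
      moreover have "ps_term (L_coeff n y0) w m - ps_term (L_coeff n y1) w m = ps_term c w m"
        by (simp only: ps_term_def c_def left_diff_distrib)
      ultimately show "vabs (ps_term (L_coeff n y0) w m - ps_term (L_coeff n y1) w m) \<le> \<epsilon> / 2" by simp
    qed (use e2 in simp)
    from vabs_diff_le[OF vabs_add_le[OF tail[OF y(1)] this] tail[OF y(2)]]
    have "vabs (ps_eval (L_coeff n y0) w - ps_eval (L_coeff n y1) w) \<le> \<epsilon> / 2" by (simp add: algebra_simps)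
    then show "vabs (ps_eval (L_coeff n y0) w - ps_eval (L_coeff n y1) w) < \<epsilon>" using \<epsilon> by linarith
  qed
qed (auto simp: everywhere_convergent_L_coeff L_value_def)

lemma monics_eval_power:
  assumes a: "a \<in> monics d"
  shows "c / emb_A \<iota> a powi s = c * one_unit_power \<iota> a (padic_of_int CHAR('q) (- s)) * (\<theta> powi (- s)) ^ d"
proof -
  have pw: "(\<theta> powi (- s)) ^ d = (\<theta> ^ d) powi (- s)"
    by (induction d) (simp_all only: power_0 power_int_1_left power_Suc power_int_mult_distrib)
  have "one_unit \<iota> a * \<theta> ^ d = emb_A \<iota> a * (inverse \<theta> * \<theta>) ^ d"
    by (simp only: one_unit_def degree_monics[OF a] mult.assoc power_mult_distrib)
  also have "\<dots> = emb_A \<iota> a" using theta_nz by simp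
  finally have "one_unit \<iota> a powi (- s) * (\<theta> ^ d) powi (- s) = emb_A \<iota> a powi (- s)"
    by (simp only: power_int_mult_distrib[symmetric])
  then have "c * one_unit_power \<iota> a (padic_of_int CHAR('q) (- s)) * (\<theta> powi (- s)) ^ d = c * emb_A \<iota> a powi (- s)"
    by (simp only: one_unit_power_padic_of_int[OF a] pw mult.assoc)
  then show ?thesis by (simp only: power_int_minus divide_inverse)
qed

lemma lookup_L_degree_part:
  "Poly_Mapping.lookup (L_degree_part \<iota> \<mu> n s d) m = (if m \<in> exponent_box n d
    then coeff_sum n (Poly_Mapping.lookup m) (\<lambda>a. one_unit_power \<iota> a (padic_of_int CHAR('q) (- s))) d * (\<theta> powi (- s)) ^ d else 0)"
proof -
  let ?e = "\<lambda>a. emb_A \<iota> (\<mu> a) / emb_A \<iota> a powi s"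
  have at: "Poly_Mapping.lookup (Poly_Mapping.single 0 (?e a) * (\<Prod>k<n. at_variable \<iota> a k)) m
      = (if m \<in> exponent_box n d then ?e a * (\<Prod>k<n. em (coeff a (Poly_Mapping.lookup m k))) else 0)"
    if a: "a \<in> monics d" for a
  proof -
    have "(\<Prod>k<n. at_variable \<iota> a k)
        = (\<Sum>m\<in>exponent_box n d. \<Prod>k<n. Poly_Mapping.single (Poly_Mapping.single k (Poly_Mapping.lookup m k)) (em (coeff a (Poly_Mapping.lookup m k))))"
      unfolding at_variable_def degree_monics[OF a] by (rule prod_sum_exponent_box)
    also have "\<dots> = (\<Sum>m\<in>exponent_box n d. Poly_Mapping.single m (\<Prod>k<n. em (coeff a (Poly_Mapping.lookup m k))))"
    proof (rule sum.cong[OF refl])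
      fix m assume "m \<in> exponent_box n d"
      then have "Poly_Mapping.keys m \<subseteq> {..<n}" by (simp add: exponent_box_def)
      then show "(\<Prod>k<n. Poly_Mapping.single (Poly_Mapping.single k (Poly_Mapping.lookup m k)) (em (coeff a (Poly_Mapping.lookup m k)))) = Poly_Mapping.single m (\<Prod>k<n. em (coeff a (Poly_Mapping.lookup m k)))"
        by (simp only: prod_single sum_single_lookup)
    qed
    finally have "Poly_Mapping.single 0 (?e a) * (\<Prod>k<n. at_variable \<iota> a k)
        = (\<Sum>m\<in>exponent_box n d. Poly_Mapping.single m (?e a * (\<Prod>k<n. em (coeff a (Poly_Mapping.lookup m k)))))"
      by (simp only: sum_distrib_left mult_single add_0_left)
    then show ?thesis
      using finite_exponent_box by (simp only: lookup_sum lookup_single when_def sum.delta')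
        (simp add: sum.delta finite_exponent_box)
  qed
  have "Poly_Mapping.lookup (L_degree_part \<iota> \<mu> n s d) m
      = (\<Sum>a\<in>monics d. if m \<in> exponent_box n d then ?e a * (\<Prod>k<n. em (coeff a (Poly_Mapping.lookup m k))) else 0)"
    unfolding L_degree_part_def lookup_sum by (rule sum.cong[OF refl at])
  also have "\<dots> = (if m \<in> exponent_box n d then \<Sum>a\<in>monics d. ?e a * (\<Prod>k<n. em (coeff a (Poly_Mapping.lookup m k))) else 0)"
    by simp
  also have "(\<Sum>a\<in>monics d. ?e a * (\<Prod>k<n. em (coeff a (Poly_Mapping.lookup m k))))
      = coeff_sum n (Poly_Mapping.lookup m) (\<lambda>a. one_unit_power \<iota> a (padic_of_int CHAR('q) (- s))) d * (\<theta> powi (- s)) ^ d"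
    unfolding coeff_sum_def sum_distrib_right
    by (rule sum.cong[OF refl]) (simp only: monics_eval_power mult_ac)
  finally show ?thesis .
qed

lemma exponent_box_mono: "d \<le> d' \<Longrightarrow> exponent_box n d \<subseteq> exponent_box n d'"
  unfolding exponent_box_def by (auto intro: order_trans)

text \<open>The part of degree d has exponents at most d, and its coefficients tend to 0 uniformly.
  So the coefficientwise sum converges uniformly, that is, in the Gauss norm. On the unit polydisc
  its value and that of \<open>L_value\<close> are sums of one and the same series.\<close>

lemma L_series_in_tate_algebra:
  "\<exists>G. tate_sums n (\<lambda>d. Poly_Mapping.lookup (L_degree_part \<iota> \<mu> n s d)) G \<and>
    (\<forall>z. (\<forall>k<n. vabs (z k) \<le> 1) \<longrightarrow>
      ps_eval G z = L_value n z (\<theta> powi s) (padic_of_int CHAR('q) (- s)))"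
proof -
  define y where "y = padic_of_int CHAR('q) (- s)"
  have y: "y \<in> padic_ints CHAR('q)" unfolding y_def by (rule padic_of_int_mem)
  define T where "T = \<theta> powi (- s)"
  \<comment> \<open>For negative s the powers of \<theta>^(-s) grow with d; the decay of the
    coefficients has to absorb them.\<close>
  define A where "A = max 1 (vabs T)"
  have A: "A \<ge> 1" by (simp add: A_def)
  define c where "c d m = Poly_Mapping.lookup (L_degree_part \<iota> \<mu> n s d) m" for d m
  have c_eq: "c d m = (if m \<in> exponent_box n d
      then coeff_sum n (Poly_Mapping.lookup m) (\<lambda>a. one_unit_power \<iota> a y) d * T ^ d else 0)" for d m
    unfolding c_def lookup_L_degree_part y_def T_def ..
  have c_out: "c d m = 0" if "m \<notin> exponent_box n d" for d m using that by (simp add: c_eq)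
  have decay: "\<exists>D. \<forall>d\<ge>D. \<forall>m. vabs (c d m) \<le> \<epsilon>" if \<epsilon>: "\<epsilon> > 0" for \<epsilon>
  proof -
    obtain D where "\<forall>d\<ge>D. \<forall>y\<in>padic_ints CHAR('q). \<forall>j.
        vabs (coeff_sum n j (\<lambda>a. one_unit_power \<iota> a y) d) * A ^ d \<le> \<epsilon>"
      by (rule exE[OF coeff_sum_decay[OF A \<epsilon>, of n]])
    note D = this[rule_format, OF _ y]
    have "vabs (c d m) \<le> \<epsilon>" if "d \<ge> D" for d m
    proof -
      let ?c = "coeff_sum n (Poly_Mapping.lookup m) (\<lambda>a. one_unit_power \<iota> a y) d"
      have "vabs (?c * T ^ d) \<le> vabs ?c * A ^ d"
        unfolding vabs_mult vabs_power by (intro mult_left_mono power_mono) (auto simp: A_def)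
      then have "vabs (?c * T ^ d) \<le> \<epsilon>" using D[OF that, of "Poly_Mapping.lookup m"] by linarith
      then show ?thesis using \<epsilon> by (simp add: c_eq)
    qed
    then show ?thesis by blast
  qed
  define G where "G m = suminf (\<lambda>d. c d m)" for m
  have tail: "\<exists>D. \<forall>N\<ge>D. \<forall>m. vabs (G m - (\<Sum>d<N. c d m)) \<le> \<epsilon>" if \<epsilon>: "\<epsilon> > 0" for \<epsilon>
  proof -
    have sm: "summable (\<lambda>d. c d m)" for m
    proof (rule nonarch_summable, rule LIMSEQ_I)
      fix r :: real assume "r > 0"
      then obtain D where D: "\<forall>d\<ge>D. \<forall>m. vabs (c d m) \<le> r / 2" using decay[OF half_gt_zero] by blast
      show "\<exists>D. \<forall>d\<ge>D. norm (vabs (c d m) - 0) < r"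
      proof (intro exI[of _ D] allI impI)
        fix d assume "D \<le> d"
        with D have "vabs (c d m) \<le> r / 2" by blast
        then show "norm (vabs (c d m) - 0) < r"
          using \<open>r > 0\<close> by (simp only: real_norm_def diff_0_right abs_of_nonneg[OF vabs_ge_0])
      qed
    qed
    obtain D where D: "\<And>d m. d \<ge> D \<Longrightarrow> vabs (c d m) \<le> \<epsilon>" using decay[OF \<epsilon>] by blast
    have "vabs (G m - (\<Sum>d<N. c d m)) \<le> \<epsilon>" if "N \<ge> D" for N m
      unfolding G_def by (rule suminf_vabs_le[OF sm D]) (use that in linarith)
    then show ?thesis by blast
  qed
  have G_out: "G m = 0" if "\<not> Poly_Mapping.keys m \<subseteq> {..<n}" for m
  proof -
    have "c d m = 0" for d using that by (intro c_out) (simp add: exponent_box_def)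
    then show ?thesis by (simp add: G_def)
  qed
  have G_small: "\<exists>D. \<forall>m. m \<notin> exponent_box n D \<longrightarrow> vabs (G m) \<le> \<epsilon>" if \<epsilon>: "\<epsilon> > 0" for \<epsilon>
  proof -
    obtain D where D: "\<And>m. vabs (G m - (\<Sum>d<D. c d m)) \<le> \<epsilon>" using tail[OF \<epsilon>] by blast
    have "vabs (G m) \<le> \<epsilon>" if "m \<notin> exponent_box n D" for m
    proof -
      have "c d m = 0" if "d < D" for d
        using exponent_box_mono[of d D n] \<open>m \<notin> exponent_box n D\<close> that by (intro c_out) auto
      then show ?thesis using D[of m] by simp
    qed
    then show ?thesis by blast
  qed
  have fin: "finite {m. vabs (f m) \<ge> \<epsilon>}"
    if "\<epsilon> > 0" "\<And>m. m \<notin> S \<Longrightarrow> vabs (f m) \<le> \<epsilon> / 2" "finite S" for \<epsilon> S and f :: "(nat \<Rightarrow>\<^sub>0 nat) \<Rightarrow> 'c"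
  proof (rule finite_subset[OF _ that(3)], rule subsetI, rule ccontr)
    fix m assume m: "m \<in> {m. vabs (f m) \<ge> \<epsilon>}" "m \<notin> S"
    from that(2)[OF m(2)] m(1) that(1) show False by simp
  qed
  have G_fin: "finite {m. vabs (G m) \<ge> \<epsilon>}" if \<epsilon>: "\<epsilon> > 0" for \<epsilon>
  proof -
    have "\<epsilon> / 2 > 0" using \<epsilon> by simp
    then obtain D where "\<And>m. m \<notin> exponent_box n D \<Longrightarrow> vabs (G m) \<le> \<epsilon> / 2" using G_small by blast
    from fin[OF \<epsilon> this finite_exponent_box] show ?thesis .
  qed
  have "tate_sums n c G"
    unfolding tate_sums_def
  proof (intro conjI allI)
    show "c d \<in> tate_algebra n" for d
      unfolding tate_algebra_def in_vars_def
    proof (intro CollectI conjI allI impI)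
      show "Poly_Mapping.keys m \<subseteq> {..<n}" if "c d m \<noteq> 0" for m
        using that c_out[of m d] unfolding exponent_box_def by blast
      show "finite {m. \<epsilon> \<le> vabs (c d m)}" if "\<epsilon> > 0" for \<epsilon>
        using that by (intro fin[of _ "exponent_box n d"] finite_exponent_box) (simp_all add: c_out)
    qed
    show "G \<in> tate_algebra n" using G_fin G_out unfolding tate_algebra_def in_vars_def by blast
    show "(\<lambda>N. gauss_norm (\<lambda>m. (\<Sum>d<N. c d m) - G m)) \<longlonglongrightarrow> 0"
    proof (rule LIMSEQ_I)
      fix r :: real assume r: "r > 0"
      then obtain D where D: "\<And>N m. N \<ge> D \<Longrightarrow> vabs (G m - (\<Sum>d<N. c d m)) \<le> r / 2"
        using tail[OF half_gt_zero[OF r]] by blast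
      show "\<exists>D. \<forall>N\<ge>D. norm (gauss_norm (\<lambda>m. (\<Sum>d<N. c d m) - G m) - 0) < r"
      proof (intro exI[of _ D] allI impI)
        fix N assume N: "D \<le> N"
        let ?f = "\<lambda>m. vabs ((\<Sum>d<N. c d m) - G m)"
        have le: "?f m \<le> r / 2" for m using D[OF N, of m] by (simp only: vabs_diff_commute)
        have "(SUP m. ?f m) \<le> r / 2" by (rule cSUP_least) (simp_all only: le UNIV_not_empty not_False_eq_True)
        moreover have "?f 0 \<le> (SUP m. ?f m)" 
          by (rule cSUP_upper[OF UNIV_I bdd_aboveI2[where M = "r / 2"]]) (rule le)
        moreover have "0 \<le> ?f 0" by (rule vabs_ge_0)
        ultimately show "norm (gauss_norm (\<lambda>m. (\<Sum>d<N. c d m) - G m) - 0) < r"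
          unfolding gauss_norm_def real_norm_def using r by linarith
      qed
    qed
  qed
  moreover have "ps_eval G z = L_value n z (\<theta> powi s) y" if z: "\<forall>k<n. vabs (z k) \<le> 1" for z
  proof -
    have ps_le: "vabs (ps_term f z m) \<le> vabs (f m)" if "Poly_Mapping.keys m \<subseteq> {..<n}" for f m
    proof -
      obtain D where "\<And>k. k < n \<Longrightarrow> Poly_Mapping.lookup m k \<le> D"
        using finite_nat_set_iff_bounded_le[of "Poly_Mapping.lookup m ` {..<n}"] by auto
      from vabs_ps_term_le[OF that this, of z 1 f] z show ?thesis by simp
    qed
    have G_le: "vabs (ps_term G z m) \<le> vabs (G m)" for m
      using ps_le[of m G] G_out[of m] by (cases "Poly_Mapping.keys m \<subseteq> {..<n}") (auto simp: ps_term_def)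
    have G_ps_fin: "finite {m. vabs (ps_term G z m) \<ge> \<epsilon>}" if "\<epsilon> > 0" for \<epsilon>
      by (rule finite_subset[OF _ G_fin[OF that]]) (use G_le in \<open>auto intro: order_trans\<close>)
    have sum_eq: "(\<Sum>m\<in>exponent_box n N. ps_term (\<lambda>m. \<Sum>d<N. c d m) z m) = (\<Sum>d<N. L_term \<iota> \<mu> n z (\<theta> powi s) y d)" for N
    proof -
      have "(\<Sum>m\<in>exponent_box n N. ps_term (\<lambda>m. \<Sum>d<N. c d m) z m)
          = (\<Sum>m\<in>exponent_box n N. \<Sum>d<N. c d m * (\<Prod>k<n. z k ^ Poly_Mapping.lookup m k))"
        by (rule sum.cong[OF refl]) (simp add: ps_term_eq_prod[where n = n] exponent_box_def sum_distrib_right)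
      also have "\<dots> = (\<Sum>d<N. \<Sum>m\<in>exponent_box n N. c d m * (\<Prod>k<n. z k ^ Poly_Mapping.lookup m k))" by (rule sum.swap)
      also have "\<dots> = (\<Sum>d<N. L_term \<iota> \<mu> n z (\<theta> powi s) y d)"
      proof (rule sum.cong[OF refl])
        fix d assume d: "d \<in> {..<N}"
        have "(\<Sum>m\<in>exponent_box n N. c d m * (\<Prod>k<n. z k ^ Poly_Mapping.lookup m k))
            = (\<Sum>m\<in>exponent_box n d. c d m * (\<Prod>k<n. z k ^ Poly_Mapping.lookup m k))"
          by (rule sum.mono_neutral_right[OF finite_exponent_box exponent_box_mono]) (use d c_out in auto)
        also have "\<dots> = (\<Sum>m\<in>exponent_box n d.
            coeff_sum n (Poly_Mapping.lookup m) (\<lambda>a. one_unit_power \<iota> a y) d * (\<Prod>k<n. z k ^ Poly_Mapping.lookup m k)) * T ^ d"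
          unfolding sum_distrib_right by (rule sum.cong[OF refl]) (simp add: c_eq mult_ac)
        also have "\<dots> = L_term \<iota> \<mu> n z (\<theta> powi s) y d"
          unfolding sum_exponent_box_coeff_sum L_term_def T_def power_int_minus by (rule mult.commute)
        finally show "(\<Sum>m\<in>exponent_box n N. c d m * (\<Prod>k<n. z k ^ Poly_Mapping.lookup m k)) = L_term \<iota> \<mu> n z (\<theta> powi s) y d" .
      qed
      finally show ?thesis .
    qed
    have "L_term \<iota> \<mu> n z (\<theta> powi s) y sums ps_eval G z"
    proof (rule sums_if_vabs_le)
      fix \<epsilon> :: real assume \<epsilon>: "\<epsilon> > 0"
      obtain D1 where D1: "\<And>N m. N \<ge> D1 \<Longrightarrow> vabs (G m - (\<Sum>d<N. c d m)) \<le> \<epsilon>" using tail[OF \<epsilon>] by blast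
      obtain D2 where D2: "\<And>m. m \<notin> exponent_box n D2 \<Longrightarrow> vabs (G m) \<le> \<epsilon>" using G_small[OF \<epsilon>] by blast
      show "\<exists>D. \<forall>N\<ge>D. vabs (ps_eval G z - (\<Sum>d<N. L_term \<iota> \<mu> n z (\<theta> powi s) y d)) \<le> \<epsilon>"
      proof (intro exI[of _ "max D1 D2"] allI impI)
        fix N assume N: "max D1 D2 \<le> N"
        have out: "vabs (ps_term G z m) \<le> \<epsilon>" if "m \<notin> exponent_box n N" for m
          by (rule order_trans[OF G_le D2]) (use exponent_box_mono[of D2 N n] N that in auto)
        have 1: "vabs (ps_eval G z - sum (ps_term G z) (exponent_box n N)) \<le> \<epsilon>"
          unfolding ps_eval_def
          by (rule nonarch_has_sum(2)[OF G_ps_fin finite_exponent_box out]) (use \<epsilon> in auto)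
        have 2: "vabs (sum (ps_term G z) (exponent_box n N) - (\<Sum>d<N. L_term \<iota> \<mu> n z (\<theta> powi s) y d)) \<le> \<epsilon>"
          unfolding sum_eq[symmetric] sum_subtractf[symmetric]
        proof (rule vabs_sum_le)
          fix m assume "m \<in> exponent_box n N"
          then have k: "Poly_Mapping.keys m \<subseteq> {..<n}" by (simp add: exponent_box_def)
          have "vabs (ps_term (\<lambda>m. G m - (\<Sum>d<N. c d m)) z m) \<le> vabs (G m - (\<Sum>d<N. c d m))"
            by (rule ps_le[OF k])
          also have "\<dots> \<le> \<epsilon>" using N by (intro D1) simp
          finally have le: "vabs (ps_term (\<lambda>m. G m - (\<Sum>d<N. c d m)) z m) \<le> \<epsilon>" .
          have "ps_term G z m - ps_term (\<lambda>m. \<Sum>d<N. c d m) z m = ps_term (\<lambda>m. G m - (\<Sum>d<N. c d m)) z m"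
            by (simp only: ps_term_def left_diff_distrib)
          then show "vabs (ps_term G z m - ps_term (\<lambda>m. \<Sum>d<N. c d m) z m) \<le> \<epsilon>"
            using le by (simp only:)
        qed (use \<epsilon> in simp)
        from vabs_add_le[OF 1 2]
        show "vabs (ps_eval G z - (\<Sum>d<N. L_term \<iota> \<mu> n z (\<theta> powi s) y d)) \<le> \<epsilon>" by simp
      qed
    qed
    then show ?thesis using L_term_sums[OF y] by (rule sums_unique2)
  qed
  ultimately show ?thesis unfolding c_def y_def by blast
qed

end

theorem theorem5p2:
  fixes \<iota> :: "'q::finite_field fls alg_closure \<Rightarrow> 'c::complete_nonarch_field"
    and \<phi> :: "'q poly poly" and \<mu> :: "'q poly \<Rightarrow> 'q poly" and r n :: nat
  assumes "is_C_infinity \<iota>"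
    and "drinfeld_module r \<phi>"
    and "is_dual_mu \<phi> \<mu>"
  shows "\<exists>F. goss_entire CHAR('q) n F \<and> continues_L_series \<iota> \<mu> n F \<and>
           (\<forall>s::int. \<exists>G.
              tate_sums n (\<lambda>d. Poly_Mapping.lookup (L_degree_part \<iota> \<mu> n s d)) G \<and>
              (\<forall>z. (\<forall>k<n. vabs (z k) \<le> 1) \<longrightarrow>
                 ps_eval G z = F z (theta \<iota> powi s) (padic_of_int CHAR('q) (- s))))"
proof -
  have \<phi>0: "coeff \<phi> 0 = [:0, 1:]" using assms(2) unfolding drinfeld_module_def by blast
  interpret dual_L_series \<iota> \<phi> \<mu>
    by unfold_locales (rule assms(1) \<phi>0 assms(3) euler_D_eq_qpoly[OF \<phi>0], assumption?)+
  show ?thesis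
    using goss_entire_L_value continues_L_value L_series_in_tate_algebra
    by (intro exI[of _ "L_value n"] conjI allI)
qed

end
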